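(* Let $n>1$. Let Assumption P (stated in the context) hold and suppose that all agents have the same initial wealth $w^i=w/n>0$ and the same utility function $u^i\equiv u$ satisfying Assumption U (stated in the context). Further assume $u_{xc}\ge0$. Then there exists a symmetric Nash equilibrium $(\hat x^1,\dots,\hat x^n,\hat C^1,\dots,\hat C^n)$, with $(\hat x^i,\hat C^i)=(\hat x^1,\hat C^1)$ for all $i=1,\dots,n$. Furthermore, any tuple of processes $(\tilde x^1,\dots,\tilde x^n,\tilde C^1,\dots,\tilde C^n)$ is a Nash equilibrium of the public good contribution game if and only if $(\tilde x^i,\tilde C^i)\in\mathcal{B}_{w^i}$ with $\tilde x^i=\hat x^i$ $P\otimes dt$-a.e. and $$E\Big[\int_0^T\psi_c(t)\,d\tilde C^i(t)\Big]=E\Big[\int_0^T\psi_c(t)\,d\hat C^i(t)\Big]\quad\text{for all }i=1,\dots,n,$$ and $\sum_i\tilde C^i(t)=\sum_i\hat C^i(t)$ for all $t\in[0,T)$, $P$-a.s.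
   Context: Setting. Fix $0<T\le\infty$, a number $n$ of agents, and a filtered probability space $(\Omega,\mathcal{F},\{\mathcal{F}_t\}_{t\in[0,T]},P)$ satisfying the usual conditions, with expectation $E$. Let $w^i>0$ be initial wealths, $\psi_x,\psi_c$ strictly positive price processes, $r$ a discount rate process. For nonnegative processes set $$\Psi(x^i,C^i):=E\Big[\int_0^T\psi_x(t)x^i(t)\,dt+\int_0^T\psi_c(t)\,dC^i(t)\Big].$$ For a nondecreasing right-continuous $C$, $\int_0^T(\cdot)\,dC(t)$ denotes the Lebesgue–Stieltjes integral over $[0,T]$, including a possible point mass $C(0)$ at $t=0$ (convention $C(0-)=0$). The budget sets are $$\mathcal{B}_{w^i}:=\{(x^i,C^i):\Omega\times[0,T]\to\mathbb{R}_+^2\text{ optional}:\ C^i\text{ right-continuous, nondecreasing},\ C^i(0-)=0\ P\text{-a.s.},\ \Psi(x^i,C^i)\le w^i\}.$$ Payoffs: with $C:=\sum_{j}C^j$, $C^{-i}:=\sum_{j\ne i}C^j$ and $u^i:\mathbb{R}_+^2\to\mathbb{R}_+$, $$U^i(x^i,C^i;C^{-i}):=E\Big[\int_0^T e^{-\int_0^t r(s)ds}u^i(x^i(t),C(t))\,dt\Big].$$ Subscripts on $u$ denote partial derivatives. Public good contribution game. Let $V^i(C^{-i}):=\sup_{(x^i,C^i)\in\mathcal{B}_{w^i}}U^i(x^i,C^i;C^{-i})$. A tuple $(\hat x^1,\dots,\hat x^n,\hat C^1,\dots,\hat C^n)$ is a Nash equilibrium if for all $i$, $(\hat x^i,\hat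 C^i)\in\mathcal{B}_{w^i}$ and $U^i(\hat x^i,\hat C^i;\hat C^{-i})=V^i(\hat C^{-i})$. Assumption U. (i) Each $u^i$ is increasing and strictly concave on $\mathbb{R}_+^2$ and twice continuously differentiable on $\mathbb{R}_{++}^2$ with negative definite Hessian; moreover $\lim_{x\downarrow0}u^i_x(x,c)=+\infty$ and $\lim_{x\uparrow\infty}u^i_x(x,c)=0$ for any $c>0$. (ii) For each $i$ the family $e^{-\int_0^t r(\omega,s)ds}u^i(x^i(\omega,t),C(\omega,t))$, indexed by $((x^j,C^j))_{j}\in\prod_{j=1}^n\mathcal{B}_{w^j}$ with $C=\sum_jC^j$, is $P\otimes dt$-uniformly integrable. Assumption P. (i) $\psi_c=\{\psi_c(t),t\in[0,T]\}$ is adapted, right-continuous, $\psi_c(t)=e^{-\int_0^t r_c(s)ds}\mathcal{E}_c(t)$ a.s. for every $t\in[0,T]$, with $r_c$ a uniformly bounded, strictly positive process and $\mathcal{E}_c=\{\mathcal{E}_c(t),t\in[0,T]\}$ an exponential martingale (strictly positive, mean one); if $T=\infty$ then $\psi_c(T)=0$ a.s. (ii) $\psi_x$ is adapted, right-continuous, $\psi_x(t)=e^{-\int_0^t r_x(s)ds}\mathcal{E}_x(t)$ a.s. for every $t\in[0,T]$, with $r_x$ uniformly bounded and strictly positive and $\mathcal{E}_x$ an exponential martingale. (iii) $r$ is optional, strictly positive and uniformly bounded.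
   Formalization: The utility u is additionally assumed continuous on the closed quadrant R_+^2 (equilibria can fail to exist otherwise); for T = infinity processes live on [0,infinity) and C(t) may tend to infinity. *)

theory Defs
  imports "HOL-Probability.Probability"
begin

text \<open>
  Processes are curried functions of type \<open>'a \<Rightarrow> real \<Rightarrow> real\<close>, and only their values at times in
  \<open>[0,T]\<close> matter. For \<open>T = \<infinity>\<close> the index set is \<open>[0,\<infinity>)\<close>: the convention \<open>\<psi>\<^sub>c(\<infinity>) = 0\<close> says that
  mass at time \<open>\<infinity>\<close> carries no cost, so it is implemented by integrating over \<open>[0,\<infinity>)\<close>. In particular
  \<open>C(t)\<close> has to be finite for every finite \<open>t\<close>, but it may be unbounded as \<open>t\<close> tends to \<open>\<infinity>\<close>.
\<close>

definition horizon :: "ereal \<Rightarrow> real set" where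
  "horizon T = {t. 0 \<le> t \<and> ereal t \<le> T}"

definition leb :: "ereal \<Rightarrow> real measure" where
  "leb T = restrict_space lborel (horizon T)"

definition filtration_on :: "'a measure \<Rightarrow> (real \<Rightarrow> 'a measure) \<Rightarrow> ereal \<Rightarrow> bool" where
  "filtration_on M F T \<longleftrightarrow>
     (\<forall>t\<in>horizon T. subalgebra M (F t)) \<and>
     (\<forall>s\<in>horizon T. \<forall>t\<in>horizon T. s \<le> t \<longrightarrow> sets (F s) \<subseteq> sets (F t))"

definition usual_conditions :: "'a measure \<Rightarrow> (real \<Rightarrow> 'a measure) \<Rightarrow> ereal \<Rightarrow> bool" where
  "usual_conditions M F T \<longleftrightarrow>
     complete_measure M \<and> null_sets M \<subseteq> sets (F 0) \<and>
     (\<forall>t\<in>horizon T. ereal t < T \<longrightarrow> sets (F t) = (\<Inter>s\<in>{s\<in>horizon T. t < s}. sets (F s)))"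

definition right_continuous_on :: "real set \<Rightarrow> (real \<Rightarrow> real) \<Rightarrow> bool" where
  "right_continuous_on S f \<longleftrightarrow> (\<forall>t\<in>S. (f \<longlongrightarrow> f t) (at t within (S \<inter> {t<..})))"

definition has_left_limits_on :: "real set \<Rightarrow> (real \<Rightarrow> real) \<Rightarrow> bool" where
  "has_left_limits_on S f \<longleftrightarrow> (\<forall>t\<in>S. \<exists>l. (f \<longlongrightarrow> l) (at t within (S \<inter> {..<t})))"

definition adapted :: "(real \<Rightarrow> 'a measure) \<Rightarrow> ereal \<Rightarrow> ('a \<Rightarrow> real \<Rightarrow> real) \<Rightarrow> bool" where
  "adapted F T X \<longleftrightarrow> (\<forall>t\<in>horizon T. (\<lambda>\<omega>. X \<omega> t) \<in> borel_measurable (F t))"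

definition cadlag_adapted ::
    "'a measure \<Rightarrow> (real \<Rightarrow> 'a measure) \<Rightarrow> ereal \<Rightarrow> ('a \<Rightarrow> real \<Rightarrow> real) \<Rightarrow> bool" where
  "cadlag_adapted M F T X \<longleftrightarrow> adapted F T X \<and>
     (\<forall>\<omega>\<in>space M. right_continuous_on (horizon T) (X \<omega>) \<and> has_left_limits_on (horizon T) (X \<omega>))"

definition optional_sigma ::
    "'a measure \<Rightarrow> (real \<Rightarrow> 'a measure) \<Rightarrow> ereal \<Rightarrow> ('a \<times> real) measure" where
  "optional_sigma M F T = sigma (space M \<times> horizon T)
     {{(\<omega>, t). \<omega> \<in> space M \<and> t \<in> horizon T \<and> X \<omega> t \<in> B} | X B.
        cadlag_adapted M F T X \<and> B \<in> sets borel}"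

definition optional_process ::
    "'a measure \<Rightarrow> (real \<Rightarrow> 'a measure) \<Rightarrow> ereal \<Rightarrow> ('a \<Rightarrow> real \<Rightarrow> real) \<Rightarrow> bool" where
  "optional_process M F T X \<longleftrightarrow> (\<lambda>(\<omega>, t). X \<omega> t) \<in> borel_measurable (optional_sigma M F T)"

definition martingale_on ::
    "'a measure \<Rightarrow> (real \<Rightarrow> 'a measure) \<Rightarrow> ereal \<Rightarrow> ('a \<Rightarrow> real \<Rightarrow> real) \<Rightarrow> bool" where
  "martingale_on M F T X \<longleftrightarrow> adapted F T X \<and>
     (\<forall>t\<in>horizon T. integrable M (\<lambda>\<omega>. X \<omega> t)) \<and>
     (\<forall>s\<in>horizon T. \<forall>t\<in>horizon T. s \<le> t \<longrightarrow>
        (AE \<omega> in M. real_cond_exp M (F s) (\<lambda>\<omega>. X \<omega> t) \<omega> = X \<omega> s))"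

definition exponential_martingale ::
    "'a measure \<Rightarrow> (real \<Rightarrow> 'a measure) \<Rightarrow> ereal \<Rightarrow> ('a \<Rightarrow> real \<Rightarrow> real) \<Rightarrow> bool" where
  "exponential_martingale M F T X \<longleftrightarrow> martingale_on M F T X \<and>
     (AE \<omega> in M. \<forall>t\<in>horizon T. 0 < X \<omega> t) \<and>
     (\<forall>t\<in>horizon T. (\<integral>\<omega>. X \<omega> t \<partial>M) = 1)"

definition pos_bounded :: "'a measure \<Rightarrow> ereal \<Rightarrow> ('a \<Rightarrow> real \<Rightarrow> real) \<Rightarrow> bool" where
  "pos_bounded M T \<rho> \<longleftrightarrow> (\<exists>K. AE \<omega> in M. \<forall>t\<in>horizon T. 0 < \<rho> \<omega> t \<and> \<rho> \<omega> t \<le> K)"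

definition discount :: "('a \<Rightarrow> real \<Rightarrow> real) \<Rightarrow> 'a \<Rightarrow> real \<Rightarrow> real" where
  "discount \<rho> \<omega> t = exp (- (LBINT s:{0..t}. \<rho> \<omega> s))"

text \<open>
  The identity \<open>\<psi>(t) = e\<^bsup>-\<integral>\<rho>\<^esup> \<E>(t)\<close> is required almost surely for each fixed \<open>t\<close>, so \<open>\<E>\<close> need not be right-continuous. The process \<open>\<rho>\<close> is jointly measurable, so that
  its time integral makes sense, but it is not assumed to be optional.
\<close>

definition price_process ::
    "'a measure \<Rightarrow> (real \<Rightarrow> 'a measure) \<Rightarrow> ereal \<Rightarrow> ('a \<Rightarrow> real \<Rightarrow> real) \<Rightarrow> bool" where
  "price_process M F T \<psi> \<longleftrightarrow> adapted F T \<psi> \<and>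
     (AE \<omega> in M. right_continuous_on (horizon T) (\<psi> \<omega>)) \<and>
     (AE \<omega> in M. \<forall>t\<in>horizon T. 0 < \<psi> \<omega> t) \<and>
     (\<exists>\<rho> \<E>. (\<lambda>(\<omega>, t). \<rho> \<omega> t) \<in> borel_measurable (M \<Otimes>\<^sub>M leb T) \<and> pos_bounded M T \<rho> \<and>
        exponential_martingale M F T \<E> \<and>
        (\<forall>t\<in>horizon T. AE \<omega> in M. \<psi> \<omega> t = discount \<rho> \<omega> t * \<E> \<omega> t))"

definition assumption_P ::
    "'a measure \<Rightarrow> (real \<Rightarrow> 'a measure) \<Rightarrow> ereal \<Rightarrow> ('a \<Rightarrow> real \<Rightarrow> real) \<Rightarrow>
     ('a \<Rightarrow> real \<Rightarrow> real) \<Rightarrow> ('a \<Rightarrow> real \<Rightarrow> real) \<Rightarrow> bool" where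
  "assumption_P M F T \<psi>x \<psi>c r \<longleftrightarrow>
     price_process M F T \<psi>c \<and> price_process M F T \<psi>x \<and>
     optional_process M F T r \<and> pos_bounded M T r"

text \<open>
  A path on \<open>[0,T]\<close> is extended by \<open>0\<close> to negative times, i.e. \<open>C(0-) = 0\<close>, and by \<open>C(T)\<close> beyond
  \<open>T\<close>. Hence its Stieltjes measure has a point mass \<open>C(0)\<close> at \<open>0\<close> and no mass outside \<open>[0,T]\<close>.
\<close>

definition extend_path :: "ereal \<Rightarrow> (real \<Rightarrow> real) \<Rightarrow> real \<Rightarrow> real" where
  "extend_path T C s = (if s < 0 then 0 else C (real_of_ereal (min (ereal s) T)))"

definition stieltjes_integral :: "ereal \<Rightarrow> (real \<Rightarrow> real) \<Rightarrow> (real \<Rightarrow> real) \<Rightarrow> ennreal" where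
  "stieltjes_integral T f C =
     (\<integral>\<^sup>+t\<in>horizon T. ennreal (f t) \<partial>interval_measure (extend_path T C))"

definition contribution_cost ::
    "'a measure \<Rightarrow> ereal \<Rightarrow> ('a \<Rightarrow> real \<Rightarrow> real) \<Rightarrow> ('a \<Rightarrow> real \<Rightarrow> real) \<Rightarrow> ennreal" where
  "contribution_cost M T \<psi>c C = (\<integral>\<^sup>+\<omega>. stieltjes_integral T (\<psi>c \<omega>) (C \<omega>) \<partial>M)"

definition total_cost ::
    "'a measure \<Rightarrow> ereal \<Rightarrow> ('a \<Rightarrow> real \<Rightarrow> real) \<Rightarrow> ('a \<Rightarrow> real \<Rightarrow> real) \<Rightarrow>
     ('a \<Rightarrow> real \<Rightarrow> real) \<Rightarrow> ('a \<Rightarrow> real \<Rightarrow> real) \<Rightarrow> ennreal" where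
  "total_cost M T \<psi>x \<psi>c x C =
     (\<integral>\<^sup>+\<omega>. (\<integral>\<^sup>+t. ennreal (\<psi>x \<omega> t * x \<omega> t) \<partial>leb T) + stieltjes_integral T (\<psi>c \<omega>) (C \<omega>) \<partial>M)"

definition budget ::
    "'a measure \<Rightarrow> (real \<Rightarrow> 'a measure) \<Rightarrow> ereal \<Rightarrow> ('a \<Rightarrow> real \<Rightarrow> real) \<Rightarrow>
     ('a \<Rightarrow> real \<Rightarrow> real) \<Rightarrow> real \<Rightarrow> (('a \<Rightarrow> real \<Rightarrow> real) \<times> ('a \<Rightarrow> real \<Rightarrow> real)) set" where
  "budget M F T \<psi>x \<psi>c w = {(x, C).
     optional_process M F T x \<and> optional_process M F T C \<and>
     (\<forall>\<omega>\<in>space M. \<forall>t\<in>horizon T. 0 \<le> x \<omega> t \<and> 0 \<le> C \<omega> t) \<and>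
     (AE \<omega> in M. right_continuous_on (horizon T) (C \<omega>) \<and> mono_on (horizon T) (C \<omega>)) \<and>
     total_cost M T \<psi>x \<psi>c x C \<le> ennreal w}"

definition partial_x :: "(real \<times> real \<Rightarrow> real) \<Rightarrow> real \<times> real \<Rightarrow> real" where
  "partial_x f = (\<lambda>(x, c). deriv (\<lambda>s. f (s, c)) x)"

definition partial_c :: "(real \<times> real \<Rightarrow> real) \<Rightarrow> real \<times> real \<Rightarrow> real" where
  "partial_c f = (\<lambda>(x, c). deriv (\<lambda>s. f (x, s)) c)"

definition C1_on :: "(real \<times> real) set \<Rightarrow> (real \<times> real \<Rightarrow> real) \<Rightarrow> bool" where
  "C1_on S f \<longleftrightarrow>
     (\<forall>(x, c)\<in>S. (\<lambda>s. f (s, c)) field_differentiable at x \<and> (\<lambda>s. f (x, s)) field_differentiable at c) \<and>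
     continuous_on S (partial_x f) \<and> continuous_on S (partial_c f)"

definition C2_on :: "(real \<times> real) set \<Rightarrow> (real \<times> real \<Rightarrow> real) \<Rightarrow> bool" where
  "C2_on S f \<longleftrightarrow> C1_on S f \<and> C1_on S (partial_x f) \<and> C1_on S (partial_c f)"

definition neg_def_hessian :: "(real \<times> real \<Rightarrow> real) \<Rightarrow> real \<times> real \<Rightarrow> bool" where
  "neg_def_hessian f p \<longleftrightarrow> (\<forall>a b. (a, b) \<noteq> (0, 0) \<longrightarrow>
     a * (partial_x (partial_x f) p * a + partial_c (partial_x f) p * b) +
     b * (partial_x (partial_c f) p * a + partial_c (partial_c f) p * b) < 0)"

definition strictly_concave_on :: "(real \<times> real) set \<Rightarrow> (real \<times> real \<Rightarrow> real) \<Rightarrow> bool" where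
  "strictly_concave_on S f \<longleftrightarrow> convex S \<and>
     (\<forall>p\<in>S. \<forall>q\<in>S. p \<noteq> q \<longrightarrow> (\<forall>\<theta>. 0 < \<theta> \<and> \<theta> < 1 \<longrightarrow>
        (1 - \<theta>) * f p + \<theta> * f q < f ((1 - \<theta>) *\<^sub>R p + \<theta> *\<^sub>R q)))"

text \<open>
  Continuity up to the boundary of the quadrant does not follow from the other conditions, and
  equilibria need not exist without it: \<open>u(x,c) = \<surd>x + \<delta>(1 - e\<^bsup>-c\<^esup>) + 1\<^bsub>{c>0}\<^esub>\<close> with small \<open>\<delta> > 0\<close>
  satisfies all of them, but an agent would like to contribute an arbitrarily small amount
  which is not \<open>0\<close>.
\<close>

definition utility_function :: "(real \<times> real \<Rightarrow> real) \<Rightarrow> bool" where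
  "utility_function u \<longleftrightarrow>
     (\<forall>p\<in>{0..} \<times> {0..}. 0 \<le> u p) \<and>
     (\<forall>x y c d. 0 \<le> x \<and> x \<le> y \<and> 0 \<le> c \<and> c \<le> d \<longrightarrow> u (x, c) \<le> u (y, d)) \<and>
     strictly_concave_on ({0..} \<times> {0..}) u \<and>
     continuous_on ({0..} \<times> {0..}) u \<and>
     C2_on ({0<..} \<times> {0<..}) u \<and>
     (\<forall>p\<in>{0<..} \<times> {0<..}. neg_def_hessian u p) \<and>
     (\<forall>c>0. filterlim (\<lambda>x. partial_x u (x, c)) at_top (at_right 0)) \<and>
     (\<forall>c>0. ((\<lambda>x. partial_x u (x, c)) \<longlongrightarrow> 0) at_top)"

text \<open>
  Uniform integrability on a possibly infinite measure space (\<open>P \<otimes> dt\<close> is infinite for \<open>T = \<infinity>\<close>):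
  the truncation level is an integrable function instead of a constant. On finite measure spaces
  this is equivalent to the usual definition with constant truncation levels.
\<close>

definition uniformly_integrable :: "'b measure \<Rightarrow> ('b \<Rightarrow> real) set \<Rightarrow> bool" where
  "uniformly_integrable N S \<longleftrightarrow> S \<subseteq> borel_measurable N \<and>
     (\<forall>\<epsilon>>0. \<exists>g. integrable N g \<and> (\<forall>z\<in>space N. 0 \<le> g z) \<and>
        (\<forall>f\<in>S. (\<integral>\<^sup>+z\<in>{z. g z < \<bar>f z\<bar>}. ennreal \<bar>f z\<bar> \<partial>N) \<le> ennreal \<epsilon>))"

definition assumption_U ::
    "'a measure \<Rightarrow> (real \<Rightarrow> 'a measure) \<Rightarrow> ereal \<Rightarrow> ('a \<Rightarrow> real \<Rightarrow> real) \<Rightarrow>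
     ('a \<Rightarrow> real \<Rightarrow> real) \<Rightarrow> ('a \<Rightarrow> real \<Rightarrow> real) \<Rightarrow> nat \<Rightarrow> (nat \<Rightarrow> real) \<Rightarrow>
     (nat \<Rightarrow> real \<times> real \<Rightarrow> real) \<Rightarrow> bool" where
  "assumption_U M F T \<psi>x \<psi>c r n w u \<longleftrightarrow>
     (\<forall>i\<in>{1..n}. utility_function (u i)) \<and>
     (\<forall>i\<in>{1..n}. uniformly_integrable (M \<Otimes>\<^sub>M leb T)
        {(\<lambda>(\<omega>, t). discount r \<omega> t * u i (x i \<omega> t, \<Sum>j\<in>{1..n}. C j \<omega> t)) | x C.
           \<forall>j\<in>{1..n}. (x j, C j) \<in> budget M F T \<psi>x \<psi>c (w j)})"

definition payoff ::
    "'a measure \<Rightarrow> ereal \<Rightarrow> ('a \<Rightarrow> real \<Rightarrow> real) \<Rightarrow> (real \<times> real \<Rightarrow> real) \<Rightarrow>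
     ('a \<Rightarrow> real \<Rightarrow> real) \<Rightarrow> ('a \<Rightarrow> real \<Rightarrow> real) \<Rightarrow> ('a \<Rightarrow> real \<Rightarrow> real) \<Rightarrow> ennreal" where
  "payoff M T r u x C D =
     (\<integral>\<^sup>+\<omega>. \<integral>\<^sup>+t. ennreal (discount r \<omega> t * u (x \<omega> t, C \<omega> t + D \<omega> t)) \<partial>leb T \<partial>M)"

definition others :: "nat \<Rightarrow> (nat \<Rightarrow> 'a \<Rightarrow> real \<Rightarrow> real) \<Rightarrow> nat \<Rightarrow> 'a \<Rightarrow> real \<Rightarrow> real" where
  "others n C i = (\<lambda>\<omega> t. \<Sum>j\<in>{1..n} - {i}. C j \<omega> t)"

definition best_value ::
    "'a measure \<Rightarrow> (real \<Rightarrow> 'a measure) \<Rightarrow> ereal \<Rightarrow> ('a \<Rightarrow> real \<Rightarrow> real) \<Rightarrow>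
     ('a \<Rightarrow> real \<Rightarrow> real) \<Rightarrow> ('a \<Rightarrow> real \<Rightarrow> real) \<Rightarrow> real \<Rightarrow> (real \<times> real \<Rightarrow> real) \<Rightarrow>
     ('a \<Rightarrow> real \<Rightarrow> real) \<Rightarrow> ennreal" where
  "best_value M F T \<psi>x \<psi>c r w u D = (SUP (x, C)\<in>budget M F T \<psi>x \<psi>c w. payoff M T r u x C D)"

definition nash_equilibrium ::
    "'a measure \<Rightarrow> (real \<Rightarrow> 'a measure) \<Rightarrow> ereal \<Rightarrow> ('a \<Rightarrow> real \<Rightarrow> real) \<Rightarrow>
     ('a \<Rightarrow> real \<Rightarrow> real) \<Rightarrow> ('a \<Rightarrow> real \<Rightarrow> real) \<Rightarrow> nat \<Rightarrow> (nat \<Rightarrow> real) \<Rightarrow>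
     (nat \<Rightarrow> real \<times> real \<Rightarrow> real) \<Rightarrow> (nat \<Rightarrow> 'a \<Rightarrow> real \<Rightarrow> real) \<Rightarrow>
     (nat \<Rightarrow> 'a \<Rightarrow> real \<Rightarrow> real) \<Rightarrow> bool" where
  "nash_equilibrium M F T \<psi>x \<psi>c r n w u x C \<longleftrightarrow> (\<forall>i\<in>{1..n}.
     (x i, C i) \<in> budget M F T \<psi>x \<psi>c (w i) \<and>
     payoff M T r (u i) (x i) (C i) (others n C i) =
       best_value M F T \<psi>x \<psi>c r (w i) (u i) (others n C i))"

end

theory Submission
  imports Defs
begin

text \<open>
  Consider a single agent with budget \<open>y\<close>, who maximizes \<open>U(x, C)\<close> subject to \<open>A x + B C \<le> y\<close>, where \<open>A\<close> and
  \<open>B\<close> are the costs of consumption and contribution. Strict concavity and uniform integrability give a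
  unique optimal plan for every \<open>y\<close>. As \<open>u\<close> is
  supermodular, both of its costs are nondecreasing in \<open>y\<close>, hence continuous, so for a suitable \<open>y\<close> the plan
  satisfies \<open>n A x + B C = w\<close>. Optimality means that \<open>(x, C)\<close> maximizes the Lagrangian \<open>U - \<mu> (A + B)\<close> over all plans.
  So no agent has a profitable deviation if all consume \<open>x\<close> and share the contribution \<open>C\<close> at equal cost.

  Conversely, let \<open>\<lambda>\<^sub>i\<close> be the multipliers of the agents in an equilibrium. Agents with a multiplier above the minimum
  do not contribute, and agents with a smaller multiplier consume more. Comparing budgets,
  all consumptions are equal, and summing the first-order conditions shows
  that consumption and total contribution solve the problem of the single agent.
\<close>

section \<open>Normal utility functions\<close>

text \<open>The game is moved to an abstract problem on the product of probability space and time
  with the optional sigma-algebra. Of contributions it uses only that they form a convex cone and a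
  lattice, that their cost is additive, monotone and above a weighted L1 norm, and that an almost
  everywhere limit of contributions has a version of no higher limiting cost. Monotonicity and the
  limit property are the probabilistic core: both fail path by path for a merely right-continuous
  price and hold in mean, by supermartingale estimates on dyadic grids. The other obstacle is that
  \<open>u\<close> may fail to be differentiable on the boundary of the quadrant. First-order
  conditions are therefore never stated as derivatives of \<open>U\<close>. Difference quotients
  along a fixed sequence of step sizes are integrated, and a Fatou argument passes to the limit.
  Contributions can be withdrawn only where the total is positive, and there the Inada condition
  makes consumption positive, so two-sided derivatives exist where they matter.\<close>

locale normal_utility =
  fixes u :: "real \<times> real \<Rightarrow> real"
  assumes utility: "utility_function u"
    and mixed_partial_nonneg: "\<forall>p\<in>{0<..} \<times> {0<..}. 0 \<le> partial_c (partial_x u) p"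
begin

lemma u_nonneg: "0 \<le> x \<Longrightarrow> 0 \<le> c \<Longrightarrow> 0 \<le> u (x, c)"
  using utility unfolding utility_function_def by auto

lemma u_mono: "0 \<le> x \<Longrightarrow> x \<le> y \<Longrightarrow> 0 \<le> c \<Longrightarrow> c \<le> d \<Longrightarrow> u (x, c) \<le> u (y, d)"
  using utility unfolding utility_function_def by auto

lemma u_cont: "continuous_on ({0..} \<times> {0..}) u"
  using utility unfolding utility_function_def by auto

lemma u_strictly_concave:
  assumes "0 \<le> x" "0 \<le> c" "0 \<le> y" "0 \<le> d" "(x, c) \<noteq> (y, d)" "0 < \<theta>" "\<theta> < 1"
  shows "(1 - \<theta>) * u (x, c) + \<theta> * u (y, d) < u ((1 - \<theta>) * x + \<theta> * y, (1 - \<theta>) * c + \<theta> * d)"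
proof -
  have "strictly_concave_on ({0..} \<times> {0..}) u"
    using utility unfolding utility_function_def by auto
  then have "(1 - \<theta>) * u (x, c) + \<theta> * u (y, d) < u ((1 - \<theta>) *\<^sub>R (x, c) + \<theta> *\<^sub>R (y, d))"
    unfolding strictly_concave_on_def using assms by (metis atLeast_iff mem_Sigma_iff)
  then show ?thesis by simp
qed

lemma u_concave:
  assumes "0 \<le> x" "0 \<le> c" "0 \<le> y" "0 \<le> d" "0 \<le> \<theta>" "\<theta> \<le> 1"
  shows "(1 - \<theta>) * u (x, c) + \<theta> * u (y, d) \<le> u ((1 - \<theta>) * x + \<theta> * y, (1 - \<theta>) * c + \<theta> * d)"
proof (cases "(x, c) = (y, d) \<or> \<theta> = 0 \<or> \<theta> = 1")
  case True
  then show ?thesis by (auto simp: algebra_simps simp flip: distrib_right)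
next
  case False
  then show ?thesis using u_strictly_concave[of x c y d \<theta>] assms by simp
qed

text \<open>\<open>utility_function\<close> only provides weak monotonicity. A flat stretch would
  contradict strict concavity at its midpoint, whose value is at most that at the right end.\<close>

lemma u_strict_mono: "0 \<le> x \<Longrightarrow> x < y \<Longrightarrow> 0 \<le> c \<Longrightarrow> u (x, c) < u (y, c)"
proof (rule ccontr)
  assume a: "0 \<le> x" "x < y" "0 \<le> c" "\<not> u (x, c) < u (y, c)"
  have "(1 - 1/2) * u (x, c) + 1/2 * u (y, c) < u ((1 - 1/2) * x + 1/2 * y, (1 - 1/2) * c + 1/2 * c)"
    using a by (intro u_strictly_concave) auto
  moreover have "u ((1 - 1/2) * x + 1/2 * y, (1 - 1/2) * c + 1/2 * c) \<le> u (y, c)"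
    using a by (intro u_mono) auto
  ultimately show False using a by auto
qed

text \<open>Concavity on the segment from the origin, where \<open>u\<close> is nonnegative. This
  carries uniform integrability from the budget \<open>w0\<close> to all budgets.\<close>

lemma u_scale: "1 \<le> \<kappa> \<Longrightarrow> 0 \<le> x \<Longrightarrow> 0 \<le> c \<Longrightarrow> u (x, c) \<le> \<kappa> * u (x / \<kappa>, c / \<kappa>)"
proof -
  assume a: "1 \<le> \<kappa>" "0 \<le> x" "0 \<le> c"
  have "(1 - 1/\<kappa>) * u (0, 0) + 1/\<kappa> * u (x, c) \<le> u ((1 - 1/\<kappa>) * 0 + 1/\<kappa> * x, (1 - 1/\<kappa>) * 0 + 1/\<kappa> * c)"
    using a by (intro u_concave) auto
  moreover have "0 \<le> (1 - 1/\<kappa>) * u (0, 0)" using a u_nonneg[of 0 0] by simp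
  ultimately have "1/\<kappa> * u (x, c) \<le> u (x / \<kappa>, c / \<kappa>)" by simp
  then have "\<kappa> * (1/\<kappa> * u (x, c)) \<le> \<kappa> * u (x / \<kappa>, c / \<kappa>)" using a by (intro mult_left_mono) auto
  then show ?thesis using a by simp
qed

lemma u_partials:
  assumes "0 < x" "0 < c"
  shows "((\<lambda>s. u (s, c)) has_field_derivative partial_x u (x, c)) (at x)"
    and "((\<lambda>s. u (x, s)) has_field_derivative partial_c u (x, c)) (at c)"
    and "((\<lambda>s. partial_x u (x, s)) has_field_derivative partial_c (partial_x u) (x, c)) (at c)"
proof -
  have "C2_on ({0<..} \<times> {0<..}) u" using utility unfolding utility_function_def by auto
  then show "((\<lambda>s. u (s, c)) has_field_derivative partial_x u (x, c)) (at x)"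
    "((\<lambda>s. u (x, s)) has_field_derivative partial_c u (x, c)) (at c)"
    "((\<lambda>s. partial_x u (x, s)) has_field_derivative partial_c (partial_x u) (x, c)) (at c)"
    unfolding C2_on_def C1_on_def
    using assms by (auto simp: partial_x_def[of u] partial_c_def DERIV_deriv_iff_field_differentiable)
qed

lemma partial_x_mono:
  assumes "0 < x" "0 < c" "c \<le> d"
  shows "partial_x u (x, c) \<le> partial_x u (x, d)"
proof (rule DERIV_nonneg_imp_nondecreasing[OF \<open>c \<le> d\<close>])
  fix s assume "c \<le> s" "s \<le> d"
  then have "((\<lambda>s. partial_x u (x, s)) has_real_derivative partial_c (partial_x u) (x, s)) (at s)"
      "0 \<le> partial_c (partial_x u) (x, s)"
    using assms mixed_partial_nonneg u_partials(3)[of x s] by auto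
  then show "\<exists>y. ((\<lambda>s. partial_x u (x, s)) has_real_derivative y) (at s) \<and> 0 \<le> y" by auto
qed

text \<open>The mixed partial derivative is available only in the open quadrant. The inequality is
  proved there and reaches the boundary by shifting all four points diagonally and using
  continuity.\<close>

lemma u_increasing_differences:
  assumes "0 \<le> x" "x \<le> y" "0 \<le> c" "c \<le> d"
  shows "u (y, c) + u (x, d) \<le> u (x, c) + u (y, d)"
proof -
  have int: "u (y, c) + u (x, d) \<le> u (x, c) + u (y, d)"
    if "0 < x" "x \<le> y" "0 < c" "c \<le> d" for x y c d
  proof -
    have "u (x, d) - u (x, c) \<le> u (y, d) - u (y, c)"
    proof (rule DERIV_nonneg_imp_nondecreasing[OF \<open>x \<le> y\<close>])
      fix s assume s: "x \<le> s" "s \<le> y"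
      have "((\<lambda>s. u (s, d) - u (s, c)) has_real_derivative
          partial_x u (s, d) - partial_x u (s, c)) (at s)"
        using that s by (intro derivative_intros u_partials) auto
      moreover have "0 \<le> partial_x u (s, d) - partial_x u (s, c)"
        using that s partial_x_mono[of s c d] by auto
      ultimately show "\<exists>y. ((\<lambda>s. u (s, d) - u (s, c)) has_real_derivative y) (at s) \<and> 0 \<le> y"
        by auto
    qed
    then show ?thesis by simp
  qed
  have lim: "(\<lambda>n. u (a + 1 / real (Suc n), b + 1 / real (Suc n))) \<longlonglongrightarrow> u (a, b)"
    if "0 \<le> a" "0 \<le> b" for a b
  proof (rule continuous_on_tendsto_compose[OF u_cont])
    have "(\<lambda>n. (a + 1 / real (Suc n), b + 1 / real (Suc n))) \<longlonglongrightarrow> (a + 0, b + 0)"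
      by (intro tendsto_intros LIMSEQ_Suc[OF lim_1_over_n])
    then show "(\<lambda>n. (a + 1 / real (Suc n), b + 1 / real (Suc n))) \<longlonglongrightarrow> (a, b)" by simp
  qed (use that in auto)
  show ?thesis
  proof (rule LIMSEQ_le)
    show "(\<lambda>n. u (y + 1 / real (Suc n), c + 1 / real (Suc n))
        + u (x + 1 / real (Suc n), d + 1 / real (Suc n))) \<longlonglongrightarrow> u (y, c) + u (x, d)"
      using assms by (intro tendsto_intros lim) auto
    show "(\<lambda>n. u (x + 1 / real (Suc n), c + 1 / real (Suc n))
        + u (y + 1 / real (Suc n), d + 1 / real (Suc n))) \<longlonglongrightarrow> u (x, c) + u (y, d)"
      using assms by (intro tendsto_intros lim) auto
    show "\<exists>N. \<forall>n\<ge>N. u (y + 1 / real (Suc n), c + 1 / real (Suc n))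
        + u (x + 1 / real (Suc n), d + 1 / real (Suc n))
      \<le> u (x + 1 / real (Suc n), c + 1 / real (Suc n))
        + u (y + 1 / real (Suc n), d + 1 / real (Suc n))"
      using assms by (intro exI allI impI int) (auto simp: add_nonneg_pos)
  qed
qed

lemma u_supermodular:
  assumes "0 \<le> x" "0 \<le> c" "0 \<le> y" "0 \<le> d"
  shows "u (x, c) + u (y, d) \<le> u (max x y, max c d) + u (min x y, min c d)"
  using assms u_increasing_differences[of x y d c] u_increasing_differences[of y x c d]
  by (auto simp: max_def min_def)

text \<open>The point is linearity in the direction: \<open>p\<close> and \<open>q\<close> are
  chosen before \<open>a\<close> and \<open>b\<close>, so the effects of contributions made and
  withdrawn add up. One partial derivative at the point and continuity of the other around it
  suffice.\<close>

lemma u_directional_derivative: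
  assumes "0 < x" "0 < c"
  obtains p q where "\<And>a b. ((\<lambda>e. (u (x + e * a, c + e * b) - u (x, c)) / e) \<longlongrightarrow> p * a + q * b) (at 0)"
proof
  fix a b
  let ?Q = "{0<..} \<times> {0<..} :: (real \<times> real) set"
  have C1: "continuous_on ?Q (partial_c u)"
    using utility unfolding utility_function_def C2_on_def C1_on_def by auto
  have "((\<lambda>(x, y). (\<lambda>x y. u (x, y)) x y) has_derivative
      (\<lambda>(tx, ty). (\<lambda>t. t * partial_x u (x, c)) tx +
         blinfun_apply ((\<lambda>x c. blinfun_scaleR_left (partial_c u (x, c))) x c) ty)) (at (x, c) within ?Q)"
  proof (rule has_derivative_partialsI[where f = "\<lambda>x y. u (x, y)" and y = c and x = x
        and fx = "\<lambda>t. t * partial_x u (x, c)" and X = "{0<..}" and Y = "{0<..}"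
        and fy = "\<lambda>x c. blinfun_scaleR_left (partial_c u (x, c))"])
    show "((\<lambda>x. u (x, c)) has_derivative (\<lambda>t. t * partial_x u (x, c))) (at x within {0<..})"
      using has_derivative_at_withinI[OF u_partials(1)[OF assms, unfolded has_field_derivative_def]]
      by (simp add: mult_commute_abs)
    fix s t :: real assume "s \<in> {0<..}" "t \<in> {0<..}"
    then have "((\<lambda>y. u (s, y)) has_derivative (*) (partial_c u (s, t))) (at t within {0<..})"
      using has_derivative_at_withinI[OF u_partials(2)[of s t, unfolded has_field_derivative_def]]
      by auto
    moreover have "blinfun_apply (blinfun_scaleR_left (partial_c u (s, t))) = (*) (partial_c u (s, t))"
      by (auto simp: fun_eq_iff)
    ultimately show "((\<lambda>y. u (s, y)) has_derivative blinfun_apply (blinfun_scaleR_left (partial_c u (s, t)))) (at t within {0<..})"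
      by simp
  next
    have "continuous_on ?Q (\<lambda>p. blinfun_scaleR_left (partial_c u p))"
      using C1 by (intro bounded_linear.continuous_on[OF bounded_linear_blinfun_scaleR_left])
    then show "continuous (at (x, c) within ?Q) (\<lambda>(x, y). blinfun_scaleR_left (partial_c u (x, y)))"
      using assms by (auto simp: continuous_on_eq_continuous_within split_def)
  qed (use assms in auto)
  then have D: "(u has_derivative (\<lambda>(tx, ty). tx * partial_x u (x, c) + ty * partial_c u (x, c))) (at (x, c))"
    using assms by (subst (asm) at_within_open) (auto simp: open_Times)
  have "((\<lambda>e. (x + e * a, c + e * b)) has_derivative (\<lambda>e. (e * a, e * b))) (at 0)"
    by (auto intro!: derivative_eq_intros)
  from has_derivative_compose[OF this, of u "\<lambda>(tx, ty). tx * partial_x u (x, c) + ty * partial_c u (x, c)"] D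
  have "((\<lambda>e. u (x + e * a, c + e * b)) has_derivative
      (\<lambda>e. e * a * partial_x u (x, c) + e * b * partial_c u (x, c))) (at 0)"
    by (auto simp: split_def)
  then have "((\<lambda>e. u (x + e * a, c + e * b)) has_field_derivative
      (partial_x u (x, c) * a + partial_c u (x, c) * b)) (at 0)"
    unfolding has_field_derivative_def
    by (rule has_derivative_eq_rhs) (auto simp: algebra_simps)
  then show "((\<lambda>e. (u (x + e * a, c + e * b) - u (x, c)) / e) \<longlongrightarrow>
      partial_x u (x, c) * a + partial_c u (x, c) * b) (at 0)"
    by (simp add: DERIV_def)
qed

text \<open>By concavity in \<open>x\<close>, the slope of a chord starting at 0 dominates the
  derivative at its right end, and that derivative blows up at 0.\<close>

lemma u_inada:
  assumes "0 < c" "0 < h"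
  shows "filterlim (\<lambda>e. (u (e * h, c) - u (0, c)) / e) at_top (at_right 0)"
proof (rule filterlim_at_top_mono)
  have "filterlim (\<lambda>x. partial_x u (x, c)) at_top (at_right 0)"
    using utility assms unfolding utility_function_def by auto
  moreover have "filterlim (\<lambda>e. e * h) (at_right 0) (at_right 0)"
  proof -
    have "((\<lambda>e. e * h) \<longlongrightarrow> 0 * h) (at_right 0)" by (intro tendsto_intros)
    then show ?thesis
      using assms by (auto simp: filterlim_at eventually_at_right_less
        intro!: eventually_mono[OF eventually_at_right_less])
  qed
  ultimately have "filterlim (\<lambda>e. partial_x u (e * h, c)) at_top (at_right 0)"
    by (rule filterlim_compose)
  then show "filterlim (\<lambda>e. h * partial_x u (e * h, c)) at_top (at_right 0)"
    using assms by (intro filterlim_tendsto_pos_mult_at_top[OF tendsto_const])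
  show "\<forall>\<^sub>F e in at_right 0. h * partial_x u (e * h, c) \<le> (u (e * h, c) - u (0, c)) / e"
  proof (rule eventually_mono[OF eventually_at_right_less])
    fix e :: real assume "0 < e"
    define x where "x = e * h"
    have x: "0 < x" using \<open>0 < e\<close> assms by (simp add: x_def)
    have "((\<lambda>s. (u (s, c) - u (x, c)) / (s - x)) \<longlongrightarrow> partial_x u (x, c)) (at x)"
      using u_partials(1)[OF x assms(1)] by (rule has_field_derivativeD)
    then have "((\<lambda>s. (u (s, c) - u (x, c)) / (s - x)) \<longlongrightarrow> partial_x u (x, c)) (at_left x)"
      by (rule tendsto_within_subset) auto
    moreover have "\<forall>\<^sub>F s in at_left x. (u (s, c) - u (x, c)) / (s - x) \<le> (u (x, c) - u (0, c)) / x"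
    proof (rule eventually_at_leftI[of 0])
      fix s assume s: "s \<in> {0<..<x}"
      define \<theta> where "\<theta> = s / x"
      have "(1 - \<theta>) * u (0, c) + \<theta> * u (x, c) \<le> u ((1 - \<theta>) * 0 + \<theta> * x, (1 - \<theta>) * c + \<theta> * c)"
        using s x assms by (intro u_concave) (auto simp: \<theta>_def)
      also have "((1 - \<theta>) * 0 + \<theta> * x, (1 - \<theta>) * c + \<theta> * c) = (s, c)"
        using x by (auto simp: \<theta>_def algebra_simps)
      finally have "(1 - \<theta>) * (u (x, c) - u (0, c)) \<ge> u (x, c) - u (s, c)" by (simp add: algebra_simps)
      moreover have "1 - \<theta> = (x - s) / x" using x by (simp add: \<theta>_def field_simps)
      moreover have "v / x * (s - x) = - ((x - s) / x * v)" for v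
        using x by (simp add: divide_simps) (simp add: algebra_simps)
      ultimately have "(u (x, c) - u (0, c)) / x * (s - x) \<le> u (s, c) - u (x, c)"
        by simp
      then show "(u (s, c) - u (x, c)) / (s - x) \<le> (u (x, c) - u (0, c)) / x"
        using s by (subst neg_divide_le_eq) auto
    qed (use x in auto)
    ultimately have "partial_x u (x, c) \<le> (u (x, c) - u (0, c)) / x"
      by (intro tendsto_upperbound[of _ _ "at_left x"]) auto
    then have "h * partial_x u (x, c) \<le> h * ((u (x, c) - u (0, c)) / x)"
      using assms by (intro mult_left_mono) auto
    then show "h * partial_x u (e * h, c) \<le> (u (e * h, c) - u (0, c)) / e"
      using assms by (simp add: x_def)
  qed
qed

lemma concavity_gap_nonneg:
  assumes "0 \<le> x" "0 \<le> c" "0 \<le> y" "0 \<le> d"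
  shows "0 \<le> u ((x + y) / 2, (c + d) / 2) - (u (x, c) + u (y, d)) / 2"
proof -
  have e: "((1 - 1/2) * x + 1/2 * y, (1 - 1/2) * c + 1/2 * d) = ((x + y) / 2, (c + d) / 2)"
    by (simp add: field_simps)
  show ?thesis using u_concave[of x c y d "1/2", unfolded e] assms by simp
qed

lemma concavity_gap_pos:
  assumes "0 \<le> x" "0 \<le> c" "0 \<le> y" "0 \<le> d" "(x, c) \<noteq> (y, d)"
  shows "0 < u ((x + y) / 2, (c + d) / 2) - (u (x, c) + u (y, d)) / 2"
proof -
  have e: "((1 - 1/2) * x + 1/2 * y, (1 - 1/2) * c + 1/2 * d) = ((x + y) / 2, (c + d) / 2)"
    by (simp add: field_simps)
  show ?thesis using u_strictly_concave[of x c y d "1/2", unfolded e] assms by simp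
qed

text \<open>
  The left-hand side is a bounded metric on the quadrant. By compactness it is controlled by the
  concavity gap, up to a small error at large arguments.
\<close>

lemma concavity_gap_controls_distance:
  assumes "0 < \<epsilon>"
  obtains C where "0 \<le> C" "\<And>x c y d. 0 \<le> x \<Longrightarrow> 0 \<le> c \<Longrightarrow> 0 \<le> y \<Longrightarrow> 0 \<le> d \<Longrightarrow>
    \<bar>x / (1 + x) - y / (1 + y)\<bar> + \<bar>c / (1 + c) - d / (1 + d)\<bar>
      \<le> \<epsilon> + \<epsilon> * (x + c + y + d) + C * (u ((x + y) / 2, (c + d) / 2) - (u (x, c) + u (y, d)) / 2)"
proof -
  define D where "D = (\<lambda>(x::real, c::real, y::real, d::real).
    \<bar>x / (1 + x) - y / (1 + y)\<bar> + \<bar>c / (1 + c) - d / (1 + d)\<bar>)"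
  define g where "g = (\<lambda>(x, c, y, d). u ((x + y) / 2, (c + d) / 2) - (u (x, c) + u (y, d)) / 2)"
  \<comment> \<open>The left-hand side is at most 2, so once the coordinates sum to at least
    \<open>R\<close>, the term \<open>\<epsilon> * (x + c + y + d)\<close> alone covers it. A
    compact box remains.\<close>
  define R where "R = 2 / \<epsilon>"
  define B where "B = {0..R} \<times> {0..R} \<times> {0..R} \<times> {0..R}"
  define S where "S = B \<inter> D -` {\<epsilon>..}"
  have "compact B" unfolding B_def by (intro compact_Times compact_Icc)
  have "continuous_on B D" unfolding D_def B_def split_def
    by (intro continuous_intros) auto
  then have "closed S" unfolding S_def
    using compact_imp_closed[OF \<open>compact B\<close>] by (intro continuous_closed_preimage) auto
  then have "compact S" unfolding S_def
    using \<open>compact B\<close> by (metis Int_absorb1 compact_Int_closed Int_lower1)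
  have "continuous_on S g" unfolding g_def split_def
    by (intro continuous_intros continuous_on_compose2[OF u_cont]) (auto simp: S_def B_def)
  have D_le: "D (x, c, y, d) \<le> 2" if "0 \<le> x" "0 \<le> c" "0 \<le> y" "0 \<le> d" for x c y d
  proof -
    have "0 \<le> t / (1 + t) \<and> t / (1 + t) \<le> 1" if "0 \<le> t" for t :: real using that by auto
    from this[of x] this[of y] this[of c] this[of d] show ?thesis
      using that unfolding D_def case_prod_conv by linarith
  qed
  have g_pos: "0 < g q" if "q \<in> S" for q
  proof -
    obtain x c y d where q: "q = (x, c, y, d)" by (metis prod_cases4)
    have "(x, c) \<noteq> (y, d)" using that \<open>0 < \<epsilon>\<close> by (auto simp: q S_def D_def)
    then have "0 < u ((x + y) / 2, (c + d) / 2) - (u (x, c) + u (y, d)) / 2"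
      using that by (intro concavity_gap_pos) (auto simp: q S_def B_def)
    then show ?thesis by (simp add: q g_def)
  qed
  \<comment> \<open>Points of \<open>S\<close> are pairs at distance at least \<epsilon>. They avoid
    the diagonal, so the gap has a positive minimum on this compact set, and the factor
    \<open>2 / \<eta>\<close> lifts it to 2.\<close>
  obtain \<eta> where \<eta>: "0 < \<eta>" "\<And>q. q \<in> S \<Longrightarrow> \<eta> \<le> g q"
  proof (cases "S = {}")
    case False
    then obtain q where "q \<in> S" "\<forall>p\<in>S. g q \<le> g p"
      using continuous_attains_inf[OF \<open>compact S\<close> _ \<open>continuous_on S g\<close>] by auto
    then show ?thesis using that[of "g q"] g_pos by auto
  qed (use that[of 1] in auto)
  have "D (x, c, y, d) \<le> \<epsilon> + \<epsilon> * (x + c + y + d) + 2 / \<eta> * g (x, c, y, d)"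
    if "0 \<le> x" "0 \<le> c" "0 \<le> y" "0 \<le> d" for x c y d
  proof -
    have g0: "0 \<le> 2 / \<eta> * g (x, c, y, d)"
      using concavity_gap_nonneg[OF that] \<eta>(1) by (auto simp: g_def)
    have s0: "0 \<le> \<epsilon> * (x + c + y + d)" using that assms by auto
    consider "D (x, c, y, d) \<le> \<epsilon>" | "(x, c, y, d) \<in> S" | "R \<le> x + c + y + d"
    proof (cases "D (x, c, y, d) \<le> \<epsilon> \<or> R \<le> x + c + y + d")
      case False
      then have "(x, c, y, d) \<in> S" using \<open>0 \<le> x\<close> \<open>0 \<le> c\<close> \<open>0 \<le> y\<close> \<open>0 \<le> d\<close> by (simp add: S_def B_def)
      then show ?thesis by fact
    qed blast
    then show ?thesis
    proof cases
      case 1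
      then show ?thesis using g0 s0 by linarith
    next
      case 2
      have "2 / \<eta> * \<eta> \<le> 2 / \<eta> * g (x, c, y, d)" using \<eta>(1) \<eta>(2)[OF 2] by (intro mult_left_mono) auto
      then show ?thesis using D_le[OF that] s0 \<eta>(1) assms by auto
    next
      case 3
      then have "2 \<le> \<epsilon> * (x + c + y + d)" using assms by (auto simp: R_def field_simps)
      then show ?thesis using D_le[OF that] g0 assms by linarith
    qed
  qed
  then show ?thesis using that[of "2 / \<eta>"] \<eta>(1) unfolding D_def g_def by simp
qed

end

section \<open>An abstract contribution problem\<close>

definition consumptions :: "'z measure \<Rightarrow> ('z \<Rightarrow> real) set" where
  "consumptions G = {x \<in> borel_measurable G. \<forall>z\<in>space G. 0 \<le> x z}"

text \<open>
  The weight \<open>\<rho>\<close> is dominated by the discount factor and by both prices, so feasible plans are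
  bounded in \<open>L\<^sup>1(\<rho>)\<close> and convergence in \<open>L\<^sup>1(\<rho>)\<close> can be read off the payoffs.
\<close>

locale contribution_problem = normal_utility u for u +
  fixes N G :: "'z measure" and d px \<rho> h :: "'z \<Rightarrow> real" and K :: "('z \<Rightarrow> real) set"
    and b :: "('z \<Rightarrow> real) \<Rightarrow> ennreal" and w0 :: real
  assumes subalg: "subalgebra N G"
    and nontrivial: "emeasure N (space N) \<noteq> 0"
    and w0: "0 < w0"
    and measN [measurable]: "d \<in> borel_measurable N" "px \<in> borel_measurable N" "\<rho> \<in> borel_measurable N"
    and rho: "\<And>z. z \<in> space N \<Longrightarrow> 0 < \<rho> z" "\<And>z. z \<in> space N \<Longrightarrow> \<rho> z \<le> d z"
      "\<And>z. z \<in> space N \<Longrightarrow> \<rho> z \<le> px z" "integrable N \<rho>"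
    and h: "h \<in> consumptions G" "\<And>z. z \<in> space N \<Longrightarrow> 0 < h z" "integrable N (\<lambda>z. px z * h z)"
    and K_sub: "K \<subseteq> consumptions G"
    and K_add: "\<And>C D. C \<in> K \<Longrightarrow> D \<in> K \<Longrightarrow> (\<lambda>z. C z + D z) \<in> K"
    and K_scale: "\<And>C s. C \<in> K \<Longrightarrow> 0 \<le> s \<Longrightarrow> (\<lambda>z. s * C z) \<in> K"
    and K_max: "\<And>C D. C \<in> K \<Longrightarrow> D \<in> K \<Longrightarrow> (\<lambda>z. max (C z) (D z)) \<in> K"
    and K_min: "\<And>C D. C \<in> K \<Longrightarrow> D \<in> K \<Longrightarrow> (\<lambda>z. min (C z) (D z)) \<in> K"
    and K_zero: "(\<lambda>z. 0) \<in> K"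
    and b_add: "\<And>C D. C \<in> K \<Longrightarrow> D \<in> K \<Longrightarrow> b (\<lambda>z. C z + D z) = b C + b D"
    and b_scale: "\<And>C s. C \<in> K \<Longrightarrow> 0 \<le> s \<Longrightarrow> b (\<lambda>z. s * C z) = ennreal s * b C"
    and b_mono: "\<And>C D. C \<in> K \<Longrightarrow> D \<in> K \<Longrightarrow> (\<And>z. z \<in> space N \<Longrightarrow> C z \<le> D z) \<Longrightarrow> b C \<le> b D"
    and b_rho: "\<And>C. C \<in> K \<Longrightarrow> (\<integral>\<^sup>+z. ennreal (\<rho> z * C z) \<partial>N) \<le> b C"
    and K_closed: "\<And>Cs L Bs \<beta>. (\<And>k. Cs k \<in> K) \<Longrightarrow> L \<in> borel_measurable G \<Longrightarrow>
        (AE z in N. (\<lambda>k. Cs k z) \<longlonglongrightarrow> L z) \<Longrightarrow> (\<And>k::nat. b (Cs k) \<le> ennreal (Bs k)) \<Longrightarrow>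
        Bs \<longlonglongrightarrow> \<beta> \<Longrightarrow> \<exists>C\<in>K. (AE z in N. C z = L z) \<and> b C \<le> ennreal \<beta>"
    and unif_int: "\<And>\<epsilon>. 0 < \<epsilon> \<Longrightarrow> \<exists>g. integrable N g \<and> (\<forall>z\<in>space N. 0 \<le> g z) \<and>
        (\<forall>x\<in>consumptions G. \<forall>C\<in>K. (\<integral>\<^sup>+z. ennreal (px z * x z) \<partial>N) + b C \<le> ennreal w0 \<longrightarrow>
           (\<integral>\<^sup>+z. ennreal (d z * u (x z, C z) - g z) \<partial>N) \<le> ennreal \<epsilon>)"
begin

text \<open>Plans of finite cost under no particular budget: the Lagrangian is compared on all of
  them.\<close>

definition adm :: "('z \<Rightarrow> real) \<Rightarrow> ('z \<Rightarrow> real) \<Rightarrow> bool" where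
  "adm x C \<longleftrightarrow> x \<in> consumptions G \<and> C \<in> K \<and> integrable N (\<lambda>z. px z * x z) \<and> b C \<noteq> \<infinity>"

definition A :: "('z \<Rightarrow> real) \<Rightarrow> real" where "A x = (\<integral>z. px z * x z \<partial>N)"
definition B :: "('z \<Rightarrow> real) \<Rightarrow> real" where "B C = enn2real (b C)"
definition U :: "('z \<Rightarrow> real) \<Rightarrow> ('z \<Rightarrow> real) \<Rightarrow> real" where
  "U x C = (\<integral>z. d z * u (x z, C z) \<partial>N)"

lemma space_G: "space G = space N"
  using subalg by (simp add: subalgebra_def)

lemma consumptionsD:
  assumes "x \<in> consumptions G"
  shows "x \<in> borel_measurable G" "x \<in> borel_measurable N" "\<And>z. z \<in> space N \<Longrightarrow> 0 \<le> x z"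
  using assms measurable_from_subalg[OF subalg] by (auto simp: consumptions_def space_G)

lemma K_D:
  assumes "C \<in> K"
  shows "C \<in> borel_measurable G" "C \<in> borel_measurable N" "\<And>z. z \<in> space N \<Longrightarrow> 0 \<le> C z"
  using assms K_sub consumptionsD by auto

lemma px_pos: "z \<in> space N \<Longrightarrow> 0 < px z" and d_pos: "z \<in> space N \<Longrightarrow> 0 < d z"
  and px_nonneg: "z \<in> space N \<Longrightarrow> 0 \<le> px z" and d_nonneg: "z \<in> space N \<Longrightarrow> 0 \<le> d z"
  using rho by (meson less_le_trans less_imp_le)+

lemma consumptions_intros:
  assumes "x \<in> consumptions G" "y \<in> consumptions G"
  shows "(\<lambda>z. x z + y z) \<in> consumptions G" "(\<lambda>z. max (x z) (y z)) \<in> consumptions G"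
    "(\<lambda>z. min (x z) (y z)) \<in> consumptions G" "0 \<le> s \<Longrightarrow> (\<lambda>z. s * x z) \<in> consumptions G"
  using assms by (auto simp: consumptions_def intro: le_max_iff_disj[THEN iffD2])

lemma admD:
  assumes "adm x C"
  shows "x \<in> consumptions G" "C \<in> K" "integrable N (\<lambda>z. px z * x z)" "b C \<noteq> \<infinity>"
    "x \<in> borel_measurable N" "C \<in> borel_measurable N" "\<And>z. z \<in> space N \<Longrightarrow> 0 \<le> x z"
    "\<And>z. z \<in> space N \<Longrightarrow> 0 \<le> C z" "b C = ennreal (B C)" "0 \<le> B C" "0 \<le> A x"
  using assms consumptionsD K_D px_nonneg unfolding adm_def A_def B_def
  by (auto simp: less_top intro!: integral_nonneg_AE AE_I2)

lemma adm_dominated: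
  assumes "adm x C" "y \<in> consumptions G" "D \<in> K"
    and "\<And>z. z \<in> space N \<Longrightarrow> y z \<le> x z" "\<And>z. z \<in> space N \<Longrightarrow> D z \<le> C z"
  shows "adm y D" "A y \<le> A x" "B D \<le> B C"
proof -
  have i: "integrable N (\<lambda>z. px z * y z)"
    using admD(5,7)[OF assms(1)] consumptionsD[OF assms(2)] px_nonneg assms(4)
    by (intro Bochner_Integration.integrable_bound[OF admD(3)[OF assms(1)]])
       (auto simp: abs_mult intro!: AE_I2 mult_left_mono)
  have b: "b D \<le> b C" by (rule b_mono) (use assms admD in auto)
  show adm: "adm y D" using i b assms admD(4)[OF assms(1)] unfolding adm_def by (auto simp: top_unique)
  show "A y \<le> A x" unfolding A_def
    using admD(3)[OF assms(1)] i assms(4) px_nonneg by (intro integral_mono) (auto intro!: mult_left_mono)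
  show "B D \<le> B C" using b admD(9,10)[OF assms(1)] admD(9,10)[OF adm] by (simp add: ennreal_le_iff)
qed

lemma adm_add:
  assumes "adm x C" "adm y D"
  shows "adm (\<lambda>z. x z + y z) (\<lambda>z. C z + D z)"
    "A (\<lambda>z. x z + y z) = A x + A y" "B (\<lambda>z. C z + D z) = B C + B D"
proof -
  show "A (\<lambda>z. x z + y z) = A x + A y"
    using admD(3)[OF assms(1)] admD(3)[OF assms(2)] unfolding A_def by (simp add: distrib_left)
  have b: "b (\<lambda>z. C z + D z) = b C + b D" using assms by (intro b_add) (auto dest: admD)
  then show "B (\<lambda>z. C z + D z) = B C + B D"
    using admD(4)[OF assms(1)] admD(4)[OF assms(2)] unfolding B_def by (simp add: enn2real_plus less_top)
  show "adm (\<lambda>z. x z + y z) (\<lambda>z. C z + D z)"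
    using assms b K_add unfolding adm_def by (auto simp: distrib_left intro!: consumptions_intros)
qed

lemma adm_scale:
  assumes "adm x C" "0 \<le> s" "0 \<le> t"
  shows "adm (\<lambda>z. s * x z) (\<lambda>z. t * C z)" "A (\<lambda>z. s * x z) = s * A x" "B (\<lambda>z. t * C z) = t * B C"
proof -
  have *: "(\<lambda>z. px z * (s * x z)) = (\<lambda>z. s * (px z * x z))" by (simp add: ac_simps)
  show "A (\<lambda>z. s * x z) = s * A x" unfolding A_def * by simp
  have b: "b (\<lambda>z. t * C z) = ennreal t * b C" using assms by (intro b_scale) (auto dest: admD)
  then show "B (\<lambda>z. t * C z) = t * B C" unfolding B_def using assms by (simp add: enn2real_mult)
  show "adm (\<lambda>z. s * x z) (\<lambda>z. t * C z)"
    using assms b K_scale unfolding adm_def * by (auto simp: ennreal_mult_eq_top_iff intro!: consumptions_intros)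
qed

lemma adm_mix:
  assumes "adm x C" "adm y D" "0 \<le> \<theta>" "\<theta> \<le> 1"
  shows "adm (\<lambda>z. (1 - \<theta>) * x z + \<theta> * y z) (\<lambda>z. (1 - \<theta>) * C z + \<theta> * D z)"
    "A (\<lambda>z. (1 - \<theta>) * x z + \<theta> * y z) = (1 - \<theta>) * A x + \<theta> * A y"
    "B (\<lambda>z. (1 - \<theta>) * C z + \<theta> * D z) = (1 - \<theta>) * B C + \<theta> * B D"
  using adm_add[OF adm_scale(1)[OF assms(1), of "1 - \<theta>" "1 - \<theta>"] adm_scale(1)[OF assms(2), of \<theta> \<theta>]]
    adm_scale(2,3)[OF assms(1), of "1 - \<theta>" "1 - \<theta>"] adm_scale(2,3)[OF assms(2), of \<theta> \<theta>] assms(3,4)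
  by auto

lemma adm_swap: "adm x C \<Longrightarrow> adm y D \<Longrightarrow> adm x D"
  by (auto simp: adm_def)

lemma adm_zero: "adm (\<lambda>z. 0) (\<lambda>z. 0)" "A (\<lambda>z. 0) = 0" "B (\<lambda>z. 0) = 0"
proof -
  have "b (\<lambda>z. 0) = 0" using b_scale[OF K_zero, of 0] by simp
  then show "adm (\<lambda>z. 0) (\<lambda>z. 0)" "A (\<lambda>z. 0) = 0" "B (\<lambda>z. 0) = 0"
    using K_zero by (auto simp: adm_def A_def B_def consumptions_def)
qed

lemma adm_h: "adm h (\<lambda>z. 0)"
  using adm_zero(1) h by (auto simp: adm_def)

text \<open>Additivity of the costs and \<open>max + min = sum\<close> make both costs modular. The
  join has finite cost because it lies below the sum.\<close>

lemma adm_max_min: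
  assumes "adm x C" "adm y D"
  shows "adm (\<lambda>z. max (x z) (y z)) (\<lambda>z. max (C z) (D z))"
    "adm (\<lambda>z. min (x z) (y z)) (\<lambda>z. min (C z) (D z))"
    "A (\<lambda>z. max (x z) (y z)) + A (\<lambda>z. min (x z) (y z)) = A x + A y"
    "B (\<lambda>z. max (C z) (D z)) + B (\<lambda>z. min (C z) (D z)) = B C + B D"
proof -
  note s = admD(1,2)[OF assms(1)] admD(1,2)[OF assms(2)]
  show mx: "adm (\<lambda>z. max (x z) (y z)) (\<lambda>z. max (C z) (D z))"
    by (rule adm_dominated(1)[OF adm_add(1)[OF assms]])
       (use s admD(7,8)[OF assms(1)] admD(7,8)[OF assms(2)] in \<open>auto intro: consumptions_intros K_max\<close>)
  show mn: "adm (\<lambda>z. min (x z) (y z)) (\<lambda>z. min (C z) (D z))"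
    by (rule adm_dominated(1)[OF assms(1)]) (use s in \<open>auto intro: consumptions_intros K_min\<close>)
  have e: "max p q + min p q = p + q" for p q :: real by auto
  show "A (\<lambda>z. max (x z) (y z)) + A (\<lambda>z. min (x z) (y z)) = A x + A y"
    "B (\<lambda>z. max (C z) (D z)) + B (\<lambda>z. min (C z) (D z)) = B C + B D"
    using adm_add(2,3)[OF mx mn] adm_add(2,3)[OF assms] by (simp_all add: e)
qed

lemma cost_le_iff:
  assumes "x \<in> consumptions G" "C \<in> K" "0 \<le> y"
  shows "(\<integral>\<^sup>+z. ennreal (px z * x z) \<partial>N) + b C \<le> ennreal y \<longleftrightarrow> adm x C \<and> A x + B C \<le> y"
proof
  assume a: "(\<integral>\<^sup>+z. ennreal (px z * x z) \<partial>N) + b C \<le> ennreal y"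
  have nn: "\<And>z. z \<in> space N \<Longrightarrow> 0 \<le> px z * x z"
    using consumptionsD[OF assms(1)] px_nonneg by auto
  have m [measurable]: "x \<in> borel_measurable N" using consumptionsD[OF assms(1)] by simp
  have fin: "(\<integral>\<^sup>+z. ennreal (px z * x z) \<partial>N) + b C < \<infinity>"
    using a ennreal_less_top le_less_trans unfolding infinity_ennreal_def by blast
  then have "integrable N (\<lambda>z. px z * x z)"
    using nn by (intro integrableI_nonneg) (auto intro!: AE_I2)
  then have adm: "adm x C" using fin assms by (auto simp: adm_def)
  moreover have "(\<integral>\<^sup>+z. ennreal (px z * x z) \<partial>N) = ennreal (A x)" unfolding A_def
    using admD(3)[OF adm] nn by (intro nn_integral_eq_integral) (auto intro!: AE_I2)
  ultimately show "adm x C \<and> A x + B C \<le> y"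
    using a admD(9,10,11)[OF adm] assms(3) by (simp flip: ennreal_plus add: ennreal_le_iff)
next
  assume a: "adm x C \<and> A x + B C \<le> y"
  then have adm: "adm x C" by simp
  have nn: "\<And>z. z \<in> space N \<Longrightarrow> 0 \<le> px z * x z"
    using consumptionsD[OF assms(1)] px_nonneg by auto
  have "(\<integral>\<^sup>+z. ennreal (px z * x z) \<partial>N) = ennreal (A x)" unfolding A_def
    using admD(3)[OF adm] nn by (intro nn_integral_eq_integral) (auto intro!: AE_I2)
  then show "(\<integral>\<^sup>+z. ennreal (px z * x z) \<partial>N) + b C \<le> ennreal y"
    using a admD(9,10,11)[OF adm] assms(3) by (simp flip: ennreal_plus add: ennreal_le_iff)
qed

lemma u_comp_measurable:
  assumes [measurable]: "x \<in> borel_measurable N" "C \<in> borel_measurable N"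
    and "\<And>z. z \<in> space N \<Longrightarrow> 0 \<le> x z" "\<And>z. z \<in> space N \<Longrightarrow> 0 \<le> C z"
  shows "(\<lambda>z. u (x z, C z)) \<in> borel_measurable N"
proof -
  \<comment> \<open>Nothing is known about \<open>u\<close> outside the quadrant; clipping the
    coordinates at 0 extends it continuously to the plane.\<close>
  have "continuous_on UNIV (\<lambda>p. u (max 0 (fst p), max 0 (snd p)))"
    by (intro continuous_intros continuous_on_compose2[OF u_cont]) auto
  then have "(\<lambda>p. u (max 0 (fst p), max 0 (snd p))) \<in> borel_measurable (borel \<Otimes>\<^sub>M borel)"
    unfolding borel_prod by (rule borel_measurable_continuous_onI)
  then have "(\<lambda>z. (\<lambda>p. u (max 0 (fst p), max 0 (snd p))) (x z, C z)) \<in> borel_measurable N"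
    by measurable
  then show ?thesis
    by (rule measurable_cong[THEN iffD1, rotated]) (use assms(3,4) in auto)
qed

text \<open>Uniform integrability is assumed for plans of cost at most \<open>w0\<close>. A plan of
  cost \<open>y\<close> divided by \<kappa> is one of these, and \<open>u_scale\<close> bounds its
  utility by \<kappa> times that of the shrunk plan.\<close>

lemma unif_int_scaled:
  assumes "0 < \<epsilon>" "0 \<le> y"
  obtains g where "integrable N g" "\<And>z. z \<in> space N \<Longrightarrow> 0 \<le> g z"
    "\<And>x C. adm x C \<Longrightarrow> A x + B C \<le> y \<Longrightarrow> (\<integral>\<^sup>+z. ennreal (d z * u (x z, C z) - g z) \<partial>N) \<le> ennreal \<epsilon>"
proof -
  define \<kappa> where "\<kappa> = max 1 (y / w0)"
  have \<kappa>: "1 \<le> \<kappa>" "y \<le> \<kappa> * w0" using w0 by (auto simp: \<kappa>_def max_def field_simps)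
  obtain g where g: "integrable N g" "\<forall>z\<in>space N. 0 \<le> g z"
    "\<forall>x\<in>consumptions G. \<forall>C\<in>K. (\<integral>\<^sup>+z. ennreal (px z * x z) \<partial>N) + b C \<le> ennreal w0 \<longrightarrow>
           (\<integral>\<^sup>+z. ennreal (d z * u (x z, C z) - g z) \<partial>N) \<le> ennreal (\<epsilon> / \<kappa>)"
    using unif_int[of "\<epsilon> / \<kappa>"] assms \<kappa> by auto
  show ?thesis
  proof (rule that[of "\<lambda>z. \<kappa> * g z"])
    fix x C assume a: "adm x C" "A x + B C \<le> y"
    define x' C' where "x' = (\<lambda>z. 1/\<kappa> * x z)" and "C' = (\<lambda>z. 1/\<kappa> * C z)"
    have *: "adm x' C'" "A x' = A x / \<kappa>" "B C' = B C / \<kappa>"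
      using adm_scale[OF a(1), of "1/\<kappa>" "1/\<kappa>"] \<kappa> by (auto simp: x'_def C'_def)
    have "A x' + B C' \<le> w0" unfolding * using a(2) \<kappa> by (simp add: field_simps flip: add_divide_distrib)
    then have "(\<integral>\<^sup>+z. ennreal (px z * x' z) \<partial>N) + b C' \<le> ennreal w0"
      using * admD[OF *(1)] w0 by (subst cost_le_iff) auto
    then have ui: "(\<integral>\<^sup>+z. ennreal (d z * u (x' z, C' z) - g z) \<partial>N) \<le> ennreal (\<epsilon> / \<kappa>)"
      using g(3) admD[OF *(1)] by blast
    have [measurable]: "(\<lambda>z. u (x' z, C' z)) \<in> borel_measurable N"
      using admD[OF *(1)] by (intro u_comp_measurable) auto
    have [measurable]: "g \<in> borel_measurable N" using g(1) by auto
    have "(\<integral>\<^sup>+z. ennreal (d z * u (x z, C z) - \<kappa> * g z) \<partial>N)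
       \<le> (\<integral>\<^sup>+z. ennreal \<kappa> * ennreal (d z * u (x' z, C' z) - g z) \<partial>N)"
    proof (rule nn_integral_mono)
      fix z assume z: "z \<in> space N"
      have "u (x z, C z) \<le> \<kappa> * u (x' z, C' z)"
        using u_scale[OF \<kappa>(1), of "x z" "C z"] admD(7,8)[OF a(1)] z by (simp add: x'_def C'_def)
      then have "d z * u (x z, C z) \<le> d z * (\<kappa> * u (x' z, C' z))"
        using d_pos[OF z] by (intro mult_left_mono) auto
      then have "d z * u (x z, C z) - \<kappa> * g z \<le> \<kappa> * (d z * u (x' z, C' z) - g z)"
        by (simp add: algebra_simps)
      then show "ennreal (d z * u (x z, C z) - \<kappa> * g z) \<le> ennreal \<kappa> * ennreal (d z * u (x' z, C' z) - g z)"
        using \<kappa> by (simp add: ennreal_leI flip: ennreal_mult')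
    qed
    also have "\<dots> = ennreal \<kappa> * (\<integral>\<^sup>+z. ennreal (d z * u (x' z, C' z) - g z) \<partial>N)"
      by (rule nn_integral_cmult) measurable
    also have "\<dots> \<le> ennreal \<kappa> * ennreal (\<epsilon> / \<kappa>)" by (rule mult_left_mono[OF ui]) simp
    also have "\<dots> = ennreal \<epsilon>" using \<kappa> assms by (simp flip: ennreal_mult)
    finally show "(\<integral>\<^sup>+z. ennreal (d z * u (x z, C z) - \<kappa> * g z) \<partial>N) \<le> ennreal \<epsilon>" .
  qed (use g \<kappa> in auto)
qed

lemma payoff_measurable [measurable (raw)]:
  "adm x C \<Longrightarrow> (\<lambda>z. d z * u (x z, C z)) \<in> borel_measurable N"
  using admD[of x C] by (intro borel_measurable_times u_comp_measurable) auto

lemma payoff_nonneg: "adm x C \<Longrightarrow> z \<in> space N \<Longrightarrow> 0 \<le> d z * u (x z, C z)"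
  using admD(7,8)[of x C z] d_pos[of z] u_nonneg[of "x z" "C z"] by auto

lemma payoff_integrable:
  assumes "adm x C" shows "integrable N (\<lambda>z. d z * u (x z, C z))"
proof -
  obtain g where g: "integrable N g" "\<And>z. z \<in> space N \<Longrightarrow> 0 \<le> g z"
    "(\<integral>\<^sup>+z. ennreal (d z * u (x z, C z) - g z) \<partial>N) \<le> ennreal 1"
    by (rule unif_int_scaled[of 1 "A x + B C"]) (use admD(10,11)[OF assms] assms in auto)
  have [measurable]: "g \<in> borel_measurable N" using g(1) by auto
  note payoff_measurable[OF assms, measurable]
  have "(\<integral>\<^sup>+z. ennreal (d z * u (x z, C z)) \<partial>N) \<le> (\<integral>\<^sup>+z. ennreal (g z) + ennreal (d z * u (x z, C z) - g z) \<partial>N)"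
  proof (rule nn_integral_mono)
    fix z assume z: "z \<in> space N"
    have "d z * u (x z, C z) \<le> g z + max 0 (d z * u (x z, C z) - g z)" by auto
    then have "ennreal (d z * u (x z, C z)) \<le> ennreal (g z + max 0 (d z * u (x z, C z) - g z))"
      by (rule ennreal_leI)
    also have "\<dots> = ennreal (g z) + ennreal (max 0 (d z * u (x z, C z) - g z))"
      using g(2)[OF z] by (intro ennreal_plus) auto
    finally show "ennreal (d z * u (x z, C z)) \<le> ennreal (g z) + ennreal (d z * u (x z, C z) - g z)"
      by (simp add: max_def ennreal_neg split: if_splits)
  qed
  also have "\<dots> = (\<integral>\<^sup>+z. ennreal (g z) \<partial>N) + (\<integral>\<^sup>+z. ennreal (d z * u (x z, C z) - g z) \<partial>N)"
    by (rule nn_integral_add) measurable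
  also have "(\<integral>\<^sup>+z. ennreal (g z) \<partial>N) = ennreal (\<integral>z. g z \<partial>N)"
    using g by (intro nn_integral_eq_integral) (auto intro!: AE_I2)
  also have "ennreal (\<integral>z. g z \<partial>N) + (\<integral>\<^sup>+z. ennreal (d z * u (x z, C z) - g z) \<partial>N) < \<infinity>"
    using g(3) by (auto simp: less_top[symmetric] top_unique)
  finally show ?thesis
    using payoff_nonneg[OF assms] by (intro integrableI_nonneg) (auto intro!: AE_I2)
qed

lemma nn_payoff: "adm x C \<Longrightarrow> (\<integral>\<^sup>+z. ennreal (d z * u (x z, C z)) \<partial>N) = ennreal (U x C)"
  unfolding U_def using payoff_integrable payoff_nonneg by (intro nn_integral_eq_integral) (auto intro!: AE_I2)

lemma U_nonneg: "adm x C \<Longrightarrow> 0 \<le> U x C"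
  unfolding U_def using payoff_nonneg by (intro integral_nonneg_AE AE_I2) auto

lemma U_cong_AE:
  assumes "adm x C" "adm y D" "AE z in N. x z = y z" "AE z in N. C z = D z"
  shows "U x C = U y D"
  unfolding U_def using assms(3,4) by (intro integral_cong_AE payoff_measurable assms(1,2)) auto

lemma U_mono_AE:
  assumes "adm x C" "adm y D" "AE z in N. x z \<le> y z" "AE z in N. C z \<le> D z"
  shows "U x C \<le> U y D"
  unfolding U_def
proof (rule integral_mono_AE[OF payoff_integrable[OF assms(1)] payoff_integrable[OF assms(2)]])
  show "AE z in N. d z * u (x z, C z) \<le> d z * u (y z, D z)"
    using assms(3,4) AE_space
  proof eventually_elim
    fix z assume "z \<in> space N" "C z \<le> D z" "x z \<le> y z"
    then show "d z * u (x z, C z) \<le> d z * u (y z, D z)"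
      using admD(7,8)[OF assms(1)] d_nonneg by (auto intro!: mult_left_mono u_mono)
  qed
qed

lemma integral_pos:
  fixes f :: "'z \<Rightarrow> real"
  assumes "integrable N f" "\<And>z. z \<in> space N \<Longrightarrow> 0 \<le> f z" "\<not> (AE z in N. f z = 0)"
  shows "0 < (\<integral>z. f z \<partial>N)"
proof -
  have "0 \<le> (\<integral>z. f z \<partial>N)" using assms by (intro Bochner_Integration.integral_nonneg) auto
  moreover have "(\<integral>z. f z \<partial>N) \<noteq> 0"
    using integral_nonneg_eq_0_iff_AE[OF assms(1)] assms(2,3) by auto
  ultimately show ?thesis by simp
qed

lemma not_AE_False: "\<not> (AE z in N. False)"
  using nontrivial by (simp add: AE_iff_null null_sets_def)

text \<open>The bundle \<open>h\<close> has finite cost and is positive everywhere, so spare money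
  can always be spent at a strict gain. This is what makes budgets bind.\<close>

lemma U_strict:
  assumes "adm x C" "0 < s"
  shows "U x C < U (\<lambda>z. x z + s * h z) C"
proof -
  have adm: "adm (\<lambda>z. x z + s * h z) C"
    using adm_add(1)[OF assms(1) adm_scale(1)[OF adm_h, of s 0]] assms(2) by simp
  have "0 < (\<integral>z. d z * u (x z + s * h z, C z) - d z * u (x z, C z) \<partial>N)"
  proof (rule integral_pos)
    have lt: "d z * u (x z, C z) < d z * u (x z + s * h z, C z)" if "z \<in> space N" for z
      using admD(7,8)[OF assms(1)] d_pos h(2) that assms(2) by (auto intro!: mult_strict_left_mono u_strict_mono)
    then show "\<And>z. z \<in> space N \<Longrightarrow> 0 \<le> d z * u (x z + s * h z, C z) - d z * u (x z, C z)"
      by (simp add: less_imp_le)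
    show "\<not> (AE z in N. d z * u (x z + s * h z, C z) - d z * u (x z, C z) = 0)"
    proof
      assume "AE z in N. d z * u (x z + s * h z, C z) - d z * u (x z, C z) = 0"
      then have "AE z in N. False" using AE_space by eventually_elim (use lt in force)
      then show False using not_AE_False by simp
    qed
  qed (intro Bochner_Integration.integrable_diff payoff_integrable adm assms)
  then show ?thesis unfolding U_def
    using payoff_integrable[OF adm] payoff_integrable[OF assms(1)] by simp
qed

lemma U_concave:
  assumes "adm x C" "adm y D" "0 \<le> \<theta>" "\<theta> \<le> 1"
  shows "(1 - \<theta>) * U x C + \<theta> * U y D \<le> U (\<lambda>z. (1 - \<theta>) * x z + \<theta> * y z) (\<lambda>z. (1 - \<theta>) * C z + \<theta> * D z)"
proof -
  have "(1 - \<theta>) * U x C + \<theta> * U y D = (\<integral>z. (1 - \<theta>) * (d z * u (x z, C z)) + \<theta> * (d z * u (y z, D z)) \<partial>N)"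
    unfolding U_def using payoff_integrable assms(1,2) by simp
  also have "\<dots> \<le> U (\<lambda>z. (1 - \<theta>) * x z + \<theta> * y z) (\<lambda>z. (1 - \<theta>) * C z + \<theta> * D z)"
    unfolding U_def
  proof (rule integral_mono)
    fix z assume z: "z \<in> space N"
    have "d z * ((1 - \<theta>) * u (x z, C z) + \<theta> * u (y z, D z))
        \<le> d z * u ((1 - \<theta>) * x z + \<theta> * y z, (1 - \<theta>) * C z + \<theta> * D z)"
      using admD(7,8)[OF assms(1) z] admD(7,8)[OF assms(2) z] d_pos[OF z] assms(3,4)
      by (intro mult_left_mono u_concave) auto
    then show "(1 - \<theta>) * (d z * u (x z, C z)) + \<theta> * (d z * u (y z, D z))
        \<le> d z * u ((1 - \<theta>) * x z + \<theta> * y z, (1 - \<theta>) * C z + \<theta> * D z)" by (simp add: algebra_simps)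
  qed (use payoff_integrable assms adm_mix(1)[OF assms] in auto)
  finally show ?thesis .
qed

lemma U_strictly_concave:
  assumes "adm x C" "adm y D" "0 < \<theta>" "\<theta> < 1" "\<not> (AE z in N. x z = y z \<and> C z = D z)"
  shows "(1 - \<theta>) * U x C + \<theta> * U y D < U (\<lambda>z. (1 - \<theta>) * x z + \<theta> * y z) (\<lambda>z. (1 - \<theta>) * C z + \<theta> * D z)"
proof -
  let ?f = "\<lambda>z. d z * u ((1 - \<theta>) * x z + \<theta> * y z, (1 - \<theta>) * C z + \<theta> * D z)
      - ((1 - \<theta>) * (d z * u (x z, C z)) + \<theta> * (d z * u (y z, D z)))"
  have i: "integrable N (\<lambda>z. d z * u ((1 - \<theta>) * x z + \<theta> * y z, (1 - \<theta>) * C z + \<theta> * D z))"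
    using payoff_integrable[OF adm_mix(1)[OF assms(1,2), of \<theta>]] assms(3,4) by simp
  have eq: "?f z = d z * (u ((1 - \<theta>) * x z + \<theta> * y z, (1 - \<theta>) * C z + \<theta> * D z)
      - ((1 - \<theta>) * u (x z, C z) + \<theta> * u (y z, D z)))" for z by (simp add: algebra_simps)
  have "0 < (\<integral>z. ?f z \<partial>N)"
  proof (rule integral_pos)
    show "integrable N ?f" using i payoff_integrable assms(1,2) by simp
    show "0 \<le> ?f z" if z: "z \<in> space N" for z unfolding eq
      using u_concave[of "x z" "C z" "y z" "D z" \<theta>] admD(7,8)[OF assms(1) z] admD(7,8)[OF assms(2) z]
        assms(3,4) d_pos[OF z] by auto
    show "\<not> (AE z in N. ?f z = 0)"
    proof
      assume "AE z in N. ?f z = 0"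
      then have "AE z in N. x z = y z \<and> C z = D z"
      proof (rule AE_mp, intro AE_I2 impI)
        fix z assume z: "z \<in> space N" "?f z = 0"
        then have "u ((1 - \<theta>) * x z + \<theta> * y z, (1 - \<theta>) * C z + \<theta> * D z)
           = (1 - \<theta>) * u (x z, C z) + \<theta> * u (y z, D z)"
          unfolding eq using d_pos by fastforce
        then have "(x z, C z) = (y z, D z)"
          using u_strictly_concave[of "x z" "C z" "y z" "D z" \<theta>] admD(7,8)[OF assms(1) z(1)]
            admD(7,8)[OF assms(2) z(1)] assms(3,4) by (metis less_irrefl)
        then show "x z = y z \<and> C z = D z" by simp
      qed
      then show False using assms(5) by simp
    qed
  qed
  also have "(\<integral>z. ?f z \<partial>N) = U (\<lambda>z. (1 - \<theta>) * x z + \<theta> * y z) (\<lambda>z. (1 - \<theta>) * C z + \<theta> * D z)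
      - ((1 - \<theta>) * U x C + \<theta> * U y D)"
    unfolding U_def using i payoff_integrable assms(1,2) by simp
  finally show ?thesis by simp
qed

lemma U_supermodular:
  assumes "adm x C" "adm y D"
  shows "U x C + U y D \<le> U (\<lambda>z. max (x z) (y z)) (\<lambda>z. max (C z) (D z))
     + U (\<lambda>z. min (x z) (y z)) (\<lambda>z. min (C z) (D z))"
proof -
  note i = payoff_integrable[OF assms(1)] payoff_integrable[OF assms(2)]
    payoff_integrable[OF adm_max_min(1)[OF assms]] payoff_integrable[OF adm_max_min(2)[OF assms]]
  have "(\<integral>z. d z * u (x z, C z) + d z * u (y z, D z) \<partial>N)
     \<le> (\<integral>z. d z * u (max (x z) (y z), max (C z) (D z)) + d z * u (min (x z) (y z), min (C z) (D z)) \<partial>N)"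
  proof (rule integral_mono)
    fix z assume z: "z \<in> space N"
    then show "d z * u (x z, C z) + d z * u (y z, D z)
       \<le> d z * u (max (x z) (y z), max (C z) (D z)) + d z * u (min (x z) (y z), min (C z) (D z))"
      unfolding distrib_left[symmetric]
      using admD(7,8)[OF assms(1) z] admD(7,8)[OF assms(2) z] d_pos[OF z]
      by (intro mult_left_mono u_supermodular) auto
  qed (use i in auto)
  then show ?thesis unfolding U_def using i by simp
qed

end

section \<open>Convergence of maximizing sequences\<close>

lemma convergent_of_bounded_transform:
  fixes a :: "nat \<Rightarrow> real"
  assumes nn: "\<And>k. 0 \<le> a k" and conv: "convergent (\<lambda>k. a k / (1 + a k))"
    and fin: "liminf (\<lambda>k. ennreal (a k)) \<noteq> \<infinity>"
  shows "convergent a"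
proof -
  obtain l where l: "(\<lambda>k. a k / (1 + a k)) \<longlonglongrightarrow> l" using conv by (auto simp: convergent_def)
  have bd: "a k / (1 + a k) < 1" for k using nn[of k] by (simp add: divide_less_eq)
  have "l \<le> 1" using bd by (intro tendsto_upperbound[OF l]) (auto intro!: always_eventually less_imp_le)
  have inv: "a k = (a k / (1 + a k)) / (1 - a k / (1 + a k))" for k
    using nn[of k] by (simp add: field_simps)
  show ?thesis
  proof (cases "l = 1")
    case False
    have "(\<lambda>k. (a k / (1 + a k)) / (1 - a k / (1 + a k))) \<longlonglongrightarrow> l / (1 - l)"
      using False by (intro tendsto_intros l) auto
    then show ?thesis unfolding inv[symmetric] by (rule convergentI)
  next
    case True
    \<comment> \<open>The transform maps the half-line onto \<open>[0, 1)\<close>, so a limit equal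
      to 1 would push \<open>a\<close> above every bound \<open>M\<close>.\<close>
    have "ennreal M \<le> liminf (\<lambda>k. ennreal (a k))" if "0 < M" for M
    proof (rule Liminf_bounded)
      have "\<forall>\<^sub>F k in sequentially. M / (1 + M) < a k / (1 + a k)"
      proof (rule order_tendstoD(1)[OF l])
        show "M / (1 + M) < l" unfolding True using that by simp
      qed
      then show "\<forall>\<^sub>F k in sequentially. ennreal M \<le> ennreal (a k)"
      proof eventually_elim
        case (elim k)
        then have "M * (1 + a k) < a k * (1 + M)" using that nn[of k] by (simp add: field_simps)
        then show ?case by (intro ennreal_leI) (simp add: algebra_simps)
      qed
    qed
    then have *: "of_nat (Suc n) \<le> liminf (\<lambda>k. ennreal (a k))" for n
      by (metis ennreal_of_nat_eq_real_of_nat of_nat_0_less_iff zero_less_Suc)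
    have "liminf (\<lambda>k. ennreal (a k)) = \<infinity>"
    proof (rule ccontr)
      assume "liminf (\<lambda>k. ennreal (a k)) \<noteq> \<infinity>"
      then obtain n where "liminf (\<lambda>k. ennreal (a k)) < of_nat n"
        using ennreal_Ex_less_of_nat[of "liminf (\<lambda>k. ennreal (a k))"] by (auto simp: less_top)
      then have "of_nat (Suc n) < (of_nat n :: ennreal)" using *[of n] by (rule le_less_trans[rotated])
      then show False by (simp add: of_nat_less_iff del: of_nat_Suc)
    qed
    then show ?thesis using fin by simp
  qed
qed

context contribution_problem
begin

lemma rho_weighted:
  assumes "adm x C"
  shows "integrable N (\<lambda>z. \<rho> z * x z)" "integrable N (\<lambda>z. \<rho> z * C z)"
    "(\<integral>z. \<rho> z * x z \<partial>N) \<le> A x" "(\<integral>z. \<rho> z * C z \<partial>N) \<le> B C"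
proof -
  note m = admD(5,6)[OF assms] and [measurable] = admD(5,6)[OF assms]
  have nn: "z \<in> space N \<Longrightarrow> 0 \<le> \<rho> z * x z" "z \<in> space N \<Longrightarrow> 0 \<le> \<rho> z * C z"
    "z \<in> space N \<Longrightarrow> \<rho> z * x z \<le> px z * x z" for z
    using admD(7,8)[OF assms] rho(1,3)[of z] by (auto simp: less_imp_le intro: mult_right_mono)
  show i: "integrable N (\<lambda>z. \<rho> z * x z)"
    by (rule Bochner_Integration.integrable_bound[OF admD(3)[OF assms]])
       (use nn in \<open>auto intro!: AE_I2 simp: abs_of_nonneg intro: order_trans[OF _ abs_ge_self]\<close>)
  show "(\<integral>z. \<rho> z * x z \<partial>N) \<le> A x" unfolding A_def
    using i admD(3)[OF assms] nn by (intro integral_mono) auto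
  have bd: "(\<integral>\<^sup>+z. ennreal (\<rho> z * C z) \<partial>N) \<le> ennreal (B C)"
    using b_rho[OF admD(2)[OF assms]] admD(9)[OF assms] by simp
  show j: "integrable N (\<lambda>z. \<rho> z * C z)"
    using nn bd by (intro integrableI_nonneg) (auto intro!: AE_I2 intro: le_less_trans)
  have "ennreal (\<integral>z. \<rho> z * C z \<partial>N) \<le> ennreal (B C)"
    using bd j nn by (subst nn_integral_eq_integral[symmetric]) (auto intro!: AE_I2)
  then show "(\<integral>z. \<rho> z * C z \<partial>N) \<le> B C"
    using admD(10)[OF assms] by (simp add: ennreal_le_iff)
qed

text \<open>The payoff above \<open>g\<close> contributes at most \<epsilon>, whereas the payoff
  below \<open>g\<close> is open to dominated convergence.\<close>

lemma U_le_truncated: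
  assumes adm: "adm x C" and g: "integrable N g" "\<And>z. z \<in> space N \<Longrightarrow> 0 \<le> g z"
    and le: "(\<integral>\<^sup>+z. ennreal (d z * u (x z, C z) - g z) \<partial>N) \<le> ennreal \<epsilon>" and "0 \<le> \<epsilon>"
  shows "integrable N (\<lambda>z. min (d z * u (x z, C z)) (g z))"
    "U x C \<le> (\<integral>z. min (d z * u (x z, C z)) (g z) \<partial>N) + \<epsilon>"
proof -
  note i = payoff_integrable[OF adm]
  show mi: "integrable N (\<lambda>z. min (d z * u (x z, C z)) (g z))" using i g by auto
  have pi: "integrable N (\<lambda>z. max 0 (d z * u (x z, C z) - g z))" using i g by auto
  have "ennreal (\<integral>z. max 0 (d z * u (x z, C z) - g z) \<partial>N)
      = (\<integral>\<^sup>+z. ennreal (max 0 (d z * u (x z, C z) - g z)) \<partial>N)"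
    using pi by (subst nn_integral_eq_integral) auto
  also have "\<dots> = (\<integral>\<^sup>+z. ennreal (d z * u (x z, C z) - g z) \<partial>N)"
    by (intro nn_integral_cong) (auto simp: max_def ennreal_neg)
  also have "\<dots> \<le> ennreal \<epsilon>" by fact
  finally have "(\<integral>z. max 0 (d z * u (x z, C z) - g z) \<partial>N) \<le> \<epsilon>"
    using \<open>0 \<le> \<epsilon>\<close> by (simp add: ennreal_le_iff)
  moreover have "U x C = (\<integral>z. min (d z * u (x z, C z)) (g z) + max 0 (d z * u (x z, C z) - g z) \<partial>N)"
    unfolding U_def by (intro Bochner_Integration.integral_cong) auto
  ultimately show "U x C \<le> (\<integral>z. min (d z * u (x z, C z)) (g z) \<partial>N) + \<epsilon>"
    using mi pi by simp
qed

lemma U_bounded: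
  assumes "0 \<le> y"
  obtains S where "\<And>x C. adm x C \<Longrightarrow> A x + B C \<le> y \<Longrightarrow> U x C \<le> S"
proof -
  obtain g where g: "integrable N g" "\<And>z. z \<in> space N \<Longrightarrow> 0 \<le> g z"
    "\<And>x C. adm x C \<Longrightarrow> A x + B C \<le> y \<Longrightarrow> (\<integral>\<^sup>+z. ennreal (d z * u (x z, C z) - g z) \<partial>N) \<le> ennreal 1"
    using unif_int_scaled[of 1 y] assms by auto
  show ?thesis
  proof (rule that)
    fix x C assume a: "adm x C" "A x + B C \<le> y"
    note t = U_le_truncated[OF a(1) g(1,2) g(3)[OF a]]
    have "(\<integral>z. min (d z * u (x z, C z)) (g z) \<partial>N) \<le> (\<integral>z. g z \<partial>N)"
      using t(1) g by (intro integral_mono) auto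
    then show "U x C \<le> (\<integral>z. g z \<partial>N) + 1" using t(2) by simp
  qed
qed

text \<open>
  Strict concavity replaces a Komlos-type compactness argument: the midpoints of a maximizing
  sequence cannot do better than the supremum, so the concavity gaps tend to 0 in mean.
\<close>

lemma maximizing_sequence_converges:
  assumes adm: "\<And>k. adm (xs k) (Cs k)" and cost: "\<And>k. A (xs k) + B (Cs k) \<le> y"
    and sup: "\<And>x C. adm x C \<Longrightarrow> A x + B C \<le> y \<Longrightarrow> U x C \<le> S"
    and max: "(\<lambda>k. U (xs k) (Cs k)) \<longlonglongrightarrow> S"
  obtains r where "strict_mono r"
    "AE z in N. convergent (\<lambda>k. xs (r k) z) \<and> convergent (\<lambda>k. Cs (r k) z)"
proof -
  \<comment> \<open>The plan in the bounded metric of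
    \<open>concavity_gap_controls_distance\<close>, weighted by \<rho>. The concavity gap controls
    exactly the L1 distance of these functions.\<close>
  define s where "s k z = \<rho> z *\<^sub>R (xs k z / (1 + xs k z), Cs k z / (1 + Cs k z))" for k z
  have [measurable]: "xs k \<in> borel_measurable N" "Cs k \<in> borel_measurable N" for k
    using admD[OF adm] by auto
  have nn: "0 \<le> xs k z" "0 \<le> Cs k z" if "z \<in> space N" for k z
    using admD(7,8)[OF adm that] by auto
  have bounded: "\<bar>t / (1 + t)\<bar> \<le> 1" if "0 \<le> t" for t :: real using that by auto
  have y0: "0 \<le> y" using cost[of 0] admD(10,11)[OF adm[of 0]] by linarith
  have norm_s: "norm (s k z) \<le> 2 * \<rho> z" if "z \<in> space N" for k z
  proof -
    have "norm (xs k z / (1 + xs k z), Cs k z / (1 + Cs k z)) \<le> 1 + 1"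
      using bounded[OF nn(1)[OF that, of k]] bounded[OF nn(2)[OF that, of k]]
      by (intro order_trans[OF norm_Pair_le] add_mono) auto
    then have "\<rho> z * norm (xs k z / (1 + xs k z), Cs k z / (1 + Cs k z)) \<le> \<rho> z * 2"
      using rho(1)[OF that] by (intro mult_left_mono) auto
    then show ?thesis using rho(1)[OF that] unfolding s_def norm_scaleR by simp
  qed
  have s_meas: "s k \<in> borel_measurable N" for k
    unfolding s_def by measurable
  have s_int: "integrable N (s k)" for k
    by (rule Bochner_Integration.integrable_bound[OF _ s_meas, of "\<lambda>z. 2 * \<rho> z"])
       (use rho(4) norm_s in \<open>auto intro: order_trans[OF norm_s abs_ge_self]\<close>)
  have dist_s: "\<exists>n. \<forall>i\<ge>n. \<forall>j\<ge>n. (\<integral>z. norm (s i z - s j z) \<partial>N) < e" if "0 < e" for e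
  proof -
    define R where "R = (\<integral>z. \<rho> z \<partial>N)"
    have R0: "0 \<le> R" unfolding R_def using rho(1) by (intro Bochner_Integration.integral_nonneg) (auto intro: less_imp_le)
    \<comment> \<open>All error terms together are at most \<open>\<epsilon> * (R + 2 * y)\<close>,
      because the L1(\<rho>) norms of a plan sum to at most \<open>y\<close>. The other half of
      \<open>e\<close> is left for the concavity gaps.\<close>
    define \<epsilon> where "\<epsilon> = e / (2 * (R + 2 * y + 1))"
    have \<epsilon>: "0 < \<epsilon>" "\<epsilon> * (R + 2 * y) \<le> e / 2" using R0 y0 that by (auto simp: \<epsilon>_def field_simps)
    obtain Cc where Cc: "0 \<le> Cc" "\<And>x c y d. 0 \<le> x \<Longrightarrow> 0 \<le> c \<Longrightarrow> 0 \<le> y \<Longrightarrow> 0 \<le> d \<Longrightarrow>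
      \<bar>x / (1 + x) - y / (1 + y)\<bar> + \<bar>c / (1 + c) - d / (1 + d)\<bar>
      \<le> \<epsilon> + \<epsilon> * (x + c + y + d) + Cc * (u ((x + y) / 2, (c + d) / 2) - (u (x, c) + u (y, d)) / 2)"
      using concavity_gap_controls_distance[OF \<epsilon>(1)] by blast
    have "(\<lambda>k. Cc * (S - U (xs k) (Cs k))) \<longlonglongrightarrow> Cc * (S - S)" by (intro tendsto_intros max)
    then have "\<forall>\<^sub>F k in sequentially. Cc * (S - U (xs k) (Cs k)) < e / 2"
      using that by (intro order_tendstoD(2)) auto
    then obtain n where n: "\<And>k. n \<le> k \<Longrightarrow> Cc * (S - U (xs k) (Cs k)) < e / 2"
      by (auto simp: eventually_sequentially)
    have "(\<integral>z. norm (s i z - s j z) \<partial>N) < e" if ij: "n \<le> i" "n \<le> j" for i j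
    proof -
      let ?x = "\<lambda>z. (1 - 1/2) * xs i z + 1/2 * xs j z" and ?C = "\<lambda>z. (1 - 1/2) * Cs i z + 1/2 * Cs j z"
      have mid: "adm ?x ?C" "A ?x + B ?C \<le> y"
        using adm_mix[OF adm[of i] adm[of j], of "1/2"] cost[of i] cost[of j] by auto
      let ?f = "\<lambda>z. \<epsilon> * \<rho> z + \<epsilon> * (\<rho> z * xs i z + \<rho> z * Cs i z + \<rho> z * xs j z + \<rho> z * Cs j z)
          + Cc * (d z * u (?x z, ?C z) - (d z * u (xs i z, Cs i z) + d z * u (xs j z, Cs j z)) / 2)"
      note ints = rho(4) rho_weighted(1,2)[OF adm] payoff_integrable[OF adm] payoff_integrable[OF mid(1)]
      have fi: "integrable N ?f" using ints by auto
      have "(\<integral>z. norm (s i z - s j z) \<partial>N) \<le> (\<integral>z. ?f z \<partial>N)"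
      proof (rule integral_mono)
        show "integrable N (\<lambda>z. norm (s i z - s j z))"
          by (intro integrable_norm Bochner_Integration.integrable_diff s_int)
        show "integrable N ?f" by fact
        fix z assume z: "z \<in> space N"
        let ?D = "\<bar>xs i z / (1 + xs i z) - xs j z / (1 + xs j z)\<bar> + \<bar>Cs i z / (1 + Cs i z) - Cs j z / (1 + Cs j z)\<bar>"
        let ?g = "u (?x z, ?C z) - (u (xs i z, Cs i z) + u (xs j z, Cs j z)) / 2"
        have e: "(xs i z + xs j z) / 2 = ?x z" "(Cs i z + Cs j z) / 2 = ?C z" by auto
        have g0: "0 \<le> ?g" using concavity_gap_nonneg[of "xs i z" "Cs i z" "xs j z" "Cs j z"] nn[OF z] unfolding e by auto
        have "norm (s i z - s j z) \<le> \<rho> z * ?D"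
        proof -
          have "s i z - s j z = \<rho> z *\<^sub>R (xs i z / (1 + xs i z) - xs j z / (1 + xs j z), Cs i z / (1 + Cs i z) - Cs j z / (1 + Cs j z))"
            by (simp add: s_def right_diff_distrib)
          then have "norm (s i z - s j z) = \<rho> z * norm (xs i z / (1 + xs i z) - xs j z / (1 + xs j z), Cs i z / (1 + Cs i z) - Cs j z / (1 + Cs j z))"
            using rho(1)[OF z] by (simp del: scaleR_Pair)
          also have "\<dots> \<le> \<rho> z * ?D"
            using rho(1)[OF z] norm_Pair_le[of "xs i z / (1 + xs i z) - xs j z / (1 + xs j z)" "Cs i z / (1 + Cs i z) - Cs j z / (1 + Cs j z)"]
            by (intro mult_left_mono) auto
          finally show ?thesis .
        qed
        also have "\<dots> \<le> \<rho> z * (\<epsilon> + \<epsilon> * (xs i z + Cs i z + xs j z + Cs j z) + Cc * ?g)"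
          using Cc(2)[of "xs i z" "Cs i z" "xs j z" "Cs j z"] nn[OF z] rho(1)[OF z] unfolding e
          by (intro mult_left_mono) auto
        also have "\<dots> = \<epsilon> * \<rho> z + \<epsilon> * (\<rho> z * xs i z + \<rho> z * Cs i z + \<rho> z * xs j z + \<rho> z * Cs j z) + Cc * (\<rho> z * ?g)"
          by (simp add: algebra_simps)
        \<comment> \<open>The gap is nonnegative, so the weight may be raised from \<rho> to
          \<open>d\<close>, and the integral becomes a gap of payoffs.\<close>
        also have "Cc * (\<rho> z * ?g) \<le> Cc * (d z * ?g)"
          using g0 rho(2)[OF z] Cc(1) by (intro mult_left_mono mult_right_mono) auto
        finally show "norm (s i z - s j z) \<le> ?f z" by (simp add: algebra_simps)
      qed
      also have "(\<integral>z. ?f z \<partial>N) = \<epsilon> * R + \<epsilon> * ((\<integral>z. \<rho> z * xs i z \<partial>N) + (\<integral>z. \<rho> z * Cs i z \<partial>N) + (\<integral>z. \<rho> z * xs j z \<partial>N) + (\<integral>z. \<rho> z * Cs j z \<partial>N))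
          + Cc * (U ?x ?C - (U (xs i) (Cs i) + U (xs j) (Cs j)) / 2)"
        unfolding U_def R_def using ints by simp
      also have "\<dots> \<le> \<epsilon> * R + \<epsilon> * (2 * y) + Cc * (S - (U (xs i) (Cs i) + U (xs j) (Cs j)) / 2)"
        using rho_weighted(3,4)[OF adm[of i]] rho_weighted(3,4)[OF adm[of j]] cost[of i] cost[of j] \<epsilon>(1) Cc(1) sup[OF mid]
        by (intro add_mono mult_left_mono) auto
      also have "\<dots> = \<epsilon> * (R + 2 * y) + (Cc * (S - U (xs i) (Cs i)) + Cc * (S - U (xs j) (Cs j))) / 2"
        by (simp add: algebra_simps add_divide_distrib diff_divide_distrib)
      also have "\<dots> < e" using \<epsilon>(2) n[OF ij(1)] n[OF ij(2)] unfolding add_divide_distrib by linarith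
      finally show ?thesis .
    qed
    then show ?thesis by blast
  qed
  obtain r where r: "strict_mono r" "AE z in N. Cauchy (\<lambda>k. s (r k) z)"
    using cauchy_L1_AE_cauchy_subseq[OF s_int dist_s] by blast
  \<comment> \<open>The transformed sequence also converges where the plan itself tends to infinity.
    Fatou's lemma excludes this, as the L1(\<rho>) norms are bounded by \<open>y\<close>.\<close>
  have fatou: "AE z in N. liminf (\<lambda>k. ennreal (\<rho> z * f k z)) \<noteq> \<infinity>"
    if [measurable]: "\<And>k. f k \<in> borel_measurable N" and f: "\<And>k z. z \<in> space N \<Longrightarrow> 0 \<le> f k z" "\<And>k. integrable N (\<lambda>z. \<rho> z * f k z)"
      "\<And>k. (\<integral>z. \<rho> z * f k z \<partial>N) \<le> y" for f :: "nat \<Rightarrow> 'z \<Rightarrow> real"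
  proof -
    have "(\<integral>\<^sup>+z. liminf (\<lambda>k. ennreal (\<rho> z * f k z)) \<partial>N) \<le> liminf (\<lambda>k. \<integral>\<^sup>+z. ennreal (\<rho> z * f k z) \<partial>N)"
      by (rule nn_integral_liminf) measurable
    also have "\<dots> \<le> liminf (\<lambda>k::nat. ennreal y)"
    proof (intro Liminf_mono always_eventually allI)
      fix k
      have "(\<integral>\<^sup>+z. ennreal (\<rho> z * f k z) \<partial>N) = ennreal (\<integral>z. \<rho> z * f k z \<partial>N)"
        using f rho(1) by (intro nn_integral_eq_integral) (auto intro!: AE_I2 simp: less_imp_le)
      then show "(\<integral>\<^sup>+z. ennreal (\<rho> z * f k z) \<partial>N) \<le> ennreal y" using f(3) by (simp add: ennreal_leI)
    qed
    also have "\<dots> = ennreal y" by (simp add: Liminf_const)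
    finally have "(\<integral>\<^sup>+z. liminf (\<lambda>k. ennreal (\<rho> z * f k z)) \<partial>N) < \<infinity>" by (auto intro: le_less_trans)
    then show ?thesis by (intro nn_integral_noteq_infinite) auto
  qed
  have le_y: "(\<integral>z. \<rho> z * xs k z \<partial>N) \<le> y" "(\<integral>z. \<rho> z * Cs k z \<partial>N) \<le> y" for k
    using rho_weighted(3,4)[OF adm[of k]] cost[of k] admD(10,11)[OF adm[of k]] by linarith+
  have fx: "AE z in N. liminf (\<lambda>k. ennreal (\<rho> z * xs (r k) z)) \<noteq> \<infinity>"
    by (rule fatou) (use rho_weighted(1)[OF adm] le_y nn in auto)
  have fC: "AE z in N. liminf (\<lambda>k. ennreal (\<rho> z * Cs (r k) z)) \<noteq> \<infinity>"
    by (rule fatou) (use rho_weighted(2)[OF adm] le_y nn in auto)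
  have "AE z in N. convergent (\<lambda>k. xs (r k) z) \<and> convergent (\<lambda>k. Cs (r k) z)"
    using r(2) fx fC AE_space
  proof eventually_elim
    fix z assume z: "z \<in> space N" "Cauchy (\<lambda>k. s (r k) z)" "liminf (\<lambda>k. ennreal (\<rho> z * xs (r k) z)) \<noteq> \<infinity>"
      "liminf (\<lambda>k. ennreal (\<rho> z * Cs (r k) z)) \<noteq> \<infinity>"
    have \<rho>: "0 < \<rho> z" using rho(1)[OF z(1)] .
    obtain l where l: "(\<lambda>k. s (r k) z) \<longlonglongrightarrow> l" using z(2) by (auto simp: Cauchy_convergent_iff convergent_def)
    have "(\<lambda>k. (1 / \<rho> z) *\<^sub>R s (r k) z) \<longlonglongrightarrow> (1 / \<rho> z) *\<^sub>R l" by (intro tendsto_intros l)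
    then have l': "(\<lambda>k. (xs (r k) z / (1 + xs (r k) z), Cs (r k) z / (1 + Cs (r k) z))) \<longlonglongrightarrow> (1 / \<rho> z) *\<^sub>R l"
      unfolding s_def using \<rho> by simp
    have conv: "convergent a" if a: "\<And>k. 0 \<le> a k" "convergent (\<lambda>k. a k / (1 + a k))"
      "liminf (\<lambda>k. ennreal (\<rho> z * a k)) \<noteq> \<infinity>" for a :: "nat \<Rightarrow> real"
    proof (rule convergent_of_bounded_transform[OF a(1,2)])
      show "liminf (\<lambda>k. ennreal (a k)) \<noteq> \<infinity>"
      proof
        assume inf: "liminf (\<lambda>k. ennreal (a k)) = \<infinity>"
        have "liminf (\<lambda>k. ennreal (\<rho> z * a k)) = \<infinity>"
        proof -
          have "(\<lambda>k. ennreal (a k)) \<longlonglongrightarrow> \<infinity>"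
            using inf Liminf_le_Limsup[of sequentially "\<lambda>k. ennreal (a k)"]
            by (intro Liminf_eq_Limsup) (auto simp: top_unique)
          then have "(\<lambda>k. ennreal (\<rho> z) * ennreal (a k)) \<longlonglongrightarrow> ennreal (\<rho> z) * \<infinity>"
            using \<rho> by (intro ennreal_tendsto_cmult) auto
          then have "(\<lambda>k. ennreal (\<rho> z * a k)) \<longlonglongrightarrow> \<infinity>"
            using \<rho> by (simp add: ennreal_mult' ennreal_mult_top)
          then show ?thesis by (intro lim_imp_Liminf) auto
        qed
        then show False using a(3) by simp
      qed
    qed
    have "convergent (\<lambda>k. xs (r k) z)"
    proof (rule conv[OF nn(1)[OF z(1)] _ z(3)])
      have "(\<lambda>k. xs (r k) z / (1 + xs (r k) z)) \<longlonglongrightarrow> fst ((1 / \<rho> z) *\<^sub>R l)"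
        using tendsto_fst[OF l'] by (simp only: fst_conv snd_conv)
      then show "convergent (\<lambda>k. xs (r k) z / (1 + xs (r k) z))" by (rule convergentI)
    qed
    moreover have "convergent (\<lambda>k. Cs (r k) z)"
    proof (rule conv[OF nn(2)[OF z(1)] _ z(4)])
      have "(\<lambda>k. Cs (r k) z / (1 + Cs (r k) z)) \<longlonglongrightarrow> snd ((1 / \<rho> z) *\<^sub>R l)"
        using tendsto_snd[OF l'] by (simp only: fst_conv snd_conv)
      then show "convergent (\<lambda>k. Cs (r k) z / (1 + Cs (r k) z))" by (rule convergentI)
    qed
    ultimately show "convergent (\<lambda>k. xs (r k) z) \<and> convergent (\<lambda>k. Cs (r k) z)" ..
  qed
  then show ?thesis using r(1) that by blast
qed

end

section \<open>Optimal plans of a single agent\<close>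

context contribution_problem
begin

definition opt :: "real \<Rightarrow> ('z \<Rightarrow> real) \<Rightarrow> ('z \<Rightarrow> real) \<Rightarrow> bool" where
  "opt y x C \<longleftrightarrow> adm x C \<and> A x + B C \<le> y \<and>
     (\<forall>x' C'. adm x' C' \<longrightarrow> A x' + B C' \<le> y \<longrightarrow> U x' C' \<le> U x C)"

lemma optD:
  assumes "opt y x C"
  shows "adm x C" "A x + B C \<le> y" "\<And>x' C'. adm x' C' \<Longrightarrow> A x' + B C' \<le> y \<Longrightarrow> U x' C' \<le> U x C"
  using assms by (auto simp: opt_def)

text \<open>Upper semicontinuity of the payoff within a budget: truncated payoffs converge by
  dominated convergence, and truncation loses at most \<epsilon> uniformly over the
  sequence.\<close>

lemma U_limit:
  assumes adm: "\<And>k. adm (xs k) (Cs k)" and cost: "\<And>k. A (xs k) + B (Cs k) \<le> y" and lim: "adm x C"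
    and conv: "AE z in N. (\<lambda>k. xs k z) \<longlonglongrightarrow> x z" "AE z in N. (\<lambda>k. Cs k z) \<longlonglongrightarrow> C z"
    and U: "(\<lambda>k. U (xs k) (Cs k)) \<longlonglongrightarrow> S" and "0 \<le> y"
  shows "S \<le> U x C"
proof (rule field_le_epsilon)
  fix \<epsilon> :: real assume \<epsilon>: "0 < \<epsilon>"
  obtain g where g: "integrable N g" "\<And>z. z \<in> space N \<Longrightarrow> 0 \<le> g z"
    "\<And>x C. adm x C \<Longrightarrow> A x + B C \<le> y \<Longrightarrow> (\<integral>\<^sup>+z. ennreal (d z * u (x z, C z) - g z) \<partial>N) \<le> ennreal \<epsilon>"
    using unif_int_scaled[OF \<epsilon> \<open>0 \<le> y\<close>] by metis
  note t = U_le_truncated[OF adm g(1,2) g(3)[OF adm cost] less_imp_le[OF \<epsilon>]]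
  have gm [measurable]: "g \<in> borel_measurable N" using g(1) by auto
  note [measurable] = payoff_measurable[OF lim] payoff_measurable[OF adm]
  have "(\<lambda>k. \<integral>z. min (d z * u (xs k z, Cs k z)) (g z) \<partial>N) \<longlonglongrightarrow> (\<integral>z. min (d z * u (x z, C z)) (g z) \<partial>N)"
  proof (rule integral_dominated_convergence[where w = g])
    show "AE z in N. (\<lambda>k. min (d z * u (xs k z, Cs k z)) (g z)) \<longlonglongrightarrow> min (d z * u (x z, C z)) (g z)"
      using conv AE_space
    proof eventually_elim
      fix z assume z: "z \<in> space N" "(\<lambda>k. xs k z) \<longlonglongrightarrow> x z" "(\<lambda>k. Cs k z) \<longlonglongrightarrow> C z"
      have "(\<lambda>k. u (xs k z, Cs k z)) \<longlonglongrightarrow> u (x z, C z)"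
        using admD(7,8)[OF adm z(1)] admD(7,8)[OF lim z(1)]
        by (intro continuous_on_tendsto_compose[OF u_cont] tendsto_Pair z) auto
      then show "(\<lambda>k. min (d z * u (xs k z, Cs k z)) (g z)) \<longlonglongrightarrow> min (d z * u (x z, C z)) (g z)"
        by (intro tendsto_intros)
    qed
    show "AE z in N. norm (min (d z * u (xs k z, Cs k z)) (g z)) \<le> g z" for k
      using AE_space by eventually_elim (use payoff_nonneg[OF adm] g(2) in auto)
  qed (use g(1) in \<open>auto intro: borel_measurable_min payoff_measurable[OF lim] payoff_measurable[OF adm]\<close>)
  then have "(\<lambda>k. (\<integral>z. min (d z * u (xs k z, Cs k z)) (g z) \<partial>N) + \<epsilon>) \<longlonglongrightarrow> (\<integral>z. min (d z * u (x z, C z)) (g z) \<partial>N) + \<epsilon>"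
    by (intro tendsto_intros)
  with U have "S \<le> (\<integral>z. min (d z * u (x z, C z)) (g z) \<partial>N) + \<epsilon>"
    by (rule LIMSEQ_le) (use t(2) in auto)
  also have "(\<integral>z. min (d z * u (x z, C z)) (g z) \<partial>N) \<le> U x C"
    unfolding U_def using payoff_integrable[OF lim] g(1) by (intro integral_mono) auto
  finally show "S \<le> U x C + \<epsilon>" by simp
qed

text \<open>The budget bounds only the sum of the two costs, whereas Fatou's lemma and
  \<open>K_closed\<close> estimate each cost by its own limit. Hence the passage to a subsequence
  along which both costs converge.\<close>

lemma limit_adm:
  assumes adm: "\<And>k. adm (xs k) (Cs k)" and cost: "\<And>k. A (xs k) + B (Cs k) \<le> y"
    and conv: "AE z in N. convergent (\<lambda>k. xs k z) \<and> convergent (\<lambda>k. Cs k z)" and "0 \<le> y"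
  obtains x C r where "adm x C" "A x + B C \<le> y" "strict_mono r"
    "AE z in N. (\<lambda>k. xs (r k) z) \<longlonglongrightarrow> x z" "AE z in N. (\<lambda>k. Cs (r k) z) \<longlonglongrightarrow> C z"
proof -
  have "compact ({0..y} \<times> {0..y})" by (intro compact_Times compact_Icc)
  then have "seq_compact ({0..y} \<times> {0..y})" by (rule compact_imp_seq_compact)
  moreover have "\<forall>k. (A (xs k), B (Cs k)) \<in> {0..y} \<times> {0..y}"
  proof
    fix k show "(A (xs k), B (Cs k)) \<in> {0..y} \<times> {0..y}"
      using cost[of k] admD(10,11)[OF adm[of k]] by auto
  qed
  ultimately obtain l r where r: "strict_mono r" "((\<lambda>k. (A (xs k), B (Cs k))) \<circ> r) \<longlonglongrightarrow> l"
    by (rule seq_compactE) blast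
  obtain \<alpha> \<beta> where l: "l = (\<alpha>, \<beta>)" by force
  have \<alpha>: "(\<lambda>k. A (xs (r k))) \<longlonglongrightarrow> \<alpha>" using tendsto_fst[OF r(2)] by (simp add: o_def l)
  have \<beta>: "(\<lambda>k. B (Cs (r k))) \<longlonglongrightarrow> \<beta>" using tendsto_snd[OF r(2)] by (simp add: o_def l)
  have \<alpha>\<beta>: "\<alpha> + \<beta> \<le> y" by (rule tendsto_upperbound[OF tendsto_add[OF \<alpha> \<beta>]]) (use cost in auto)
  have "0 \<le> \<alpha>" by (rule tendsto_lowerbound[OF \<alpha>]) (use admD(11)[OF adm] in auto)
  have "0 \<le> \<beta>" by (rule tendsto_lowerbound[OF \<beta>]) (use admD(10)[OF adm] in auto)
  have [measurable]: "xs k \<in> borel_measurable G" "Cs k \<in> borel_measurable G" for k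
    using consumptionsD(1)[OF admD(1)[OF adm]] K_D(1)[OF admD(2)[OF adm]] by auto
  \<comment> \<open>Where the sequence diverges, \<open>lim\<close> is an arbitrary value; the
    maximum keeps the plan nonnegative everywhere.\<close>
  define x where "x z = max 0 (lim (\<lambda>k. xs (r k) z))" for z
  define L where "L z = lim (\<lambda>k. Cs (r k) z)" for z
  have xG: "x \<in> consumptions G"
  proof -
    have "(\<lambda>z. lim (\<lambda>k. xs (r k) z)) \<in> borel_measurable G" by (rule borel_measurable_lim_metric) simp
    then show ?thesis unfolding consumptions_def x_def by auto
  qed
  have LG: "L \<in> borel_measurable G" unfolding L_def by (rule borel_measurable_lim_metric) simp
  have xconv: "AE z in N. (\<lambda>k. xs (r k) z) \<longlonglongrightarrow> x z"
    using conv AE_space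
  proof eventually_elim
    fix z assume z: "z \<in> space N" "convergent (\<lambda>k. xs k z) \<and> convergent (\<lambda>k. Cs k z)"
    then have "convergent (\<lambda>k. xs (r k) z)" using convergent_subseq_convergent[OF _ r(1)] by (force simp: o_def)
    then have c: "(\<lambda>k. xs (r k) z) \<longlonglongrightarrow> lim (\<lambda>k. xs (r k) z)" by (simp add: convergent_LIMSEQ_iff)
    have "0 \<le> lim (\<lambda>k. xs (r k) z)" by (rule tendsto_lowerbound[OF c]) (use admD(7)[OF adm z(1)] in auto)
    then show "(\<lambda>k. xs (r k) z) \<longlonglongrightarrow> x z" using c by (simp add: x_def)
  qed
  have Lconv: "AE z in N. (\<lambda>k. Cs (r k) z) \<longlonglongrightarrow> L z"
    using conv
  proof eventually_elim
    fix z assume z: "convergent (\<lambda>k. xs k z) \<and> convergent (\<lambda>k. Cs k z)"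
    then have "convergent (\<lambda>k. Cs (r k) z)" using convergent_subseq_convergent[OF _ r(1)] by (force simp: o_def)
    then show "(\<lambda>k. Cs (r k) z) \<longlonglongrightarrow> L z" by (simp add: convergent_LIMSEQ_iff L_def)
  qed
  have "\<exists>C\<in>K. (AE z in N. C z = L z) \<and> b C \<le> ennreal \<beta>"
    by (rule K_closed[OF _ LG Lconv _ \<beta>]) (use admD(2,9)[OF adm] in auto)
  then obtain C where C: "C \<in> K" "AE z in N. C z = L z" "b C \<le> ennreal \<beta>" by auto
  have Cconv: "AE z in N. (\<lambda>k. Cs (r k) z) \<longlonglongrightarrow> C z" using Lconv C(2) by eventually_elim simp
  have [measurable]: "xs k \<in> borel_measurable N" "x \<in> borel_measurable N" for k
    using admD(5)[OF adm] consumptionsD[OF xG] by auto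
  have "(\<integral>\<^sup>+z. ennreal (px z * x z) \<partial>N) = (\<integral>\<^sup>+z. liminf (\<lambda>k. ennreal (px z * xs (r k) z)) \<partial>N)"
  proof (rule nn_integral_cong_AE)
    show "AE z in N. ennreal (px z * x z) = liminf (\<lambda>k. ennreal (px z * xs (r k) z))"
      using xconv by eventually_elim (intro lim_imp_Liminf[symmetric] tendsto_ennrealI tendsto_intros, auto)
  qed
  also have "\<dots> \<le> liminf (\<lambda>k. \<integral>\<^sup>+z. ennreal (px z * xs (r k) z) \<partial>N)"
    by (rule nn_integral_liminf) measurable
  also have "(\<lambda>k. \<integral>\<^sup>+z. ennreal (px z * xs (r k) z) \<partial>N) = (\<lambda>k. ennreal (A (xs (r k))))"
  proof
    fix k show "(\<integral>\<^sup>+z. ennreal (px z * xs (r k) z) \<partial>N) = ennreal (A (xs (r k)))" unfolding A_def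
      using admD(3,7)[OF adm] px_nonneg by (intro nn_integral_eq_integral) (auto intro!: AE_I2)
  qed
  also have "liminf \<dots> = ennreal \<alpha>" by (intro lim_imp_Liminf tendsto_ennrealI \<alpha>) auto
  finally have "(\<integral>\<^sup>+z. ennreal (px z * x z) \<partial>N) + b C \<le> ennreal \<alpha> + ennreal \<beta>"
    using C(3) by (rule add_mono)
  also have "\<dots> \<le> ennreal y"
    using \<alpha>\<beta> \<open>0 \<le> \<alpha>\<close> \<open>0 \<le> \<beta>\<close> by (simp flip: ennreal_plus add: ennreal_leI)
  finally have "adm x C \<and> A x + B C \<le> y" using cost_le_iff[OF xG C(1) \<open>0 \<le> y\<close>] by simp
  then show ?thesis using that r(1) xconv Cconv by blast
qed

lemma exists_opt:
  assumes "0 \<le> y" obtains x C where "opt y x C"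
proof -
  define V where "V = {U x C | x C. adm x C \<and> A x + B C \<le> y}"
  obtain S0 where "\<And>x C. adm x C \<Longrightarrow> A x + B C \<le> y \<Longrightarrow> U x C \<le> S0" using U_bounded[OF assms] by blast
  then have bdd: "bdd_above V" unfolding V_def by (intro bdd_aboveI[of _ S0]) auto
  have "U (\<lambda>z. 0) (\<lambda>z. 0) \<in> V" unfolding V_def using adm_zero assms by force
  then have "V \<noteq> {}" by auto
  define S where "S = Sup V"
  have sup: "U x C \<le> S" if "adm x C" "A x + B C \<le> y" for x C
    unfolding S_def using that bdd by (intro cSup_upper) (auto simp: V_def)
  have "\<exists>x C. adm x C \<and> A x + B C \<le> y \<and> S - 1 / real (Suc k) < U x C" for k
  proof -
    have "S - 1 / real (Suc k) < Sup V" unfolding S_def by simp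
    then obtain v where "v \<in> V" "S - 1 / real (Suc k) < v" using less_cSupD[OF \<open>V \<noteq> {}\<close>] by blast
    then show ?thesis unfolding V_def by auto
  qed
  then obtain xs Cs where p: "\<And>k. adm (xs k) (Cs k)" "\<And>k. A (xs k) + B (Cs k) \<le> y"
    "\<And>k. S - 1 / real (Suc k) < U (xs k) (Cs k)" by metis
  have lim: "(\<lambda>k. U (xs k) (Cs k)) \<longlonglongrightarrow> S"
  proof (rule tendsto_sandwich)
    show "(\<lambda>k. S - 1 / real (Suc k)) \<longlonglongrightarrow> S"
      using tendsto_diff[OF tendsto_const LIMSEQ_Suc[OF lim_1_over_n], of S] by simp
    show "\<forall>\<^sub>F k in sequentially. S - 1 / real (Suc k) \<le> U (xs k) (Cs k)"
      using p(3) by (intro always_eventually allI less_imp_le)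
    show "\<forall>\<^sub>F k in sequentially. U (xs k) (Cs k) \<le> S" using sup[OF p(1,2)] by auto
  qed auto
  obtain r where r: "strict_mono r" "AE z in N. convergent (\<lambda>k. xs (r k) z) \<and> convergent (\<lambda>k. Cs (r k) z)"
    using maximizing_sequence_converges[OF p(1,2) sup lim] by blast
  obtain x C r' where x: "adm x C" "A x + B C \<le> y" "strict_mono r'"
    "AE z in N. (\<lambda>k. xs (r (r' k)) z) \<longlonglongrightarrow> x z" "AE z in N. (\<lambda>k. Cs (r (r' k)) z) \<longlonglongrightarrow> C z"
    using limit_adm[of "\<lambda>k. xs (r k)" "\<lambda>k. Cs (r k)", OF p(1,2) r(2) assms] by blast
  have "(\<lambda>k. U (xs (r (r' k))) (Cs (r (r' k)))) \<longlonglongrightarrow> S"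
    using LIMSEQ_subseq_LIMSEQ[OF lim strict_mono_compose[OF r(1) x(3)]] by (simp add: o_def)
  from U_limit[OF p(1,2) x(1,4,5) this assms] have "S \<le> U x C" .
  then have "opt y x C" using x(1,2) sup unfolding opt_def by (meson order_trans)
  then show ?thesis by (rule that)
qed

lemma opt_unique:
  assumes "opt y x C" "opt y x' C'"
  shows "AE z in N. x z = x' z \<and> C z = C' z"
proof (rule ccontr)
  assume "\<not> ?thesis"
  from U_strictly_concave[OF optD(1)[OF assms(1)] optD(1)[OF assms(2)] _ _ this, of "1/2"]
  have "U x C / 2 + U x' C' / 2 < U (\<lambda>z. (1 - 1/2) * x z + 1/2 * x' z) (\<lambda>z. (1 - 1/2) * C z + 1/2 * C' z)" by simp
  also have "\<dots> \<le> U x C"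
    using adm_mix[OF optD(1)[OF assms(1)] optD(1)[OF assms(2)], of "1/2"] optD(2)[OF assms(1)] optD(2)[OF assms(2)]
    by (intro optD(3)[OF assms(1)]) auto
  finally show False using optD(3)[OF assms(2) optD(1,2)[OF assms(1)]] optD(3)[OF assms(1) optD(1,2)[OF assms(2)]]
    by simp
qed

lemma add_h_cost:
  assumes "adm x C" "0 \<le> s"
  shows "adm (\<lambda>z. x z + s * h z) C" "A (\<lambda>z. x z + s * h z) = A x + s * A h"
  using adm_add[OF assms(1) adm_scale(1)[OF adm_h, of s 0]] adm_scale(2)[OF adm_h, of s 0] assms(2) by auto

lemma A_h_pos: "0 < A h"
  unfolding A_def
proof (rule integral_pos)
  show "\<not> (AE z in N. px z * h z = 0)"
  proof
    assume "AE z in N. px z * h z = 0"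
    then have "AE z in N. False" using AE_space by eventually_elim (use px_pos h(2) in force)
    then show False using not_AE_False by simp
  qed
qed (use h px_nonneg in \<open>auto simp: less_imp_le\<close>)

lemma opt_binding:
  assumes "opt y x C" shows "A x + B C = y"
proof (rule ccontr)
  assume "A x + B C \<noteq> y"
  define s where "s = (y - (A x + B C)) / A h"
  have s: "0 < s" using \<open>A x + B C \<noteq> y\<close> optD(2)[OF assms] A_h_pos by (simp add: s_def)
  have "A (\<lambda>z. x z + s * h z) + B C = y"
    using add_h_cost(2)[OF optD(1)[OF assms], of s] s A_h_pos by (simp add: s_def)
  then show False
    using optD(3)[OF assms add_h_cost(1)[OF optD(1)[OF assms], of s]] U_strict[OF optD(1)[OF assms] s] s by simp
qed

text \<open>
  The optimal plan is monotone in the budget: utility is supermodular and costs are modular, so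
  if the meet of two optimal plans cost less than the smaller budget, mixtures of meet and
  join would beat both plans.
\<close>

lemma opt_mono:
  assumes o: "opt y x C" "opt y' x' C'" and "y < y'"
  shows "A x \<le> A x'" "B C \<le> B C'" "AE z in N. x z \<le> x' z \<and> C z \<le> C' z"
proof -
  note a = optD(1)[OF o(1)] optD(1)[OF o(2)]
  define xm Cm where "xm = (\<lambda>z. min (x z) (x' z))" and "Cm = (\<lambda>z. min (C z) (C' z))"
  define xj Cj where "xj = (\<lambda>z. max (x z) (x' z))" and "Cj = (\<lambda>z. max (C z) (C' z))"
  have m: "adm xm Cm" and j: "adm xj Cj" and sums: "A xj + A xm = A x + A x'" "B Cj + B Cm = B C + B C'"
    using adm_max_min[OF a] by (auto simp: xm_def Cm_def xj_def Cj_def)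
  have Um: "U x C + U x' C' \<le> U xj Cj + U xm Cm"
    using U_supermodular[OF a] by (simp add: xm_def Cm_def xj_def Cj_def)
  have le: "A xm \<le> A x" "B Cm \<le> B C" "A xm \<le> A x'" "B Cm \<le> B C'"
    using adm_dominated(2,3)[OF a(1) admD(1,2)[OF m]] adm_dominated(2,3)[OF a(2) admD(1,2)[OF m]]
    by (auto simp: xm_def Cm_def)
  define e where "e = A xm + B Cm"
  have cj: "A xj + B Cj = y + y' - e"
    using sums opt_binding[OF o(1)] opt_binding[OF o(2)] by (simp add: e_def)
  have "e \<le> y" using le opt_binding[OF o(1)] by (simp add: e_def)
  have "e = y"
  proof (rule ccontr)
    assume "e \<noteq> y"
    then have "e < y" using \<open>e \<le> y\<close> by simp
    \<comment> \<open>The weight for which the mixture of meet and join costs exactly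
      \<open>y\<close>. With the weights exchanged it costs \<open>y'\<close>, because meet and join
      together cost \<open>y + y'\<close>.\<close>
    define t where "t = (y - e) / (y + y' - 2 * e)"
    have t: "0 < t" "t < 1" using \<open>e < y\<close> \<open>y < y'\<close> by (auto simp: t_def divide_less_eq)
    have te: "t * (y + y' - 2 * e) = y - e" using \<open>e < y\<close> \<open>y < y'\<close> by (simp add: t_def)
    \<comment> \<open>If meet and join agreed, so would the two plans, and the first would be
      optimal for \<open>y'\<close> without exhausting it.\<close>
    have ne: "\<not> (AE z in N. xm z = xj z \<and> Cm z = Cj z)"
    proof
      assume "AE z in N. xm z = xj z \<and> Cm z = Cj z"
      then have "AE z in N. x z = x' z \<and> C z = C' z"
        by eventually_elim (auto simp: xm_def Cm_def xj_def Cj_def min_def max_def split: if_splits)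
      then have "U x C = U x' C'" by (intro U_cong_AE a) auto
      then have "opt y' x C"
        using optD[OF o(1)] optD[OF o(2)] \<open>y < y'\<close> unfolding opt_def by auto
      from opt_binding[OF this] opt_binding[OF o(1)] \<open>y < y'\<close> show False by simp
    qed
    let ?q = "\<lambda>t z. (1 - t) * xm z + t * xj z" and ?Q = "\<lambda>t z. (1 - t) * Cm z + t * Cj z"
    have t': "0 \<le> 1 - t" "1 - t \<le> 1" "0 \<le> t" "t \<le> 1" using t by auto
    note q = adm_mix[OF m j t'(3,4)] and q' = adm_mix[OF m j t'(1,2)]
    have "A (?q t) + B (?Q t) = (1 - t) * e + t * (y + y' - e)"
      unfolding q(2,3) cj[symmetric] unfolding e_def by (simp add: algebra_simps)
    also have "\<dots> = y" using te by (simp add: algebra_simps)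
    finally have 1: "U (?q t) (?Q t) \<le> U x C" by (intro optD(3)[OF o(1)] q(1)) simp
    have "A (?q (1 - t)) + B (?Q (1 - t)) = t * e + (1 - t) * (y + y' - e)"
      unfolding q'(2,3) cj[symmetric] unfolding e_def by (simp add: algebra_simps)
    also have "\<dots> = y'" using te by (simp add: algebra_simps)
    finally have 2: "U (?q (1 - t)) (?Q (1 - t)) \<le> U x' C'" by (intro optD(3)[OF o(2)] q'(1)) simp
    have "(1 - t) * U xm Cm + t * U xj Cj < U (?q t) (?Q t)"
      using t by (intro U_strictly_concave[OF m j _ _ ne]) auto
    moreover have "t * U xm Cm + (1 - t) * U xj Cj < U (?q (1 - t)) (?Q (1 - t))"
      using t U_strictly_concave[OF m j _ _ ne, of "1 - t"] by auto
    ultimately have "U xm Cm + U xj Cj < U x C + U x' C'"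
      using 1 2 by (simp add: algebra_simps)
    then show False using Um by simp
  qed
  \<comment> \<open>Now the meet is feasible for \<open>y\<close> and the join for
    \<open>y'\<close>. Supermodularity leaves no slack, so the meet is itself optimal for
    \<open>y\<close> and coincides with the first plan.\<close>
  have "U xm Cm \<le> U x C" using \<open>e = y\<close> by (intro optD(3)[OF o(1)] m) (simp add: e_def)
  moreover have "U xj Cj \<le> U x' C'" using \<open>e = y\<close> cj by (intro optD(3)[OF o(2)] j) simp
  ultimately have "U xm Cm = U x C" using Um by simp
  then have "opt y xm Cm" using m \<open>e = y\<close> optD(3)[OF o(1)] by (simp add: opt_def e_def)
  from opt_unique[OF o(1) this] have "AE z in N. x z = xm z \<and> C z = Cm z" .
  then show "AE z in N. x z \<le> x' z \<and> C z \<le> C' z"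
    by eventually_elim (auto simp: xm_def Cm_def min_def split: if_splits)
  have "A x = A xm" "B C = B Cm" using le \<open>e = y\<close> opt_binding[OF o(1)] by (auto simp: e_def)
  then show "A x \<le> A x'" "B C \<le> B C'" using le by auto
qed

end

text \<open>\<open>P\<close> consists of pairs of cost and value. Concavity places every slope from
  \<open>(y, v)\<close> to a point on the right below every slope to a point on the left, and \<mu>
  is the supremum of the former. Mixtures have to exist only up to domination.\<close>

lemma exists_multiplier:
  fixes P :: "(real \<times> real) set"
  assumes mix: "\<And>p q \<theta>. p \<in> P \<Longrightarrow> q \<in> P \<Longrightarrow> 0 \<le> \<theta> \<Longrightarrow> \<theta> \<le> 1 \<Longrightarrow>
      \<exists>r\<in>P. fst r \<le> (1 - \<theta>) * fst p + \<theta> * fst q \<and> (1 - \<theta>) * snd p + \<theta> * snd q \<le> snd r"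
    and max: "\<And>p. p \<in> P \<Longrightarrow> fst p \<le> y \<Longrightarrow> snd p \<le> v"
    and slater: "p0 \<in> P" "fst p0 < y"
  obtains \<mu> where "0 \<le> \<mu>" "\<And>p. p \<in> P \<Longrightarrow> snd p - v \<le> \<mu> * (fst p - y)"
proof -
  \<comment> \<open>Including 0 makes \<mu> nonnegative and the supremum meaningful when no point
    costs more than \<open>y\<close>. The Slater point bounds the slopes from above.\<close>
  define S where "S = insert 0 {(snd p - v) / (fst p - y) | p. p \<in> P \<and> y < fst p}"
  have slopes: "(snd p - v) / (fst p - y) \<le> (v - snd q) / (y - fst q)"
    if pq: "p \<in> P" "q \<in> P" "y < fst p" "fst q < y" for p q
  proof -
    \<comment> \<open>The weight at which the mixture of \<open>p\<close> and \<open>q\<close> costs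
      exactly \<open>y\<close>.\<close>
    define \<theta> where "\<theta> = (fst p - y) / (fst p - fst q)"
    have \<theta>: "0 \<le> \<theta>" "\<theta> \<le> 1" using pq by (auto simp: \<theta>_def divide_le_eq)
    have e: "\<theta> * (fst p - fst q) = fst p - y" using pq by (simp add: \<theta>_def)
    obtain r where r: "r \<in> P" "fst r \<le> (1 - \<theta>) * fst p + \<theta> * fst q" "(1 - \<theta>) * snd p + \<theta> * snd q \<le> snd r"
      using mix[OF pq(1,2) \<theta>] by blast
    have "(1 - \<theta>) * fst p + \<theta> * fst q = y" using e by (simp add: algebra_simps)
    then have "snd r \<le> v" using max[OF r(1)] r(2) by simp
    then have "(1 - \<theta>) * (snd p - v) \<le> \<theta> * (v - snd q)" using r(3) by (simp add: algebra_simps)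
    moreover have "1 - \<theta> = (y - fst q) / (fst p - fst q)" using pq by (simp add: \<theta>_def field_simps)
    ultimately have "(y - fst q) / (fst p - fst q) * (snd p - v) \<le> (fst p - y) / (fst p - fst q) * (v - snd q)"
      by (simp add: \<theta>_def)
    then have "(y - fst q) * (snd p - v) \<le> (fst p - y) * (v - snd q)"
      using pq by (simp add: divide_le_cancel)
    then show ?thesis using pq by (simp add: divide_le_eq pos_le_divide_eq mult.commute)
  qed
  have "bdd_above S"
    unfolding S_def using slopes[OF _ slater(1) _ slater(2)] max[OF slater(1)] slater(2)
    by (intro bdd_aboveI[of _ "(v - snd p0) / (y - fst p0)"]) auto
  define \<mu> where "\<mu> = Sup S"
  have "0 \<le> \<mu>" unfolding \<mu>_def using \<open>bdd_above S\<close> by (intro cSup_upper) (auto simp: S_def)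
  moreover have "snd p - v \<le> \<mu> * (fst p - y)" if p: "p \<in> P" for p
  proof (cases "y < fst p")
    case True
    then have "(snd p - v) / (fst p - y) \<in> S" using p unfolding S_def by blast
    then have "(snd p - v) / (fst p - y) \<le> \<mu>" unfolding \<mu>_def using \<open>bdd_above S\<close>
      by (rule cSup_upper)
    then show ?thesis using True by (simp add: divide_le_eq)
  next
    case False
    show ?thesis
    proof (cases "fst p = y")
      case True
      then show ?thesis using max[OF p] by simp
    next
      case False
      then have "fst p < y" using \<open>\<not> y < fst p\<close> by simp
      have "0 \<le> (v - snd p) / (y - fst p)" using max[OF p] \<open>fst p < y\<close> by simp
      then have "\<mu> \<le> (v - snd p) / (y - fst p)"
        unfolding \<mu>_def S_def using slopes[OF _ p _ \<open>fst p < y\<close>] by (intro cSup_least) auto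
      then show ?thesis using \<open>fst p < y\<close> by (simp add: pos_le_divide_eq algebra_simps)
    qed
  qed
  ultimately show ?thesis by (rule that)
qed

section \<open>Equilibria of the abstract problem\<close>

text \<open>The initial slope of a concave function on a segment is at least the slope of the whole
  segment. Since this holds on the boundary as well and uniformly in \<open>e\<close>, it yields
  integrable minorants for difference quotients.\<close>

lemma (in normal_utility) u_difference_quotient:
  assumes "0 \<le> x" "0 \<le> c" "0 \<le> y" "0 \<le> d" "0 < e" "e \<le> 1"
  shows "u (y, d) - u (x, c) \<le> (u ((1 - e) * x + e * y, (1 - e) * c + e * d) - u (x, c)) / e"
proof -
  have "(1 - e) * u (x, c) + e * u (y, d) \<le> u ((1 - e) * x + e * y, (1 - e) * c + e * d)"
    using assms by (intro u_concave) auto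
  moreover have "(1 - e) * u (x, c) + e * u (y, d) = u (x, c) + (u (y, d) - u (x, c)) * e"
    by (simp add: algebra_simps)
  ultimately have "(u (y, d) - u (x, c)) * e \<le> u ((1 - e) * x + e * y, (1 - e) * c + e * d) - u (x, c)"
    by linarith
  then show ?thesis using assms by (subst pos_le_divide_eq) auto
qed

lemma (in normal_utility) u_directional_derivative_seq:
  assumes "0 < x" "0 < c" and e: "e \<longlonglongrightarrow> 0" "\<And>k. e k \<noteq> 0"
  obtains p q where "\<And>a b. (\<lambda>k. (u (x + e k * a, c + e k * b) - u (x, c)) / e k) \<longlonglongrightarrow> p * a + q * b"
proof -
  obtain p q where pq: "\<And>a b. ((\<lambda>e. (u (x + e * a, c + e * b) - u (x, c)) / e) \<longlongrightarrow> p * a + q * b) (at 0)"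
    using u_directional_derivative[OF assms(1,2)] by blast
  have "filterlim e (at 0) sequentially" using e by (simp add: filterlim_at)
  then show ?thesis using filterlim_compose[OF pq] that by blast
qed

text \<open>Fatou's lemma in the shape of a first-order condition: \<open>F k\<close> are difference
  quotients with or without a limit, and \<open>f\<close> is a lower bound for what they approach.
  Capping \<open>F k\<close> at \<open>f\<close> reduces it to dominated convergence.\<close>

lemma integral_fatou_real:
  fixes f g :: "'b \<Rightarrow> real" and F :: "nat \<Rightarrow> 'b \<Rightarrow> real"
  assumes f: "integrable M f" and F: "\<And>k. integrable M (F k)" and g: "integrable M g"
    and lower: "\<And>k. AE z in M. - g z \<le> F k z"
    and ev: "AE z in M. \<forall>\<delta>>0. \<forall>\<^sub>F k in sequentially. f z - \<delta> \<le> F k z"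
    and le: "\<And>k. (\<integral>z. F k z \<partial>M) \<le> c"
  shows "(\<integral>z. f z \<partial>M) \<le> c"
proof -
  have [measurable]: "f \<in> borel_measurable M" "F k \<in> borel_measurable M" for k using f F by auto
  have "(\<lambda>k. \<integral>z. min (F k z) (f z) \<partial>M) \<longlonglongrightarrow> (\<integral>z. f z \<partial>M)"
  proof (rule integral_dominated_convergence[where w = "\<lambda>z. \<bar>f z\<bar> + \<bar>g z\<bar>"])
    show "AE z in M. (\<lambda>k. min (F k z) (f z)) \<longlonglongrightarrow> f z"
      using ev
    proof eventually_elim
      fix z assume z: "\<forall>\<delta>>0. \<forall>\<^sub>F k in sequentially. f z - \<delta> \<le> F k z"
      show "(\<lambda>k. min (F k z) (f z)) \<longlonglongrightarrow> f z"
      proof (rule tendstoI)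
        fix \<delta> :: real assume "0 < \<delta>"
        then have "\<forall>\<^sub>F k in sequentially. f z - \<delta> / 2 \<le> F k z" using z by simp
        then show "\<forall>\<^sub>F k in sequentially. dist (min (F k z) (f z)) (f z) < \<delta>"
          by eventually_elim (use \<open>0 < \<delta>\<close> in \<open>auto simp: dist_real_def min_def\<close>)
      qed
    qed
    show "AE z in M. norm (min (F k z) (f z)) \<le> \<bar>f z\<bar> + \<bar>g z\<bar>" for k
      using lower[of k] by eventually_elim auto
  qed (use f g in auto)
  moreover have "(\<integral>z. min (F k z) (f z) \<partial>M) \<le> c" for k
    using f F by (intro order_trans[OF integral_mono le[of k]]) auto
  ultimately show ?thesis by (intro LIMSEQ_le_const2) auto
qed

section \<open>Lagrangian optima are equilibria\<close>

context contribution_problem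
begin

definition lagrangian_opt :: "real \<Rightarrow> ('z \<Rightarrow> real) \<Rightarrow> ('z \<Rightarrow> real) \<Rightarrow> bool" where
  "lagrangian_opt \<mu> x C \<longleftrightarrow> 0 \<le> \<mu> \<and> adm x C \<and>
     (\<forall>x' C'. adm x' C' \<longrightarrow> U x' C' - U x C \<le> \<mu> * (A x' + B C' - (A x + B C)))"

definition ne :: "nat \<Rightarrow> (nat \<Rightarrow> 'z \<Rightarrow> real) \<Rightarrow> (nat \<Rightarrow> 'z \<Rightarrow> real) \<Rightarrow> bool" where
  "ne n x C \<longleftrightarrow> (\<forall>i\<in>{1..n}. adm (x i) (C i) \<and> A (x i) + B (C i) \<le> w0 \<and>
     (\<forall>x' C'. adm x' C' \<longrightarrow> A x' + B C' \<le> w0 \<longrightarrow>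
        U x' (\<lambda>z. C' z + (\<Sum>j\<in>{1..n} - {i}. C j z)) \<le> U (x i) (\<lambda>z. \<Sum>j\<in>{1..n}. C j z)))"

lemma adm_sum:
  assumes "finite J" "\<And>j. j \<in> J \<Longrightarrow> adm (x j) (C j)" "adm y D"
  shows "adm y (\<lambda>z. \<Sum>j\<in>J. C j z)" "B (\<lambda>z. \<Sum>j\<in>J. C j z) = (\<Sum>j\<in>J. B (C j))"
proof -
  have "adm y (\<lambda>z. \<Sum>j\<in>J. C j z) \<and> B (\<lambda>z. \<Sum>j\<in>J. C j z) = (\<Sum>j\<in>J. B (C j))"
    using assms
  proof (induction J)
    case empty
    then show ?case using adm_zero adm_swap[OF empty(2) adm_zero(1)] by simp
  next
    case (insert i J)
    then have IH: "adm y (\<lambda>z. \<Sum>j\<in>J. C j z)" "B (\<lambda>z. \<Sum>j\<in>J. C j z) = (\<Sum>j\<in>J. B (C j))" by auto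
    have "adm (\<lambda>z. 0) (C i)" using adm_swap[OF adm_zero(1)] insert by auto
    from adm_add[OF this IH(1)] IH(2) show ?case using insert by simp
  qed
  then show "adm y (\<lambda>z. \<Sum>j\<in>J. C j z)" "B (\<lambda>z. \<Sum>j\<in>J. C j z) = (\<Sum>j\<in>J. B (C j))" by auto
qed

text \<open>\<open>D\<close> is what the others contribute: it enters the payoff but not the cost.
  Spending nothing is the Slater point.\<close>

lemma multiplier:
  assumes D: "adm y D" and x: "adm x C"
    and max: "\<And>x' C'. adm x' C' \<Longrightarrow> A x' + B C' \<le> c \<Longrightarrow> U x' (\<lambda>z. C' z + D z) \<le> v"
    and "0 < c"
  obtains \<mu> where "0 \<le> \<mu>"
    "\<And>x' C'. adm x' C' \<Longrightarrow> U x' (\<lambda>z. C' z + D z) - v \<le> \<mu> * (A x' + B C' - c)"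
proof -
  define P where "P = {(A x' + B C', U x' (\<lambda>z. C' z + D z)) | x' C'. adm x' C'}"
  have tot: "adm x' (\<lambda>z. C' z + D z)" if "adm x' C'" for x' C'
    using adm_add(1)[OF that adm_swap[OF adm_zero(1) D]] by simp
  obtain \<mu> where "0 \<le> \<mu>" "\<And>p. p \<in> P \<Longrightarrow> snd p - v \<le> \<mu> * (fst p - c)"
  proof (rule exists_multiplier[of P c v "(0, U (\<lambda>z. 0) (\<lambda>z. 0 + D z))"])
    fix p q \<theta> assume "p \<in> P" "q \<in> P" and \<theta>: "0 \<le> \<theta>" "\<theta> \<le> (1::real)"
    then obtain x1 C1 x2 C2 where p: "p = (A x1 + B C1, U x1 (\<lambda>z. C1 z + D z))" "adm x1 C1"
      and q: "q = (A x2 + B C2, U x2 (\<lambda>z. C2 z + D z))" "adm x2 C2" unfolding P_def by blast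
    let ?x = "\<lambda>z. (1 - \<theta>) * x1 z + \<theta> * x2 z" and ?C = "\<lambda>z. (1 - \<theta>) * C1 z + \<theta> * C2 z"
    note m = adm_mix[OF p(2) q(2) \<theta>]
    have e: "(\<lambda>z. (1 - \<theta>) * (C1 z + D z) + \<theta> * (C2 z + D z)) = (\<lambda>z. ?C z + D z)"
      by (auto simp: algebra_simps)
    have "(A ?x + B ?C, U ?x (\<lambda>z. ?C z + D z)) \<in> P" using m(1) unfolding P_def by blast
    moreover have "A ?x + B ?C = (1 - \<theta>) * (A x1 + B C1) + \<theta> * (A x2 + B C2)"
      unfolding m(2,3) by (simp add: algebra_simps)
    ultimately show "\<exists>r\<in>P. fst r \<le> (1 - \<theta>) * fst p + \<theta> * fst q \<and> (1 - \<theta>) * snd p + \<theta> * snd q \<le> snd r"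
      using U_concave[OF tot[OF p(2)] tot[OF q(2)] \<theta>] unfolding e p(1) q(1) by (intro bexI) auto
  next
    show "(0, U (\<lambda>z. 0) (\<lambda>z. 0 + D z)) \<in> P"
      using adm_zero unfolding P_def by (intro CollectI exI[of _ "\<lambda>z. 0"]) auto
  qed (use max \<open>0 < c\<close> in \<open>auto simp: P_def\<close>)
  note \<mu> = this
  show ?thesis
  proof (rule that[OF \<mu>(1)])
    fix x' C' assume "adm x' C'"
    then have "(A x' + B C', U x' (\<lambda>z. C' z + D z)) \<in> P" unfolding P_def by blast
    from \<mu>(2)[OF this] show "U x' (\<lambda>z. C' z + D z) - v \<le> \<mu> * (A x' + B C' - c)" by simp
  qed
qed

lemma opt_imp_lagrangian_opt:
  assumes "opt y x C" "0 < y"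
  obtains \<mu> where "lagrangian_opt \<mu> x C"
proof -
  obtain \<mu> where \<mu>: "0 \<le> \<mu>" "\<And>x' C'. adm x' C' \<Longrightarrow> U x' (\<lambda>z. C' z + (\<lambda>z. 0) z) - U x C \<le> \<mu> * (A x' + B C' - y)"
    using multiplier[OF adm_zero(1) optD(1)[OF assms(1)], of y "U x C"] optD(3)[OF assms(1)] assms(2) by auto
  then show ?thesis using that[of \<mu>] optD(1)[OF assms(1)] opt_binding[OF assms(1)]
    by (simp add: lagrangian_opt_def)
qed

lemma lagrangian_opt_imp_opt:
  assumes "lagrangian_opt \<mu> x C" shows "opt (A x + B C) x C"
  unfolding opt_def
proof (intro conjI allI impI)
  fix x' C' assume a: "adm x' C'" "A x' + B C' \<le> A x + B C"
  have "U x' C' - U x C \<le> \<mu> * (A x' + B C' - (A x + B C))" "0 \<le> \<mu>"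
    using assms a by (auto simp: lagrangian_opt_def)
  moreover have "\<mu> * (A x' + B C' - (A x + B C)) \<le> 0"
    using a(2) \<open>0 \<le> \<mu>\<close> by (intro mult_nonneg_nonpos) auto
  ultimately show "U x' C' \<le> U x C" by simp
qed (use assms in \<open>auto simp: lagrangian_opt_def\<close>)

lemma A_cong_AE:
  assumes "x \<in> consumptions G" "y \<in> consumptions G" "AE z in N. x z = y z"
  shows "A x = A y"
  unfolding A_def using consumptionsD(2)[OF assms(1)] consumptionsD(2)[OF assms(2)] assms(3)
  by (intro integral_cong_AE) auto

lemma total_split:
  "i \<in> {1..n} \<Longrightarrow> (\<Sum>j\<in>{1..n}. C j z) = C i z + (\<Sum>j\<in>{1..n::nat} - {i}. C j z :: real)"
  by (simp add: sum.remove)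

text \<open>The contributions of the others cancel: a deviation changes the cost of the total plan
  by exactly the change of the agent's own cost. So a gain within the budget would contradict
  optimality in the Lagrangian.\<close>

lemma lagrangian_opt_imp_ne:
  assumes lag: "lagrangian_opt \<mu> xh Ch"
    and i: "\<And>i. i \<in> {1..n} \<Longrightarrow> adm (x i) (C i)" "\<And>i. i \<in> {1..n} \<Longrightarrow> AE z in N. x i z = xh z"
    and cost: "\<And>i. i \<in> {1..n} \<Longrightarrow> A xh + B (C i) = w0"
    and total: "AE z in N. (\<Sum>j\<in>{1..n}. C j z) = Ch z" "(\<Sum>j\<in>{1..n}. B (C j)) = B Ch"
  shows "ne n x C"
  unfolding ne_def
proof (intro ballI conjI allI impI)
  fix i assume i': "i \<in> {1..n}"
  have adm: "adm xh Ch" using lag by (simp add: lagrangian_opt_def)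
  show "adm (x i) (C i)" using i i' by simp
  have Ax: "A (x i) = A xh"
    using i[OF i'] adm by (intro A_cong_AE) (auto dest: admD)
  then show "A (x i) + B (C i) \<le> w0" using cost[OF i'] by simp
  fix x' C' assume a: "adm x' C'" "A x' + B C' \<le> w0"
  let ?D = "\<lambda>z. \<Sum>j\<in>{1..n} - {i}. C j z"
  have D: "adm (\<lambda>z. 0) ?D" "B ?D = (\<Sum>j\<in>{1..n} - {i}. B (C j))"
    using adm_sum[of "{1..n} - {i}" x C "\<lambda>z. 0" "\<lambda>z. 0"] i adm_zero(1) by auto
  have dev: "adm x' (\<lambda>z. C' z + ?D z)" "B (\<lambda>z. C' z + ?D z) = B C' + B ?D"
    using adm_add[OF a(1) D(1)] by auto
  have "B Ch = B (C i) + B ?D" using total(2) i' D(2) by (simp add: sum.remove)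
  moreover have "U x' (\<lambda>z. C' z + ?D z) - U xh Ch \<le> \<mu> * (A x' + (B C' + B ?D) - (A xh + B Ch))" "0 \<le> \<mu>"
    using lag dev(1) unfolding lagrangian_opt_def dev(2)[symmetric] by blast+
  ultimately have "U x' (\<lambda>z. C' z + ?D z) - U xh Ch \<le> \<mu> * (A x' + B C' - w0)"
    using cost[OF i'] by (simp add: algebra_simps)
  also have "\<dots> \<le> 0" using a(2) \<open>0 \<le> \<mu>\<close> by (intro mult_nonneg_nonpos) auto
  finally have "U x' (\<lambda>z. C' z + ?D z) \<le> U xh Ch" by simp
  also have "U xh Ch = U (x i) (\<lambda>z. \<Sum>j\<in>{1..n}. C j z)"
  proof (rule U_cong_AE[OF adm])
    show "adm (x i) (\<lambda>z. \<Sum>j\<in>{1..n}. C j z)" using adm_sum(1)[of "{1..n}" x C] i i' by blast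
    show "AE z in N. xh z = x i z" using i(2)[OF i'] by eventually_elim simp
    show "AE z in N. Ch z = (\<Sum>j\<in>{1..n}. C j z)" using total(1) by eventually_elim simp
  qed
  finally show "U x' (\<lambda>z. C' z + ?D z) \<le> U (x i) (\<lambda>z. \<Sum>j\<in>{1..n}. C j z)" .
qed

text \<open>Step sizes of the difference quotients. They lie in \<open>(0, 1]\<close>, so they also
  serve as mixing weights.\<close>

definition step :: "nat \<Rightarrow> real" where "step k = 1 / real (Suc k)"

lemma step: "0 < step k" "step k \<le> 1" "step \<longlonglongrightarrow> 0" "step k \<noteq> 0"
  using LIMSEQ_Suc[OF lim_1_over_n] unfolding step_def by (auto simp: step_def[abs_def])

section \<open>First-order conditions of a given equilibrium\<close>

context
  fixes n :: nat and x C :: "nat \<Rightarrow> 'z \<Rightarrow> real"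
begin

definition Ct :: "'z \<Rightarrow> real" where "Ct z = (\<Sum>j\<in>{1..n}. C j z)"
definition oth :: "nat \<Rightarrow> 'z \<Rightarrow> real" where "oth i z = (\<Sum>j\<in>{1..n} - {i}. C j z)"

lemma Ct_split: "i \<in> {1..n} \<Longrightarrow> Ct z = C i z + oth i z"
  unfolding Ct_def oth_def by (rule total_split)

context
  assumes ne: "ne n x C"
begin

lemma ne_adm: "i \<in> {1..n} \<Longrightarrow> adm (x i) (C i)"
  and ne_best: "i \<in> {1..n} \<Longrightarrow> adm x' C' \<Longrightarrow> A x' + B C' \<le> w0 \<Longrightarrow> U x' (\<lambda>z. C' z + oth i z) \<le> U (x i) Ct"
  using ne unfolding ne_def oth_def Ct_def[abs_def] by auto

lemma oth_adm: "adm y D \<Longrightarrow> adm y (oth i)"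
  unfolding oth_def[abs_def] by (rule adm_sum(1)[of _ x C]) (use ne_adm in auto)

lemma Ct_adm: "adm y D \<Longrightarrow> adm y Ct" and B_Ct: "0 < n \<Longrightarrow> B Ct = (\<Sum>j\<in>{1..n}. B (C j))"
proof -
  show "adm y D \<Longrightarrow> adm y Ct"
    unfolding Ct_def[abs_def] by (rule adm_sum(1)[of _ x C]) (use ne_adm in auto)
  show "B Ct = (\<Sum>j\<in>{1..n}. B (C j))"
    unfolding Ct_def[abs_def] by (rule adm_sum(2)[of _ x C, OF _ _ adm_zero(1)]) (use ne_adm in auto)
qed

lemma C_le_Ct: "i \<in> {1..n} \<Longrightarrow> z \<in> space N \<Longrightarrow> 0 \<le> C i z \<and> C i z \<le> Ct z"
  using admD(8)[OF ne_adm] unfolding Ct_def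
  by (auto intro!: member_le_sum)

lemma ne_binding:
  assumes i: "i \<in> {1..n}" shows "A (x i) + B (C i) = w0"
proof (rule ccontr)
  assume ne': "A (x i) + B (C i) \<noteq> w0"
  define s where "s = (w0 - (A (x i) + B (C i))) / A h"
  have le: "A (x i) + B (C i) \<le> w0" using ne i by (auto simp: ne_def)
  have s: "0 < s" using ne' le A_h_pos by (simp add: s_def)
  note ah = add_h_cost[OF ne_adm[OF i], of s]
  have "A (\<lambda>z. x i z + s * h z) + B (C i) = w0" using ah(2) s A_h_pos by (simp add: s_def)
  then have "U (\<lambda>z. x i z + s * h z) (\<lambda>z. C i z + oth i z) \<le> U (x i) Ct"
    using ah s by (intro ne_best[OF i]) auto
  moreover have "(\<lambda>z. C i z + oth i z) = Ct" using Ct_split[OF i] by auto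
  ultimately show False using U_strict[OF Ct_adm[OF ne_adm[OF i]] s] by simp
qed

text \<open>Each agent faces a different concave problem, in which the others' contributions are a
  free good, hence a separate multiplier. The total \<open>D\<close> is described by a pointwise
  equation so that the bound applies to totals written in other forms.\<close>

lemma ne_multipliers:
  obtains l where "\<And>i. i \<in> {1..n} \<Longrightarrow> 0 \<le> l i"
    "\<And>i x' C' D. i \<in> {1..n} \<Longrightarrow> adm x' C' \<Longrightarrow> (\<And>z. D z = C' z + oth i z) \<Longrightarrow>
       U x' D - U (x i) Ct \<le> l i * (A x' - A (x i) + (B C' - B (C i)))"
proof -
  have "\<exists>\<mu>\<ge>0. \<forall>x' C'. adm x' C' \<longrightarrow>
      U x' (\<lambda>z. C' z + oth i z) - U (x i) Ct \<le> \<mu> * (A x' + B C' - w0)" if i: "i \<in> {1..n}" for i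
    by (rule multiplier[OF oth_adm[OF ne_adm[OF i], of i] ne_adm[OF i] ne_best[OF i] w0]) auto
  then have "\<forall>i\<in>{1..n}. \<exists>\<mu>. 0 \<le> \<mu> \<and> (\<forall>x' C'. adm x' C' \<longrightarrow>
      U x' (\<lambda>z. C' z + oth i z) - U (x i) Ct \<le> \<mu> * (A x' + B C' - w0))" by blast
  from bchoice[OF this] obtain l where l: "\<And>i. i \<in> {1..n} \<Longrightarrow> 0 \<le> l i"
    "\<And>i x' C'. i \<in> {1..n} \<Longrightarrow> adm x' C' \<Longrightarrow>
       U x' (\<lambda>z. C' z + oth i z) - U (x i) Ct \<le> l i * (A x' + B C' - w0)" by blast
  show ?thesis
  proof (rule that[OF l(1)])
    fix i x' C' D assume i: "i \<in> {1..n}" and a: "adm x' C'" "\<And>z. D z = C' z + oth i z"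
    have "D = (\<lambda>z. C' z + oth i z)" using a(2) by auto
    then show "U x' D - U (x i) Ct \<le> l i * (A x' - A (x i) + (B C' - B (C i)))"
      using l(2)[OF i a(1)] ne_binding[OF i] by (simp add: algebra_simps)
  qed
qed

text \<open>The Inada condition: on \<open>{Ct > 0}\<close> the marginal utility of consumption is infinite at 0.\<close>

lemma ne_consumption_pos:
  assumes i: "i \<in> {1..n}"
  shows "AE z in N. 0 < Ct z \<longrightarrow> 0 < x i z"
proof -
  obtain l where l: "\<And>i. i \<in> {1..n} \<Longrightarrow> 0 \<le> l i"
    "\<And>i x' C' D. i \<in> {1..n} \<Longrightarrow> adm x' C' \<Longrightarrow> (\<And>z. D z = C' z + oth i z) \<Longrightarrow>
       U x' D - U (x i) Ct \<le> l i * (A x' - A (x i) + (B C' - B (C i)))" using ne_multipliers by blast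
  define S where "S = {z \<in> space N. x i z = 0 \<and> 0 < Ct z}"
  note Ct = Ct_adm[OF ne_adm[OF i]] and xi = ne_adm[OF i]
  have [measurable]: "x i \<in> borel_measurable G" "Ct \<in> borel_measurable G" "h \<in> borel_measurable G"
    using consumptionsD(1) K_D(1) admD(1,2)[OF Ct] h(1) by auto
  have "S \<in> sets G" unfolding S_def space_G[symmetric] by measurable
  then have SN [measurable]: "S \<in> sets N" using subalg by (auto simp: subalgebra_def)
  \<comment> \<open>Extra consumption exactly where there is none. Its cost is at most that of
    \<open>h\<close>, so the quotients of the cost are bounded.\<close>
  define hS where "hS z = indicator S z * h z" for z
  have hS_G: "hS \<in> consumptions G"
    unfolding consumptions_def hS_def space_G using \<open>S \<in> sets G\<close> h(2)
    by (auto simp: less_imp_le indicator_def)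
  have hS: "adm hS (C i)" "A hS \<le> A h"
    using adm_dominated(1,2)[OF adm_swap[OF adm_h xi] hS_G admD(2)[OF xi]] h(2)
    by (auto simp: hS_def indicator_def less_imp_le)
  let ?x = "\<lambda>k z. x i z + step k * hS z"
  have xk: "adm (?x k) (C i)" "A (?x k) = A (x i) + step k * A hS" for k
    using adm_add(1,2)[OF xi adm_scale(1)[OF hS(1), of "step k" 0]] adm_scale(2)[OF hS(1), of "step k" 0] step(1)[of k] by auto
  note xkC = Ct_adm[OF xk(1)]
  let ?F = "\<lambda>k z. (d z * u (?x k z, Ct z) - d z * u (x i z, Ct z)) / step k"
  \<comment> \<open>On \<open>S\<close> the utility quotients tend to infinity, so they eventually
    exceed any \<open>M\<close>, while the marginal cost on the right is fixed. Letting
    \<open>M\<close> grow shows that \<open>S\<close> is a null set.\<close>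
  have bound: "M * (\<integral>z. \<rho> z * indicator S z \<partial>N) \<le> l i * A h" if M: "0 < M" for M :: real
  proof -
    have "(\<integral>z. M * (\<rho> z * indicator S z) \<partial>N) \<le> l i * A h"
    proof (rule integral_fatou_real[where F = ?F and g = "\<lambda>z. 0"])
      show "integrable N (\<lambda>z. M * (\<rho> z * indicator S z))"
        using integrable_real_mult_indicator[OF SN rho(4)] by simp
      show "integrable N (?F k)" for k using payoff_integrable[OF xkC] payoff_integrable[OF Ct] by simp
      show "AE z in N. - 0 \<le> ?F k z" for k
        using AE_space
      proof eventually_elim
        fix z assume z: "z \<in> space N"
        have "u (x i z, Ct z) \<le> u (?x k z, Ct z)"
          using admD(7,8)[OF Ct z] h(2)[OF z] step(1)[of k] by (intro u_mono) (auto simp: hS_def)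
        then show "- 0 \<le> ?F k z" using d_nonneg[OF z] step(1)[of k] by (simp add: mult_left_mono)
      qed
      show "AE z in N. \<forall>\<delta>>0. \<forall>\<^sub>F k in sequentially. M * (\<rho> z * indicator S z) - \<delta> \<le> ?F k z"
        using AE_space
      proof (eventually_elim, intro allI impI)
        fix z and \<delta> :: real assume z: "z \<in> space N" and \<delta>: "0 < \<delta>"
        show "\<forall>\<^sub>F k in sequentially. M * (\<rho> z * indicator S z) - \<delta> \<le> ?F k z"
        proof (cases "z \<in> S")
          case False
          then show ?thesis using \<delta> by (simp add: hS_def)
        next
          case True
          have "filterlim step (at_right 0) sequentially"
            using step by (auto simp: filterlim_at)
          then have "filterlim (\<lambda>k. (u (step k * h z, Ct z) - u (0, Ct z)) / step k) at_top sequentially"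
            using filterlim_compose[OF u_inada[of "Ct z" "h z"]] True h(2)[OF z] by (simp add: S_def)
          then have "\<forall>\<^sub>F k in sequentially. M \<le> (u (step k * h z, Ct z) - u (0, Ct z)) / step k"
            by (simp add: filterlim_at_top)
          then show ?thesis
          proof eventually_elim
            case (elim k)
            have "\<rho> z * M \<le> d z * ((u (step k * h z, Ct z) - u (0, Ct z)) / step k)"
              using elim rho(1,2)[OF z] M by (intro mult_mono) auto
            then show ?case using True \<delta> by (simp add: S_def hS_def right_diff_distrib mult.commute)
          qed
        qed
      qed
      show "(\<integral>z. ?F k z \<partial>N) \<le> l i * A h" for k
      proof -
        have "(\<integral>z. ?F k z \<partial>N) = (U (?x k) Ct - U (x i) Ct) / step k"
          unfolding U_def using payoff_integrable[OF xkC] payoff_integrable[OF Ct] by simp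
        also have "\<dots> \<le> l i * (step k * A hS) / step k"
          using l(2)[OF i xk(1) Ct_split[OF i], of k] xk(2) step(1)[of k] by (intro divide_right_mono) auto
        also have "\<dots> = l i * A hS" using step(4)[of k] by simp
        also have "\<dots> \<le> l i * A h" using hS(2) l(1)[OF i] by (rule mult_left_mono)
        finally show ?thesis .
      qed
    qed simp
    then show ?thesis by simp
  qed
  have "(\<integral>z. \<rho> z * indicator S z \<partial>N) \<le> 0"
  proof (rule ccontr)
    assume "\<not> ?thesis"
    then have pos: "0 < (\<integral>z. \<rho> z * indicator S z \<partial>N)" by simp
    have "0 \<le> l i * A h" using l(1)[OF i] A_h_pos by simp
    then have "0 < (l i * A h + 1) / (\<integral>z. \<rho> z * indicator S z \<partial>N)" using pos by simp
    from bound[OF this] pos show False by simp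
  qed
  moreover have "0 \<le> (\<integral>z. \<rho> z * indicator S z \<partial>N)"
    using rho(1) by (intro Bochner_Integration.integral_nonneg) (auto simp: less_imp_le)
  ultimately have "AE z in N. \<rho> z * indicator S z = 0"
    using integrable_real_mult_indicator[OF SN rho(4)] rho(1)
    by (subst integral_nonneg_eq_0_iff_AE[symmetric]) (auto simp: less_imp_le intro!: AE_I2)
  then show ?thesis using AE_space
  proof eventually_elim
    fix z assume z: "z \<in> space N" "\<rho> z * indicator S z = 0"
    then have "z \<notin> S" using rho(1)[OF z(1)] by auto
    then show "0 < Ct z \<longrightarrow> 0 < x i z" using admD(7)[OF xi z(1)] z(1) by (auto simp: S_def)
  qed
qed

text \<open>Two exchanges between the agents are tested: of consumption, where supermodularity makes
  the joint gain nonnegative, and of contribution, where increasing differences do so to first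
  order. Equal costs change hands but are valued at different multipliers, which fixes the
  sign.\<close>

lemma ne_unequal_multipliers:
  assumes l: "\<And>i. i \<in> {1..n} \<Longrightarrow> 0 \<le> l i"
    "\<And>i x' C' D. i \<in> {1..n} \<Longrightarrow> adm x' C' \<Longrightarrow> (\<And>z. D z = C' z + oth i z) \<Longrightarrow>
       U x' D - U (x i) Ct \<le> l i * (A x' - A (x i) + (B C' - B (C i)))"
    and i: "i \<in> {1..n}" and j: "j \<in> {1..n}" and less: "l i < l j"
  shows "AE z in N. x i z = x j z" "B (C i) = 0" "B (C j) = 0"
proof -
  note xi = ne_adm[OF i] and xj = ne_adm[OF j]
  note Ci = Ct_adm[OF xi] and Cj = Ct_adm[OF xj]
  let ?M = "\<lambda>z. max (x i z) (x j z)" and ?m = "\<lambda>z. min (x i z) (x j z)"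
  have M: "adm ?M (C i)" and m: "adm ?m (C j)"
    using adm_max_min[OF xi xj] adm_swap xi xj by blast+
  have eA: "A ?M + A ?m = A (x i) + A (x j)" using adm_max_min(3)[OF xi xj] .
  \<comment> \<open>Agent \<open>i\<close> deviates to the join of the two consumptions and agent
    \<open>j\<close> to the meet. What one spends the other saves, at multipliers \<open>l i\<close>
    and \<open>l j\<close>.\<close>
  have "U (x i) Ct + U (x j) Ct \<le> U ?M Ct + U ?m Ct" using U_supermodular[OF Ci Cj] by simp
  moreover have "U ?M Ct - U (x i) Ct \<le> l i * (A ?M - A (x i))"
    using l(2)[OF i M Ct_split[OF i]] by simp
  moreover have "U ?m Ct - U (x j) Ct \<le> l j * (A ?m - A (x j))"
    using l(2)[OF j m Ct_split[OF j]] by simp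
  moreover have "A ?M - A (x i) = A (x j) - A ?m" using eA by simp
  ultimately have "0 \<le> (l i - l j) * (A (x j) - A ?m)" by (simp add: algebra_simps)
  then have "A (x j) \<le> A ?m" using less by (simp add: zero_le_mult_iff)
  moreover have "(\<integral>z. px z * (x j z - ?m z) \<partial>N) = A (x j) - A ?m"
    unfolding A_def right_diff_distrib using admD(3)[OF xj] admD(3)[OF m] by simp
  moreover have int: "integrable N (\<lambda>z. px z * (x j z - ?m z))"
    unfolding right_diff_distrib using admD(3)[OF xj] admD(3)[OF m] by simp
  moreover have nn: "0 \<le> px z * (x j z - ?m z)" if "z \<in> space N" for z using px_nonneg[OF that] by simp
  ultimately have "AE z in N. px z * (x j z - ?m z) = 0"
    using Bochner_Integration.integral_nonneg[of N "\<lambda>z. px z * (x j z - ?m z)"]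
    by (subst integral_nonneg_eq_0_iff_AE[symmetric]) auto
  then have xji: "AE z in N. x j z \<le> x i z"
    using AE_space by eventually_elim (use px_pos in \<open>force simp: min_def split: if_splits\<close>)
  \<comment> \<open>Agent \<open>i\<close> takes over a small share of the contribution of
    \<open>j\<close>. Consuming at least as much, \<open>i\<close> values the increase at least as
    highly as \<open>j\<close> would, and at the consumption of \<open>j\<close> increase and
    decrease cancel to first order.\<close>
  have BCj: "0 \<le> (l i - l j) * B (C j)"
  proof -
    let ?F = "\<lambda>k z. (d z * u (x i z, Ct z + step k * C j z) - d z * u (x i z, Ct z)) / step k
      + (d z * u (x j z, Ct z - step k * C j z) - d z * u (x j z, Ct z)) / step k"
    have up: "adm (x i) (\<lambda>z. C i z + step k * C j z)" "B (\<lambda>z. C i z + step k * C j z) = B (C i) + step k * B (C j)"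
      and dn: "adm (x j) (\<lambda>z. (1 - step k) * C j z)" "B (\<lambda>z. (1 - step k) * C j z) = (1 - step k) * B (C j)" for k
      using adm_add(1,3)[OF xi adm_scale(1)[OF adm_swap[OF adm_zero(1) xj], of 0 "step k"]] adm_scale(3)[OF xj, of 0 "step k"]
        adm_scale(1,3)[OF xj, of 1 "1 - step k"] step(1,2)[of k] by auto
    have upC: "adm (x i) (\<lambda>z. Ct z + step k * C j z)" and dnC: "adm (x j) (\<lambda>z. Ct z - step k * C j z)" for k
    proof -
      have "(\<lambda>z. Ct z + step k * C j z) = (\<lambda>z. (C i z + step k * C j z) + oth i z)" using Ct_split[OF i] by auto
      then show "adm (x i) (\<lambda>z. Ct z + step k * C j z)"
        using adm_add(1)[OF up(1) oth_adm[OF adm_zero(1)]] by simp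
      have "(\<lambda>z. Ct z - step k * C j z) = (\<lambda>z. (1 - step k) * C j z + oth j z)"
        using Ct_split[OF j] by (auto simp: algebra_simps)
      then show "adm (x j) (\<lambda>z. Ct z - step k * C j z)"
        using adm_add(1)[OF dn(1) oth_adm[OF adm_zero(1)]] by simp
    qed
    note ints = payoff_integrable[OF upC] payoff_integrable[OF dnC] payoff_integrable[OF Ci] payoff_integrable[OF Cj]
    have dn_ge: "- (d z * u (x j z, Ct z)) \<le> (d z * u (x j z, Ct z - step k * C j z) - d z * u (x j z, Ct z)) / step k"
      if z: "z \<in> space N" for z k
    proof -
      have "u (x j z, Ct z - C j z) - u (x j z, Ct z)
          \<le> (u ((1 - step k) * x j z + step k * x j z, (1 - step k) * Ct z + step k * (Ct z - C j z)) - u (x j z, Ct z)) / step k"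
        using admD(7,8)[OF Cj z] C_le_Ct[OF j z] step(1,2) by (intro u_difference_quotient) auto
      also have "(1 - step k) * x j z + step k * x j z = x j z" by (simp add: algebra_simps)
      also have "(1 - step k) * Ct z + step k * (Ct z - C j z) = Ct z - step k * C j z" by (simp add: algebra_simps)
      finally have "- u (x j z, Ct z) \<le> (u (x j z, Ct z - step k * C j z) - u (x j z, Ct z)) / step k"
        using u_nonneg[of "x j z" "Ct z - C j z"] admD(7)[OF Cj z] C_le_Ct[OF j z] by simp
      then have "d z * (- u (x j z, Ct z)) \<le> d z * ((u (x j z, Ct z - step k * C j z) - u (x j z, Ct z)) / step k)"
        using d_nonneg[OF z] by (rule mult_left_mono)
      then show ?thesis by (simp add: right_diff_distrib)
    qed
    have up_ge: "(d z * u (x j z, Ct z + step k * C j z) - d z * u (x j z, Ct z)) / step k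
        \<le> (d z * u (x i z, Ct z + step k * C j z) - d z * u (x i z, Ct z)) / step k"
      if z: "z \<in> space N" "x j z \<le> x i z" for z k
    proof -
      have "u (x i z, Ct z) + u (x j z, Ct z + step k * C j z) \<le> u (x j z, Ct z) + u (x i z, Ct z + step k * C j z)"
        using admD(7,8)[OF Cj z(1)] C_le_Ct[OF j z(1)] step(1)[of k] z(2) by (intro u_increasing_differences) auto
      then have "d z * (u (x j z, Ct z + step k * C j z) - u (x j z, Ct z)) \<le> d z * (u (x i z, Ct z + step k * C j z) - u (x i z, Ct z))"
        using d_nonneg[OF z(1)] by (intro mult_left_mono) auto
      then show ?thesis using step(1)[of k] by (intro divide_right_mono) (auto simp: right_diff_distrib)
    qed
    have up_nonneg: "0 \<le> (d z * u (x i z, Ct z + step k * C j z) - d z * u (x i z, Ct z)) / step k" if z: "z \<in> space N" for z k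
    proof -
      have "u (x i z, Ct z) \<le> u (x i z, Ct z + step k * C j z)"
        using admD(7,8)[OF Ci z] C_le_Ct[OF j z] step(1)[of k] by (intro u_mono) auto
      then show ?thesis using d_nonneg[OF z] step(1)[of k] by (simp add: mult_left_mono)
    qed
    have "(\<integral>z. 0 \<partial>N) \<le> (l i - l j) * B (C j)"
    proof (rule integral_fatou_real[where F = ?F and g = "\<lambda>z. d z * u (x j z, Ct z)"])
      show "AE z in N. - (d z * u (x j z, Ct z)) \<le> ?F k z" for k
        using AE_space
      proof eventually_elim
        case (elim z)
        show ?case using dn_ge[OF elim, of k] up_nonneg[OF elim, of k] by linarith
      qed
      show "AE z in N. \<forall>\<delta>>0. \<forall>\<^sub>F k in sequentially. 0 - \<delta> \<le> ?F k z"
        using AE_space xji ne_consumption_pos[OF j]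
      proof (eventually_elim, intro allI impI)
        fix z and \<delta> :: real assume z: "z \<in> space N" "x j z \<le> x i z" "0 < Ct z \<longrightarrow> 0 < x j z" and \<delta>: "0 < \<delta>"
        let ?G = "\<lambda>k. (d z * u (x j z, Ct z + step k * C j z) - d z * u (x j z, Ct z)) / step k
            + (d z * u (x j z, Ct z - step k * C j z) - d z * u (x j z, Ct z)) / step k"
        have "?G \<longlonglongrightarrow> 0"
        proof (cases "0 < Ct z")
          case True
          then obtain p q where pq: "\<And>a b. (\<lambda>k. (u (x j z + step k * a, Ct z + step k * b) - u (x j z, Ct z)) / step k) \<longlonglongrightarrow> p * a + q * b"
            using u_directional_derivative_seq[of "x j z" "Ct z" step, OF _ True step(3,4)] z(3) by blast
          have "(\<lambda>k. d z * ((u (x j z + step k * 0, Ct z + step k * C j z) - u (x j z, Ct z)) / step k)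
              + d z * ((u (x j z + step k * 0, Ct z + step k * (- C j z)) - u (x j z, Ct z)) / step k))
              \<longlonglongrightarrow> d z * (p * 0 + q * C j z) + d z * (p * 0 + q * (- C j z))"
            by (intro tendsto_intros pq)
          then show ?thesis by (simp add: right_diff_distrib)
        next
          case False
          \<comment> \<open>Where the total is zero, \<open>u\<close> need not be differentiable,
            but there agent \<open>j\<close> has nothing to hand over and both quotients
            vanish.\<close>
          then have "C j z = 0" using C_le_Ct[OF j z(1)] by auto
          then show ?thesis by simp
        qed
        then have "\<forall>\<^sub>F k in sequentially. - \<delta> < ?G k" using \<delta> by (intro order_tendstoD(1)) auto
        then show "\<forall>\<^sub>F k in sequentially. 0 - \<delta> \<le> ?F k z"
        proof eventually_elim
          case (elim k)
          show ?case using elim up_ge[OF z(1,2), of k] by linarith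
        qed
      qed
      show "(\<integral>z. ?F k z \<partial>N) \<le> (l i - l j) * B (C j)" for k
      proof -
        have "(\<integral>z. ?F k z \<partial>N) = (U (x i) (\<lambda>z. Ct z + step k * C j z) - U (x i) Ct) / step k
            + (U (x j) (\<lambda>z. Ct z - step k * C j z) - U (x j) Ct) / step k"
          unfolding U_def using ints by simp
        also have "\<dots> \<le> l i * (step k * B (C j)) / step k + l j * (- step k * B (C j)) / step k"
        proof (intro add_mono divide_right_mono)
          show "U (x i) (\<lambda>z. Ct z + step k * C j z) - U (x i) Ct \<le> l i * (step k * B (C j))"
            using l(2)[OF i up(1), of "\<lambda>z. Ct z + step k * C j z" k] Ct_split[OF i] up(2)[of k] by simp
          show "U (x j) (\<lambda>z. Ct z - step k * C j z) - U (x j) Ct \<le> l j * (- step k * B (C j))"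
          proof -
            have "Ct z - step k * C j z = (1 - step k) * C j z + oth j z" for z
              using Ct_split[OF j, of z] by (simp add: algebra_simps)
            from l(2)[OF j dn(1)[of k] this]
            have "U (x j) (\<lambda>z. Ct z - step k * C j z) - U (x j) Ct \<le> l j * ((1 - step k) * B (C j) - B (C j))"
              unfolding dn(2) by simp
            also have "(1 - step k) * B (C j) - B (C j) = - step k * B (C j)" by (simp add: algebra_simps)
            finally show ?thesis .
          qed
        qed (use step(1)[of k] in auto)
        also have "\<dots> = (l i - l j) * B (C j)" using step(4)[of k] by (simp add: algebra_simps)
        finally show ?thesis .
      qed
    qed (use ints in auto)
    then show ?thesis by simp
  qed
  then show "B (C j) = 0" using less admD(10)[OF xj] by (auto simp: zero_le_mult_iff)
  \<comment> \<open>Agent \<open>j\<close> spends the entire budget on consumption, and agent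
    \<open>i\<close> consumes at least as much, so \<open>i\<close> has nothing left to contribute
    either.\<close>
  then have "A (x j) = w0" using ne_binding[OF j] by simp
  moreover have "A (x j) \<le> A (x i)"
    unfolding A_def
  proof (rule integral_mono_AE[OF admD(3)[OF xj] admD(3)[OF xi]])
    show "AE z in N. px z * x j z \<le> px z * x i z"
      using xji AE_space by eventually_elim (auto intro: mult_left_mono simp: px_nonneg)
  qed
  ultimately have eqA: "A (x i) = A (x j)" "B (C i) = 0"
    using ne_binding[OF i] admD(10)[OF xi] by linarith+
  then show "B (C i) = 0" by simp
  have "(\<integral>z. px z * (x i z - x j z) \<partial>N) = 0" "integrable N (\<lambda>z. px z * (x i z - x j z))"
    using eqA(1) admD(3)[OF xi] admD(3)[OF xj] unfolding A_def right_diff_distrib by simp_all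
  moreover have "AE z in N. 0 \<le> px z * (x i z - x j z)"
    using xji AE_space by eventually_elim (simp add: px_nonneg)
  ultimately have "AE z in N. px z * (x i z - x j z) = 0"
    by (subst integral_nonneg_eq_0_iff_AE[symmetric]) auto
  then show "AE z in N. x i z = x j z"
    using AE_space by eventually_elim (use px_pos in force)
qed

end

end

end

section \<open>Equilibria are Lagrangian optima, and characterization of equilibria\<close>

context contribution_problem
begin

text \<open>Both agents may deviate to their average consumption. Valued at the same multiplier, the
  two changes of cost cancel, so by strict concavity one of the agents would gain if the
  consumptions differed.\<close>

lemma ne_equal_multipliers:
  assumes ne: "ne n x C" and "0 \<le> \<mu>"
    and l: "\<And>i x' C' D. i \<in> {1..n} \<Longrightarrow> adm x' C' \<Longrightarrow> (\<And>z. D z = C' z + oth n C i z) \<Longrightarrow>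
       U x' D - U (x i) (Ct n C) \<le> \<mu> * (A x' - A (x i) + (B C' - B (C i)))"
    and i: "i \<in> {1..n}" and j: "j \<in> {1..n}"
  shows "AE z in N. x i z = x j z"
proof (rule ccontr)
  assume neq: "\<not> ?thesis"
  note xi = ne_adm[OF ne i] and xj = ne_adm[OF ne j]
  note Ci = Ct_adm[OF ne xi] and Cj = Ct_adm[OF ne xj]
  have half: "adm (\<lambda>z. (1 - 1/2) * x i z + 1/2 * x j z) D" "A (\<lambda>z. (1 - 1/2) * x i z + 1/2 * x j z) = A (x i) / 2 + A (x j) / 2"
    if "adm y D" for y D
    using adm_swap[OF adm_mix(1)[OF xi xj] that, of "1/2"] adm_mix(2)[OF xi xj, of "1/2"] by auto
  have "(1 - 1/2) * U (x i) (Ct n C) + 1/2 * U (x j) (Ct n C)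
      < U (\<lambda>z. (1 - 1/2) * x i z + 1/2 * x j z) (\<lambda>z. (1 - 1/2) * Ct n C z + 1/2 * Ct n C z)"
    using neq by (intro U_strictly_concave Ci Cj) auto
  also have "(\<lambda>z. (1 - 1/2) * Ct n C z + 1/2 * Ct n C z) = Ct n C" by auto
  finally have "U (x i) (Ct n C) + U (x j) (Ct n C) < 2 * U (\<lambda>z. (1 - 1/2) * x i z + 1/2 * x j z) (Ct n C)" by simp
  moreover have "U (\<lambda>z. (1 - 1/2) * x i z + 1/2 * x j z) (Ct n C) - U (x i) (Ct n C) \<le> \<mu> * ((A (x j) - A (x i)) / 2)"
    using l[OF i half(1)[OF xi] Ct_split[OF i]] unfolding half(2)[OF xi] by (simp add: field_simps)
  moreover have "U (\<lambda>z. (1 - 1/2) * x i z + 1/2 * x j z) (Ct n C) - U (x j) (Ct n C) \<le> \<mu> * ((A (x i) - A (x j)) / 2)"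
    using l[OF j half(1)[OF xj] Ct_split[OF j]] unfolding half(2)[OF xj] by (simp add: field_simps)
  moreover have "\<mu> * ((A (x j) - A (x i)) / 2) + \<mu> * ((A (x i) - A (x j)) / 2) = 0" by (simp add: field_simps)
  ultimately show False by linarith
qed

text \<open>
  The agents' first-order conditions add up to the one for the total contribution: a joint deviation towards
  \<open>(x', C')\<close> is, to first order, one agent moving towards \<open>(x', C + C')\<close> while every agent \<open>i\<close>
  withdraws the contribution \<open>C i\<close>.
\<close>

lemma ne_equal_multipliers_lagrangian_opt:
  assumes ne: "ne n x C" and "0 \<le> \<mu>" and n: "0 < n"
    and l: "\<And>i x' C' D. i \<in> {1..n} \<Longrightarrow> adm x' C' \<Longrightarrow> (\<And>z. D z = C' z + oth n C i z) \<Longrightarrow>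
       U x' D - U (x i) (Ct n C) \<le> \<mu> * (A x' - A (x i) + (B C' - B (C i)))"
    and eq: "\<And>i. i \<in> {1..n} \<Longrightarrow> AE z in N. x i z = x 1 z"
  shows "lagrangian_opt \<mu> (x 1) (Ct n C)"
  unfolding lagrangian_opt_def
proof (intro conjI allI impI)
  have 1: "1 \<in> {1..n}" using n by simp
  note x1 = ne_adm[OF ne 1] and xi = ne_adm[OF ne]
  note C1 = Ct_adm[OF ne x1] and Ci = Ct_adm[OF ne xi]
  show "0 \<le> \<mu>" "adm (x 1) (Ct n C)" by fact+
  fix x' C' assume a: "adm x' C'"
  let ?c = "Ct n C"
  let ?up = "\<lambda>k z. (d z * u ((1 - step k) * x 1 z + step k * x' z, ?c z + step k * C' z) - d z * u (x 1 z, ?c z)) / step k"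
  let ?dn = "\<lambda>i k z. (d z * u (x i z, ?c z - step k * C i z) - d z * u (x i z, ?c z)) / step k"
  let ?F = "\<lambda>k z. ?up k z + (\<Sum>i\<in>{1..n}. ?dn i k z)"
  let ?f = "\<lambda>z. d z * u (x' z, C' z) - d z * u (x 1 z, ?c z)"
  let ?g = "\<lambda>z. d z * u (x 1 z, ?c z) + (\<Sum>i\<in>{1..n}. d z * u (x i z, ?c z))"
  have up: "adm (\<lambda>z. (1 - step k) * x 1 z + step k * x' z) (\<lambda>z. C 1 z + step k * C' z)"
    "A (\<lambda>z. (1 - step k) * x 1 z + step k * x' z) = (1 - step k) * A (x 1) + step k * A x'"
    "B (\<lambda>z. C 1 z + step k * C' z) = B (C 1) + step k * B C'" for k
    using adm_swap[OF adm_mix(1)[OF x1 a, of "step k"] adm_add(1)[OF x1 adm_scale(1)[OF a, of 0 "step k"]]]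
      adm_mix(2)[OF x1 a, of "step k"] adm_add(3)[OF x1 adm_scale(1)[OF a, of 0 "step k"]] adm_scale(3)[OF a, of 0 "step k"]
      step(1,2)[of k] by auto
  have dn: "adm (x i) (\<lambda>z. (1 - step k) * C i z)" "B (\<lambda>z. (1 - step k) * C i z) = (1 - step k) * B (C i)"
    if "i \<in> {1..n}" for i k
    using adm_scale(1,3)[OF xi[OF that], of 1 "1 - step k"] step(1,2)[of k] by auto
  have upe: "?c z + step k * C' z = (C 1 z + step k * C' z) + oth n C 1 z" for k z
    using Ct_split[OF 1, of C z] by simp
  have dne: "?c z - step k * C i z = (1 - step k) * C i z + oth n C i z" if "i \<in> {1..n}" for i k z
    using Ct_split[OF that, of C z] by (simp add: algebra_simps)
  have upC: "adm (\<lambda>z. (1 - step k) * x 1 z + step k * x' z) (\<lambda>z. ?c z + step k * C' z)" for k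
    unfolding upe using adm_add(1)[OF up(1)[of k] oth_adm[OF ne adm_zero(1), of 1]] by simp
  have dnC: "adm (x i) (\<lambda>z. ?c z - step k * C i z)" if "i \<in> {1..n}" for i k
    unfolding dne[OF that] using adm_add(1)[OF dn(1)[OF that] oth_adm[OF ne adm_zero(1)]] by simp
  note ints = payoff_integrable[OF upC] payoff_integrable[OF dnC] payoff_integrable[OF C1] payoff_integrable[OF Ci]
    payoff_integrable[OF a]
  have scale_d: "d z * v \<le> (d z * p - d z * q) / s" if "z \<in> space N" "v \<le> (p - q) / s" for v p q s z
  proof -
    have "d z * v \<le> d z * ((p - q) / s)" using that d_nonneg by (intro mult_left_mono) auto
    then show ?thesis by (simp add: right_diff_distrib)
  qed
  have "(\<integral>z. ?f z \<partial>N) \<le> \<mu> * (A x' + B C' - (A (x 1) + B ?c))"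
  proof (rule integral_fatou_real[where F = ?F and g = ?g])
    show "AE z in N. - ?g z \<le> ?F k z" for k
      using AE_space
    proof eventually_elim
      fix z assume z: "z \<in> space N"
      have nn: "0 \<le> x 1 z" "0 \<le> x' z" "0 \<le> C' z" "0 \<le> ?c z" using admD(7,8)[OF a z] admD(7,8)[OF C1 z] by auto
      have "u (x' z, ?c z + C' z) - u (x 1 z, ?c z)
         \<le> (u ((1 - step k) * x 1 z + step k * x' z, (1 - step k) * ?c z + step k * (?c z + C' z)) - u (x 1 z, ?c z)) / step k"
        using nn step by (intro u_difference_quotient) auto
      also have "(1 - step k) * ?c z + step k * (?c z + C' z) = ?c z + step k * C' z" by (simp add: algebra_simps)
      finally have "- u (x 1 z, ?c z)
         \<le> (u ((1 - step k) * x 1 z + step k * x' z, ?c z + step k * C' z) - u (x 1 z, ?c z)) / step k"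
        using u_nonneg[of "x' z" "?c z + C' z"] nn by linarith
      from scale_d[OF z this] have 1: "- (d z * u (x 1 z, ?c z)) \<le> ?up k z" by simp
      have "- (d z * u (x i z, ?c z)) \<le> ?dn i k z" if i: "i \<in> {1..n}" for i
      proof -
        have nni: "0 \<le> x i z" "0 \<le> ?c z - C i z" using admD(7,8)[OF xi[OF i] z] C_le_Ct[OF ne i z] by auto
        have "u (x i z, ?c z - C i z) - u (x i z, ?c z)
           \<le> (u ((1 - step k) * x i z + step k * x i z, (1 - step k) * ?c z + step k * (?c z - C i z)) - u (x i z, ?c z)) / step k"
          using nn nni step by (intro u_difference_quotient) auto
        also have "(1 - step k) * ?c z + step k * (?c z - C i z) = ?c z - step k * C i z" by (simp add: algebra_simps)
        also have "(1 - step k) * x i z + step k * x i z = x i z" by (simp add: algebra_simps)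
        finally have "- u (x i z, ?c z) \<le> (u (x i z, ?c z - step k * C i z) - u (x i z, ?c z)) / step k"
          using u_nonneg[OF nni] by linarith
        from scale_d[OF z this] show ?thesis by simp
      qed
      then have "(\<Sum>i\<in>{1..n}. - (d z * u (x i z, ?c z))) \<le> (\<Sum>i\<in>{1..n}. ?dn i k z)" by (intro sum_mono)
      then show "- ?g z \<le> ?F k z" using 1 unfolding sum_negf by linarith
    qed
    have "AE z in N. \<forall>i\<in>{1..n}. x i z = x 1 z" using eq by (intro AE_finite_allI) auto
    then show "AE z in N. \<forall>\<delta>>0. \<forall>\<^sub>F k in sequentially. ?f z - \<delta> \<le> ?F k z"
      using ne_consumption_pos[OF ne 1] AE_space
    proof (eventually_elim, intro allI impI)
      fix z and \<delta> :: real assume z: "z \<in> space N" "0 < ?c z \<longrightarrow> 0 < x 1 z" "\<forall>i\<in>{1..n}. x i z = x 1 z" and \<delta>: "0 < \<delta>"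
      have nn: "0 \<le> x 1 z" "0 \<le> x' z" "0 \<le> C' z" "0 \<le> ?c z" using admD(7,8)[OF a z(1)] admD(7,8)[OF C1 z(1)] by auto
      have dn_eq: "(\<Sum>i\<in>{1..n}. ?dn i k z) = (\<Sum>i\<in>{1..n}. (d z * u (x 1 z, ?c z - step k * C i z) - d z * u (x 1 z, ?c z)) / step k)" for k
      proof (intro sum.cong refl)
        fix i assume "i \<in> {1..n}"
        then have "x i z = x 1 z" using z(3) by blast
        then show "?dn i k z = (d z * u (x 1 z, ?c z - step k * C i z) - d z * u (x 1 z, ?c z)) / step k"
          by (simp only:)
      qed
      have dq: "u (x' z, C' z) - u (x 1 z, ?c z)
         \<le> (u ((1 - step k) * x 1 z + step k * x' z, (1 - step k) * ?c z + step k * C' z) - u (x 1 z, ?c z)) / step k" for k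
        using nn step by (intro u_difference_quotient) auto
      show "\<forall>\<^sub>F k in sequentially. ?f z - \<delta> \<le> ?F k z"
      proof (cases "0 < ?c z")
        case False
        \<comment> \<open>Nothing can be withdrawn here, so the quotients \<open>?dn\<close> vanish,
          and concavity along the segment to \<open>(x', C')\<close> bounds \<open>?up\<close>
          without any derivative.\<close>
        then have c0: "?c z = 0" using nn by simp
        then have "C i z = 0" if "i \<in> {1..n}" for i using C_le_Ct[OF ne that z(1)] by auto
        then have "(\<Sum>i\<in>{1..n}. ?dn i k z) = 0" for k unfolding dn_eq by (intro sum.neutral) auto
        moreover have "?f z \<le> ?up k z" for k
          using scale_d[OF z(1) dq, of k] c0 by (simp add: right_diff_distrib)
        ultimately show ?thesis using \<delta> by (intro always_eventually allI) (smt (verit))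
      next
        case True
        then obtain p q where pq: "\<And>a b. (\<lambda>k. (u (x 1 z + step k * a, ?c z + step k * b) - u (x 1 z, ?c z)) / step k) \<longlonglongrightarrow> p * a + q * b"
          using u_directional_derivative_seq[of "x 1 z" "?c z" step, OF _ True step(3,4)] z(2) by blast
        have "(\<lambda>k. d z * ((u (x 1 z + step k * (x' z - x 1 z), ?c z + step k * C' z) - u (x 1 z, ?c z)) / step k)
            + (\<Sum>i\<in>{1..n}. d z * ((u (x 1 z + step k * 0, ?c z + step k * (- C i z)) - u (x 1 z, ?c z)) / step k)))
            \<longlonglongrightarrow> d z * (p * (x' z - x 1 z) + q * C' z) + (\<Sum>i\<in>{1..n}. d z * (p * 0 + q * (- C i z)))"
          by (intro tendsto_intros pq)
        also have "(\<lambda>k. d z * ((u (x 1 z + step k * (x' z - x 1 z), ?c z + step k * C' z) - u (x 1 z, ?c z)) / step k)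
            + (\<Sum>i\<in>{1..n}. d z * ((u (x 1 z + step k * 0, ?c z + step k * (- C i z)) - u (x 1 z, ?c z)) / step k))) = (\<lambda>k. ?F k z)"
        proof
          fix k
          have e: "x 1 z + step k * (x' z - x 1 z) = (1 - step k) * x 1 z + step k * x' z" by (simp add: algebra_simps)
          show "d z * ((u (x 1 z + step k * (x' z - x 1 z), ?c z + step k * C' z) - u (x 1 z, ?c z)) / step k)
            + (\<Sum>i\<in>{1..n}. d z * ((u (x 1 z + step k * 0, ?c z + step k * (- C i z)) - u (x 1 z, ?c z)) / step k)) = ?F k z"
            unfolding dn_eq e by (simp add: right_diff_distrib)
        qed
        also have "d z * (p * (x' z - x 1 z) + q * C' z) + (\<Sum>i\<in>{1..n}. d z * (p * 0 + q * (- C i z)))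
            = d z * (p * (x' z - x 1 z) + q * (C' z - ?c z))"
          by (simp add: Ct_def sum_distrib_left sum_negf algebra_simps)
        finally have lim: "(\<lambda>k. ?F k z) \<longlonglongrightarrow> d z * (p * (x' z - x 1 z) + q * (C' z - ?c z))" .
        \<comment> \<open>A concave function lies below its linearization. The limit of the agents'
          quotients is this linearization because \<open>q\<close> multiplies the added
          \<open>C'\<close> and the withdrawn \<open>C i\<close> alike.\<close>
        have "u (x' z, C' z) - u (x 1 z, ?c z) \<le> p * (x' z - x 1 z) + q * (C' z - ?c z)"
        proof (rule tendsto_lowerbound[OF pq])
          show "\<forall>\<^sub>F k in sequentially. u (x' z, C' z) - u (x 1 z, ?c z)
              \<le> (u (x 1 z + step k * (x' z - x 1 z), ?c z + step k * (C' z - ?c z)) - u (x 1 z, ?c z)) / step k"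
          proof (intro always_eventually allI)
            fix k
            have "x 1 z + step k * (x' z - x 1 z) = (1 - step k) * x 1 z + step k * x' z"
              "?c z + step k * (C' z - ?c z) = (1 - step k) * ?c z + step k * C' z" by (simp_all add: algebra_simps)
            then show "u (x' z, C' z) - u (x 1 z, ?c z)
              \<le> (u (x 1 z + step k * (x' z - x 1 z), ?c z + step k * (C' z - ?c z)) - u (x 1 z, ?c z)) / step k"
              using dq[of k] by simp
          qed
        qed simp
        then have "d z * (u (x' z, C' z) - u (x 1 z, ?c z)) \<le> d z * (p * (x' z - x 1 z) + q * (C' z - ?c z))"
          using d_nonneg[OF z(1)] by (rule mult_left_mono)
        then have "?f z \<le> d z * (p * (x' z - x 1 z) + q * (C' z - ?c z))" by (simp only: right_diff_distrib)
        then have "\<forall>\<^sub>F k in sequentially. ?f z - \<delta> < ?F k z"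
          using \<delta> by (intro order_tendstoD(1)[OF lim]) linarith
        then show ?thesis by eventually_elim simp
      qed
    qed
    show "(\<integral>z. ?F k z \<partial>N) \<le> \<mu> * (A x' + B C' - (A (x 1) + B ?c))" for k
    proof -
      have "(\<integral>z. ?F k z \<partial>N) = (U (\<lambda>z. (1 - step k) * x 1 z + step k * x' z) (\<lambda>z. ?c z + step k * C' z) - U (x 1) ?c) / step k
          + (\<Sum>i\<in>{1..n}. (U (x i) (\<lambda>z. ?c z - step k * C i z) - U (x i) ?c) / step k)"
        unfolding U_def using ints by (simp del: One_nat_def atLeastAtMost_iff)
      also have "\<dots> \<le> \<mu> * (step k * (A x' - A (x 1) + B C')) / step k + (\<Sum>i\<in>{1..n}. \<mu> * (- step k * B (C i)) / step k)"
      proof (intro add_mono divide_right_mono sum_mono)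
        show "U (\<lambda>z. (1 - step k) * x 1 z + step k * x' z) (\<lambda>z. ?c z + step k * C' z) - U (x 1) ?c
            \<le> \<mu> * (step k * (A x' - A (x 1) + B C'))"
          using l[OF 1 up(1)[of k] upe] unfolding up(2,3) by (simp add: algebra_simps)
        fix i assume i: "i \<in> {1..n}"
        have "U (x i) (\<lambda>z. ?c z - step k * C i z) - U (x i) ?c \<le> \<mu> * ((1 - step k) * B (C i) - B (C i))"
          using l[OF i dn(1)[OF i, of k] dne[OF i]] unfolding dn(2)[OF i] by simp
        also have "(1 - step k) * B (C i) - B (C i) = - step k * B (C i)" by (simp add: algebra_simps)
        finally show "U (x i) (\<lambda>z. ?c z - step k * C i z) - U (x i) ?c \<le> \<mu> * (- step k * B (C i))" .
      qed (use step(1)[of k] in auto)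
      also have "\<dots> = \<mu> * (A x' - A (x 1) + B C') + (\<Sum>i\<in>{1..n}. - (\<mu> * B (C i)))"
        using step(4)[of k] by simp
      also have "\<dots> = \<mu> * (A x' + B C' - (A (x 1) + B ?c))"
        using B_Ct[OF ne n] by (simp add: sum_negf sum_distrib_left algebra_simps)
      finally show ?thesis .
    qed
  qed (auto intro!: Bochner_Integration.integrable_add Bochner_Integration.integrable_sum
      Bochner_Integration.integrable_diff Bochner_Integration.integrable_divide ints
      simp del: One_nat_def atLeastAtMost_iff)
  moreover have "(\<integral>z. ?f z \<partial>N) = U x' C' - U (x 1) ?c" unfolding U_def using ints by simp
  ultimately show "U x' C' - U (x 1) ?c \<le> \<mu> * (A x' + B C' - (A (x 1) + B ?c))" by simp
qed

text \<open>With equal multipliers the first-order conditions add up. Otherwise every agent's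
  multiplier differs from that of one of two fixed agents, so the cost of each contribution is 0,
  and the condition of agent 1 alone is already the Lagrangian one.\<close>

lemma ne_imp_lagrangian_opt:
  assumes ne: "ne n x C" and n: "0 < n"
  obtains \<mu> where "lagrangian_opt \<mu> (x 1) (Ct n C)" "\<And>i. i \<in> {1..n} \<Longrightarrow> AE z in N. x i z = x 1 z"
proof -
  have 1: "1 \<in> {1..n}" using n by simp
  obtain l where l: "\<And>i. i \<in> {1..n} \<Longrightarrow> 0 \<le> l i"
    "\<And>i x' C' D. i \<in> {1..n} \<Longrightarrow> adm x' C' \<Longrightarrow> (\<And>z. D z = C' z + oth n C i z) \<Longrightarrow>
       U x' D - U (x i) (Ct n C) \<le> l i * (A x' - A (x i) + (B C' - B (C i)))" using ne_multipliers[OF ne] by blast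
  have unequal: "(AE z in N. x i z = x j z) \<and> B (C i) = 0 \<and> B (C j) = 0"
    if "i \<in> {1..n}" "j \<in> {1..n}" "l i < l j" for i j
    by (intro conjI; rule ne_unequal_multipliers[OF ne _ _ that]; fact l)
  show ?thesis
  proof (cases "\<exists>i\<in>{1..n}. \<exists>j\<in>{1..n}. l i \<noteq> l j")
    case False
    then have eq: "l i = l 1" if "i \<in> {1..n}" for i using that 1 by blast
    have l': "\<And>i x' C' D. i \<in> {1..n} \<Longrightarrow> adm x' C' \<Longrightarrow> (\<And>z. D z = C' z + oth n C i z) \<Longrightarrow>
       U x' D - U (x i) (Ct n C) \<le> l 1 * (A x' - A (x i) + (B C' - B (C i)))"
      using l(2) eq by metis
    have eq1: "\<And>i. i \<in> {1..n} \<Longrightarrow> AE z in N. x i z = x 1 z"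
      by (rule ne_equal_multipliers[OF ne l(1)[OF 1] l' _ 1]) auto
    have "lagrangian_opt (l 1) (x 1) (Ct n C)"
      by (rule ne_equal_multipliers_lagrangian_opt[OF ne l(1)[OF 1] n]) (fact l', fact eq1)
    then show ?thesis using eq1 by (rule that)
  next
    case True
    have pair: "B (C i) = 0 \<and> B (C j) = 0 \<and> (AE z in N. x i z = x j z)"
      if "i \<in> {1..n}" "j \<in> {1..n}" "l i \<noteq> l j" for i j
    proof (cases "l i < l j")
      case True
      then show ?thesis using unequal[OF that(1,2)] by auto
    next
      case False
      then have "l j < l i" using that(3) by simp
      from unequal[OF that(2,1) this] show ?thesis by (auto elim!: eventually_mono)
    qed
    obtain i j where ij: "i \<in> {1..n}" "j \<in> {1..n}" "l i \<noteq> l j" using True by blast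
    have all: "B (C k) = 0 \<and> (AE z in N. x k z = x i z)" if k: "k \<in> {1..n}" for k
    proof (cases "l k = l i")
      case False
      then show ?thesis using pair[OF k ij(1)] by simp
    next
      case True
      then have "l k \<noteq> l j" using ij(3) by simp
      from pair[OF k ij(2) this] pair[OF ij] show ?thesis by (auto elim!: eventually_elim2)
    qed
    have "AE z in N. x k z = x 1 z" if k: "k \<in> {1..n}" for k
      using all[OF k] all[OF 1] by (auto elim!: eventually_elim2)
    moreover have "lagrangian_opt (l 1) (x 1) (Ct n C)"
      unfolding lagrangian_opt_def
    proof (intro conjI allI impI)
      show "0 \<le> l 1" using l(1)[OF 1] .
      show "adm (x 1) (Ct n C)" by (rule Ct_adm[OF ne ne_adm[OF ne 1]])
      fix x' C' assume a: "adm x' C'"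
      have tot: "adm x' (\<lambda>z. C' z + oth n C 1 z)" using adm_add(1)[OF a oth_adm[OF ne adm_zero(1)]] by simp
      \<comment> \<open>Adding what the others contribute helps the deviation, and all existing
        contributions have cost 0.\<close>
      have "U x' C' \<le> U x' (\<lambda>z. C' z + oth n C 1 z)"
        by (rule U_mono_AE[OF a tot]) (use admD(8)[OF oth_adm[OF ne a]] in \<open>auto intro!: AE_I2\<close>)
      moreover have "U x' (\<lambda>z. C' z + oth n C 1 z) - U (x 1) (Ct n C) \<le> l 1 * (A x' - A (x 1) + (B C' - B (C 1)))"
        by (rule l(2)[OF 1 a]) simp
      moreover have "B (C 1) = 0" "B (Ct n C) = 0" using all 1 B_Ct[OF ne n] by auto
      ultimately show "U x' C' - U (x 1) (Ct n C) \<le> l 1 * (A x' + B C' - (A (x 1) + B (Ct n C)))"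
        by (simp add: algebra_simps)
    qed
    ultimately show ?thesis using that by blast
  qed
qed

text \<open>
  Whatever the budget \<open>y\<close>, the plan solving the one-agent problem is an equilibrium candidate. It is
  feasible for \<open>n\<close> agents who share the contribution iff \<open>n A x + B C = n w0\<close>. Both cost components are nondecreasing in
  \<open>y\<close> and add up to \<open>y\<close>, hence are continuous, and the intermediate value theorem applies.
\<close>

lemma exists_balanced_opt:
  assumes n: "0 < n"
  obtains y x C where "opt y x C" "0 < y" "real n * A x + B C = real n * w0"
proof -
  have "\<forall>y\<in>{0..}. \<exists>p. opt y (fst p) (snd p)"
  proof
    fix y :: real assume "y \<in> {0..}"
    then obtain x C where "opt y x C" using exists_opt[of y] by auto
    then show "\<exists>p. opt y (fst p) (snd p)" by (intro exI[of _ "(x, C)"]) simp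
  qed
  from bchoice[OF this] obtain p where "\<forall>y\<in>{0..}. opt y (fst (p y)) (snd (p y))" by blast
  then have p: "opt y (fst (p y)) (snd (p y))" if "0 \<le> y" for y using that by simp
  define \<alpha> where "\<alpha> y = A (fst (p y))" for y
  have lip: "0 \<le> \<alpha> y' - \<alpha> y \<and> \<alpha> y' - \<alpha> y \<le> y' - y" if "0 \<le> y" "y < y'" for y y'
    using opt_mono(1,2)[OF p p that(2)] opt_binding[OF p[of y]] opt_binding[OF p[of y']] that
    by (auto simp: \<alpha>_def)
  have "1-lipschitz_on {0..} \<alpha>"
  proof (rule lipschitz_onI)
    fix y y' :: real assume "y \<in> {0..}" "y' \<in> {0..}"
    then show "dist (\<alpha> y) (\<alpha> y') \<le> 1 * dist y y'"
      using lip[of y y'] lip[of y' y] by (cases y y' rule: linorder_cases) (auto simp: dist_real_def)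
  qed simp
  then have cont: "continuous_on {w0..real n * w0} \<alpha>"
    using w0 by (intro continuous_on_subset[OF lipschitz_on_continuous_on]) auto
  have nw: "w0 \<le> real n * w0" using n w0 by (simp add: mult_le_cancel_right1)
  \<comment> \<open>Since the budget binds, \<open>n A + B\<close> is \<open>(n - 1) A + y\<close>.
    At \<open>y = w0\<close> this is at most \<open>n w0\<close> because \<open>A\<close> is at most
    \<open>w0\<close>; at \<open>y = n w0\<close> it is at least \<open>n w0\<close> because
    \<open>A\<close> is nonnegative.\<close>
  have "\<exists>y\<ge>w0. y \<le> real n * w0 \<and> (real n - 1) * \<alpha> y + y = real n * w0"
  proof (rule IVT')
    have "\<alpha> w0 \<le> w0"
      using opt_binding[OF p[of w0]] w0 admD(10)[OF optD(1)[OF p[of w0]]] by (simp add: \<alpha>_def)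
    then have "(real n - 1) * \<alpha> w0 \<le> (real n - 1) * w0" using n by (intro mult_left_mono) auto
    then show "(real n - 1) * \<alpha> w0 + w0 \<le> real n * w0" by (simp add: algebra_simps)
    have "0 \<le> \<alpha> (real n * w0)"
      using admD(11)[OF optD(1)[OF p[of "real n * w0"]]] w0 by (simp add: \<alpha>_def)
    then show "real n * w0 \<le> (real n - 1) * \<alpha> (real n * w0) + real n * w0" using n by simp
    show "continuous_on {w0..real n * w0} (\<lambda>y. (real n - 1) * \<alpha> y + y)" by (intro continuous_intros cont)
  qed fact
  then obtain y where y: "w0 \<le> y" "(real n - 1) * \<alpha> y + y = real n * w0" by blast
  have "real n * \<alpha> y + B (snd (p y)) = real n * w0"
    using y w0 opt_binding[OF p[of y]] by (simp add: \<alpha>_def algebra_simps)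
  then show ?thesis using that[OF p[of y]] y(1) w0 by (simp add: \<alpha>_def)
qed

text \<open>An equilibrium yields an optimal one-agent plan for some budget \<open>y'\<close> that
  satisfies the same balance equation. As \<open>A\<close> is nondecreasing in the budget,
  \<open>(n - 1) A + y\<close> is strictly increasing. Hence the budgets agree, and
  \<open>opt_unique\<close> identifies the plans.\<close>

theorem ne_characterization:
  assumes n: "0 < n"
  obtains xh Ch where "adm xh Ch"
    "\<And>x C. ne n x C \<longleftrightarrow>
      (\<forall>i\<in>{1..n}. adm (x i) (C i) \<and> A (x i) + B (C i) \<le> w0 \<and> (AE z in N. x i z = xh z) \<and> B (C i) = B Ch / real n) \<and>
      (AE z in N. (\<Sum>j\<in>{1..n}. C j z) = Ch z)"
    "A xh + B Ch / real n = w0"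
proof -
  obtain y xh Ch where o: "opt y xh Ch" "0 < y" "real n * A xh + B Ch = real n * w0"
    using exists_balanced_opt[OF n] by blast
  obtain \<mu> where \<mu>: "lagrangian_opt \<mu> xh Ch" using opt_imp_lagrangian_opt[OF o(1,2)] by blast
  have bal: "A xh + B Ch / real n = w0" using o(3) n by (simp add: field_simps)
  note adm = optD(1)[OF o(1)]
  show ?thesis
  proof (rule that[OF adm _ bal], rule iffI)
    fix x C assume a: "(\<forall>i\<in>{1..n}. adm (x i) (C i) \<and> A (x i) + B (C i) \<le> w0 \<and> (AE z in N. x i z = xh z) \<and> B (C i) = B Ch / real n) \<and>
      (AE z in N. (\<Sum>j\<in>{1..n}. C j z) = Ch z)"
    show "ne n x C"
    proof (rule lagrangian_opt_imp_ne[OF \<mu>])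
      have "(\<Sum>j\<in>{1..n}. B (C j)) = (\<Sum>j\<in>{1..n}. B Ch / real n)" using a by (intro sum.cong) auto
      then show "(\<Sum>j\<in>{1..n}. B (C j)) = B Ch" using n by simp
    qed (use a bal in auto)
  next
    fix x C assume ne: "ne n x C"
    have 1: "1 \<in> {1..n}" using n by simp
    obtain \<mu>' where lag: "lagrangian_opt \<mu>' (x 1) (Ct n C)" and eq: "\<And>i. i \<in> {1..n} \<Longrightarrow> AE z in N. x i z = x 1 z"
      using ne_imp_lagrangian_opt[OF ne n] by blast
    define y' where "y' = A (x 1) + B (Ct n C)"
    have o': "opt y' (x 1) (Ct n C)" unfolding y'_def by (rule lagrangian_opt_imp_opt[OF lag])
    have Aeq: "A (x i) = A (x 1)" if "i \<in> {1..n}" for i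
      using eq[OF that] ne_adm[OF ne that] ne_adm[OF ne 1] by (intro A_cong_AE) (auto dest: admD)
    have "B (Ct n C) = (\<Sum>i\<in>{1..n}. w0 - A (x 1))"
      unfolding B_Ct[OF ne n]
    proof (intro sum.cong refl)
      fix i assume "i \<in> {1..n}"
      from ne_binding[OF ne this] Aeq[OF this] show "B (C i) = w0 - A (x 1)" by linarith
    qed
    then have bal': "real n * A (x 1) + B (Ct n C) = real n * w0" using n by (simp add: algebra_simps)
    have "y = y'"
    proof (rule ccontr)
      assume "y \<noteq> y'"
      have e: "(real n - 1) * A xh + y = (real n - 1) * A (x 1) + y'"
        using opt_binding[OF o(1)] o(3) bal' by (simp add: y'_def algebra_simps)
      show False
      proof (cases "y < y'")
        case True
        from mult_left_mono[OF opt_mono(1)[OF o(1) o' True], of "real n - 1"] show False using e True n by simp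
      next
        case False
        then have "y' < y" using \<open>y \<noteq> y'\<close> by simp
        from mult_left_mono[OF opt_mono(1)[OF o' o(1) this], of "real n - 1"] show False using e \<open>y' < y\<close> n by simp
      qed
    qed
    with o' have uniq: "AE z in N. x 1 z = xh z \<and> Ct n C z = Ch z" using opt_unique[OF _ o(1)] by simp
    have x1: "A (x 1) = A xh"
      using uniq ne_adm[OF ne 1] adm by (intro A_cong_AE) (auto dest: admD)
    show "(\<forall>i\<in>{1..n}. adm (x i) (C i) \<and> A (x i) + B (C i) \<le> w0 \<and> (AE z in N. x i z = xh z) \<and> B (C i) = B Ch / real n) \<and>
      (AE z in N. (\<Sum>j\<in>{1..n}. C j z) = Ch z)"
    proof (intro conjI ballI)
      fix i assume i: "i \<in> {1..n}"
      show "adm (x i) (C i)" by (rule ne_adm[OF ne i])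
      show "A (x i) + B (C i) \<le> w0" using ne_binding[OF ne i] by simp
      show "AE z in N. x i z = xh z" using eq[OF i] uniq by eventually_elim simp
      show "B (C i) = B Ch / real n" using ne_binding[OF ne i] Aeq[OF i] x1 bal by simp
    next
      show "AE z in N. (\<Sum>j\<in>{1..n}. C j z) = Ch z" using uniq by eventually_elim (simp add: Ct_def)
    qed
  qed
qed

end

section \<open>Contribution paths and their costs\<close>

text \<open>Time stopped at the horizon. Evaluating paths at stopped times lets the dyadic grid on
  the half-line serve finite and infinite horizons alike.\<close>

definition tau :: "ereal \<Rightarrow> real \<Rightarrow> real" where
  "tau T s = real_of_ereal (min (ereal s) T)"

definition good_path :: "ereal \<Rightarrow> (real \<Rightarrow> real) \<Rightarrow> bool" where
  "good_path T C \<longleftrightarrow> right_continuous_on (horizon T) C \<and> mono_on (horizon T) C \<and> (\<forall>t\<in>horizon T. 0 \<le> C t)"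

text \<open>A Riemann-Stieltjes sum. The value preceding index 0 is 0, in accordance with
  \<open>C(0-) = 0\<close>, so the jump at time 0 is counted.\<close>

definition increment_sum :: "(nat \<Rightarrow> real) \<Rightarrow> (nat \<Rightarrow> real) \<Rightarrow> nat \<Rightarrow> real" where
  "increment_sum \<phi> z J = (\<Sum>j<J. \<phi> j * (z j - (if j = 0 then 0 else z (j - 1))))"

text \<open>The price is capped at \<open>c\<close> and read \<open>e\<close> grid steps after the
  right end of each increment. The limit does not depend on \<open>e\<close>; the value 1 arises
  when a contribution is delayed by one step.\<close>

definition path_sum :: "ereal \<Rightarrow> nat \<Rightarrow> nat \<Rightarrow> real \<Rightarrow> nat \<Rightarrow> (real \<Rightarrow> real) \<Rightarrow> (real \<Rightarrow> real) \<Rightarrow> real" where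
  "path_sum T e n c J f C =
     increment_sum (\<lambda>j. min (f (tau T (real (j + e) / 2 ^ n))) c) (\<lambda>j. C (tau T (real j / 2 ^ n))) J"

text \<open>Cutting off price and time at \<open>m\<close> makes the integral finite on good paths
  and a limit of grid sums; it increases to \<open>stieltjes_integral\<close>.\<close>

definition path_integral :: "ereal \<Rightarrow> nat \<Rightarrow> (real \<Rightarrow> real) \<Rightarrow> (real \<Rightarrow> real) \<Rightarrow> ennreal" where
  "path_integral T m f C = (\<integral>\<^sup>+s. ennreal (min (f (tau T s)) (real m)) * indicator {0..real m} s
     \<partial>interval_measure (extend_path T C))"

lemma increment_sum_Suc:
  "increment_sum \<phi> z (Suc J) = increment_sum \<phi> z J + \<phi> J * (z J - (if J = 0 then 0 else z (J - 1)))"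
  by (simp add: increment_sum_def)

lemma horizon_down:
  assumes "t \<in> horizon T" "0 \<le> s" "s \<le> t" shows "s \<in> horizon T"
proof -
  have "ereal s \<le> ereal t" "ereal t \<le> T" using assms by (auto simp: horizon_def)
  then show ?thesis using assms(2) order_trans unfolding horizon_def by blast
qed

context
  fixes T :: ereal
  assumes T: "0 < T"
begin

lemma tau_cases:
  obtains (infinite) "T = \<infinity>" "tau T = (\<lambda>s. s)" "horizon T = {0..}"
  | (finite) T0 where "0 < T0" "T = ereal T0" "tau T = (\<lambda>s. min s T0)" "horizon T = {0..T0}"
proof (cases T)
  case PInf
  then show ?thesis by (intro infinite) (auto simp: tau_def horizon_def fun_eq_iff)
next
  case (real T0)
  then show ?thesis using T by (intro finite[of T0]) (auto simp: tau_def horizon_def fun_eq_iff min_def)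
qed (use T in auto)

lemma tau_facts:
  shows tau_horizon: "0 \<le> s \<Longrightarrow> tau T s \<in> horizon T"
    and tau_ident: "t \<in> horizon T \<Longrightarrow> tau T t = t"
    and tau_mono: "s \<le> t \<Longrightarrow> tau T s \<le> tau T t"
    and horizon_nonneg: "t \<in> horizon T \<Longrightarrow> 0 \<le> t"
    and zero_horizon: "0 \<in> horizon T"
    and horizon_measurable: "horizon T \<in> sets borel"
    and tau_tendsto: "(X \<longlongrightarrow> s) F' \<Longrightarrow> ((\<lambda>i. tau T (X i)) \<longlongrightarrow> tau T s) F'"
    and tau_less: "ereal t < T \<Longrightarrow> t < s \<Longrightarrow> t < tau T s"
    and tau_le: "tau T s \<le> s"
  by (cases rule: tau_cases; auto intro: tendsto_min)+

text \<open>The sequence may meet its limit, as it does on the grid or beyond the horizon. So the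
  punctured limit in \<open>right_continuous_on\<close> is first turned into continuity on a set
  containing the point.\<close>

lemma right_continuous_sequentially:
  assumes rc: "right_continuous_on (horizon T) f" and s: "0 \<le> s" "\<And>n. s \<le> \<sigma> n" "\<sigma> \<longlonglongrightarrow> s"
  shows "(\<lambda>n. f (tau T (\<sigma> n))) \<longlonglongrightarrow> f (tau T s)"
proof -
  let ?t = "tau T s"
  have "(f \<longlongrightarrow> f ?t) (at ?t within (horizon T \<inter> {?t<..}))"
    using rc tau_horizon[OF s(1)] by (auto simp: right_continuous_on_def)
  moreover have "at ?t within (horizon T \<inter> {?t..}) = at ?t within (horizon T \<inter> {?t<..})"
    unfolding at_within_def by (intro arg_cong2[of _ _ _ _ inf] arg_cong[of _ _ principal]) auto
  ultimately have "continuous (at ?t within (horizon T \<inter> {?t..})) f" by (simp add: continuous_within)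
  moreover have "\<forall>n. tau T (\<sigma> n) \<in> horizon T \<inter> {?t..}"
    using s tau_horizon tau_mono by (auto intro: order_trans)
  moreover have "(\<lambda>n. tau T (\<sigma> n)) \<longlonglongrightarrow> ?t" by (rule tau_tendsto[OF s(3)])
  ultimately show ?thesis unfolding continuous_within_sequentially by (auto simp: o_def)
qed

lemma right_grid:
  fixes s :: real
  shows "s \<le> real_of_int (\<lceil>2 ^ n * s\<rceil> + int e) / 2 ^ n"
    and "(\<lambda>n. real_of_int (\<lceil>2 ^ n * s\<rceil> + int e) / 2 ^ n) \<longlonglongrightarrow> s"
proof -
  have le: "s \<le> real_of_int (\<lceil>2 ^ n * s\<rceil> + int e) / 2 ^ n" for n
  proof -
    have "2 ^ n * s \<le> real_of_int \<lceil>2 ^ n * s\<rceil>" by (rule le_of_int_ceiling)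
    also have "\<dots> \<le> real_of_int (\<lceil>2 ^ n * s\<rceil> + int e)" by simp
    finally have "2 ^ n * s \<le> real_of_int (\<lceil>2 ^ n * s\<rceil> + int e)" .
    then show ?thesis by (simp add: pos_le_divide_eq mult.commute)
  qed
  then show "s \<le> real_of_int (\<lceil>2 ^ n * s\<rceil> + int e) / 2 ^ n" .
  have up: "real_of_int (\<lceil>2 ^ n * s\<rceil> + int e) / 2 ^ n \<le> s + (1 + real e) * (1 / 2) ^ n" for n
  proof -
    have "real_of_int (\<lceil>2 ^ n * s\<rceil> + int e) \<le> 2 ^ n * s + (1 + real e)" 
      using of_int_ceiling_le_add_one[of "2 ^ n * s"] unfolding of_int_add of_int_of_nat_eq by linarith
    then have "real_of_int (\<lceil>2 ^ n * s\<rceil> + int e) / 2 ^ n \<le> (2 ^ n * s + (1 + real e)) / 2 ^ n"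
      by (intro divide_right_mono) auto
    also have "\<dots> = s + (1 + real e) * (1 / 2) ^ n" by (simp add: add_divide_distrib power_divide)
    finally show ?thesis .
  qed
  have "(\<lambda>n. s + (1 + real e) * (1 / 2) ^ n) \<longlonglongrightarrow> s + (1 + real e) * 0"
    by (intro tendsto_intros LIMSEQ_power_zero) auto
  then have lim: "(\<lambda>n. s + (1 + real e) * (1 / 2) ^ n) \<longlonglongrightarrow> s" by simp
  show "(\<lambda>n. real_of_int (\<lceil>2 ^ n * s\<rceil> + int e) / 2 ^ n) \<longlonglongrightarrow> s"
    by (rule tendsto_sandwich[OF _ _ tendsto_const lim]) (intro always_eventually allI le up)+
qed

lemma extend_path_eq: "extend_path T C s = (if s < 0 then 0 else C (tau T s))"
  by (simp add: extend_path_def tau_def)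

lemma extend_path_mono:
  assumes "good_path T C" "s \<le> t" shows "extend_path T C s \<le> extend_path T C t"
  using assms tau_horizon[of s] tau_horizon[of t] tau_mono[OF assms(2)]
  by (auto simp: extend_path_eq good_path_def mono_on_def)

lemma extend_path_right_continuous:
  assumes "good_path T C" shows "continuous (at_right a) (extend_path T C)"
proof (rule continuous_within_sequentiallyI)
  fix \<sigma> :: "nat \<Rightarrow> real" assume \<sigma>: "\<sigma> \<longlonglongrightarrow> a" "\<forall>n. \<sigma> n \<in> {a<..}"
  show "(\<lambda>n. extend_path T C (\<sigma> n)) \<longlonglongrightarrow> extend_path T C a"
  proof (cases "a < 0")
    case True
    have "\<forall>\<^sub>F n in sequentially. \<sigma> n < 0" using order_tendstoD(2)[OF \<sigma>(1) True] .
    then have "\<forall>\<^sub>F n in sequentially. extend_path T C (\<sigma> n) = extend_path T C a"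
      by eventually_elim (use True in \<open>simp add: extend_path_eq\<close>)
    then show ?thesis by (rule tendsto_eventually)
  next
    case False
    then have "(\<lambda>n. C (tau T (\<sigma> n))) \<longlonglongrightarrow> C (tau T a)"
      using assms \<sigma> by (intro right_continuous_sequentially) (auto simp: good_path_def less_imp_le)
    moreover have "\<not> \<sigma> n < 0" for n using \<sigma>(2) False by (auto simp: not_less intro: order_trans less_imp_le)
    ultimately show ?thesis using False by (simp add: extend_path_eq)
  qed
qed

lemma emeasure_path:
  assumes "good_path T C" "a \<le> b"
  shows "emeasure (interval_measure (extend_path T C)) {a<..b} = ennreal (extend_path T C b - extend_path T C a)"
  using emeasure_interval_measure_Ioc[OF assms(2) extend_path_mono[OF assms(1)] extend_path_right_continuous[OF assms(1)]] .

text \<open>The sums are integrals of step functions against the Stieltjes measure. Each step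
  function reads the price at a grid time not before the current one, so right-continuity alone
  gives pointwise convergence, and the cap on the price allows dominated convergence.\<close>

lemma path_sum_converges:
  assumes C: "good_path T C" and f: "right_continuous_on (horizon T) f" "\<And>t. t \<in> horizon T \<Longrightarrow> 0 \<le> f t"
  shows "(\<lambda>n. ennreal (path_sum T e n (real m) (m * 2 ^ n + 1) f C)) \<longlonglongrightarrow> path_integral T m f C"
    and "path_integral T m f C \<le> ennreal (real m * C (tau T (real m)))"
    and "(\<lambda>s. f (tau T s) * indicator {0..} s) \<in> borel_measurable borel"
proof -
  let ?\<nu> = "interval_measure (extend_path T C)"
  define H where "H n s = (\<Sum>j<m * 2 ^ n + 1. ennreal (min (f (tau T (real (j + e) / 2 ^ n))) (real m))
      * indicator {(real j - 1) / 2 ^ n<..real j / 2 ^ n} s)" for n and s :: real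
  \<comment> \<open>Exactly one grid interval contains \<open>s\<close>, the one of index
    \<open>\<lceil>2 ^ n * s\<rceil>\<close>, so the sum \<open>H\<close> has at most one nonzero
    term.\<close>
  define H' where "H' n s = (if 0 \<le> \<lceil>2 ^ n * s\<rceil> \<and> \<lceil>2 ^ n * s\<rceil> \<le> int (m * 2 ^ n)
      then ennreal (min (f (tau T (real_of_int (\<lceil>2 ^ n * s\<rceil> + int e) / 2 ^ n))) (real m)) else 0)" for n and s :: real
  define h where "h s = ennreal (min (f (tau T s)) (real m)) * indicator {0..real m} s" for s
  have H_meas [measurable]: "H n \<in> borel_measurable ?\<nu>" for n unfolding H_def by measurable
  have f0: "0 \<le> f (tau T s)" if "0 \<le> s" for s using f(2)[OF tau_horizon[OF that]] .
  have HH': "H n s = H' n s" for n s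
  proof -
    have ind: "indicator {(real j - 1) / 2 ^ n<..real j / 2 ^ n} s = (if \<lceil>2 ^ n * s\<rceil> = int j then 1 else (0::ennreal))" for j
    proof -
      have "s \<in> {(real j - 1) / 2 ^ n<..real j / 2 ^ n} \<longleftrightarrow> real j - 1 < 2 ^ n * s \<and> 2 ^ n * s \<le> real j"
        by (simp add: divide_less_eq pos_le_divide_eq mult.commute)
      also have "\<dots> \<longleftrightarrow> \<lceil>2 ^ n * s\<rceil> = int j" by (subst ceiling_eq_iff) simp
      finally show ?thesis by (simp add: indicator_def)
    qed
    show ?thesis
    proof (cases "0 \<le> \<lceil>2 ^ n * s\<rceil>")
      case True
      then obtain i where i: "\<lceil>2 ^ n * s\<rceil> = int i" by (metis nonneg_int_cases)
      have "H n s = (\<Sum>j<m * 2 ^ n + 1. if j = i then ennreal (min (f (tau T (real (j + e) / 2 ^ n))) (real m)) else 0)"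
        unfolding H_def ind i by (intro sum.cong) auto
      moreover have le_iff: "int i \<le> int (m * 2 ^ n) \<longleftrightarrow> i < m * 2 ^ n + 1" unfolding of_nat_le_iff by auto
      ultimately have "H n s = (if i < m * 2 ^ n + 1 then ennreal (min (f (tau T (real (i + e) / 2 ^ n))) (real m)) else 0)"
        by (simp only: sum.delta[OF finite_lessThan] lessThan_iff)
      also have "\<dots> = H' n s" unfolding H'_def i le_iff by simp
      finally show ?thesis .
    next
      case False
      then have "\<lceil>2 ^ n * s\<rceil> \<noteq> int j" for j by linarith
      then have "H n s = 0" unfolding H_def ind by (intro sum.neutral) auto
      moreover have "H' n s = 0" unfolding H'_def by (rule if_not_P) (use False in blast)
      ultimately show ?thesis by simp
    qed
  qed
  have sum_eq: "ennreal (path_sum T e n (real m) (m * 2 ^ n + 1) f C) = (\<integral>\<^sup>+s. H n s \<partial>?\<nu>)" for n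
  proof -
    have inc: "ennreal (C (tau T (real j / 2 ^ n)) - (if j = 0 then 0 else C (tau T (real (j - 1) / 2 ^ n))))
        = emeasure ?\<nu> {(real j - 1) / 2 ^ n<..real j / 2 ^ n}"
      "0 \<le> C (tau T (real j / 2 ^ n)) - (if j = 0 then 0 else C (tau T (real (j - 1) / 2 ^ n)))" for j
    proof -
      have le: "(real j - 1) / 2 ^ n \<le> real j / 2 ^ n" by (simp add: divide_right_mono)
      have "extend_path T C ((real j - 1) / 2 ^ n) = (if j = 0 then 0 else C (tau T (real (j - 1) / 2 ^ n)))"
        by (cases j) (auto simp: extend_path_eq divide_less_0_iff)
      moreover have "extend_path T C (real j / 2 ^ n) = C (tau T (real j / 2 ^ n))"
        by (simp add: extend_path_eq divide_less_0_iff)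
      ultimately show "ennreal (C (tau T (real j / 2 ^ n)) - (if j = 0 then 0 else C (tau T (real (j - 1) / 2 ^ n))))
        = emeasure ?\<nu> {(real j - 1) / 2 ^ n<..real j / 2 ^ n}"
        "0 \<le> C (tau T (real j / 2 ^ n)) - (if j = 0 then 0 else C (tau T (real (j - 1) / 2 ^ n)))"
        using emeasure_path[OF C le] extend_path_mono[OF C le] by auto
    qed
    have "(\<integral>\<^sup>+s. H n s \<partial>?\<nu>) = (\<Sum>j<m * 2 ^ n + 1. ennreal (min (f (tau T (real (j + e) / 2 ^ n))) (real m))
        * emeasure ?\<nu> {(real j - 1) / 2 ^ n<..real j / 2 ^ n})"
      unfolding H_def by (subst nn_integral_sum) (auto simp: nn_integral_cmult_indicator)
    also have "\<dots> = ennreal (path_sum T e n (real m) (m * 2 ^ n + 1) f C)"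
      unfolding path_sum_def increment_sum_def inc(1)[symmetric]
      using inc(2) f0 by (subst sum_ennreal[symmetric]) (auto intro!: sum.cong simp: ennreal_mult)
    finally show ?thesis by simp
  qed
  have lim: "(\<lambda>n. H n s) \<longlonglongrightarrow> h s" for s
  proof -
    consider "s < 0" | "real m < s" | "0 \<le> s" "s \<le> real m" by linarith
    then show ?thesis
    proof cases
      case 1
      have "\<forall>\<^sub>F n in sequentially. H' n s = 0"
      proof -
        \<comment> \<open>The grid interval of index 0 extends to the left of 0 in order to catch
          the mass at time 0. A negative \<open>s\<close> leaves it only when the mesh has become
          fine enough.\<close>
        obtain n0 where n0: "1 / (- s) < 2 ^ n0" using real_arch_pow[of 2 "1 / (- s)"] by auto
        have "H' n s = 0" if "n0 \<le> n" for n
        proof -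
          have "(2::real) ^ n0 \<le> 2 ^ n" using that by (intro power_increasing) auto
          then have "1 / (- s) < 2 ^ n" using n0 by linarith
          then have "1 < 2 ^ n * (- s)" using 1 by (subst (asm) pos_divide_less_eq) auto
          then have "2 ^ n * s < -1" by simp
          then have "\<lceil>2 ^ n * s\<rceil> < 0" by linarith
          then show ?thesis by (simp add: H'_def)
        qed
        then show ?thesis by (auto simp: eventually_sequentially)
      qed
      then show ?thesis unfolding HH' using 1 by (intro tendsto_eventually) (simp add: h_def)
    next
      case 2
      have "\<not> \<lceil>2 ^ n * s\<rceil> \<le> int (m * 2 ^ n)" for n
        using 2 by (simp add: ceiling_le_iff not_le mult.commute)
      then have "H' n s = 0" for n by (simp add: H'_def)
      then show ?thesis unfolding HH' using 2 by (simp add: h_def)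
    next
      case 3
      have "H' n s = ennreal (min (f (tau T (real_of_int (\<lceil>2 ^ n * s\<rceil> + int e) / 2 ^ n))) (real m))" for n
      proof -
        have "(-1::real) < 2 ^ n * s" using 3 by (meson less_le_trans mult_nonneg_nonneg neg_less_0_iff_less zero_less_one zero_le_numeral zero_le_power)
        then have "0 \<le> \<lceil>2 ^ n * s\<rceil>" by linarith
        moreover have "\<lceil>2 ^ n * s\<rceil> \<le> int (m * 2 ^ n)" using 3 by (simp add: ceiling_le_iff mult.commute)
        ultimately show ?thesis by (simp add: H'_def)
      qed
      moreover have "(\<lambda>n. ennreal (min (f (tau T (real_of_int (\<lceil>2 ^ n * s\<rceil> + int e) / 2 ^ n))) (real m)))
          \<longlonglongrightarrow> ennreal (min (f (tau T s)) (real m))"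
        by (intro tendsto_intros tendsto_ennrealI right_continuous_sequentially[OF f(1) 3(1)] right_grid)
      ultimately show ?thesis unfolding HH' h_def using 3 by simp
    qed
  qed
  have h_meas [measurable]: "h \<in> borel_measurable ?\<nu>"
    using lim H_meas by (rule borel_measurable_LIMSEQ_order)
  have m0: "emeasure ?\<nu> {-1<..real m} = ennreal (C (tau T (real m)))"
    using emeasure_path[OF C, of "-1" "real m"] by (simp add: extend_path_eq)
  have "(\<lambda>n. \<integral>\<^sup>+s. H n s \<partial>?\<nu>) \<longlonglongrightarrow> (\<integral>\<^sup>+s. h s \<partial>?\<nu>)"
  \<comment> \<open>The dominating function starts at -1 because of the grid interval of index 0.
    The extended path vanishes before time 0, so its mass there is just the jump at 0.\<close>
  proof (rule nn_integral_dominated_convergence[where w = "\<lambda>s. ennreal (real m) * indicator {-1<..real m} s"])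
    show "AE s in ?\<nu>. H n s \<le> ennreal (real m) * indicator {-1<..real m} s" for n
    proof (rule AE_I2)
      fix s
      show "H n s \<le> ennreal (real m) * indicator {-1<..real m} s"
      proof (cases "0 \<le> \<lceil>2 ^ n * s\<rceil> \<and> \<lceil>2 ^ n * s\<rceil> \<le> int (m * 2 ^ n)")
        case True
        then have "- 1 < 2 ^ n * s" "2 ^ n * s \<le> real m * 2 ^ n" by (auto simp: ceiling_le_iff)
        then have "s \<le> real m" by (simp add: mult.commute)
        moreover have "-1 < s"
        proof (rule ccontr)
          assume "\<not> - 1 < s"
          then have "2 ^ n * s \<le> 2 ^ n * (-1)" by (intro mult_left_mono) auto
          moreover have "(1::real) \<le> 2 ^ n" by simp
          ultimately show False using \<open>- 1 < 2 ^ n * s\<close> by linarith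
        qed
        ultimately show ?thesis unfolding HH' H'_def using True by (auto intro!: ennreal_leI)
      next
        case False
        then have "H' n s = 0" unfolding H'_def by (rule if_not_P)
        then show ?thesis by (simp add: HH')
      qed
    qed
    show "(\<integral>\<^sup>+s. ennreal (real m) * indicator {-1<..real m} s \<partial>?\<nu>) < \<infinity>"
      by (subst nn_integral_cmult_indicator) (auto simp: m0 ennreal_mult_less_top)
    show "AE s in ?\<nu>. (\<lambda>n. H n s) \<longlonglongrightarrow> h s" using lim by simp
  qed auto
  then show "(\<lambda>n. ennreal (path_sum T e n (real m) (m * 2 ^ n + 1) f C)) \<longlonglongrightarrow> path_integral T m f C"
    unfolding sum_eq path_integral_def h_def .
  have "path_integral T m f C \<le> (\<integral>\<^sup>+s. ennreal (real m) * indicator {-1<..real m} s \<partial>?\<nu>)"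
    unfolding path_integral_def by (intro nn_integral_mono) (auto simp: indicator_def intro!: ennreal_leI)
  also have "\<dots> = ennreal (real m * C (tau T (real m)))"
    using C tau_horizon[of "real m"] by (subst nn_integral_cmult_indicator) (auto simp: m0 good_path_def ennreal_mult)
  finally show "path_integral T m f C \<le> ennreal (real m * C (tau T (real m)))" .
  show "(\<lambda>s. f (tau T s) * indicator {0..} s) \<in> borel_measurable borel"
  proof (rule borel_measurable_LIMSEQ_metric)
    fix s :: real
    show "(\<lambda>n. f (tau T (real_of_int (\<lceil>2 ^ n * s\<rceil> + int 0) / 2 ^ n)) * indicator {0..} s) \<longlonglongrightarrow> f (tau T s) * indicator {0..} s"
    proof (cases "0 \<le> s")
      case True
      then show ?thesis by (intro tendsto_intros right_continuous_sequentially[OF f(1)] right_grid)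
    qed simp
  next
    fix n
    have "(\<lambda>s::real. (\<lambda>i. f (tau T (real_of_int (i + int 0) / 2 ^ n))) \<lceil>2 ^ n * s\<rceil>) \<in> borel_measurable borel"
      by (rule measurable_compose_countable) (auto)
    from borel_measurable_times[OF this borel_measurable_indicator[of "{0..}" borel]]
    show "(\<lambda>s::real. f (tau T (real_of_int (\<lceil>2 ^ n * s\<rceil> + int 0) / 2 ^ n)) * indicator {0..} s) \<in> borel_measurable borel"
      by simp
  qed
qed

lemma path_integral_mono_index: "m \<le> m' \<Longrightarrow> path_integral T m f C \<le> path_integral T m' f C"
  unfolding path_integral_def by (intro nn_integral_mono) (auto simp: indicator_def intro!: ennreal_leI)

text \<open>Monotone convergence. The extended path is constant beyond \<open>T\<close>, so its
  measure has no mass there and stopping the time changes nothing almost everywhere.\<close>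

lemma stieltjes_integral_eq_SUP:
  assumes C: "good_path T C" and f: "right_continuous_on (horizon T) f" "\<And>t. t \<in> horizon T \<Longrightarrow> 0 \<le> f t"
  shows "stieltjes_integral T f C = (SUP m. path_integral T m f C)"
proof -
  let ?\<nu> = "interval_measure (extend_path T C)"
  have AE: "AE s in ?\<nu>. s \<le> tau T s"
  proof (cases rule: tau_cases)
    case (finite T0)
    have "{T0<..T0 + real k} \<in> null_sets ?\<nu>" for k
      using emeasure_path[OF C, of T0 "T0 + real k"] finite(1) by (auto simp: extend_path_eq null_sets_def finite(3))
    then have "(\<Union>k. {T0<..T0 + real k}) \<in> null_sets ?\<nu>" by auto
    then show ?thesis
    proof (rule AE_I')
      show "{s \<in> space ?\<nu>. \<not> s \<le> tau T s} \<subseteq> (\<Union>k. {T0<..T0 + real k})"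
      proof
        fix s assume "s \<in> {s \<in> space ?\<nu>. \<not> s \<le> tau T s}"
        then have "T0 < s" using finite by (auto simp: min_def split: if_splits)
        moreover obtain k where "s - T0 \<le> real k" using real_arch_simple by blast
        ultimately show "s \<in> (\<Union>k. {T0<..T0 + real k})" by (auto intro!: exI[of _ k])
      qed
    qed
  qed auto
  have hor: "s \<in> horizon T \<longleftrightarrow> 0 \<le> s" if "s \<le> tau T s" for s
    using that tau_le[of s] tau_horizon[of s] horizon_nonneg by (cases "0 \<le> s") (auto simp: order_antisym)
  have tau_s: "tau T s = s" if "s \<le> tau T s" for s using that tau_le[of s] by simp
  let ?g = "\<lambda>m s. ennreal (min (f (tau T s) * indicator {0..} s) (real m)) * indicator {0..real m} s"
  note [measurable] = path_sum_converges(3)[OF C f]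
  have pm: "path_integral T m f C = (\<integral>\<^sup>+s. ?g m s \<partial>?\<nu>)" for m
    unfolding path_integral_def by (intro nn_integral_cong) (auto simp: indicator_def)
  have "stieltjes_integral T f C = (\<integral>\<^sup>+s. (SUP m. ?g m s) \<partial>?\<nu>)"
    unfolding stieltjes_integral_def
  proof (rule nn_integral_cong_AE)
    show "AE s in ?\<nu>. ennreal (f s) * indicator (horizon T) s = (SUP m. ?g m s)"
      using AE
    proof eventually_elim
      fix s assume s: "s \<le> tau T s"
      show "ennreal (f s) * indicator (horizon T) s = (SUP m. ?g m s)"
      proof (cases "0 \<le> s")
        case False
        then show ?thesis using hor[OF s] by (simp add: indicator_def)
      next
        case True
        then have fs: "0 \<le> f s" using f(2) hor[OF s] by simp
        have "(SUP m. ?g m s) = ennreal (f s)"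
        proof (rule antisym)
          show "(SUP m. ?g m s) \<le> ennreal (f s)"
            using True tau_s[OF s] by (intro SUP_least) (auto simp: indicator_def intro!: ennreal_leI)
          obtain m where m: "max s (f s) \<le> real m" using real_arch_simple by blast
          then have "?g m s = ennreal (f s)" using True tau_s[OF s] by simp
          moreover have "?g m s \<le> (SUP m. ?g m s)" by (rule SUP_upper) simp
          ultimately show "ennreal (f s) \<le> (SUP m. ?g m s)" by (simp only:)
        qed
        then show ?thesis using hor[OF s] True by simp
      qed
    qed
  qed
  also have "\<dots> = (SUP m. \<integral>\<^sup>+s. ?g m s \<partial>?\<nu>)"
  proof (rule nn_integral_monotone_convergence_SUP)
    show "incseq (\<lambda>m s. ?g m s)"
      by (auto simp: incseq_def le_fun_def indicator_def intro!: ennreal_leI min.mono)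
  qed measurable
  finally show ?thesis unfolding pm .
qed

end

lemma good_path_intros:
  assumes "good_path T C" "good_path T D"
  shows "good_path T (\<lambda>t. C t + D t)" "good_path T (\<lambda>t. max (C t) (D t))"
    "good_path T (\<lambda>t. min (C t) (D t))" "0 \<le> s \<Longrightarrow> good_path T (\<lambda>t. s * C t)"
    "0 \<le> s \<Longrightarrow> good_path T (\<lambda>t. min (C t) s)"
  using assms unfolding good_path_def right_continuous_on_def mono_on_def
  by (auto intro!: tendsto_intros add_mono mult_left_mono
      intro: min.coboundedI1 min.coboundedI2 max.coboundedI1 max.coboundedI2)

lemma path_sum_add:
  "path_sum T e n c J f (\<lambda>t. C t + D t) = path_sum T e n c J f C + path_sum T e n c J f D"
  unfolding path_sum_def increment_sum_def sum.distrib[symmetric]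
  by (intro sum.cong) (auto simp: algebra_simps)

lemma path_sum_scale:
  "path_sum T e n c J f (\<lambda>t. s * C t) = s * path_sum T e n c J f C"
  unfolding path_sum_def increment_sum_def sum_distrib_left
  by (intro sum.cong) (auto simp: algebra_simps)

section \<open>Monotonicity, truncation and linearity of grid sums and path integrals\<close>

context
  fixes T :: ereal
  assumes T: "0 < T"
begin

lemma grid_increment_nonneg:
  assumes "good_path T C"
  shows "0 \<le> C (tau T (real j / 2 ^ n)) - (if j = 0 then 0 else C (tau T (real (j - 1) / 2 ^ n)))"
proof -
  have "tau T (real (j - 1) / 2 ^ n) \<le> tau T (real j / 2 ^ n)"
    by (intro tau_mono[OF T] divide_right_mono) auto
  then show ?thesis
    using assms tau_horizon[OF T, of "real j / 2 ^ n"] tau_horizon[OF T, of "real (j - 1) / 2 ^ n"]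
    unfolding good_path_def mono_on_def by auto
qed

lemma path_sum_mono:
  assumes C: "good_path T C" and f: "\<And>t. t \<in> horizon T \<Longrightarrow> 0 \<le> f t"
    and "0 \<le> c" "c \<le> c'" "J \<le> J'"
  shows "0 \<le> path_sum T e n c J f C" "path_sum T e n c J f C \<le> path_sum T e n c' J' f C"
proof -
  have f': "0 \<le> f (tau T (real j / 2 ^ n))" for j using f tau_horizon[OF T] by simp
  show "0 \<le> path_sum T e n c J f C"
    unfolding path_sum_def increment_sum_def
    using f' assms(3) grid_increment_nonneg[OF C]
    by (intro sum_nonneg mult_nonneg_nonneg) (auto simp del: of_nat_add)
  have "path_sum T e n c J f C \<le> path_sum T e n c' J f C"
    unfolding path_sum_def increment_sum_def
    using f' assms(3,4) grid_increment_nonneg[OF C]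
    by (intro sum_mono mult_right_mono) (auto simp del: of_nat_add)
  also have "\<dots> \<le> path_sum T e n c' J' f C"
    unfolding path_sum_def increment_sum_def
  proof (rule sum_mono2)
    fix j assume "j \<in> {..<J'} - {..<J}"
    show "0 \<le> min (f (tau T (real (j + e) / 2 ^ n))) c' * (C (tau T (real j / 2 ^ n)) - (if j = 0 then 0 else C (tau T (real (j - 1) / 2 ^ n))))"
      using f'[of "j + e"] assms(3,4) grid_increment_nonneg[OF C] by (intro mult_nonneg_nonneg) (auto simp del: of_nat_add)
  qed (use assms(5) in auto)
  finally show "path_sum T e n c J f C \<le> path_sum T e n c' J' f C" .
qed

lemma path_sum_nonneg:
  assumes "good_path T C" "\<And>t. t \<in> horizon T \<Longrightarrow> 0 \<le> f t" "0 \<le> c"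
  shows "0 \<le> path_sum T e n c J f C"
  using path_sum_mono(1)[OF assms order_refl order_refl] .

lemma path_sum_truncated_le:
  assumes C: "good_path T C" and f: "\<And>t. t \<in> horizon T \<Longrightarrow> 0 \<le> f t" and "0 \<le> c" "0 \<le> K"
  shows "path_sum T e n c J f (\<lambda>t. min (C t) K) \<le> path_sum T e n c J f C"
  unfolding path_sum_def increment_sum_def
proof (intro sum_mono mult_left_mono)
  fix j
  show "min (C (tau T (real j / 2 ^ n))) K - (if j = 0 then 0 else min (C (tau T (real (j - 1) / 2 ^ n))) K)
      \<le> C (tau T (real j / 2 ^ n)) - (if j = 0 then 0 else C (tau T (real (j - 1) / 2 ^ n)))"
  proof -
    have "min p K - (if b then 0 else min q K) \<le> p - (if b then 0 else q)"
      if "0 \<le> p - (if b then 0 else q)" for p q :: real and b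
      using that by (auto simp: min_def split: if_splits)
    from this[OF grid_increment_nonneg[OF C]] show ?thesis .
  qed
  show "0 \<le> min (f (tau T (real (j + e) / 2 ^ n))) c"
    using f[OF tau_horizon[OF T, of "real (j + e) / 2 ^ n"]] assms(3) by simp
qed

lemma path_sum_truncated_eq:
  assumes C: "good_path T C" and le: "C (tau T (real m)) \<le> K"
  shows "path_sum T e n c (m * 2 ^ n + 1) f (\<lambda>t. min (C t) K) = path_sum T e n c (m * 2 ^ n + 1) f C"
proof -
  have "C (tau T (real j / 2 ^ n)) \<le> K" if "j < m * 2 ^ n + 1" for j
  proof -
    have "j \<le> m * 2 ^ n" using that by simp
    then have "real j \<le> real (m * 2 ^ n)" by (rule of_nat_mono)
    then have "real j / 2 ^ n \<le> real m" by (simp add: pos_divide_le_eq)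
    then have "tau T (real j / 2 ^ n) \<le> tau T (real m)" by (rule tau_mono[OF T])
    then have "C (tau T (real j / 2 ^ n)) \<le> C (tau T (real m))"
      using C tau_horizon[OF T, of "real j / 2 ^ n"] tau_horizon[OF T, of "real m"]
      unfolding good_path_def mono_on_def by auto
    then show ?thesis using le by simp
  qed
  then have eq: "min (C (tau T (real j / 2 ^ n))) K = C (tau T (real j / 2 ^ n))" if "j < m * 2 ^ n + 1" for j
    using that by (simp add: min_absorb1)
  show ?thesis unfolding path_sum_def increment_sum_def
  proof (intro sum.cong refl)
    fix j assume "j \<in> {..<m * 2 ^ n + 1}"
    then have j: "j < m * 2 ^ n + 1" "j - 1 < m * 2 ^ n + 1" by auto
    show "min (f (tau T (real (j + e) / 2 ^ n))) c * (min (C (tau T (real j / 2 ^ n))) K - (if j = 0 then 0 else min (C (tau T (real (j - 1) / 2 ^ n))) K))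
      = min (f (tau T (real (j + e) / 2 ^ n))) c * (C (tau T (real j / 2 ^ n)) - (if j = 0 then 0 else C (tau T (real (j - 1) / 2 ^ n))))"
      by (simp only: eq[OF j(1)] eq[OF j(2)])
  qed
qed

lemma path_integral_truncated_le:
  assumes C: "good_path T C" and f: "right_continuous_on (horizon T) f" "\<And>t. t \<in> horizon T \<Longrightarrow> 0 \<le> f t" and "0 \<le> K"
  shows "path_integral T m f (\<lambda>t. min (C t) K) \<le> path_integral T m f C"
  by (rule LIMSEQ_le[OF path_sum_converges(1)[OF T good_path_intros(5)[OF C C] f, of _ 0]
      path_sum_converges(1)[OF T C f, of 0]])
    (use path_sum_truncated_le[OF C f(2)] \<open>0 \<le> K\<close> in \<open>auto intro!: ennreal_leI\<close>)

lemma path_integral_truncated_eq: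
  assumes C: "good_path T C" and f: "right_continuous_on (horizon T) f" "\<And>t. t \<in> horizon T \<Longrightarrow> 0 \<le> f t"
    and le: "C (tau T (real m)) \<le> K" "0 \<le> K"
  shows "path_integral T m f (\<lambda>t. min (C t) K) = path_integral T m f C"
  using path_sum_converges(1)[OF T good_path_intros(5)[OF C C le(2)] f, of 0 m] path_sum_converges(1)[OF T C f, of 0 m]
  unfolding path_sum_truncated_eq[where f = f and e = 0 and c = "real m", OF C le(1)] by (rule LIMSEQ_unique)

lemma stieltjes_integral_add:
  assumes C: "good_path T C" and D: "good_path T D" and f: "right_continuous_on (horizon T) f" "\<And>t. t \<in> horizon T \<Longrightarrow> 0 \<le> f t"
  shows "stieltjes_integral T f (\<lambda>t. C t + D t) = stieltjes_integral T f C + stieltjes_integral T f D"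
proof -
  have "path_integral T m f (\<lambda>t. C t + D t) = path_integral T m f C + path_integral T m f D" for m
  proof (rule LIMSEQ_unique[OF path_sum_converges(1)[OF T good_path_intros(1)[OF C D] f, of 0]])
    have "(\<lambda>n. ennreal (path_sum T 0 n (real m) (m * 2 ^ n + 1) f C) + ennreal (path_sum T 0 n (real m) (m * 2 ^ n + 1) f D))
        \<longlonglongrightarrow> path_integral T m f C + path_integral T m f D"
      by (intro tendsto_add path_sum_converges(1)[OF T C f] path_sum_converges(1)[OF T D f])
    then show "(\<lambda>n. ennreal (path_sum T 0 n (real m) (m * 2 ^ n + 1) f (\<lambda>t. C t + D t))) \<longlonglongrightarrow> path_integral T m f C + path_integral T m f D"
      unfolding path_sum_add
      by (simp add: path_sum_nonneg[where f = f, OF C] path_sum_nonneg[where f = f, OF D] f(2))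
  qed
  then show ?thesis
    using stieltjes_integral_eq_SUP[OF T C f] stieltjes_integral_eq_SUP[OF T D f]
      stieltjes_integral_eq_SUP[OF T good_path_intros(1)[OF C D] f]
    by (simp add: ennreal_SUP_add incseq_def path_integral_mono_index[OF T])
qed

lemma stieltjes_integral_scale:
  assumes C: "good_path T C" and f: "right_continuous_on (horizon T) f" "\<And>t. t \<in> horizon T \<Longrightarrow> 0 \<le> f t" and s: "0 \<le> s"
  shows "stieltjes_integral T f (\<lambda>t. s * C t) = ennreal s * stieltjes_integral T f C"
proof -
  have "path_integral T m f (\<lambda>t. s * C t) = ennreal s * path_integral T m f C" for m
  proof (rule LIMSEQ_unique[OF path_sum_converges(1)[OF T good_path_intros(4)[OF C C s] f, of 0]])
    have "(\<lambda>n. ennreal s * ennreal (path_sum T 0 n (real m) (m * 2 ^ n + 1) f C)) \<longlonglongrightarrow> ennreal s * path_integral T m f C"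
      by (intro ennreal_tendsto_cmult path_sum_converges(1)[OF T C f]) simp
    then show "(\<lambda>n. ennreal (path_sum T 0 n (real m) (m * 2 ^ n + 1) f (\<lambda>t. s * C t))) \<longlonglongrightarrow> ennreal s * path_integral T m f C"
      unfolding path_sum_scale using s by (simp add: ennreal_mult path_sum_nonneg[where f = f, OF C] f(2))
  qed
  then show ?thesis
    using stieltjes_integral_eq_SUP[OF T C f] stieltjes_integral_eq_SUP[OF T good_path_intros(4)[OF C C s] f]
    by (simp add: SUP_mult_left_ennreal)
qed

end

text \<open>A price whose regularity holds for every \<omega>. \<open>super\<close> is the
  supermartingale property of the capped price, tested against bounded nonnegative variables known
  at time \<open>s\<close>. The cap keeps all expectations finite.\<close>

locale price = prob_space M for M :: "'a measure" +
  fixes F :: "real \<Rightarrow> 'a measure" and T :: ereal and \<psi> :: "'a \<Rightarrow> real \<Rightarrow> real"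
  assumes T: "0 < T"
    and filt: "filtration_on M F T"
    and adapt: "adapted F T \<psi>"
    and rc: "\<And>\<omega>. \<omega> \<in> space M \<Longrightarrow> right_continuous_on (horizon T) (\<psi> \<omega>)"
    and pos: "\<And>\<omega> t. \<omega> \<in> space M \<Longrightarrow> t \<in> horizon T \<Longrightarrow> 0 < \<psi> \<omega> t"
    and super: "\<And>s t c Z k. s \<in> horizon T \<Longrightarrow> t \<in> horizon T \<Longrightarrow> s \<le> t \<Longrightarrow> Z \<in> borel_measurable (F s) \<Longrightarrow>
        (\<And>\<omega>. \<omega> \<in> space M \<Longrightarrow> 0 \<le> Z \<omega> \<and> Z \<omega> \<le> k) \<Longrightarrow> 0 \<le> c \<Longrightarrow>
        (\<integral>\<omega>. min (\<psi> \<omega> t) c * Z \<omega> \<partial>M) \<le> (\<integral>\<omega>. min (\<psi> \<omega> s) c * Z \<omega> \<partial>M)"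
begin

lemma measurable_F:
  assumes "f \<in> borel_measurable (F t)" "t \<in> horizon T" shows "f \<in> borel_measurable M"
proof (rule measurable_from_subalg)
  show "subalgebra M (F t)" using filt assms(2) by (auto simp: filtration_on_def)
qed fact

lemma measurable_F_mono:
  assumes "f \<in> borel_measurable (F s)" "s \<in> horizon T" "t \<in> horizon T" "s \<le> t"
  shows "f \<in> borel_measurable (F t)"
proof (rule measurable_from_subalg)
  show "subalgebra (F t) (F s)" using filt assms by (auto simp: filtration_on_def subalgebra_def)
qed fact

lemma grid_horizon: "tau T (real j / 2 ^ n) \<in> horizon T"
  by (rule tau_horizon[OF T]) simp

lemma grid_mono: "i \<le> j \<Longrightarrow> tau T (real i / 2 ^ n) \<le> tau T (real j / 2 ^ n)"
  by (intro tau_mono[OF T] divide_right_mono) auto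

lemma psi_measurable: "t \<in> horizon T \<Longrightarrow> (\<lambda>\<omega>. \<psi> \<omega> t) \<in> borel_measurable M"
  using adapt measurable_F by (auto simp: adapted_def)

lemma bounded_integrable:
  assumes "Z \<in> borel_measurable M" "\<And>\<omega>. \<omega> \<in> space M \<Longrightarrow> \<bar>Z \<omega>\<bar> \<le> k" "t \<in> horizon T" "0 \<le> c"
  shows "integrable M (\<lambda>\<omega>. min (\<psi> \<omega> t) c * Z \<omega>)"
proof (rule integrable_const_bound[where B = "c * k"])
  show "AE \<omega> in M. norm (min (\<psi> \<omega> t) c * Z \<omega>) \<le> c * k"
  proof (rule AE_I2)
    fix \<omega> assume "\<omega> \<in> space M"
    then have "\<bar>min (\<psi> \<omega> t) c\<bar> \<le> c" "\<bar>Z \<omega>\<bar> \<le> k" using assms(2,4) pos[OF _ assms(3), of \<omega>] by auto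
    then show "norm (min (\<psi> \<omega> t) c * Z \<omega>) \<le> c * k"
      unfolding real_norm_def abs_mult using assms(4) by (intro mult_mono) auto
  qed
  show "(\<lambda>\<omega>. min (\<psi> \<omega> t) c * Z \<omega>) \<in> borel_measurable M"
    using assms(1) psi_measurable[OF assms(3)] by measurable
qed

abbreviation \<phi> where "\<phi> n c j \<omega> \<equiv> min (\<psi> \<omega> (tau T (real j / 2 ^ n))) c"

lemma increment_sum_integrable:
  assumes z: "\<And>j. z j \<in> borel_measurable M" "\<And>j \<omega>. \<omega> \<in> space M \<Longrightarrow> \<bar>z j \<omega>\<bar> \<le> k" and "0 \<le> c" "0 \<le> k"
  shows "integrable M (\<lambda>\<omega>. increment_sum (\<lambda>j. \<phi> n c (e j) \<omega>) (\<lambda>j. z j \<omega>) J)"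
  unfolding increment_sum_def
proof (intro Bochner_Integration.integrable_sum bounded_integrable grid_horizon)
  fix j
  show "(\<lambda>\<omega>. z j \<omega> - (if j = 0 then 0 else z (j - 1) \<omega>)) \<in> borel_measurable M"
    using z(1) by (cases j) auto
  show "\<bar>z j \<omega> - (if j = 0 then 0 else z (j - 1) \<omega>)\<bar> \<le> 2 * k" if "\<omega> \<in> space M" for \<omega>
    using z(2)[OF that, of j] z(2)[OF that, of "j - 1"] assms(4) by auto
qed (use \<open>0 \<le> c\<close> in auto)

text \<open>
  Summation by parts: \<open>\<Sum> \<phi>\<^sub>j (y\<^sub>j - y\<^sub>j\<^sub>-\<^sub>1)\<close> puts the weight \<open>\<phi>\<^sub>j - \<phi>\<^sub>j\<^sub>+\<^sub>1\<close> on \<open>y\<^sub>j\<close>, which is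
  nonnegative in conditional expectation.
\<close>

lemma supermartingale_sum:
  assumes y: "\<And>j. y j \<in> borel_measurable (F (tau T (real j / 2 ^ n)))"
      "\<And>j \<omega>. \<omega> \<in> space M \<Longrightarrow> 0 \<le> y j \<omega> \<and> y j \<omega> \<le> k" and "0 \<le> c"
  shows "(\<integral>\<omega>. \<phi> n c J \<omega> * y J \<omega> \<partial>M) \<le> (\<integral>\<omega>. increment_sum (\<lambda>j. \<phi> n c j \<omega>) (\<lambda>j. y j \<omega>) (Suc J) \<partial>M)"
proof (induction J)
  case 0
  then show ?case by (simp add: increment_sum_def)
next
  case (Suc J)
  have yM: "y j \<in> borel_measurable M" for j using measurable_F[OF y(1) grid_horizon] .
  have k: "0 \<le> k" using y(2) not_empty by fastforce
  have ab: "\<bar>y j \<omega>\<bar> \<le> k" if "\<omega> \<in> space M" for j \<omega> using y(2)[OF that, of j] by auto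
  have i: "integrable M (\<lambda>\<omega>. \<phi> n c j \<omega> * y i \<omega>)" for i j
    by (rule bounded_integrable[OF yM ab grid_horizon \<open>0 \<le> c\<close>])
  have s: "integrable M (\<lambda>\<omega>. increment_sum (\<lambda>j. \<phi> n c j \<omega>) (\<lambda>j. y j \<omega>) (Suc J))"
    by (rule increment_sum_integrable[OF yM ab \<open>0 \<le> c\<close> k])
  have e: "increment_sum (\<lambda>j. \<phi> n c j \<omega>) (\<lambda>j. y j \<omega>) (Suc (Suc J)) =
     increment_sum (\<lambda>j. \<phi> n c j \<omega>) (\<lambda>j. y j \<omega>) (Suc J) + (\<phi> n c (Suc J) \<omega> * y (Suc J) \<omega> - \<phi> n c (Suc J) \<omega> * y J \<omega>)" for \<omega>
    by (subst increment_sum_Suc) (simp add: right_diff_distrib)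
  have "(\<integral>\<omega>. \<phi> n c (Suc J) \<omega> * y J \<omega> \<partial>M) \<le> (\<integral>\<omega>. \<phi> n c J \<omega> * y J \<omega> \<partial>M)"
    using y \<open>0 \<le> c\<close> by (intro super[where k = k] grid_horizon grid_mono) auto
  moreover have "(\<integral>\<omega>. increment_sum (\<lambda>j. \<phi> n c j \<omega>) (\<lambda>j. y j \<omega>) (Suc (Suc J)) \<partial>M)
    = (\<integral>\<omega>. increment_sum (\<lambda>j. \<phi> n c j \<omega>) (\<lambda>j. y j \<omega>) (Suc J) \<partial>M)
      + ((\<integral>\<omega>. \<phi> n c (Suc J) \<omega> * y (Suc J) \<omega> \<partial>M) - (\<integral>\<omega>. \<phi> n c (Suc J) \<omega> * y J \<omega> \<partial>M))"
    unfolding e by (simp add: i s del: of_nat_Suc)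
  ultimately show ?case using Suc by linarith
qed

lemma increment_sum_mono:
  assumes z: "\<And>j. z j \<in> borel_measurable (F (tau T (real j / 2 ^ n)))" "\<And>j \<omega>. \<omega> \<in> space M \<Longrightarrow> \<bar>z j \<omega>\<bar> \<le> k"
    and z': "\<And>j. z' j \<in> borel_measurable (F (tau T (real j / 2 ^ n)))" "\<And>j \<omega>. \<omega> \<in> space M \<Longrightarrow> \<bar>z' j \<omega>\<bar> \<le> k"
    and le: "\<And>j \<omega>. \<omega> \<in> space M \<Longrightarrow> z j \<omega> \<le> z' j \<omega>" and "0 \<le> c"
  shows "(\<integral>\<omega>. increment_sum (\<lambda>j. \<phi> n c j \<omega>) (\<lambda>j. z j \<omega>) J \<partial>M) \<le> (\<integral>\<omega>. increment_sum (\<lambda>j. \<phi> n c j \<omega>) (\<lambda>j. z' j \<omega>) J \<partial>M)"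
proof (cases J)
  case 0
  then show ?thesis by (simp add: increment_sum_def)
next
  case (Suc J')
  have k: "0 \<le> k" using z(2) not_empty by fastforce
  let ?y = "\<lambda>j \<omega>. z' j \<omega> - z j \<omega>"
  have y: "?y j \<in> borel_measurable (F (tau T (real j / 2 ^ n)))" for j using z(1) z'(1) by simp
  have yk: "0 \<le> ?y j \<omega> \<and> ?y j \<omega> \<le> 2 * k" if "\<omega> \<in> space M" for j \<omega>
    using z(2)[OF that, of j] z'(2)[OF that, of j] le[OF that, of j] by auto
  have "0 \<le> (\<integral>\<omega>. \<phi> n c J' \<omega> * ?y J' \<omega> \<partial>M)"
    using yk pos[OF _ grid_horizon] \<open>0 \<le> c\<close> by (intro Bochner_Integration.integral_nonneg mult_nonneg_nonneg) (auto simp: less_imp_le)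
  also have "\<dots> \<le> (\<integral>\<omega>. increment_sum (\<lambda>j. \<phi> n c j \<omega>) (\<lambda>j. ?y j \<omega>) J \<partial>M)"
    unfolding Suc by (rule supermartingale_sum[OF y yk \<open>0 \<le> c\<close>])
  also have "\<dots> = (\<integral>\<omega>. increment_sum (\<lambda>j. \<phi> n c j \<omega>) (\<lambda>j. z' j \<omega>) J - increment_sum (\<lambda>j. \<phi> n c j \<omega>) (\<lambda>j. z j \<omega>) J \<partial>M)"
    unfolding increment_sum_def sum_subtractf[symmetric]
    by (intro Bochner_Integration.integral_cong refl sum.cong) (auto simp: algebra_simps)
  also have "\<dots> = (\<integral>\<omega>. increment_sum (\<lambda>j. \<phi> n c j \<omega>) (\<lambda>j. z' j \<omega>) J \<partial>M) - (\<integral>\<omega>. increment_sum (\<lambda>j. \<phi> n c j \<omega>) (\<lambda>j. z j \<omega>) J \<partial>M)"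
    using z'(1)[THEN measurable_F, OF grid_horizon] z(1)[THEN measurable_F, OF grid_horizon]
    by (intro Bochner_Integration.integral_diff increment_sum_integrable[where k = k]) (use z(2) z'(2) \<open>0 \<le> c\<close> k in auto)
  finally show ?thesis by simp
qed

definition contrib :: "('a \<Rightarrow> real \<Rightarrow> real) \<Rightarrow> bool" where
  "contrib C \<longleftrightarrow> adapted F T C \<and> (\<forall>\<omega>\<in>space M. \<forall>t\<in>horizon T. 0 \<le> C \<omega> t) \<and> (AE \<omega> in M. good_path T (C \<omega>))"

lemma contribD:
  assumes "contrib C"
  shows "AE \<omega> in M. good_path T (C \<omega>)" "\<And>\<omega> t. \<omega> \<in> space M \<Longrightarrow> t \<in> horizon T \<Longrightarrow> 0 \<le> C \<omega> t"
    "\<And>t. t \<in> horizon T \<Longrightarrow> (\<lambda>\<omega>. C \<omega> t) \<in> borel_measurable (F t)"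
  using assms by (auto simp: contrib_def adapted_def)

lemma contrib_measurable: "contrib C \<Longrightarrow> t \<in> horizon T \<Longrightarrow> (\<lambda>\<omega>. C \<omega> t) \<in> borel_measurable M"
  using contribD(3) measurable_F by blast

lemma path_sum_measurable:
  assumes "contrib C"
  shows "(\<lambda>\<omega>. path_sum T e n c J (\<psi> \<omega>) (C \<omega>)) \<in> borel_measurable M"
proof -
  have m [measurable]: "(\<lambda>\<omega>. C \<omega> (tau T (real j / 2 ^ n))) \<in> borel_measurable M"
    and [measurable]: "(\<lambda>\<omega>. \<psi> \<omega> (tau T (real j / 2 ^ n))) \<in> borel_measurable M" for j
    using contrib_measurable[OF assms grid_horizon] psi_measurable[OF grid_horizon] by auto
  have "(\<lambda>\<omega>. if j = 0 then 0 else C \<omega> (tau T (real (j - 1) / 2 ^ n))) \<in> borel_measurable M" for j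
  proof (cases "j = 0")
    case False
    then show ?thesis using m[of "j - 1"] by (simp only: if_False)
  qed simp
  then show ?thesis unfolding path_sum_def increment_sum_def by measurable
qed

lemma contrib_truncate: "contrib C \<Longrightarrow> 0 \<le> K \<Longrightarrow> contrib (\<lambda>\<omega> t. min (C \<omega> t) K)"
  unfolding contrib_def adapted_def by (auto elim!: eventually_mono intro: good_path_intros)

text \<open>Paths are good only almost surely, so nothing is known about measurability of the path
  integral itself. The upper limit of the grid sums is a measurable version.\<close>

lemma path_integral_measurable:
  assumes "contrib C"
  obtains g where "g \<in> borel_measurable M" "AE \<omega> in M. path_integral T m (\<psi> \<omega>) (C \<omega>) = g \<omega>"
    "AE \<omega> in M. (\<lambda>n. ennreal (path_sum T e n (real m) (m * 2 ^ n + 1) (\<psi> \<omega>) (C \<omega>))) \<longlonglongrightarrow> g \<omega>"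
proof -
  let ?g = "\<lambda>\<omega>. limsup (\<lambda>n. ennreal (path_sum T e n (real m) (m * 2 ^ n + 1) (\<psi> \<omega>) (C \<omega>)))"
  note [measurable] = path_sum_measurable[OF assms]
  have *: "AE \<omega> in M. (\<lambda>n. ennreal (path_sum T e n (real m) (m * 2 ^ n + 1) (\<psi> \<omega>) (C \<omega>))) \<longlonglongrightarrow> path_integral T m (\<psi> \<omega>) (C \<omega>)"
    using contribD(1)[OF assms] AE_space
    by eventually_elim (intro path_sum_converges(1)[OF T _ rc], auto simp: pos less_imp_le)
  then have eq: "AE \<omega> in M. path_integral T m (\<psi> \<omega>) (C \<omega>) = ?g \<omega>"
    by eventually_elim (simp add: lim_imp_Limsup)
  from * eq have "AE \<omega> in M. (\<lambda>n. ennreal (path_sum T e n (real m) (m * 2 ^ n + 1) (\<psi> \<omega>) (C \<omega>))) \<longlonglongrightarrow> ?g \<omega>"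
    by eventually_elim simp
  then show ?thesis using eq by (intro that[of ?g]) auto
qed

lemma AE_stieltjes:
  assumes "contrib C"
  shows "AE \<omega> in M. stieltjes_integral T (\<psi> \<omega>) (C \<omega>) = (SUP m. path_integral T m (\<psi> \<omega>) (C \<omega>))"
  using contribD(1)[OF assms] AE_space
  by eventually_elim (intro stieltjes_integral_eq_SUP[OF T _ rc], auto simp: pos less_imp_le)

lemma stieltjes_measurable:
  assumes "contrib C"
  obtains g where "g \<in> borel_measurable M" "AE \<omega> in M. stieltjes_integral T (\<psi> \<omega>) (C \<omega>) = g \<omega>"
proof -
  have "\<exists>g. g \<in> borel_measurable M \<and> (AE \<omega> in M. path_integral T m (\<psi> \<omega>) (C \<omega>) = g \<omega>)" for m
    using path_integral_measurable[OF assms] by metis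
  then obtain g where g: "\<And>m. g m \<in> borel_measurable M" "\<And>m. AE \<omega> in M. path_integral T m (\<psi> \<omega>) (C \<omega>) = g m \<omega>" by metis
  have "AE \<omega> in M. \<forall>m. path_integral T m (\<psi> \<omega>) (C \<omega>) = g m \<omega>" using g(2) by (simp add: AE_all_countable)
  then have "AE \<omega> in M. stieltjes_integral T (\<psi> \<omega>) (C \<omega>) = (SUP m. g m \<omega>)"
    using AE_stieltjes[OF assms] by eventually_elim simp
  then show ?thesis using g(1) by (intro that[of "\<lambda>\<omega>. SUP m. g m \<omega>"]) auto
qed

abbreviation cost where "cost C \<equiv> contribution_cost M T \<psi> C"

lemma cost_add:
  assumes C: "contrib C" and D: "contrib D"
  shows "cost (\<lambda>\<omega> t. C \<omega> t + D \<omega> t) = cost C + cost D"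
proof -
  obtain g where g: "g \<in> borel_measurable M" "AE \<omega> in M. stieltjes_integral T (\<psi> \<omega>) (C \<omega>) = g \<omega>"
    using stieltjes_measurable[OF C] .
  obtain g' where g': "g' \<in> borel_measurable M" "AE \<omega> in M. stieltjes_integral T (\<psi> \<omega>) (D \<omega>) = g' \<omega>"
    using stieltjes_measurable[OF D] .
  have "cost (\<lambda>\<omega> t. C \<omega> t + D \<omega> t) = (\<integral>\<^sup>+\<omega>. g \<omega> + g' \<omega> \<partial>M)"
    unfolding contribution_cost_def
  proof (rule nn_integral_cong_AE)
    show "AE \<omega> in M. stieltjes_integral T (\<psi> \<omega>) (\<lambda>t. C \<omega> t + D \<omega> t) = g \<omega> + g' \<omega>"
      using contribD(1)[OF C] contribD(1)[OF D] g(2) g'(2) AE_space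
    proof eventually_elim
      case (elim \<omega>)
      then show ?case
        using stieltjes_integral_add[OF T elim(1,2) rc[OF elim(5)]] pos[OF elim(5)] by (simp add: less_imp_le)
    qed
  qed
  also have "\<dots> = cost C + cost D"
    unfolding contribution_cost_def nn_integral_cong_AE[OF g(2)] nn_integral_cong_AE[OF g'(2)]
    using g(1) g'(1) by (rule nn_integral_add)
  finally show ?thesis .
qed

lemma cost_scale:
  assumes C: "contrib C" and s: "0 \<le> s"
  shows "cost (\<lambda>\<omega> t. s * C \<omega> t) = ennreal s * cost C"
proof -
  obtain g where g: "g \<in> borel_measurable M" "AE \<omega> in M. stieltjes_integral T (\<psi> \<omega>) (C \<omega>) = g \<omega>"
    using stieltjes_measurable[OF C] .
  have "cost (\<lambda>\<omega> t. s * C \<omega> t) = (\<integral>\<^sup>+\<omega>. ennreal s * g \<omega> \<partial>M)"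
    unfolding contribution_cost_def
  proof (rule nn_integral_cong_AE)
    show "AE \<omega> in M. stieltjes_integral T (\<psi> \<omega>) (\<lambda>t. s * C \<omega> t) = ennreal s * g \<omega>"
      using contribD(1)[OF C] g(2) AE_space
    proof eventually_elim
      case (elim \<omega>)
      then show ?case
        using stieltjes_integral_scale[OF T elim(1) rc[OF elim(3)] _ s] pos[OF elim(3)] by (simp add: less_imp_le)
    qed
  qed
  also have "\<dots> = ennreal s * cost C"
    unfolding contribution_cost_def nn_integral_cong_AE[OF g(2)] using g(1) by (rule nn_integral_cmult)
  finally show ?thesis .
qed

end

text \<open>Holding the path at the last even index makes the odd increments vanish. This rewrites a
  sum on a coarse grid as a sum on the refined grid.\<close>

lemma increment_sum_even:
  "increment_sum \<phi> (\<lambda>i. z (2 * (i div 2))) (2 * J + 1) = increment_sum (\<lambda>j. \<phi> (2 * j)) (\<lambda>j. z (2 * j)) (J + 1)"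
proof (induction J)
  case (Suc J)
  have "increment_sum \<phi> (\<lambda>i. z (2 * (i div 2))) (2 * Suc J + 1)
      = increment_sum \<phi> (\<lambda>i. z (2 * (i div 2))) (Suc (Suc (2 * J + 1)))" by simp
  also have "\<dots> = increment_sum (\<lambda>j. \<phi> (2 * j)) (\<lambda>j. z (2 * j)) (J + 1) + \<phi> (2 * Suc J) * (z (2 * Suc J) - z (2 * J))"
    unfolding increment_sum_Suc Suc by simp
  finally show ?case by (simp add: increment_sum_Suc)
qed (simp add: increment_sum_def)

lemma increment_sum_shift:
  "increment_sum \<phi> (\<lambda>i. if i = 0 then 0 else z (i - 1)) (Suc J) = increment_sum (\<lambda>j. \<phi> (j + 1)) z J"
  unfolding increment_sum_def by (subst sum.lessThan_Suc_shift) (auto intro!: sum.cong)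

lemma increment_sum_telescope:
  fixes J :: nat
  shows "(\<Sum>j<J. z j - (if j = 0 then 0 else z (j - 1) :: real)) = (if J = 0 then 0 else z (J - 1))"
  by (induction J) auto

text \<open>About \<open>q\<close> only an eventual lower bound is known; capping at
  \<open>z\<close> from above turns it into convergence.\<close>

lemma tendsto_min_eventually_ge:
  fixes z p m :: real
  assumes "\<And>\<delta>. 0 < \<delta> \<Longrightarrow> \<forall>\<^sub>F k in F. p - \<delta> \<le> q k" "z \<le> p" "z \<le> m"
  shows "((\<lambda>k. min z (min (q k) m)) \<longlongrightarrow> z) F"
proof (rule tendstoI)
  fix \<delta> :: real assume \<delta>: "0 < \<delta>"
  have "\<forall>\<^sub>F k in F. p - \<delta> / 2 \<le> q k" using assms(1)[of "\<delta> / 2"] \<delta> by simp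
  then show "\<forall>\<^sub>F k in F. dist (min z (min (q k) m)) z < \<delta>"
    by eventually_elim (use assms(2,3) \<delta> in \<open>auto simp: dist_real_def min_def\<close>)
qed

section \<open>Expected cost: dyadic approximation, monotonicity and lower semicontinuity\<close>

context price
begin

lemma increment_sum_mono_AE:
  assumes z: "\<And>j. z j \<in> borel_measurable (F (tau T (real j / 2 ^ n)))" "\<And>j \<omega>. \<omega> \<in> space M \<Longrightarrow> \<bar>z j \<omega>\<bar> \<le> k"
    and z': "\<And>j. z' j \<in> borel_measurable (F (tau T (real j / 2 ^ n)))" "\<And>j \<omega>. \<omega> \<in> space M \<Longrightarrow> \<bar>z' j \<omega>\<bar> \<le> k"
    and le: "AE \<omega> in M. \<forall>j. z j \<omega> \<le> z' j \<omega>" and "0 \<le> c"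
  shows "(\<integral>\<omega>. increment_sum (\<lambda>j. \<phi> n c j \<omega>) (\<lambda>j. z j \<omega>) J \<partial>M) \<le> (\<integral>\<omega>. increment_sum (\<lambda>j. \<phi> n c j \<omega>) (\<lambda>j. z' j \<omega>) J \<partial>M)"
proof -
  \<comment> \<open>Replacing \<open>z'\<close> by the maximum makes the comparison hold for every
    \<omega>. It stays adapted and differs from \<open>z'\<close> only on a null set.\<close>
  let ?m = "\<lambda>j \<omega>. max (z j \<omega>) (z' j \<omega>)"
  have k: "0 \<le> k" using z(2) not_empty by fastforce
  have m: "?m j \<in> borel_measurable (F (tau T (real j / 2 ^ n)))" for j using z(1) z'(1) by measurable
  have mk: "\<bar>?m j \<omega>\<bar> \<le> k" if "\<omega> \<in> space M" for j \<omega> using z(2)[OF that, of j] z'(2)[OF that, of j] by auto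
  note zM = z'(1)[THEN measurable_F, OF grid_horizon] m[THEN measurable_F, OF grid_horizon]
  have "(\<integral>\<omega>. increment_sum (\<lambda>j. \<phi> n c j \<omega>) (\<lambda>j. z j \<omega>) J \<partial>M) \<le> (\<integral>\<omega>. increment_sum (\<lambda>j. \<phi> n c j \<omega>) (\<lambda>j. ?m j \<omega>) J \<partial>M)"
    by (rule increment_sum_mono[OF z m mk _ \<open>0 \<le> c\<close>]) auto
  also have "\<dots> = (\<integral>\<omega>. increment_sum (\<lambda>j. \<phi> n c j \<omega>) (\<lambda>j. z' j \<omega>) J \<partial>M)"
  proof (rule integral_cong_AE)
    show "(\<lambda>\<omega>. increment_sum (\<lambda>j. \<phi> n c j \<omega>) (\<lambda>j. ?m j \<omega>) J) \<in> borel_measurable M"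
      using increment_sum_integrable[OF zM(2) mk \<open>0 \<le> c\<close> k, where e = "\<lambda>j. j"] by auto
    show "(\<lambda>\<omega>. increment_sum (\<lambda>j. \<phi> n c j \<omega>) (\<lambda>j. z' j \<omega>) J) \<in> borel_measurable M"
      using increment_sum_integrable[OF zM(1) z'(2) \<open>0 \<le> c\<close> k, where e = "\<lambda>j. j"] by auto
    show "AE \<omega> in M. increment_sum (\<lambda>j. \<phi> n c j \<omega>) (\<lambda>j. ?m j \<omega>) J = increment_sum (\<lambda>j. \<phi> n c j \<omega>) (\<lambda>j. z' j \<omega>) J"
      using le by eventually_elim (simp add: max_absorb2)
  qed
  finally show ?thesis .
qed

context
  fixes C :: "'a \<Rightarrow> real \<Rightarrow> real" and K :: real
  assumes C: "contrib C" and K: "0 \<le> K"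
begin

abbreviation Z where "Z \<omega> t \<equiv> min (C \<omega> t) K"

lemma Z_contrib: "contrib Z"
  using contrib_truncate[OF C K] .

lemma Z_bounded: "\<omega> \<in> space M \<Longrightarrow> \<bar>Z \<omega> (tau T (real j / 2 ^ n))\<bar> \<le> K"
  using contribD(2)[OF C _ grid_horizon, of \<omega>] K by (auto simp: min_def)

lemma Z_F: "(\<lambda>\<omega>. Z \<omega> (tau T (real j / 2 ^ n))) \<in> borel_measurable (F (tau T (real j / 2 ^ n)))"
  using contribD(3)[OF Z_contrib grid_horizon] .

lemma Z_sum_integrable:
  assumes "0 \<le> c" shows "integrable M (\<lambda>\<omega>. path_sum T e n c J (\<psi> \<omega>) (Z \<omega>))"
  unfolding path_sum_def
  using increment_sum_integrable[where e = "\<lambda>j. j + e", OF measurable_F[OF Z_F grid_horizon] Z_bounded assms K] .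

lemma Z_sum_AE:
  assumes "0 \<le> c"
  shows "AE \<omega> in M. 0 \<le> path_sum T e n c J (\<psi> \<omega>) (Z \<omega>) \<and> path_sum T e n c J (\<psi> \<omega>) (Z \<omega>) \<le> c * K"
  using contribD(1)[OF Z_contrib] AE_space
proof eventually_elim
  case (elim \<omega>)
  have p: "\<And>t. t \<in> horizon T \<Longrightarrow> 0 \<le> \<psi> \<omega> t" using pos[OF elim(2)] by (simp add: less_imp_le)
  have "path_sum T e n c J (\<psi> \<omega>) (Z \<omega>)
      \<le> (\<Sum>j<J. c * (Z \<omega> (tau T (real j / 2 ^ n)) - (if j = 0 then 0 else Z \<omega> (tau T (real (j - 1) / 2 ^ n)))))"
    unfolding path_sum_def increment_sum_def
    by (intro sum_mono mult_right_mono grid_increment_nonneg[OF T elim(1)]) auto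
  also have "\<dots> = c * (if J = 0 then 0 else Z \<omega> (tau T (real (J - 1) / 2 ^ n)))"
    unfolding sum_distrib_left[symmetric] increment_sum_telescope[of "\<lambda>j. Z \<omega> (tau T (real j / 2 ^ n))"] ..
  also have "\<dots> \<le> c * K" using Z_bounded[OF elim(2), of "J - 1" n] K assms by (intro mult_left_mono) auto
  finally show ?case using path_sum_nonneg[OF T elim(1) p assms] by simp
qed

lemma Z_sum_nn:
  assumes "0 \<le> c"
  shows "(\<integral>\<^sup>+\<omega>. ennreal (path_sum T e n c J (\<psi> \<omega>) (Z \<omega>)) \<partial>M) = ennreal (\<integral>\<omega>. path_sum T e n c J (\<psi> \<omega>) (Z \<omega>) \<partial>M)"
  using Z_sum_AE[OF assms] by (intro nn_integral_eq_integral Z_sum_integrable assms) (auto elim!: eventually_mono)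

text \<open>The coarse sum is the fine sum of the path held at the last coarse grid time, and
  holding a nondecreasing path back lowers its cost in mean.\<close>

lemma path_sum_refine:
  assumes "0 \<le> c"
  shows "(\<integral>\<omega>. path_sum T 0 n c (m * 2 ^ n + 1) (\<psi> \<omega>) (Z \<omega>) \<partial>M)
    \<le> (\<integral>\<omega>. path_sum T 0 (Suc n) c (m * 2 ^ Suc n + 1) (\<psi> \<omega>) (Z \<omega>) \<partial>M)"
proof -
  let ?z = "\<lambda>j \<omega>. Z \<omega> (tau T (real j / 2 ^ Suc n))"
  let ?y = "\<lambda>i. ?z (2 * (i div 2))"
  have e: "real (2 * j) / 2 ^ Suc n = real j / 2 ^ n" for j by simp
  have "path_sum T 0 n c (m * 2 ^ n + 1) (\<psi> \<omega>) (Z \<omega>)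
      = increment_sum (\<lambda>j. \<phi> (Suc n) c j \<omega>) (\<lambda>i. ?y i \<omega>) (m * 2 ^ Suc n + 1)" for \<omega>
  proof -
    have J: "m * 2 ^ Suc n + 1 = 2 * (m * 2 ^ n) + 1" by simp
    have "increment_sum (\<lambda>j. \<phi> n c j \<omega>) (\<lambda>j. Z \<omega> (tau T (real j / 2 ^ n))) (m * 2 ^ n + 1)
      = increment_sum (\<lambda>j. \<phi> (Suc n) c (2 * j) \<omega>) (\<lambda>j. ?z (2 * j) \<omega>) (m * 2 ^ n + 1)" unfolding e ..
    also have "\<dots> = increment_sum (\<lambda>j. \<phi> (Suc n) c j \<omega>) (\<lambda>i. ?y i \<omega>) (2 * (m * 2 ^ n) + 1)"
      by (rule increment_sum_even[symmetric])
    finally show ?thesis unfolding path_sum_def add_0_right J .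
  qed
  then have "(\<integral>\<omega>. path_sum T 0 n c (m * 2 ^ n + 1) (\<psi> \<omega>) (Z \<omega>) \<partial>M)
      = (\<integral>\<omega>. increment_sum (\<lambda>j. \<phi> (Suc n) c j \<omega>) (\<lambda>i. ?y i \<omega>) (m * 2 ^ Suc n + 1) \<partial>M)" by simp
  also have "\<dots> \<le> (\<integral>\<omega>. increment_sum (\<lambda>j. \<phi> (Suc n) c j \<omega>) (\<lambda>i. ?z i \<omega>) (m * 2 ^ Suc n + 1) \<partial>M)"
  proof (rule increment_sum_mono_AE[OF _ _ Z_F Z_bounded _ assms])
    show "\<bar>?y j \<omega>\<bar> \<le> K" if "\<omega> \<in> space M" for j \<omega> by (rule Z_bounded[OF that])
    show "?y j \<in> borel_measurable (F (tau T (real j / 2 ^ Suc n)))" for j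
      by (rule measurable_F_mono[OF Z_F grid_horizon grid_horizon grid_mono]) simp
    show "AE \<omega> in M. \<forall>j. ?y j \<omega> \<le> ?z j \<omega>"
      using contribD(1)[OF Z_contrib]
    proof (eventually_elim, intro allI)
      fix \<omega> j assume "good_path T (Z \<omega>)"
      moreover have "tau T (real (2 * (j div 2)) / 2 ^ Suc n) \<le> tau T (real j / 2 ^ Suc n)" by (rule grid_mono) simp
      ultimately show "?y j \<omega> \<le> ?z j \<omega>"
        using grid_horizon[of "2 * (j div 2)" "Suc n"] grid_horizon[of j "Suc n"]
        unfolding good_path_def mono_on_def by blast
    qed
  qed
  also have "\<dots> = (\<integral>\<omega>. path_sum T 0 (Suc n) c (m * 2 ^ Suc n + 1) (\<psi> \<omega>) (Z \<omega>) \<partial>M)"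
    by (simp add: path_sum_def)
  finally show ?thesis .
qed

text \<open>The means increase under refinement, so each of them lies below their limit. Dominated
  convergence identifies this limit with the mean of a truncated path integral.\<close>

lemma path_sum_le_cost_dyadic:
  "ennreal (\<integral>\<omega>. path_sum T 0 n (real m) (m * 2 ^ n + 1) (\<psi> \<omega>) (Z \<omega>) \<partial>M) \<le> cost C"
proof -
  define a where "a k = (\<integral>\<omega>. path_sum T 0 k (real m) (m * 2 ^ k + 1) (\<psi> \<omega>) (Z \<omega>) \<partial>M)" for k
  have "incseq a" unfolding a_def using path_sum_refine[of "real m"] by (intro incseq_SucI) auto
  obtain g where g: "g \<in> borel_measurable M" "AE \<omega> in M. path_integral T m (\<psi> \<omega>) (Z \<omega>) = g \<omega>"
    "AE \<omega> in M. (\<lambda>n. ennreal (path_sum T 0 n (real m) (m * 2 ^ n + 1) (\<psi> \<omega>) (Z \<omega>))) \<longlonglongrightarrow> g \<omega>"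
    using path_integral_measurable[OF Z_contrib] .
  have "(\<lambda>k. \<integral>\<^sup>+\<omega>. ennreal (path_sum T 0 k (real m) (m * 2 ^ k + 1) (\<psi> \<omega>) (Z \<omega>)) \<partial>M) \<longlonglongrightarrow> (\<integral>\<^sup>+\<omega>. g \<omega> \<partial>M)"
  proof (rule nn_integral_dominated_convergence[where w = "\<lambda>_. ennreal (real m * K)"])
    show "(\<lambda>\<omega>. ennreal (path_sum T 0 k (real m) (m * 2 ^ k + 1) (\<psi> \<omega>) (Z \<omega>))) \<in> borel_measurable M" for k
      using path_sum_measurable[OF Z_contrib] by measurable
    show "AE \<omega> in M. ennreal (path_sum T 0 k (real m) (m * 2 ^ k + 1) (\<psi> \<omega>) (Z \<omega>)) \<le> ennreal (real m * K)" for k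
      using Z_sum_AE[of "real m" 0 k "m * 2 ^ k + 1", OF of_nat_0_le_iff] by eventually_elim (intro ennreal_leI, blast)
    show "(\<integral>\<^sup>+\<omega>. ennreal (real m * K) \<partial>M) < \<infinity>" by (simp add: emeasure_space_1)
  qed (use g in auto)
  then have "(\<lambda>k. ennreal (a k)) \<longlonglongrightarrow> (\<integral>\<^sup>+\<omega>. g \<omega> \<partial>M)"
    using Z_sum_nn[of "real m"] unfolding a_def by simp
  then have "ennreal (a n) \<le> (\<integral>\<^sup>+\<omega>. g \<omega> \<partial>M)"
  proof (rule LIMSEQ_le_const)
    show "\<exists>N. \<forall>k\<ge>N. ennreal (a n) \<le> ennreal (a k)"
      using \<open>incseq a\<close> by (intro exI[of _ n]) (auto simp: incseq_def intro!: ennreal_leI)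
  qed
  also have "\<dots> \<le> cost C" unfolding contribution_cost_def
  proof (rule nn_integral_mono_AE)
    show "AE \<omega> in M. g \<omega> \<le> stieltjes_integral T (\<psi> \<omega>) (C \<omega>)"
      using g(2) AE_stieltjes[OF C] contribD(1)[OF C] AE_space
    proof eventually_elim
      case (elim \<omega>)
      have p: "\<And>t. t \<in> horizon T \<Longrightarrow> 0 \<le> \<psi> \<omega> t" using pos[OF elim(4)] by (simp add: less_imp_le)
      have "g \<omega> \<le> path_integral T m (\<psi> \<omega>) (C \<omega>)"
        unfolding elim(1)[symmetric] by (rule path_integral_truncated_le[OF T elim(3) rc[OF elim(4)] p K])
      also have "\<dots> \<le> stieltjes_integral T (\<psi> \<omega>) (C \<omega>)" unfolding elim(2) by (rule SUP_upper) simp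
      finally show ?case .
    qed
  qed
  finally show ?thesis unfolding a_def .
qed

lemma path_sum_le_cost:
  assumes c: "0 \<le> c"
  shows "ennreal (\<integral>\<omega>. path_sum T 0 n c J (\<psi> \<omega>) (Z \<omega>) \<partial>M) \<le> cost C"
proof -
  obtain m0 where m0: "c \<le> real m0" using real_arch_simple by blast
  define m where "m = max m0 J"
  have m: "c \<le> real m" "J \<le> m * 2 ^ n + 1"
  proof -
    show "c \<le> real m" using m0 by (simp add: m_def)
    have "J * 1 \<le> m * 2 ^ n" by (intro mult_le_mono) (auto simp: m_def)
    then show "J \<le> m * 2 ^ n + 1" by simp
  qed
  have "(\<integral>\<omega>. path_sum T 0 n c J (\<psi> \<omega>) (Z \<omega>) \<partial>M) \<le> (\<integral>\<omega>. path_sum T 0 n (real m) (m * 2 ^ n + 1) (\<psi> \<omega>) (Z \<omega>) \<partial>M)"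
  proof (rule integral_mono_AE[OF Z_sum_integrable[OF c] Z_sum_integrable])
    show "AE \<omega> in M. path_sum T 0 n c J (\<psi> \<omega>) (Z \<omega>) \<le> path_sum T 0 n (real m) (m * 2 ^ n + 1) (\<psi> \<omega>) (Z \<omega>)"
      using contribD(1)[OF Z_contrib] AE_space
    proof eventually_elim
      case (elim \<omega>)
      have p: "\<And>t. t \<in> horizon T \<Longrightarrow> 0 \<le> \<psi> \<omega> t" using pos[OF elim(2)] by (simp add: less_imp_le)
      show ?case by (rule path_sum_mono(2)[OF T elim(1) p c m])
    qed
  qed simp
  then have "ennreal (\<integral>\<omega>. path_sum T 0 n c J (\<psi> \<omega>) (Z \<omega>) \<partial>M) \<le> ennreal (\<integral>\<omega>. path_sum T 0 n (real m) (m * 2 ^ n + 1) (\<psi> \<omega>) (Z \<omega>) \<partial>M)"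
    by (rule ennreal_leI)
  also have "\<dots> \<le> cost C" by (rule path_sum_le_cost_dyadic)
  finally show ?thesis .
qed

end

text \<open>A counterpart of \<open>path_sum_le_cost\<close>: Fatou's lemma is applied once as the
  grid is refined and once as the truncation is lifted. The delay \<open>e\<close> is free because
  it disappears in the limit.\<close>

lemma cost_le:
  assumes C: "contrib C"
    and le: "\<And>n m. (\<integral>\<omega>. path_sum T e n (real m) (m * 2 ^ n + 1) (\<psi> \<omega>) (\<lambda>t. min (C \<omega> t) (real m)) \<partial>M) \<le> \<beta>"
  shows "cost C \<le> ennreal \<beta>"
proof -
  let ?Z = "\<lambda>m \<omega> t. min (C \<omega> t) (real m)"
  have "\<forall>m. \<exists>g. g \<in> borel_measurable M \<and> (AE \<omega> in M. path_integral T m (\<psi> \<omega>) (?Z m \<omega>) = g \<omega>) \<and>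
    (AE \<omega> in M. (\<lambda>n. ennreal (path_sum T e n (real m) (m * 2 ^ n + 1) (\<psi> \<omega>) (?Z m \<omega>))) \<longlonglongrightarrow> g \<omega>)"
  proof
    fix m
    show "\<exists>g. g \<in> borel_measurable M \<and> (AE \<omega> in M. path_integral T m (\<psi> \<omega>) (?Z m \<omega>) = g \<omega>) \<and>
      (AE \<omega> in M. (\<lambda>n. ennreal (path_sum T e n (real m) (m * 2 ^ n + 1) (\<psi> \<omega>) (?Z m \<omega>))) \<longlonglongrightarrow> g \<omega>)"
      by (rule path_integral_measurable[OF contrib_truncate[OF C of_nat_0_le_iff[of m]], of m e]) blast
  qed
  from choice[OF this] obtain g where g: "\<And>m. g m \<in> borel_measurable M" "\<And>m. AE \<omega> in M. path_integral T m (\<psi> \<omega>) (?Z m \<omega>) = g m \<omega>"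
    "\<And>m. AE \<omega> in M. (\<lambda>n. ennreal (path_sum T e n (real m) (m * 2 ^ n + 1) (\<psi> \<omega>) (?Z m \<omega>))) \<longlonglongrightarrow> g m \<omega>"
    by blast
  have gm: "(\<integral>\<^sup>+\<omega>. g m \<omega> \<partial>M) \<le> ennreal \<beta>" for m
  proof -
    have "(\<integral>\<^sup>+\<omega>. g m \<omega> \<partial>M) = (\<integral>\<^sup>+\<omega>. liminf (\<lambda>n. ennreal (path_sum T e n (real m) (m * 2 ^ n + 1) (\<psi> \<omega>) (?Z m \<omega>))) \<partial>M)"
      using g(3)[of m] by (intro nn_integral_cong_AE) (auto elim!: eventually_mono simp: lim_imp_Liminf)
    also have "\<dots> \<le> liminf (\<lambda>n. \<integral>\<^sup>+\<omega>. ennreal (path_sum T e n (real m) (m * 2 ^ n + 1) (\<psi> \<omega>) (?Z m \<omega>)) \<partial>M)"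
      using path_sum_measurable[OF contrib_truncate[OF C of_nat_0_le_iff[of m]]]
      by (intro nn_integral_liminf) measurable
    also have "\<dots> \<le> liminf (\<lambda>n::nat. ennreal \<beta>)"
      unfolding Z_sum_nn[OF C of_nat_0_le_iff of_nat_0_le_iff]
      by (intro Liminf_mono always_eventually allI ennreal_leI le)
    finally show ?thesis by (simp add: Liminf_const)
  qed
  have all: "AE \<omega> in M. \<forall>m. path_integral T m (\<psi> \<omega>) (?Z m \<omega>) = g m \<omega>" using g(2) by (simp add: AE_all_countable)
  have "cost C \<le> (\<integral>\<^sup>+\<omega>. liminf (\<lambda>m. g m \<omega>) \<partial>M)" unfolding contribution_cost_def
  proof (rule nn_integral_mono_AE)
    show "AE \<omega> in M. stieltjes_integral T (\<psi> \<omega>) (C \<omega>) \<le> liminf (\<lambda>m. g m \<omega>)"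
      using all AE_stieltjes[OF C] contribD(1)[OF C] AE_space
    proof eventually_elim
      case (elim \<omega>)
      have p: "\<And>t. t \<in> horizon T \<Longrightarrow> 0 \<le> \<psi> \<omega> t" using pos[OF elim(4)] by (simp add: less_imp_le)
      note r = rc[OF elim(4)]
      have "path_integral T m0 (\<psi> \<omega>) (C \<omega>) \<le> liminf (\<lambda>m. g m \<omega>)" for m0
      proof (rule Liminf_bounded)
        \<comment> \<open>Once \<open>m\<close> exceeds the value of the path at time
          \<open>m0\<close>, capping the path at \<open>m\<close> leaves its integral up to
          \<open>m0\<close> unchanged.\<close>
        obtain m1 where m1: "C \<omega> (tau T (real m0)) \<le> real m1" using real_arch_simple by blast
        have "path_integral T m0 (\<psi> \<omega>) (C \<omega>) \<le> g m \<omega>" if "max m0 m1 \<le> m" for m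
        proof -
          have "C \<omega> (tau T (real m0)) \<le> real m" using m1 that by auto
          then have "path_integral T m0 (\<psi> \<omega>) (C \<omega>) = path_integral T m0 (\<psi> \<omega>) (?Z m \<omega>)"
            using path_integral_truncated_eq[OF T elim(3) r p, of m0 "real m"] by simp
          also have "\<dots> \<le> path_integral T m (\<psi> \<omega>) (?Z m \<omega>)"
            using that by (intro path_integral_mono_index[OF T]) auto
          finally show ?thesis using elim(1) by simp
        qed
        then show "\<forall>\<^sub>F m in sequentially. path_integral T m0 (\<psi> \<omega>) (C \<omega>) \<le> g m \<omega>"
          unfolding eventually_sequentially by blast
      qed
      then show ?case unfolding elim(2) by (intro SUP_least)
    qed
  qed
  also have "\<dots> \<le> liminf (\<lambda>m. \<integral>\<^sup>+\<omega>. g m \<omega> \<partial>M)" using g(1) by (rule nn_integral_liminf)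
  also have "\<dots> \<le> liminf (\<lambda>m::nat. ennreal \<beta>)" by (intro Liminf_mono always_eventually allI gm)
  finally show ?thesis by (simp add: Liminf_const)
qed

lemma path_sum_le_real:
  assumes "contrib C" "0 \<le> K" "0 \<le> c" "cost C \<le> ennreal \<beta>" "0 \<le> \<beta>"
  shows "(\<integral>\<omega>. path_sum T 0 n c J (\<psi> \<omega>) (\<lambda>t. min (C \<omega> t) K) \<partial>M) \<le> \<beta>"
  using order_trans[OF path_sum_le_cost[OF assms(1-3)] assms(4)] assms(5) by (simp add: ennreal_le_iff)

text \<open>This fails path by path: if the price rises, a smaller but later contribution can cost
  more. In mean it holds because grid sums are monotone and approximate the cost from below and
  above.\<close>

lemma cost_mono:
  assumes C: "contrib C" and D: "contrib D" and le: "\<And>\<omega> t. \<omega> \<in> space M \<Longrightarrow> t \<in> horizon T \<Longrightarrow> C \<omega> t \<le> D \<omega> t"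
  shows "cost C \<le> cost D"
proof (cases "cost D = \<infinity>")
  case False
  then obtain \<beta> where \<beta>: "cost D = ennreal \<beta>" "0 \<le> \<beta>" by (cases "cost D") auto
  have "(\<integral>\<omega>. path_sum T 0 n (real m) (m * 2 ^ n + 1) (\<psi> \<omega>) (\<lambda>t. min (C \<omega> t) (real m)) \<partial>M) \<le> \<beta>" for n m
  proof -
    have "(\<integral>\<omega>. path_sum T 0 n (real m) (m * 2 ^ n + 1) (\<psi> \<omega>) (\<lambda>t. min (C \<omega> t) (real m)) \<partial>M)
      \<le> (\<integral>\<omega>. path_sum T 0 n (real m) (m * 2 ^ n + 1) (\<psi> \<omega>) (\<lambda>t. min (D \<omega> t) (real m)) \<partial>M)"
      unfolding path_sum_def add_0_right
    proof (rule increment_sum_mono[OF Z_F[OF C] Z_bounded[OF C] Z_F[OF D] Z_bounded[OF D]])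
      show "min (C \<omega> (tau T (real j / 2 ^ n))) (real m) \<le> min (D \<omega> (tau T (real j / 2 ^ n))) (real m)"
        if "\<omega> \<in> space M" for j \<omega> by (rule min.mono[OF le[OF that grid_horizon] order_refl])
    qed auto
    also have "\<dots> \<le> \<beta>" by (rule path_sum_le_real[OF D]) (use \<beta> in auto)
    finally show ?thesis .
  qed
  from cost_le[OF C this] show ?thesis using \<beta> by simp
qed simp

text \<open>Summation by parts bounds the mean of a later price times the contribution at that later
  time by the cost; a nondecreasing path is no larger at the earlier time \<open>t\<close>.\<close>

lemma weighted_le_cost:
  assumes C: "contrib C" and t: "t \<in> horizon T" "t \<le> real m"
  shows "(\<integral>\<^sup>+\<omega>. ennreal (min (\<psi> \<omega> (tau T (real m))) (real m) * C \<omega> t) \<partial>M) \<le> cost C"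
proof -
  let ?t = "tau T (real m)"
  have hor: "?t \<in> horizon T" by (rule tau_horizon[OF T]) simp
  have "t \<le> ?t" using tau_mono[OF T t(2)] tau_ident[OF T t(1)] by simp
  note [measurable] = psi_measurable[OF hor] contrib_measurable[OF C hor]
  have le: "(\<integral>\<^sup>+\<omega>. ennreal (min (\<psi> \<omega> ?t) (real m) * min (C \<omega> ?t) (real k)) \<partial>M) \<le> cost C" for k
  proof -
    note z = Z_F[OF C of_nat_0_le_iff[of k], of _ 0] Z_bounded[OF C of_nat_0_le_iff[of k], of _ _ 0]
    have nn: "0 \<le> min (C \<omega> (tau T (real j / 2 ^ 0))) (real k) \<and> min (C \<omega> (tau T (real j / 2 ^ 0))) (real k) \<le> real k"
      if "\<omega> \<in> space M" for \<omega> j using contribD(2)[OF C that grid_horizon[of j 0]] by simp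
    \<comment> \<open>The grid of mesh 1 is used, so that the last grid time is the integer
      \<open>m\<close>, stopped at the horizon.\<close>
    have "(\<integral>\<omega>. min (\<psi> \<omega> (tau T (real m / 2 ^ 0))) (real m) * min (C \<omega> (tau T (real m / 2 ^ 0))) (real k) \<partial>M)
        \<le> (\<integral>\<omega>. path_sum T 0 0 (real m) (Suc m) (\<psi> \<omega>) (\<lambda>t. min (C \<omega> t) (real k)) \<partial>M)"
      unfolding path_sum_def add_0_right by (rule supermartingale_sum[OF z(1) nn]) auto
    then have "(\<integral>\<omega>. min (\<psi> \<omega> ?t) (real m) * min (C \<omega> ?t) (real k) \<partial>M)
        \<le> (\<integral>\<omega>. path_sum T 0 0 (real m) (Suc m) (\<psi> \<omega>) (\<lambda>t. min (C \<omega> t) (real k)) \<partial>M)" by simp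
    then have "ennreal (\<integral>\<omega>. min (\<psi> \<omega> ?t) (real m) * min (C \<omega> ?t) (real k) \<partial>M) \<le> cost C"
      by (intro order_trans[OF ennreal_leI path_sum_le_cost[OF C]]) auto
    moreover have "integrable M (\<lambda>\<omega>. min (\<psi> \<omega> ?t) (real m) * min (C \<omega> ?t) (real k))"
      by (rule bounded_integrable[where k = "real k"]) (use contribD(2)[OF C _ hor] hor in auto)
    moreover have "AE \<omega> in M. 0 \<le> min (\<psi> \<omega> ?t) (real m) * min (C \<omega> ?t) (real k)"
      using contribD(2)[OF C _ hor] pos[OF _ hor] by (intro AE_I2 mult_nonneg_nonneg) (auto simp: less_imp_le)
    ultimately show ?thesis by (subst nn_integral_eq_integral) auto
  qed
  have "(\<integral>\<^sup>+\<omega>. ennreal (min (\<psi> \<omega> ?t) (real m) * C \<omega> t) \<partial>M)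
    \<le> (\<integral>\<^sup>+\<omega>. liminf (\<lambda>k. ennreal (min (\<psi> \<omega> ?t) (real m) * min (C \<omega> ?t) (real k))) \<partial>M)"
  proof (rule nn_integral_mono_AE)
    show "AE \<omega> in M. ennreal (min (\<psi> \<omega> ?t) (real m) * C \<omega> t)
      \<le> liminf (\<lambda>k. ennreal (min (\<psi> \<omega> ?t) (real m) * min (C \<omega> ?t) (real k)))"
      using contribD(1)[OF C] AE_space
    proof eventually_elim
      case (elim \<omega>)
      have mono: "C \<omega> t \<le> C \<omega> ?t" using elim(1) t(1) hor \<open>t \<le> ?t\<close> unfolding good_path_def mono_on_def by blast
      obtain k0 where k0: "C \<omega> ?t \<le> real k0" using real_arch_simple by blast
      have "ennreal (min (\<psi> \<omega> ?t) (real m) * C \<omega> t) \<le> ennreal (min (\<psi> \<omega> ?t) (real m) * min (C \<omega> ?t) (real k))" if "k0 \<le> k" for k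
      proof (intro ennreal_leI mult_left_mono)
        have "C \<omega> ?t \<le> real k" using k0 that by (meson of_nat_le_iff order_trans)
        then show "C \<omega> t \<le> min (C \<omega> ?t) (real k)" using mono by simp
        show "0 \<le> min (\<psi> \<omega> ?t) (real m)" using pos[OF elim(2) hor] by simp
      qed
      then show ?case by (intro Liminf_bounded) (auto simp: eventually_sequentially)
    qed
  qed
  also have "\<dots> \<le> liminf (\<lambda>k. \<integral>\<^sup>+\<omega>. ennreal (min (\<psi> \<omega> ?t) (real m) * min (C \<omega> ?t) (real k)) \<partial>M)"
    by (rule nn_integral_liminf) measurable
  also have "\<dots> \<le> liminf (\<lambda>k::nat. cost C)" by (intro Liminf_mono always_eventually allI le)
  finally show ?thesis by (simp add: Liminf_const)
qed

text \<open>
  Lower semicontinuity of the cost. Mass of \<open>Cs k\<close> just before a jump of the price may move to the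
  jump time in the limit, so this fails path by path. In mean, postponing is never more expensive, so it
  suffices to compare \<open>C\<close> delayed by one grid step with \<open>Cs k\<close>.
\<close>

lemma cost_lsc:
  assumes C: "contrib C" and Cs: "\<And>k. contrib (Cs k)"
    and le: "\<And>k. cost (Cs k) \<le> ennreal (Bs k)" "\<And>k. 0 \<le> Bs k" and B: "Bs \<longlonglongrightarrow> \<beta>"
    and conv: "AE \<omega> in M. \<forall>s t \<delta>. 0 \<le> s \<longrightarrow> s < t \<longrightarrow> 0 < \<delta> \<longrightarrow> (\<forall>\<^sub>F k in sequentially. C \<omega> (tau T s) - \<delta> \<le> Cs k \<omega> (tau T t))"
  shows "cost C \<le> ennreal \<beta>"
proof (rule cost_le[OF C, of 1])
  fix n m :: nat
  let ?J = "m * 2 ^ n + 1"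
  let ?Z = "\<lambda>\<omega> t. min (C \<omega> t) (real m)"
  let ?z = "\<lambda>i \<omega>. if i = 0 then 0 else ?Z \<omega> (tau T (real (i - 1) / 2 ^ n))"
  \<comment> \<open>The minimum of the delayed path and \<open>Cs k\<close> is adapted and lies
    below \<open>Cs k\<close>, so its cost in mean is at most \<open>Bs k\<close>. It tends to the
    delayed path, because \<open>Cs k\<close> at a grid time eventually almost exceeds
    \<open>C\<close> one step before.\<close>
  let ?y = "\<lambda>k i \<omega>. min (?z i \<omega>) (min (Cs k \<omega> (tau T (real i / 2 ^ n))) (real m))"
  have zF: "?z i \<in> borel_measurable (F (tau T (real i / 2 ^ n)))" for i
  proof (cases "i = 0")
    case False
    have "(\<lambda>\<omega>. ?Z \<omega> (tau T (real (i - 1) / 2 ^ n))) \<in> borel_measurable (F (tau T (real i / 2 ^ n)))"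
      by (rule measurable_F_mono[OF Z_F[OF C] grid_horizon grid_horizon grid_mono]) auto
    then show ?thesis using False by (simp only: if_False)
  qed simp
  have yF: "?y k i \<in> borel_measurable (F (tau T (real i / 2 ^ n)))" for k i
    by (intro borel_measurable_min zF Z_F[OF Cs]) auto
  have zb: "0 \<le> ?z i \<omega> \<and> ?z i \<omega> \<le> real m" if "\<omega> \<in> space M" for i \<omega>
  proof -
    have "0 \<le> (if i = 0 then 0 else min p (real m)) \<and> (if i = 0 then 0 else min p (real m)) \<le> real m" if "0 \<le> p" for p :: real
      using that by auto
    from this[OF contribD(2)[OF C that grid_horizon]] show ?thesis .
  qed
  have csb: "0 \<le> Cs k \<omega> (tau T (real i / 2 ^ n))" if "\<omega> \<in> space M" for i k \<omega>
    using contribD(2)[OF Cs that grid_horizon] .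
  have yb: "\<bar>?y k i \<omega>\<bar> \<le> real m" if "\<omega> \<in> space M" for k i \<omega>
  proof -
    have "0 \<le> ?y k i \<omega>" "?y k i \<omega> \<le> real m" using zb[OF that, of i] csb[OF that, of k i] by auto
    then show ?thesis by (simp only: abs_of_nonneg)
  qed
  have sum_y: "(\<integral>\<omega>. increment_sum (\<lambda>j. \<phi> n (real m) j \<omega>) (\<lambda>j. ?y k j \<omega>) (Suc ?J) \<partial>M) \<le> Bs k" for k
  proof -
    have "(\<integral>\<omega>. increment_sum (\<lambda>j. \<phi> n (real m) j \<omega>) (\<lambda>j. ?y k j \<omega>) (Suc ?J) \<partial>M)
      \<le> (\<integral>\<omega>. increment_sum (\<lambda>j. \<phi> n (real m) j \<omega>) (\<lambda>j. min (Cs k \<omega> (tau T (real j / 2 ^ n))) (real m)) (Suc ?J) \<partial>M)"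
      by (rule increment_sum_mono[OF yF yb Z_F[OF Cs] Z_bounded[OF Cs]]) auto
    also have "\<dots> = (\<integral>\<omega>. path_sum T 0 n (real m) (Suc ?J) (\<psi> \<omega>) (\<lambda>t. min (Cs k \<omega> t) (real m)) \<partial>M)"
      unfolding path_sum_def add_0_right ..
    also have "\<dots> \<le> Bs k" by (rule path_sum_le_real[OF Cs _ _ le]) auto
    finally show ?thesis .
  qed
  have "(\<lambda>k. \<integral>\<omega>. increment_sum (\<lambda>j. \<phi> n (real m) j \<omega>) (\<lambda>j. ?y k j \<omega>) (Suc ?J) \<partial>M)
    \<longlonglongrightarrow> (\<integral>\<omega>. increment_sum (\<lambda>j. \<phi> n (real m) j \<omega>) (\<lambda>j. ?z j \<omega>) (Suc ?J) \<partial>M)"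
  \<comment> \<open>The bound counts the summands, each at most the price cap \<open>m\<close> times
    an increment of size at most \<open>2 * m\<close>.\<close>
  proof (rule integral_dominated_convergence[where w = "\<lambda>_. real (Suc ?J) * (real m * (2 * real m))"])
    show "(\<lambda>\<omega>. increment_sum (\<lambda>j. \<phi> n (real m) j \<omega>) (\<lambda>j. ?z j \<omega>) (Suc ?J)) \<in> borel_measurable M"
    proof -
      have "\<bar>?z j \<omega>\<bar> \<le> real m" if "\<omega> \<in> space M" for j \<omega>
        using zb[OF that, of j] by (simp only: abs_of_nonneg)
      from increment_sum_integrable[OF measurable_F[OF zF grid_horizon] this, where e = "\<lambda>j. j"] show ?thesis by auto
    qed
    show "(\<lambda>\<omega>. increment_sum (\<lambda>j. \<phi> n (real m) j \<omega>) (\<lambda>j. ?y k j \<omega>) (Suc ?J)) \<in> borel_measurable M" for k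
      using increment_sum_integrable[OF measurable_F[OF yF grid_horizon] yb, where e = "\<lambda>j. j"] by auto
    show "AE \<omega> in M. (\<lambda>k. increment_sum (\<lambda>j. \<phi> n (real m) j \<omega>) (\<lambda>j. ?y k j \<omega>) (Suc ?J))
      \<longlonglongrightarrow> increment_sum (\<lambda>j. \<phi> n (real m) j \<omega>) (\<lambda>j. ?z j \<omega>) (Suc ?J)"
      using conv AE_space
    proof eventually_elim
      case (elim \<omega>)
      have y_lim: "(\<lambda>k. ?y k i \<omega>) \<longlonglongrightarrow> ?z i \<omega>" for i
      proof (cases "i = 0")
        case True
        have "min 0 (min c (real m)) = 0" if "0 \<le> c" for c using that by simp
        from this[OF csb[OF elim(2)]] show ?thesis by (simp only: True refl if_True tendsto_const)
      next
        case False
        have lt: "real (i - 1) / 2 ^ n < real i / 2 ^ n" using False by (intro divide_strict_right_mono) auto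
        have "(\<lambda>k. min (?Z \<omega> (tau T (real (i - 1) / 2 ^ n))) (min (Cs k \<omega> (tau T (real i / 2 ^ n))) (real m)))
            \<longlonglongrightarrow> ?Z \<omega> (tau T (real (i - 1) / 2 ^ n))"
        proof (rule tendsto_min_eventually_ge)
          show "\<forall>\<^sub>F k in sequentially. C \<omega> (tau T (real (i - 1) / 2 ^ n)) - \<delta> \<le> Cs k \<omega> (tau T (real i / 2 ^ n))"
            if "0 < \<delta>" for \<delta> using elim(1) lt that by (meson divide_nonneg_nonneg of_nat_0_le_iff zero_le_numeral zero_le_power)
        qed auto
        then show ?thesis using False by (simp only: if_False)
      qed
      have "(\<lambda>k. if j = 0 then 0 else ?y k (j - 1) \<omega>) \<longlonglongrightarrow> (if j = 0 then 0 else ?z (j - 1) \<omega>)" for j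
      proof (cases "j = 0")
        case False
        then show ?thesis using y_lim[of "j - 1"] by (simp only: if_False)
      qed simp
      then show ?case unfolding increment_sum_def by (intro tendsto_intros y_lim)
    qed
    show "AE \<omega> in M. norm (increment_sum (\<lambda>j. \<phi> n (real m) j \<omega>) (\<lambda>j. ?y k j \<omega>) (Suc ?J)) \<le> real (Suc ?J) * (real m * (2 * real m))" for k
    proof (rule AE_I2)
      fix \<omega> assume \<omega>: "\<omega> \<in> space M"
      have "norm (increment_sum (\<lambda>j. \<phi> n (real m) j \<omega>) (\<lambda>j. ?y k j \<omega>) (Suc ?J))
        \<le> (\<Sum>j<Suc ?J. norm (\<phi> n (real m) j \<omega> * (?y k j \<omega> - (if j = 0 then 0 else ?y k (j - 1) \<omega>))))"
        unfolding increment_sum_def by (rule norm_sum)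
      also have "\<dots> \<le> (\<Sum>j<Suc ?J. real m * (2 * real m))"
      proof (rule sum_mono)
        fix j
        have a: "\<bar>\<phi> n (real m) j \<omega>\<bar> \<le> real m" using pos[OF \<omega> grid_horizon, of j n] by auto
        have b: "\<bar>if j = 0 then 0 else ?y k (j - 1) \<omega>\<bar> \<le> real m" 
          using yb[OF \<omega>, of "j - 1" k] by (cases "j = 0") (simp_all only: refl if_True if_False abs_zero of_nat_0_le_iff)
        have d: "\<bar>?y k j \<omega> - (if j = 0 then 0 else ?y k (j - 1) \<omega>)\<bar> \<le> 2 * real m"
        proof -
          have "\<bar>p - q\<bar> \<le> 2 * real m" if "\<bar>p\<bar> \<le> real m" "\<bar>q\<bar> \<le> real m" for p q using that by linarith
          from this[OF yb[OF \<omega>] b] show ?thesis .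
        qed
        show "norm (\<phi> n (real m) j \<omega> * (?y k j \<omega> - (if j = 0 then 0 else ?y k (j - 1) \<omega>))) \<le> real m * (2 * real m)"
          unfolding real_norm_def abs_mult by (rule mult_mono[OF a d]) (rule of_nat_0_le_iff, rule abs_ge_zero)
      qed
      finally show "norm (increment_sum (\<lambda>j. \<phi> n (real m) j \<omega>) (\<lambda>j. ?y k j \<omega>) (Suc ?J)) \<le> real (Suc ?J) * (real m * (2 * real m))"
        by (simp only: sum_constant card_lessThan)
    qed
  qed simp
  then have "(\<integral>\<omega>. increment_sum (\<lambda>j. \<phi> n (real m) j \<omega>) (\<lambda>j. ?z j \<omega>) (Suc ?J) \<partial>M) \<le> \<beta>"
    by (rule LIMSEQ_le[OF _ B]) (use sum_y in blast)
  \<comment> \<open>The first delayed increment is 0. The remaining ones form the sum for the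
    original path with prices read one step later, hence \<open>e = 1\<close>.\<close>
  also have "(\<lambda>\<omega>. increment_sum (\<lambda>j. \<phi> n (real m) j \<omega>) (\<lambda>j. ?z j \<omega>) (Suc ?J))
      = (\<lambda>\<omega>. path_sum T 1 n (real m) ?J (\<psi> \<omega>) (?Z \<omega>))"
    unfolding path_sum_def by (rule ext) (rule increment_sum_shift)
  finally show "(\<integral>\<omega>. path_sum T 1 n (real m) ?J (\<psi> \<omega>) (?Z \<omega>) \<partial>M) \<le> \<beta>" .
qed

end

section \<open>Optional processes\<close>

text \<open>The right-continuous regularization of a monotone function, taken over the rationals so
  that it is a countable infimum. The last claim confines the infimum to times before
  \<open>s\<close>; adaptedness of the regularized process rests on it.\<close>

lemma right_limit_path:
  fixes g :: "real \<Rightarrow> real"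
  assumes mono: "\<And>s t. 0 \<le> s \<Longrightarrow> s \<le> t \<Longrightarrow> g s \<le> g t" and nn: "\<And>s. 0 \<le> s \<Longrightarrow> 0 \<le> g s"
  defines "D \<equiv> \<lambda>t. INF q\<in>{q\<in>\<rat>. t < q}. g q"
  shows right_limit_ge: "\<And>t. 0 \<le> t \<Longrightarrow> g t \<le> D t"
    and right_limit_le: "\<And>t s. 0 \<le> t \<Longrightarrow> t < s \<Longrightarrow> D t \<le> g s"
    and right_limit_mono: "\<And>s t. 0 \<le> s \<Longrightarrow> s \<le> t \<Longrightarrow> D s \<le> D t"
    and right_limit_cont: "\<And>t. 0 \<le> t \<Longrightarrow> (D \<longlongrightarrow> D t) (at_right t)"
    and right_limit_countable: "countable {t\<in>{0..}. D t \<noteq> g t}"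
    and right_limit_INF_bounded: "\<And>t s. 0 \<le> t \<Longrightarrow> t < s \<Longrightarrow> D t = (INF q\<in>{q\<in>\<rat>. t < q \<and> q < s}. g q)"
proof -
  have bdd: "bdd_below (g ` {q\<in>\<rat>. t < q})" if "0 \<le> t" for t
  proof (rule bdd_belowI2)
    fix q assume "q \<in> {q\<in>\<rat>. t < q}"
    then show "0 \<le> g q" using that by (intro nn) simp
  qed
  have ne: "{q\<in>\<rat>. t < q} \<noteq> {}" for t :: real
  proof -
    obtain q where "q \<in> \<rat>" "t < q" using Rats_dense_in_real[of t "t + 1"] by fastforce
    then show ?thesis by blast
  qed
  show ge: "g t \<le> D t" if "0 \<le> t" for t
    unfolding D_def
  proof (intro cINF_greatest ne)
    fix q assume "q \<in> {q\<in>\<rat>. t < q}"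
    then show "g t \<le> g q" using that by (intro mono) simp_all
  qed
  show le: "D t \<le> g s" if ts: "0 \<le> t" "t < s" for t s
  proof -
    obtain q where q: "q \<in> \<rat>" "t < q" "q < s" using Rats_dense_in_real[OF ts(2)] by blast
    have "D t \<le> g q" unfolding D_def using q bdd[OF ts(1)] by (intro cINF_lower) simp_all
    also have "\<dots> \<le> g s" using q ts by (intro mono) simp_all
    finally show ?thesis .
  qed
  show mD: "D s \<le> D t" if "0 \<le> s" "s \<le> t" for s t
    unfolding D_def using that bdd by (intro cINF_superset_mono ne) fastforce+
  show "(D \<longlongrightarrow> D t) (at_right t)" if t: "0 \<le> t" for t
  proof (rule order_tendstoI)
    fix a assume "a < D t"
    show "\<forall>\<^sub>F x in at_right t. a < D x"
    proof (rule eventually_at_rightI[of t "t + 1"])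
      fix x assume "x \<in> {t<..<t + 1}"
      then have "D t \<le> D x" using t by (intro mD) auto
      then show "a < D x" using \<open>a < D t\<close> by simp
    qed simp
  next
    fix a assume "D t < a"
    then obtain q where q: "q \<in> \<rat>" "t < q" "g q < a"
      unfolding D_def using ne[of t] bdd[OF t] by (auto simp: cINF_less_iff)
    show "\<forall>\<^sub>F x in at_right t. D x < a"
    proof (rule eventually_at_rightI[of t q])
      fix x assume "x \<in> {t<..<q}"
      then have "D x \<le> g q" using t by (intro le) auto
      then show "D x < a" using q(3) by simp
    qed (use q in auto)
  qed
  have "mono_on {0..} g" using mono by (auto simp: mono_on_def)
  from mono_on_ctble_discont[OF this]
  show "countable {t\<in>{0..}. D t \<noteq> g t}"
  proof (rule countable_subset[rotated])
    show "{t\<in>{0..}. D t \<noteq> g t} \<subseteq> {a \<in> {0..}. \<not> continuous (at a within {0..}) g}"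
    proof safe
      fix t :: real assume t: "0 \<le> t" "D t \<noteq> g t" "continuous (at t within {0..}) g"
      have l: "(\<lambda>n. t + 1 / real (Suc n)) \<longlonglongrightarrow> t"
        using tendsto_add[OF tendsto_const LIMSEQ_Suc[OF lim_1_over_n], of t] by simp
      then have "(\<lambda>n. g (t + 1 / real (Suc n))) \<longlonglongrightarrow> g t"
        using t(3) t(1) unfolding continuous_within_sequentially by (auto simp: o_def)
      then have "D t \<le> g t"
        by (rule tendsto_lowerbound) (use le t(1) in \<open>auto intro!: always_eventually\<close>)
      then show False using ge[OF t(1)] t(2) by simp
    qed
  qed
  show "D t = (INF q\<in>{q\<in>\<rat>. t < q \<and> q < s}. g q)" if t: "0 \<le> t" "t < s" for t s
  proof (rule antisym)
    obtain q0 where q0: "q0 \<in> \<rat>" "t < q0" "q0 < s" using Rats_dense_in_real[OF t(2)] by blast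
    then have ne': "{q\<in>\<rat>. t < q \<and> q < s} \<noteq> {}" by auto
    show "D t \<le> (INF q\<in>{q\<in>\<rat>. t < q \<and> q < s}. g q)"
      unfolding D_def using bdd[OF t(1)] by (intro cINF_superset_mono ne') auto
    have bdd': "bdd_below (g ` {q\<in>\<rat>. t < q \<and> q < s})"
      by (rule bdd_below_mono[OF bdd[OF t(1)]]) auto
    show "(INF q\<in>{q\<in>\<rat>. t < q \<and> q < s}. g q) \<le> D t"
      unfolding D_def
    proof (intro cINF_greatest ne)
      fix q assume q: "q \<in> {q \<in> \<rat>. t < q}"
      show "(INF q\<in>{q\<in>\<rat>. t < q \<and> q < s}. g q) \<le> g q"
      proof (cases "q < s")
        case True
        then show ?thesis using q bdd' by (intro cINF_lower) auto
      next
        case False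
        have "(INF q\<in>{q\<in>\<rat>. t < q \<and> q < s}. g q) \<le> g q0" using q0 bdd' by (intro cINF_lower) auto
        also have "\<dots> \<le> g q" using False q0 t(1) by (intro mono) auto
        finally show ?thesis .
      qed
    qed
  qed
qed

lemma mono_on_has_left_limits:
  fixes f :: "real \<Rightarrow> real"
  assumes "mono_on S f"
  shows "has_left_limits_on S f"
  unfolding has_left_limits_on_def
proof
  fix t assume t: "t \<in> S"
  show "\<exists>l. (f \<longlongrightarrow> l) (at t within S \<inter> {..<t})"
  proof (cases "S \<inter> {..<t} = {}")
    case False
    let ?l = "Sup (f ` (S \<inter> {..<t}))"
    have bdd: "bdd_above (f ` (S \<inter> {..<t}))"
      using assms t by (intro bdd_aboveI[of _ "f t"]) (auto simp: mono_on_def)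
    have "(f \<longlongrightarrow> ?l) (at t within S \<inter> {..<t})"
    proof (rule order_tendstoI)
      fix a assume "a < ?l"
      then obtain s where s: "s \<in> S" "s < t" "a < f s" using less_cSup_iff[OF _ bdd] False by auto
      have "a < f x" if "x \<in> {s<..}" "x \<in> S \<inter> {..<t}" for x
        using assms s that unfolding mono_on_def by (auto intro: less_le_trans)
      then show "\<forall>\<^sub>F x in at t within S \<inter> {..<t}. a < f x"
        unfolding eventually_at_topological using s by (intro exI[of _ "{s<..}"]) auto
    next
      fix a assume "?l < a"
      then have "f x < a" if "x \<in> S \<inter> {..<t}" for x
        using cSup_upper[OF imageI[OF that, of f] bdd] by simp
      then show "\<forall>\<^sub>F x in at t within S \<inter> {..<t}. f x < a"
        unfolding eventually_at_topological by (intro exI[of _ UNIV]) auto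
    qed
    then show ?thesis ..
  qed (simp add: at_within_def)
qed

locale filtered = prob_space M for M :: "'a measure" +
  fixes F :: "real \<Rightarrow> 'a measure" and T :: ereal
  assumes T: "0 < T" and filt: "filtration_on M F T" and usual: "usual_conditions M F T"
begin

lemma sub: "t \<in> horizon T \<Longrightarrow> subalgebra M (F t)"
  using filt by (auto simp: filtration_on_def)

lemma space_F: "t \<in> horizon T \<Longrightarrow> space (F t) = space M"
  using sub by (auto simp: subalgebra_def)

lemma null_sets_F: "A \<in> null_sets M \<Longrightarrow> t \<in> horizon T \<Longrightarrow> A \<in> sets (F t)"
  using usual filt zero_horizon[OF T] horizon_nonneg[OF T]
  unfolding usual_conditions_def filtration_on_def by blast

lemma space_leb: "space (leb T) = horizon T"
  using horizon_measurable[OF T] by (simp add: leb_def)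

lemma space_product: "space (M \<Otimes>\<^sub>M leb T) = space M \<times> horizon T"
  by (simp add: space_pair_measure space_leb)

lemma leb_sigma_finite: "sigma_finite_measure (leb T)"
  unfolding leb_def using horizon_measurable[OF T]
  by (intro sigma_finite_measure_restrict_space lborel.sigma_finite_measure_axioms) simp

sublocale P: pair_sigma_finite M "leb T"
  by (rule pair_sigma_finite.intro[OF sigma_finite_measure_axioms leb_sigma_finite])

lemma measurable_leb: "f \<in> borel_measurable borel \<Longrightarrow> f \<in> borel_measurable (leb T)"
  unfolding leb_def by (intro measurable_restrict_space1) simp

text \<open>The process is approximated by its value at the next dyadic time on the right, which
  takes countably many values.\<close>

lemma right_continuous_measurable:
  fixes X :: "'a \<Rightarrow> real \<Rightarrow> real"
  assumes X: "\<And>t. t \<in> horizon T \<Longrightarrow> (\<lambda>\<omega>. X \<omega> t) \<in> borel_measurable M"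
    and rc: "\<And>\<omega>. \<omega> \<in> space M \<Longrightarrow> right_continuous_on (horizon T) (X \<omega>)"
  shows "(\<lambda>(\<omega>, t). X \<omega> t) \<in> borel_measurable (M \<Otimes>\<^sub>M leb T)"
proof (rule borel_measurable_LIMSEQ_metric)
  let ?X = "\<lambda>n (\<omega>, t). X \<omega> (tau T (max 0 (real_of_int (\<lceil>2 ^ n * t\<rceil> + int 0) / 2 ^ n)))"
  show "(\<lambda>n. ?X n z) \<longlonglongrightarrow> (case z of (\<omega>, t) \<Rightarrow> X \<omega> t)" if z0: "z \<in> space (M \<Otimes>\<^sub>M leb T)" for z
  proof -
    obtain \<omega> t where z: "z = (\<omega>, t)" "\<omega> \<in> space M" "t \<in> horizon T" using z0 by (auto simp: space_product)
    have t0: "0 \<le> t" using horizon_nonneg[OF T z(3)] .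
    have "t \<le> max 0 (real_of_int (\<lceil>2 ^ n * t\<rceil> + int 0) / 2 ^ n)" for n
      using right_grid(1)[OF T, of t n 0] by simp
    moreover have "(\<lambda>n. max 0 (real_of_int (\<lceil>2 ^ n * t\<rceil> + int 0) / 2 ^ n)) \<longlonglongrightarrow> max 0 t"
      by (intro tendsto_intros right_grid(2)[OF T])
    ultimately have "(\<lambda>n. X \<omega> (tau T (max 0 (real_of_int (\<lceil>2 ^ n * t\<rceil> + int 0) / 2 ^ n)))) \<longlonglongrightarrow> X \<omega> (tau T t)"
      using t0 by (intro right_continuous_sequentially[OF T rc[OF z(2)] t0]) (auto simp: max_absorb2)
    then show ?thesis by (simp add: z tau_ident[OF T z(3)])
  qed
  show "?X n \<in> borel_measurable (M \<Otimes>\<^sub>M leb T)" for n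
  proof -
    have "(\<lambda>z. \<lceil>2 ^ n * snd z\<rceil>) \<in> (M \<Otimes>\<^sub>M leb T) \<rightarrow>\<^sub>M count_space UNIV"
    proof -
      have "(\<lambda>t::real. \<lceil>2 ^ n * t\<rceil>) \<in> leb T \<rightarrow>\<^sub>M count_space UNIV"
        unfolding leb_def by (intro measurable_restrict_space1) auto
      from measurable_compose[OF measurable_snd this] show ?thesis .
    qed
    moreover have "(\<lambda>z. X (fst z) (tau T (max 0 (real_of_int (i + int 0) / 2 ^ n)))) \<in> borel_measurable (M \<Otimes>\<^sub>M leb T)" for i
      by (rule measurable_compose[OF measurable_fst X]) (rule tau_horizon[OF T], simp)
    ultimately have "(\<lambda>z. X (fst z) (tau T (max 0 (real_of_int (\<lceil>2 ^ n * snd z\<rceil> + int 0) / 2 ^ n)))) \<in> borel_measurable (M \<Otimes>\<^sub>M leb T)"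
      by (rule measurable_compose_countable[where f = "\<lambda>i z. X (fst z) (tau T (max 0 (real_of_int (i + int 0) / 2 ^ n)))", rotated])
    then show ?thesis by (simp add: split_def)
  qed
qed

abbreviation G where "G \<equiv> optional_sigma M F T"

lemma optional_generators:
  "{{(\<omega>, t). \<omega> \<in> space M \<and> t \<in> horizon T \<and> X \<omega> t \<in> B} | X B. cadlag_adapted M F T X \<and> B \<in> sets borel}
    \<subseteq> Pow (space M \<times> horizon T)"
  by auto

lemma space_optional: "space G = space M \<times> horizon T"
  unfolding optional_sigma_def by (rule space_measure_of[OF optional_generators])

lemma cadlag_imp_optional:
  assumes "cadlag_adapted M F T X"
  shows "optional_process M F T X"
  unfolding optional_process_def
proof (rule measurableI)
  fix B :: "real set" assume "B \<in> sets borel"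
  then have "{(\<omega>, t). \<omega> \<in> space M \<and> t \<in> horizon T \<and> X \<omega> t \<in> B} \<in> sets G"
    unfolding optional_sigma_def sets_measure_of[OF optional_generators] using assms
    by (intro sigma_sets.Basic) blast
  also have "{(\<omega>, t). \<omega> \<in> space M \<and> t \<in> horizon T \<and> X \<omega> t \<in> B} = (\<lambda>(\<omega>, t). X \<omega> t) -` B \<inter> space G"
    by (auto simp: space_optional)
  finally show "(\<lambda>(\<omega>, t). X \<omega> t) -` B \<inter> space G \<in> sets G" .
qed simp

text \<open>The time slice sending \<omega> to the pair of \<omega> and \<open>t\<close> is
  measurable from \<open>F t\<close> to the optional sigma-algebra, as its generators show.\<close>

lemma optional_imp_adapted:
  assumes "optional_process M F T X"
  shows "adapted F T X"
  unfolding adapted_def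
proof
  fix t assume t: "t \<in> horizon T"
  have "(\<lambda>\<omega>. (\<omega>, t)) \<in> measurable (F t) G"
    unfolding optional_sigma_def
  proof (rule measurable_measure_of[OF optional_generators])
    show "(\<lambda>\<omega>. (\<omega>, t)) \<in> space (F t) \<rightarrow> space M \<times> horizon T" using t space_F by auto
    fix y assume "y \<in> {{(\<omega>, t). \<omega> \<in> space M \<and> t \<in> horizon T \<and> X \<omega> t \<in> B} | X B. cadlag_adapted M F T X \<and> B \<in> sets borel}"
    then obtain Y B where y: "y = {(\<omega>, t). \<omega> \<in> space M \<and> t \<in> horizon T \<and> Y \<omega> t \<in> B}" "cadlag_adapted M F T Y" "B \<in> sets borel" by blast
    then have "(\<lambda>\<omega>. Y \<omega> t) \<in> borel_measurable (F t)" using t by (auto simp: cadlag_adapted_def adapted_def)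
    then have "(\<lambda>\<omega>. Y \<omega> t) -` B \<inter> space (F t) \<in> sets (F t)" using y(3) by (rule measurable_sets)
    also have "(\<lambda>\<omega>. Y \<omega> t) -` B \<inter> space (F t) = (\<lambda>\<omega>. (\<omega>, t)) -` y \<inter> space (F t)"
      using t by (auto simp: y(1) space_F)
    finally show "(\<lambda>\<omega>. (\<omega>, t)) -` y \<inter> space (F t) \<in> sets (F t)" .
  qed
  from measurable_compose[OF this assms[unfolded optional_process_def]]
  show "(\<lambda>\<omega>. X \<omega> t) \<in> borel_measurable (F t)" by simp
qed

lemma optional_subalgebra: "subalgebra (M \<Otimes>\<^sub>M leb T) G"
  unfolding subalgebra_def
proof
  show "space G = space (M \<Otimes>\<^sub>M leb T)" by (simp add: space_optional space_product)
  have "sigma_sets (space M \<times> horizon T)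
    {{(\<omega>, t). \<omega> \<in> space M \<and> t \<in> horizon T \<and> X \<omega> t \<in> B} | X B. cadlag_adapted M F T X \<and> B \<in> sets borel}
    \<subseteq> sets (M \<Otimes>\<^sub>M leb T)"
    unfolding space_product[symmetric]
  proof (rule sets.sigma_sets_subset, safe)
    fix X and B :: "real set" assume X: "cadlag_adapted M F T X" "B \<in> sets borel"
    have "(\<lambda>(\<omega>, t). X \<omega> t) \<in> borel_measurable (M \<Otimes>\<^sub>M leb T)"
    proof (rule right_continuous_measurable)
      show "(\<lambda>\<omega>. X \<omega> t) \<in> borel_measurable M" if "t \<in> horizon T" for t
        using X(1) that by (intro measurable_from_subalg[OF sub[OF that]]) (auto simp: cadlag_adapted_def adapted_def)
    qed (use X in \<open>auto simp: cadlag_adapted_def\<close>)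
    from measurable_sets[OF this X(2)]
    show "{(\<omega>, t). \<omega> \<in> space M \<and> t \<in> horizon T \<and> X \<omega> t \<in> B} \<in> sets (M \<Otimes>\<^sub>M leb T)"
      by (rule back_subst[where P = "\<lambda>A. A \<in> sets (M \<Otimes>\<^sub>M leb T)"]) (auto simp: space_product)
  qed
  then show "sets G \<subseteq> sets (M \<Otimes>\<^sub>M leb T)"
    unfolding optional_sigma_def by (simp add: sets_measure_of[OF optional_generators])
qed

lemma optional_product_measurable:
  "optional_process M F T X \<Longrightarrow> (\<lambda>(\<omega>, t). X \<omega> t) \<in> borel_measurable (M \<Otimes>\<^sub>M leb T)"
  unfolding optional_process_def by (rule measurable_from_subalg[OF optional_subalgebra])

lemma discount_measurable:
  assumes "(\<lambda>(\<omega>, t). r \<omega> t) \<in> borel_measurable (M \<Otimes>\<^sub>M leb T)"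
  shows "(\<lambda>(\<omega>, t). discount r \<omega> t) \<in> borel_measurable (M \<Otimes>\<^sub>M leb T)"
proof -
  \<comment> \<open>\<open>r\<close> is jointly measurable only over the horizon. Clipping the time
    extends it to the real line without changing integrals over \<open>{0..t}\<close> inside the
    horizon.\<close>
  let ?r = "\<lambda>\<omega> s. r \<omega> (tau T (max 0 s))"
  have "continuous_on UNIV (\<lambda>s. tau T (max 0 s))"
    unfolding continuous_on_def by (auto intro!: tau_tendsto[OF T] tendsto_intros)
  then have [measurable]: "(\<lambda>s. tau T (max 0 s)) \<in> borel_measurable borel"
    by (rule borel_measurable_continuous_onI)
  have "(\<lambda>s. tau T (max 0 s)) \<in> lborel \<rightarrow>\<^sub>M leb T"
    unfolding leb_def using tau_horizon[OF T] by (intro measurable_restrict_space2) auto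
  then have "(\<lambda>z. (fst z, tau T (max 0 (snd z)))) \<in> (M \<Otimes>\<^sub>M lborel) \<rightarrow>\<^sub>M (M \<Otimes>\<^sub>M leb T)"
    by measurable
  from measurable_compose[OF this assms]
  have r': "(\<lambda>(\<omega>, s). ?r \<omega> s) \<in> borel_measurable (M \<Otimes>\<^sub>M lborel)" by (simp add: split_def)
  have "(\<lambda>(z, s). indicator {0..snd z} s *\<^sub>R ?r (fst z) s) \<in> borel_measurable ((M \<Otimes>\<^sub>M leb T) \<Otimes>\<^sub>M lborel)"
  proof -
    have [measurable]: "(\<lambda>p. ?r (fst (fst p)) (snd p)) \<in> borel_measurable ((M \<Otimes>\<^sub>M leb T) \<Otimes>\<^sub>M lborel)"
      using measurable_compose[OF _ r', of "\<lambda>p. (fst (fst p), snd p)" "(M \<Otimes>\<^sub>M leb T) \<Otimes>\<^sub>M lborel"] by simp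
    have s [measurable]: "(\<lambda>p. snd (fst p)) \<in> borel_measurable ((M \<Otimes>\<^sub>M leb T) \<Otimes>\<^sub>M lborel)"
      using measurable_compose[OF measurable_compose[OF measurable_fst measurable_snd] measurable_leb[OF measurable_ident]] by simp
    have "(\<lambda>p. (if 0 \<le> snd p \<and> snd p \<le> snd (fst p) then ?r (fst (fst p)) (snd p) else 0)) \<in> borel_measurable ((M \<Otimes>\<^sub>M leb T) \<Otimes>\<^sub>M lborel)"
      by measurable
    then show ?thesis
      by (rule measurable_cong[THEN iffD1, rotated]) (auto simp: indicator_def split_def)
  qed
  from lborel.borel_measurable_lebesgue_integral[OF this]
  have "(\<lambda>z. LINT s|lborel. indicator {0..snd z} s *\<^sub>R ?r (fst z) s) \<in> borel_measurable (M \<Otimes>\<^sub>M leb T)" .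
  then have "(\<lambda>z. exp (- (LINT s|lborel. indicator {0..snd z} s *\<^sub>R ?r (fst z) s))) \<in> borel_measurable (M \<Otimes>\<^sub>M leb T)"
    by measurable
  then show ?thesis
  proof (rule measurable_cong[THEN iffD1, rotated])
    fix z assume "z \<in> space (M \<Otimes>\<^sub>M leb T)"
    then obtain \<omega> t where z: "z = (\<omega>, t)" "t \<in> horizon T" by (auto simp: space_product)
    have "tau T (max 0 s) = s" if "0 \<le> s" "s \<le> t" for s
      using horizon_down[OF z(2) that] that(1) tau_ident[OF T] by (simp add: max_absorb2)
    then show "exp (- (LINT s|lborel. indicator {0..snd z} s *\<^sub>R ?r (fst z) s)) = (case z of (\<omega>, t) \<Rightarrow> discount r \<omega> t)"
      unfolding z discount_def set_lebesgue_integral_def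
      by (auto intro!: Bochner_Integration.integral_cong simp: indicator_def)
  qed
qed

end

section \<open>Prices and limits of contributions\<close>

context filtered
begin

lemma discount_decreasing:
  assumes "(\<lambda>(\<omega>, t). \<rho> \<omega> t) \<in> borel_measurable (M \<Otimes>\<^sub>M leb T)" "\<omega> \<in> space M"
    and "\<And>t. t \<in> horizon T \<Longrightarrow> 0 < \<rho> \<omega> t \<and> \<rho> \<omega> t \<le> K" and st: "0 \<le> s" "s \<le> t" "t \<in> horizon T"
  shows "discount \<rho> \<omega> t \<le> discount \<rho> \<omega> s" "discount \<rho> \<omega> s \<le> 1"
proof -
  have hor: "q \<in> horizon T" if "0 \<le> q" "q \<le> t" for q
    using horizon_down[OF st(3) that] .
  have "\<rho> \<omega> \<in> borel_measurable (leb T)"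
    using measurable_compose[OF measurable_Pair1' assms(1), of \<omega>] assms(2) by simp
  then have m: "(\<lambda>x. indicator (horizon T) x *\<^sub>R \<rho> \<omega> x) \<in> borel_measurable lborel"
    unfolding leb_def using horizon_measurable[OF T] by (subst (asm) borel_measurable_restrict_space_iff) auto
  have int: "integrable lborel (\<lambda>x. indicator {0..q} x *\<^sub>R \<rho> \<omega> x)" if "q \<le> t" for q
  proof (rule Bochner_Integration.integrable_bound[of _ "\<lambda>x. K * indicator {0..q} x"])
    show "(\<lambda>x. indicator {0..q} x *\<^sub>R \<rho> \<omega> x) \<in> borel_measurable lborel"
    proof -
      have "(\<lambda>x. indicator {0..q} x * (indicator (horizon T) x *\<^sub>R \<rho> \<omega> x)) \<in> borel_measurable lborel"
        using m by measurable
      moreover have "indicator {0..q} x * (indicator (horizon T) x *\<^sub>R \<rho> \<omega> x) = indicator {0..q} x *\<^sub>R \<rho> \<omega> x" for x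
        using hor[of x] that by (auto simp: indicator_def)
      ultimately show ?thesis by (simp only:)
    qed
    show "AE x in lborel. norm (indicator {0..q} x *\<^sub>R \<rho> \<omega> x) \<le> norm (K * indicator {0..q} x)"
      using assms(3)[OF hor] that by (intro AE_I2) (force simp: indicator_def)
    have "integrable lborel (indicat_real {0..q})"
      by (rule integrable_real_indicator) (auto simp: emeasure_lborel_Icc_eq)
    then show "integrable lborel (\<lambda>x. K * indicator {0..q} x)" by simp
  qed
  have mono: "(LBINT x:{0..s}. \<rho> \<omega> x) \<le> (LBINT x:{0..t}. \<rho> \<omega> x)"
    unfolding set_lebesgue_integral_def
  proof (rule integral_mono[OF int int])
    fix x show "indicator {0..s} x *\<^sub>R \<rho> \<omega> x \<le> indicator {0..t} x *\<^sub>R \<rho> \<omega> x"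
      using assms(3)[OF hor, of x] st by (auto simp: indicator_def less_imp_le)
  qed (use st in auto)
  then show "discount \<rho> \<omega> t \<le> discount \<rho> \<omega> s" by (simp add: discount_def)
  have "0 \<le> (LBINT x:{0..s}. \<rho> \<omega> x)"
    unfolding set_lebesgue_integral_def
  proof (rule Bochner_Integration.integral_nonneg)
    fix x show "0 \<le> indicator {0..s} x *\<^sub>R \<rho> \<omega> x"
      using assms(3)[OF hor, of x] st by (auto simp: indicator_def less_imp_le)
  qed
  then show "discount \<rho> \<omega> s \<le> 1" by (simp add: discount_def)
qed

text \<open>
  The price is a supermartingale, but discount and martingale need not be adapted and right-continuous,
  respectively. At each time the discount factor agrees with the quotient of two adapted processes.
\<close>

lemma price_good_version:
  assumes "price_process M F T \<psi>"
  obtains \<psi>' where "price M F T \<psi>'" "AE \<omega> in M. \<forall>t\<in>horizon T. \<psi>' \<omega> t = \<psi> \<omega> t"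
    "\<And>t. t \<in> horizon T \<Longrightarrow> (\<integral>\<^sup>+\<omega>. ennreal (\<psi>' \<omega> t) \<partial>M) \<le> 1"
proof -
  obtain \<rho> E where \<psi>: "adapted F T \<psi>" "AE \<omega> in M. right_continuous_on (horizon T) (\<psi> \<omega>)"
    "AE \<omega> in M. \<forall>t\<in>horizon T. 0 < \<psi> \<omega> t"
    and \<rho>: "(\<lambda>(\<omega>, t). \<rho> \<omega> t) \<in> borel_measurable (M \<Otimes>\<^sub>M leb T)" "pos_bounded M T \<rho>"
    and E: "exponential_martingale M F T E" and eq: "\<And>t. t \<in> horizon T \<Longrightarrow> AE \<omega> in M. \<psi> \<omega> t = discount \<rho> \<omega> t * E \<omega> t"
    using assms unfolding price_process_def by blast
  have Em: "\<And>t. t \<in> horizon T \<Longrightarrow> (\<lambda>\<omega>. E \<omega> t) \<in> borel_measurable (F t)"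
    "\<And>t. t \<in> horizon T \<Longrightarrow> integrable M (\<lambda>\<omega>. E \<omega> t)"
    "\<And>s t. s \<in> horizon T \<Longrightarrow> t \<in> horizon T \<Longrightarrow> s \<le> t \<Longrightarrow> AE \<omega> in M. real_cond_exp M (F s) (\<lambda>\<omega>. E \<omega> t) \<omega> = E \<omega> s"
    "AE \<omega> in M. \<forall>t\<in>horizon T. 0 < E \<omega> t" "\<And>t. t \<in> horizon T \<Longrightarrow> (\<integral>\<omega>. E \<omega> t \<partial>M) = 1"
    using E by (auto simp: exponential_martingale_def martingale_on_def adapted_def)
  obtain K where K: "AE \<omega> in M. \<forall>t\<in>horizon T. 0 < \<rho> \<omega> t \<and> \<rho> \<omega> t \<le> K" using \<rho>(2) by (auto simp: pos_bounded_def)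
  have "AE \<omega> in M. right_continuous_on (horizon T) (\<psi> \<omega>) \<and> (\<forall>t\<in>horizon T. 0 < \<psi> \<omega> t)" using \<psi>(2,3) by simp
  then obtain S where S: "S \<in> null_sets M"
    "{\<omega> \<in> space M. \<not> (right_continuous_on (horizon T) (\<psi> \<omega>) \<and> (\<forall>t\<in>horizon T. 0 < \<psi> \<omega> t))} \<subseteq> S"
    unfolding eventually_ae_filter by blast
  \<comment> \<open>On the exceptional null set the price is set to 1. The usual conditions put this
    set into every \<open>F t\<close>, so the process stays adapted.\<close>
  define \<psi>' where "\<psi>' \<omega> t = (if \<omega> \<in> S then 1 else \<psi> \<omega> t)" for \<omega> t
  have AE_S: "AE \<omega> in M. \<omega> \<notin> S" by (rule AE_not_in[OF S(1)])
  have eq': "AE \<omega> in M. \<forall>t\<in>horizon T. \<psi>' \<omega> t = \<psi> \<omega> t" using AE_S by eventually_elim (simp add: \<psi>'_def)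
  have \<psi>'_F: "(\<lambda>\<omega>. \<psi>' \<omega> t) \<in> borel_measurable (F t)" if t: "t \<in> horizon T" for t
    unfolding \<psi>'_def
  proof (rule measurable_If_set)
    show "(\<lambda>\<omega>. \<psi> \<omega> t) \<in> borel_measurable (F t)" using \<psi>(1) t by (auto simp: adapted_def)
    show "S \<inter> space (F t) \<in> sets (F t)" using null_sets_F[OF S(1) t] by simp
  qed simp
  have toM: "f \<in> borel_measurable (F t) \<Longrightarrow> t \<in> horizon T \<Longrightarrow> f \<in> borel_measurable M" for f :: "'a \<Rightarrow> real" and t
    using measurable_from_subalg[OF sub] by blast
  have pos': "0 < \<psi>' \<omega> t" if "\<omega> \<in> space M" "t \<in> horizon T" for \<omega> t
    using S(2) that unfolding \<psi>'_def by auto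
  have disc: "AE \<omega> in M. \<psi>' \<omega> s = discount \<rho> \<omega> s * E \<omega> s \<and> \<psi>' \<omega> t = discount \<rho> \<omega> t * E \<omega> t \<and> 0 < E \<omega> s \<and> 0 < E \<omega> t
      \<and> discount \<rho> \<omega> t \<le> discount \<rho> \<omega> s \<and> 0 < discount \<rho> \<omega> s \<and> discount \<rho> \<omega> s \<le> 1"
    if st: "s \<in> horizon T" "t \<in> horizon T" "s \<le> t" for s t
    using eq[OF st(1)] eq[OF st(2)] eq' Em(4) K AE_space
  proof eventually_elim
    case (elim \<omega>)
    have "discount \<rho> \<omega> t \<le> discount \<rho> \<omega> s" "discount \<rho> \<omega> s \<le> 1"
      using discount_decreasing[OF \<rho>(1) elim(6) _ horizon_nonneg[OF T st(1)] st(3,2), of K] elim(5) by auto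
    then show ?case using elim st by (simp add: discount_def)
  qed
  have nn: "(\<integral>\<^sup>+\<omega>. ennreal (\<psi>' \<omega> t) \<partial>M) \<le> 1" if t: "t \<in> horizon T" for t
  proof -
    have "(\<integral>\<^sup>+\<omega>. ennreal (\<psi>' \<omega> t) \<partial>M) \<le> (\<integral>\<^sup>+\<omega>. ennreal (E \<omega> t) \<partial>M)"
    proof (rule nn_integral_mono_AE)
      show "AE \<omega> in M. ennreal (\<psi>' \<omega> t) \<le> ennreal (E \<omega> t)"
        using disc[OF t t order_refl]
      proof eventually_elim
        case (elim \<omega>)
        then have "discount \<rho> \<omega> t * E \<omega> t \<le> 1 * E \<omega> t" by (intro mult_right_mono) auto
        then show ?case using elim by (intro ennreal_leI) simp
      qed
    qed
    also have "\<dots> = ennreal (\<integral>\<omega>. E \<omega> t \<partial>M)"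
    proof (rule nn_integral_eq_integral[OF Em(2)[OF t]])
      show "AE \<omega> in M. 0 \<le> E \<omega> t" using disc[OF t t order_refl] by eventually_elim auto
    qed
    finally show ?thesis using Em(5)[OF t] by simp
  qed
  have "price M F T \<psi>'"
  proof (unfold_locales, fact T, fact filt)
    show "adapted F T \<psi>'" using \<psi>'_F by (auto simp: adapted_def)
    show "right_continuous_on (horizon T) (\<psi>' \<omega>)" if "\<omega> \<in> space M" for \<omega>
    proof (cases "\<omega> \<in> S")
      case True
      then have "\<psi>' \<omega> = (\<lambda>t. 1)" by (auto simp: \<psi>'_def)
      then show ?thesis by (simp add: right_continuous_on_def)
    next
      case False
      then have "\<psi>' \<omega> = \<psi> \<omega>" by (auto simp: \<psi>'_def)
      then show ?thesis using False S(2) that by auto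
    qed
    show "0 < \<psi>' \<omega> t" if "\<omega> \<in> space M" "t \<in> horizon T" for \<omega> t using pos' that .
    fix s t c k :: real and Z :: "'a \<Rightarrow> real"
    assume st: "s \<in> horizon T" "t \<in> horizon T" "s \<le> t" and Z: "Z \<in> borel_measurable (F s)"
      "\<And>\<omega>. \<omega> \<in> space M \<Longrightarrow> 0 \<le> Z \<omega> \<and> Z \<omega> \<le> k" and c: "0 \<le> c"
    interpret finite_measure_subalgebra M "F s"
      by (unfold_locales) (rule sub[OF st(1)])
    define D where "D \<omega> = min 1 (max 0 (\<psi>' \<omega> s / E \<omega> s))" for \<omega>
    \<comment> \<open>\<open>W\<close> and \<open>R\<close> separate whether the cap
      \<open>c\<close> is active at time \<open>s\<close>. The capped price at \<open>t\<close>
      times \<open>Z\<close> lies below \<open>W * E + R\<close>, with equality at \<open>s\<close>,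
      and \<open>W * E\<close> has the same mean at both times.\<close>
    define W where "W \<omega> = (if D \<omega> * E \<omega> s \<le> c then Z \<omega> * D \<omega> else 0)" for \<omega>
    define R where "R \<omega> = (if D \<omega> * E \<omega> s \<le> c then 0 else c * Z \<omega>)" for \<omega>
    note [measurable] = \<psi>'_F[OF st(1)] Em(1)[OF st(1)] Z(1)
    have D_F [measurable]: "D \<in> borel_measurable (F s)" unfolding D_def by measurable
    have W_F [measurable]: "W \<in> borel_measurable (F s)" unfolding W_def by measurable
    have R_F [measurable]: "R \<in> borel_measurable (F s)" unfolding R_def by measurable
    have bd: "0 \<le> D \<omega>" "D \<omega> \<le> 1" for \<omega> by (auto simp: D_def)
    have Wb: "\<bar>W \<omega>\<bar> \<le> k" if "\<omega> \<in> space M" for \<omega>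
    proof -
      have "\<bar>Z \<omega> * D \<omega>\<bar> \<le> k * 1" unfolding abs_mult using Z(2)[OF that] bd[of \<omega>] by (intro mult_mono) auto
      then show ?thesis using Z(2)[OF that] by (auto simp: W_def)
    qed
    have Rint: "integrable M R"
    proof (rule integrable_const_bound[where B = "c * k"])
      show "AE \<omega> in M. norm (R \<omega>) \<le> c * k"
        using Z(2) c by (intro AE_I2) (auto simp: R_def abs_mult intro!: mult_left_mono mult_nonneg_nonneg intro: order_trans)
    qed (rule toM[OF R_F st(1)])
    have WE: "integrable M (\<lambda>\<omega>. W \<omega> * E \<omega> q)" if q: "q \<in> horizon T" for q
    proof (rule Bochner_Integration.integrable_bound[of _ "\<lambda>\<omega>. k * E \<omega> q"])
      show "integrable M (\<lambda>\<omega>. k * E \<omega> q)" using Em(2)[OF q] by simp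
      show "(\<lambda>\<omega>. W \<omega> * E \<omega> q) \<in> borel_measurable M"
        using toM[OF W_F st(1)] toM[OF Em(1)[OF q] q] by measurable
      show "AE \<omega> in M. norm (W \<omega> * E \<omega> q) \<le> norm (k * E \<omega> q)"
      proof (rule AE_I2)
        fix \<omega> assume "\<omega> \<in> space M"
        then have "\<bar>W \<omega>\<bar> \<le> \<bar>k\<bar>" using Wb[of \<omega>] by linarith
        then show "norm (W \<omega> * E \<omega> q) \<le> norm (k * E \<omega> q)" by (simp add: abs_mult mult_right_mono)
      qed
    qed
    have mart: "(\<integral>\<omega>. W \<omega> * E \<omega> t \<partial>M) = (\<integral>\<omega>. W \<omega> * E \<omega> s \<partial>M)"
    proof -
      have "(\<integral>\<omega>. W \<omega> * E \<omega> t \<partial>M) = (\<integral>\<omega>. W \<omega> * real_cond_exp M (F s) (\<lambda>\<omega>. E \<omega> t) \<omega> \<partial>M)"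
        using real_cond_exp_intg(2)[OF WE[OF st(2)] W_F] toM[OF Em(1)[OF st(2)] st(2)] by simp
      also have "\<dots> = (\<integral>\<omega>. W \<omega> * E \<omega> s \<partial>M)"
        using toM[OF W_F st(1)] toM[OF Em(1)[OF st(1)] st(1)] Em(3)[OF st]
        by (intro integral_cong_AE) (auto elim!: eventually_mono intro: borel_measurable_cond_exp2)
      finally show ?thesis .
    qed
    have minint: "integrable M (\<lambda>\<omega>. min (\<psi>' \<omega> q) c * Z \<omega>)" if q: "q \<in> horizon T" for q
    proof (rule integrable_const_bound[where B = "c * k"])
      show "AE \<omega> in M. norm (min (\<psi>' \<omega> q) c * Z \<omega>) \<le> c * k"
      proof (rule AE_I2)
        fix \<omega> assume \<omega>: "\<omega> \<in> space M"
        have "\<bar>min (\<psi>' \<omega> q) c\<bar> \<le> c" using pos'[OF \<omega> q] c by auto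
        then show "norm (min (\<psi>' \<omega> q) c * Z \<omega>) \<le> c * k"
          unfolding real_norm_def abs_mult using Z(2)[OF \<omega>] c by (intro mult_mono) auto
      qed
      show "(\<lambda>\<omega>. min (\<psi>' \<omega> q) c * Z \<omega>) \<in> borel_measurable M"
        using toM[OF \<psi>'_F[OF q] q] toM[OF Z(1) st(1)] by measurable
    qed
    have D_eq: "AE \<omega> in M. D \<omega> = discount \<rho> \<omega> s"
      using disc[OF st] by eventually_elim (simp add: D_def)
    have "(\<integral>\<omega>. min (\<psi>' \<omega> t) c * Z \<omega> \<partial>M) \<le> (\<integral>\<omega>. W \<omega> * E \<omega> t + R \<omega> \<partial>M)"
    proof (rule integral_mono_AE[OF minint[OF st(2)]])
      show "integrable M (\<lambda>\<omega>. W \<omega> * E \<omega> t + R \<omega>)" using WE[OF st(2)] Rint by simp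
      show "AE \<omega> in M. min (\<psi>' \<omega> t) c * Z \<omega> \<le> W \<omega> * E \<omega> t + R \<omega>"
        using disc[OF st] D_eq AE_space
      proof eventually_elim
        case (elim \<omega>)
        have "\<psi>' \<omega> t \<le> D \<omega> * E \<omega> t" using elim by (simp add: mult_right_mono)
        then have "min (\<psi>' \<omega> t) c * Z \<omega> \<le> (D \<omega> * E \<omega> t) * Z \<omega>" "min (\<psi>' \<omega> t) c * Z \<omega> \<le> c * Z \<omega>"
          using Z(2)[OF elim(3)] by (auto intro!: mult_right_mono simp: min_le_iff_disj)
        then show ?case by (auto simp: W_def R_def ac_simps)
      qed
    qed
    also have "\<dots> = (\<integral>\<omega>. W \<omega> * E \<omega> s + R \<omega> \<partial>M)" using WE st Rint mart by simp
    also have "\<dots> = (\<integral>\<omega>. min (\<psi>' \<omega> s) c * Z \<omega> \<partial>M)"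
    proof (rule integral_cong_AE)
      show "(\<lambda>\<omega>. W \<omega> * E \<omega> s + R \<omega>) \<in> borel_measurable M" "(\<lambda>\<omega>. min (\<psi>' \<omega> s) c * Z \<omega>) \<in> borel_measurable M"
        using WE[OF st(1)] Rint minint[OF st(1)] by auto
      show "AE \<omega> in M. W \<omega> * E \<omega> s + R \<omega> = min (\<psi>' \<omega> s) c * Z \<omega>"
        using disc[OF st] D_eq by eventually_elim (auto simp: W_def R_def min_def)
    qed
    finally show "(\<integral>\<omega>. min (\<psi>' \<omega> t) c * Z \<omega> \<partial>M) \<le> (\<integral>\<omega>. min (\<psi>' \<omega> s) c * Z \<omega> \<partial>M)" .
  qed
  then show ?thesis using eq' nn by (rule that)
qed

end

text \<open>The given sequence converges only at almost every time, so a path is built from the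
  lower limit at all times and then made right-continuous. The lower bound at strictly later times
  is what survives this and what \<open>cost_lsc\<close> asks for. A monotone function has countably
  many discontinuities, so the path agrees with the limit almost everywhere.\<close>

lemma liminf_path:
  fixes c :: "nat \<Rightarrow> real \<Rightarrow> real"
  assumes T: "0 < T" and c: "\<And>k. good_path T (c k)"
    and fin: "\<And>m::nat. liminf (\<lambda>k. ennreal (c k (tau T (real m)))) \<noteq> \<infinity>"
  defines "g \<equiv> \<lambda>s. enn2real (liminf (\<lambda>k. ennreal (c k (tau T s))))"
  defines "D \<equiv> \<lambda>t. INF q\<in>{q\<in>\<rat>. t < q}. g q"
  shows "\<And>s t. 0 \<le> s \<Longrightarrow> s \<le> t \<Longrightarrow> g s \<le> g t"
    and "good_path T D"
    and "\<And>s t \<delta>. 0 \<le> s \<Longrightarrow> s < t \<Longrightarrow> 0 < \<delta> \<Longrightarrow> \<forall>\<^sub>F k in sequentially. D (tau T s) - \<delta> \<le> c k (tau T t)"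
    and "\<And>l. AE t in leb T. (\<lambda>k. c k t) \<longlonglongrightarrow> l t \<Longrightarrow> AE t in leb T. D t = l t"
proof -
  let ?l = "\<lambda>s. liminf (\<lambda>k. ennreal (c k (tau T s)))"
  have l_mono: "?l s \<le> ?l t" if "0 \<le> s" "s \<le> t" for s t
    using c tau_mono[OF T that(2)] tau_horizon[OF T that(1)] tau_horizon[OF T order_trans[OF that]]
    by (intro Liminf_mono always_eventually allI ennreal_leI) (auto simp: good_path_def mono_on_def)
  have l_fin: "?l s \<noteq> \<infinity>" if "0 \<le> s" for s
  proof -
    obtain m :: nat where "s \<le> real m" using real_arch_simple by blast
    then show ?thesis using l_mono[OF that, of "real m"] fin[of m] by (auto simp: top_unique)
  qed
  then have g_eq: "ennreal (g s) = ?l s" if "0 \<le> s" for s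
    using that by (simp add: g_def less_top)
  show mono: "g s \<le> g t" if "0 \<le> s" "s \<le> t" for s t
    using l_mono[OF that] l_fin[of t] that by (auto simp: g_def less_top intro!: enn2real_mono)
  have nn: "0 \<le> g s" for s by (simp add: g_def)
  have path: "0 \<le> t \<Longrightarrow> g t \<le> D t" "0 \<le> t \<Longrightarrow> t < s \<Longrightarrow> D t \<le> g s" "0 \<le> s \<Longrightarrow> s \<le> t \<Longrightarrow> D s \<le> D t"
    "0 \<le> t \<Longrightarrow> (D \<longlongrightarrow> D t) (at_right t)" "countable {t\<in>{0..}. D t \<noteq> g t}" for s t
    unfolding D_def
    by (rule right_limit_ge right_limit_le right_limit_mono right_limit_cont right_limit_countable; use mono nn in auto)+
  have D0: "0 \<le> D t" if "0 \<le> t" for t using path(1)[OF that] nn[of t] by linarith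
  show "good_path T D"
    unfolding good_path_def right_continuous_on_def mono_on_def
  proof (intro conjI ballI allI impI)
    fix t assume "t \<in> horizon T"
    then show "(D \<longlongrightarrow> D t) (at t within horizon T \<inter> {t<..})" "0 \<le> D t"
      using tendsto_within_subset[OF path(4)] D0 horizon_nonneg[OF T] by auto
  qed (use path(3) horizon_nonneg[OF T] in auto)
  show "\<forall>\<^sub>F k in sequentially. D (tau T s) - \<delta> \<le> c k (tau T t)" if st: "0 \<le> s" "s < t" and \<delta>: "0 < \<delta>" for s t \<delta>
  proof (cases "D (tau T s) - \<delta> < 0")
    case True
    have "0 \<le> c k (tau T t)" for k using c[of k] tau_horizon[OF T, of t] st by (auto simp: good_path_def)
    then show ?thesis using True by (intro always_eventually allI) (smt (verit))
  next
    case False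
    have "tau T s < t" using tau_le[OF T, of s] st by linarith
    then have "D (tau T s) \<le> g t" using path(2) horizon_nonneg[OF T tau_horizon[OF T st(1)]] by blast
    then have "ennreal (D (tau T s) - \<delta>) < ennreal (g t)" using False \<delta> by (intro ennreal_lessI) auto
    then have "ennreal (D (tau T s) - \<delta>) < ?l t" using g_eq[of t] st by simp
    from less_LiminfD[OF this] show ?thesis
    proof eventually_elim
      case (elim k)
      then show ?case using False by (simp add: ennreal_less_iff)
    qed
  qed
  show "AE t in leb T. D t = l t" if lim: "AE t in leb T. (\<lambda>k. c k t) \<longlonglongrightarrow> l t" for l
  proof -
    have "AE t in lborel. t \<notin> {t\<in>{0..}. D t \<noteq> g t}"
      using countable_imp_null_set_lborel[OF path(5)] by (rule AE_not_in)
    then have "AE t in leb T. t \<notin> {t\<in>{0..}. D t \<noteq> g t}"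
      using horizon_measurable[OF T] unfolding leb_def by (subst AE_restrict_space_iff) (auto elim: eventually_mono)
    moreover have "AE t in leb T. t \<in> horizon T"
      using horizon_measurable[OF T] by (intro AE_I2) (simp add: leb_def)
    ultimately show ?thesis using lim
    proof eventually_elim
      case (elim t)
      have "(\<lambda>k. ennreal (c k t)) \<longlonglongrightarrow> ennreal (l t)" using elim by (intro tendsto_ennrealI)
      then have "?l t = ennreal (l t)"
        using elim(2) tau_ident[OF T] by (simp add: lim_imp_Liminf)
      moreover have "0 \<le> l t"
        using elim(2) c by (intro tendsto_lowerbound[OF elim(3)] always_eventually) (auto simp: good_path_def)
      ultimately show ?case using elim horizon_nonneg[OF T] by (auto simp: g_def)
    qed
  qed
qed

text \<open>
  The limit is only known almost everywhere in time. The right limits of \<open>liminf\<^sub>k Cs k\<close>, which is finite by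
  Fatou's lemma, give a version with good paths; it is adapted by the usual conditions.
\<close>

lemma (in filtered) limit_contribution:
  assumes price: "price M F T \<psi>"
    and Cs: "\<And>k. optional_process M F T (Cs k)" "\<And>k \<omega> t. \<omega> \<in> space M \<Longrightarrow> t \<in> horizon T \<Longrightarrow> 0 \<le> Cs k \<omega> t"
      "\<And>k. AE \<omega> in M. good_path T (Cs k \<omega>)"
    and L: "L \<in> borel_measurable (M \<Otimes>\<^sub>M leb T)"
      "AE z in M \<Otimes>\<^sub>M leb T. (\<lambda>k. Cs k (fst z) (snd z)) \<longlonglongrightarrow> L z"
    and cost: "\<And>k. contribution_cost M T \<psi> (Cs k) \<le> ennreal (Bs k)" "Bs \<longlonglongrightarrow> \<beta>"
  obtains C where "optional_process M F T C" "\<And>\<omega>. \<omega> \<in> space M \<Longrightarrow> good_path T (C \<omega>)"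
    "AE z in M \<Otimes>\<^sub>M leb T. C (fst z) (snd z) = L z" "contribution_cost M T \<psi> C \<le> ennreal \<beta>"
proof -
  interpret c: price M F T \<psi> by fact
  have contrib: "c.contrib (Cs k)" for k
    unfolding c.contrib_def using Cs optional_imp_adapted by blast
  have fin: "AE \<omega> in M. liminf (\<lambda>k. ennreal (Cs k \<omega> (tau T (real m)))) \<noteq> \<infinity>" for m :: nat
  proof -
    \<comment> \<open>\<open>Suc m\<close> instead of \<open>m\<close>: for \<open>m = 0\<close> the
      price capped at \<open>m\<close> would be 0, and a weighted bound would say nothing.\<close>
    define W where "W \<omega> = min (\<psi> \<omega> (tau T (real (Suc m)))) (real (Suc m))" for \<omega>
    have hor: "tau T (real m) \<in> horizon T" "tau T (real m) \<le> real (Suc m)"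
      using tau_horizon[OF T, of "real m"] tau_le[OF T, of "real m"] by auto
    have meas: "(\<lambda>\<omega>. ennreal (W \<omega> * Cs k \<omega> (tau T (real m)))) \<in> borel_measurable M" for k
      unfolding W_def using c.psi_measurable[OF tau_horizon[OF T]] c.contrib_measurable[OF contrib hor(1)] by measurable
    have le: "(\<integral>\<^sup>+\<omega>. ennreal (W \<omega> * Cs k \<omega> (tau T (real m))) \<partial>M) \<le> ennreal (Bs k)" for k
      using c.weighted_le_cost[OF contrib hor, of k] cost(1)[of k] unfolding W_def by (rule order_trans)
    have "(\<integral>\<^sup>+\<omega>. liminf (\<lambda>k. ennreal (W \<omega> * Cs k \<omega> (tau T (real m)))) \<partial>M)
        \<le> liminf (\<lambda>k. \<integral>\<^sup>+\<omega>. ennreal (W \<omega> * Cs k \<omega> (tau T (real m))) \<partial>M)"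
      using meas by (rule nn_integral_liminf)
    also have "\<dots> \<le> liminf (\<lambda>k. ennreal (Bs k))" using le by (intro Liminf_mono always_eventually) auto
    also have "\<dots> = ennreal \<beta>" using cost(2) by (intro lim_imp_Liminf tendsto_ennrealI) auto
    finally have "(\<integral>\<^sup>+\<omega>. liminf (\<lambda>k. ennreal (W \<omega> * Cs k \<omega> (tau T (real m)))) \<partial>M) \<noteq> \<infinity>" by (auto simp: top_unique)
    then have "AE \<omega> in M. liminf (\<lambda>k. ennreal (W \<omega> * Cs k \<omega> (tau T (real m)))) \<noteq> \<infinity>"
      using meas by (intro nn_integral_PInf_AE) auto
    then show ?thesis using AE_space
    proof eventually_elim
      case (elim \<omega>)
      have W: "0 < W \<omega>" using c.pos[OF elim(2) tau_horizon[OF T]] by (simp add: W_def)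
      show ?case
      proof
        assume "liminf (\<lambda>k. ennreal (Cs k \<omega> (tau T (real m)))) = \<infinity>"
        then have lim: "(\<lambda>k. ennreal (Cs k \<omega> (tau T (real m)))) \<longlonglongrightarrow> \<infinity>"
          using Liminf_le_Limsup[of sequentially "\<lambda>k. ennreal (Cs k \<omega> (tau T (real m)))"]
          by (intro Liminf_eq_Limsup) (auto simp: top_unique)
        have "(\<lambda>k. ennreal (W \<omega>) * ennreal (Cs k \<omega> (tau T (real m)))) \<longlonglongrightarrow> ennreal (W \<omega>) * \<infinity>"
          using lim W by (intro ennreal_tendsto_cmult) auto
        then have "(\<lambda>k. ennreal (W \<omega> * Cs k \<omega> (tau T (real m)))) \<longlonglongrightarrow> \<infinity>"
          using W Cs(2)[OF elim(2) hor(1)] by (simp add: ennreal_mult ennreal_mult_top less_imp_le)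
        then show False using elim(1) lim_imp_Liminf[of sequentially] by auto
      qed
    qed
  qed
  have "AE \<omega> in M. (\<forall>k. good_path T (Cs k \<omega>)) \<and> (\<forall>m::nat. liminf (\<lambda>k. ennreal (Cs k \<omega> (tau T (real m)))) \<noteq> \<infinity>)"
    using Cs(3) fin by (simp add: AE_all_countable)
  then obtain S where S: "S \<in> null_sets M" "{\<omega> \<in> space M. \<not> ((\<forall>k. good_path T (Cs k \<omega>)) \<and>
      (\<forall>m::nat. liminf (\<lambda>k. ennreal (Cs k \<omega> (tau T (real m)))) \<noteq> \<infinity>))} \<subseteq> S"
    unfolding eventually_ae_filter by blast
  have AE_S: "AE \<omega> in M. \<omega> \<notin> S" by (rule AE_not_in[OF S(1)])
  have good: "good_path T (Cs k \<omega>)" "liminf (\<lambda>k. ennreal (Cs k \<omega> (tau T (real m)))) \<noteq> \<infinity>"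
    if "\<omega> \<in> space M" "\<omega> \<notin> S" for \<omega> k and m :: nat using S(2) that by auto
  define g where "g \<omega> s = enn2real (liminf (\<lambda>k. ennreal (Cs k \<omega> (tau T s))))" for \<omega> s
  define C where "C \<omega> t = (if \<omega> \<in> S then 0 else INF q\<in>{q\<in>\<rat>. t < q}. g \<omega> q)" for \<omega> t
  note lim = liminf_path[OF T good, folded g_def]
  have C_eq: "C \<omega> = (\<lambda>t. INF q\<in>{q\<in>\<rat>. t < q}. g \<omega> q)" if "\<omega> \<notin> S" for \<omega>
    using that by (simp add: C_def fun_eq_iff)
  have C_good: "good_path T (C \<omega>)" if "\<omega> \<in> space M" for \<omega>
  proof (cases "\<omega> \<in> S")
    case True
    then have "C \<omega> = (\<lambda>t. 0)" by (simp add: C_def fun_eq_iff)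
    then show ?thesis by (simp add: good_path_def right_continuous_on_def mono_on_def)
  next
    case False
    then show ?thesis using lim(2)[OF that False that False] C_eq[OF False] by simp
  qed
  have g_F: "(\<lambda>\<omega>. g \<omega> q) \<in> borel_measurable (F v)" if v: "0 \<le> q" "v \<in> horizon T" "tau T q \<le> v" for q v
  proof -
    have [measurable]: "(\<lambda>\<omega>. Cs k \<omega> (tau T q)) \<in> borel_measurable (F v)" for k
      using c.measurable_F_mono[OF c.contribD(3)[OF contrib tau_horizon[OF T v(1)]] tau_horizon[OF T v(1)] v(2,3)] .
    show ?thesis unfolding g_def by measurable
  qed
  \<comment> \<open>Stated with \<open>v\<close> to serve two cases. Before the horizon
    \<open>v\<close> is any later time, and right-continuity of the filtration then yields
    \<open>F t\<close>. At \<open>t = T\<close> all stopped times are at most \<open>T\<close>, so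
    \<open>v = t\<close> is possible.\<close>
  have C_F: "(\<lambda>\<omega>. C \<omega> t) \<in> borel_measurable (F v)"
    if t: "t \<in> horizon T" "t < s" and v: "v \<in> horizon T" "\<And>q. t < q \<Longrightarrow> q < s \<Longrightarrow> tau T q \<le> v" for t s v
  proof -
    have t0: "0 \<le> t" using horizon_nonneg[OF T t(1)] .
    have "(\<lambda>\<omega>. if \<omega> \<in> S then 0 else INF q\<in>{q\<in>\<rat>. t < q \<and> q < s}. g \<omega> q) \<in> borel_measurable (F v)"
    proof (rule measurable_If_set)
      show "S \<inter> space (F v) \<in> sets (F v)" using null_sets_F[OF S(1) v(1)] by simp
      show "(\<lambda>\<omega>. INF q\<in>{q\<in>\<rat>. t < q \<and> q < s}. g \<omega> q) \<in> borel_measurable (F v)"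
      proof (rule borel_measurable_cINF)
        show "countable {q\<in>\<rat>. t < q \<and> q < s}" by (rule countable_subset[OF _ countable_rat]) auto
        show "bdd_below ((\<lambda>q. g \<omega> q) ` {q\<in>\<rat>. t < q \<and> q < s})" for \<omega>
          by (rule bdd_belowI[of _ 0]) (auto simp: g_def)
      qed (use g_F v t0 in auto)
    qed simp
    then show ?thesis
    proof (rule measurable_cong[THEN iffD1, rotated])
      fix \<omega> assume "\<omega> \<in> space (F v)"
      then have "\<omega> \<in> space M" using space_F v(1) by simp
      then show "(if \<omega> \<in> S then 0 else INF q\<in>{q\<in>\<rat>. t < q \<and> q < s}. g \<omega> q) = C \<omega> t"
        unfolding C_def using right_limit_INF_bounded[of "g \<omega>", OF lim(1) _ t0 t(2)] by (auto simp: g_def)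
    qed
  qed
  have "adapted F T C"
    unfolding adapted_def
  proof
    fix t assume t: "t \<in> horizon T"
    have tT: "ereal t \<le> T" using t by (simp add: horizon_def)
    show "(\<lambda>\<omega>. C \<omega> t) \<in> borel_measurable (F t)"
    proof (cases "ereal t < T")
      case True
      have eq: "sets (F t) = (\<Inter>s\<in>{s\<in>horizon T. t < s}. sets (F s))"
        using usual t True by (auto simp: usual_conditions_def)
      show ?thesis
      proof (rule measurableI)
        fix B :: "real set" assume B: "B \<in> sets borel"
        have "(\<lambda>\<omega>. C \<omega> t) -` B \<inter> space M \<in> sets (F s)" if "s \<in> horizon T" "t < s" for s
        proof -
          have "(\<lambda>\<omega>. C \<omega> t) \<in> borel_measurable (F s)"
            by (rule C_F[OF t that(2,1)]) (use tau_le[OF T] in \<open>auto intro: order_trans less_imp_le\<close>)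
          from measurable_sets[OF this B] show ?thesis using space_F[OF that(1)] by simp
        qed
        then show "(\<lambda>\<omega>. C \<omega> t) -` B \<inter> space (F t) \<in> sets (F t)" unfolding eq space_F[OF t] by blast
      qed simp
    next
      case False
      have "tau T q \<le> t" for q
        using False tT by (cases rule: tau_cases[OF T]) auto
      then show ?thesis by (intro C_F[OF t, of "t + 1"] t) auto
    qed
  qed
  then have cad: "cadlag_adapted M F T C"
    using C_good mono_on_has_left_limits by (auto simp: cadlag_adapted_def good_path_def)
  then have opt: "optional_process M F T C" by (rule cadlag_imp_optional)
  have C_contrib: "c.contrib C"
    unfolding c.contrib_def using cad C_good by (auto simp: cadlag_adapted_def good_path_def intro!: AE_I2)
  have eq: "AE z in M \<Otimes>\<^sub>M leb T. C (fst z) (snd z) = L z"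
  proof -
    have "AE \<omega> in M. AE t in leb T. (\<lambda>k. Cs k \<omega> t) \<longlonglongrightarrow> L (\<omega>, t)"
      using P.AE_pair[OF L(2)] by simp
    then have "AE \<omega> in M. AE t in leb T. C \<omega> t = L (\<omega>, t)"
      using AE_S AE_space
    proof eventually_elim
      case (elim \<omega>)
      show ?case using lim(4)[OF elim(3,2,3,2,1)] C_eq[OF elim(2)] by simp
    qed
    moreover have "{z \<in> space (M \<Otimes>\<^sub>M leb T). C (fst z) (snd z) = L z} \<in> sets (M \<Otimes>\<^sub>M leb T)"
      using optional_product_measurable[OF opt] L(1) unfolding split_def by measurable
    ultimately show ?thesis by (intro P.AE_pair_measure) auto
  qed
  \<comment> \<open>\<open>cost_lsc\<close> wants nonnegative bounds, and \<open>ennreal\<close>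
    does not distinguish negative numbers from 0.\<close>
  have "contribution_cost M T \<psi> C \<le> ennreal (max 0 \<beta>)"
  proof (rule c.cost_lsc[OF C_contrib contrib])
    show "contribution_cost M T \<psi> (Cs k) \<le> ennreal (max 0 (Bs k))" for k
      using cost(1)[of k] by (rule order_trans) (auto intro: ennreal_leI)
    show "(\<lambda>k. max 0 (Bs k)) \<longlonglongrightarrow> max 0 \<beta>" using cost(2) by (intro tendsto_intros)
    show "AE \<omega> in M. \<forall>s t \<delta>. 0 \<le> s \<longrightarrow> s < t \<longrightarrow> 0 < \<delta> \<longrightarrow>
        (\<forall>\<^sub>F k in sequentially. C \<omega> (tau T s) - \<delta> \<le> Cs k \<omega> (tau T t))"
      using AE_S AE_space
    proof eventually_elim
      case (elim \<omega>)
      show ?case unfolding C_eq[OF elim(1)] by (intro allI impI lim(3)[OF elim(2,1,2,1)])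
    qed
  qed simp
  also have "ennreal (max 0 \<beta>) = ennreal \<beta>" by (simp add: max_def ennreal_neg)
  finally show ?thesis using that[OF opt C_good eq] by blast
qed

section \<open>The contribution game\<close>

text \<open>Equality almost everywhere provides points of equality arbitrarily close on the right of
  any \<open>t\<close> before \<open>T\<close>, and right-continuity does the rest. At the terminal
  time itself there is nothing to the right, and a single point is a null set.\<close>

lemma good_path_AE_eq_iff:
  assumes T: "0 < T" and f: "good_path T f" and g: "good_path T g"
  shows "(AE t in leb T. f t = g t) \<longleftrightarrow> (\<forall>t. 0 \<le> t \<and> ereal t < T \<longrightarrow> f t = g t)"
proof (intro iffI allI impI)
  fix t assume ae: "AE t in leb T. f t = g t" and t: "0 \<le> t \<and> ereal t < T"
  have th: "t \<in> horizon T" using t by (auto simp: horizon_def)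
  have "AE s in lborel. s \<in> horizon T \<longrightarrow> f s = g s"
    using ae horizon_measurable[OF T] unfolding leb_def by (subst (asm) AE_restrict_space_iff) auto
  then obtain S where S: "S \<in> null_sets lborel" "{s. \<not> (s \<in> horizon T \<longrightarrow> f s = g s)} \<subseteq> S"
    unfolding eventually_ae_filter by auto
  have "\<exists>s. t < s \<and> s < t + 1 / real (Suc n) \<and> s \<in> horizon T \<and> f s = g s" for n
  proof (rule ccontr)
    \<comment> \<open>Stopping the right end keeps the interval inside the horizon, and
      \<open>t < T\<close> keeps it nonempty, so no null set contains it.\<close>
    define b where "b = tau T (t + 1 / real (Suc n))"
    have b: "t < b" "b \<le> t + 1 / real (Suc n)" "b \<in> horizon T"
      using tau_less[OF T, of t "t + 1 / real (Suc n)"] tau_le[OF T] tau_horizon[OF T] t by (auto simp: b_def)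
    have hor: "s \<in> horizon T" if "t < s" "s < b" for s
      using horizon_down[OF b(3)] that t by auto
    assume "\<nexists>s. t < s \<and> s < t + 1 / real (Suc n) \<and> s \<in> horizon T \<and> f s = g s"
    then have "{t<..<b} \<subseteq> S" using S(2) b(2) hor by fastforce
    then have "emeasure lborel {t<..<b} \<le> emeasure lborel S" using S(1) by (intro emeasure_mono) auto
    then show False using S(1) b(1) by (simp add: null_sets_def ennreal_eq_0_iff)
  qed
  then obtain \<sigma> where \<sigma>: "\<And>n. t < \<sigma> n" "\<And>n. \<sigma> n < t + 1 / real (Suc n)" "\<And>n. \<sigma> n \<in> horizon T" "\<And>n. f (\<sigma> n) = g (\<sigma> n)"
    by metis
  have "(\<lambda>n. t + 1 / real (Suc n)) \<longlonglongrightarrow> t + 0"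
    by (intro tendsto_intros LIMSEQ_Suc[OF lim_1_over_n])
  then have "\<sigma> \<longlonglongrightarrow> t"
    using \<sigma>(1,2)
    by (intro tendsto_sandwich[where f = "\<lambda>_. t" and g = \<sigma> and h = "\<lambda>n. t + 1 / real (Suc n)"] always_eventually allI)
      (auto intro: less_imp_le)
  then have "(\<lambda>n. h (\<sigma> n)) \<longlonglongrightarrow> h t" if "good_path T h" for h
    using right_continuous_sequentially[OF T, of h t \<sigma>] that \<sigma>(1,3) t tau_ident[OF T] th
    by (auto simp: good_path_def less_imp_le)
  from this[OF f] this[OF g] show "f t = g t" unfolding \<sigma>(4) by (rule LIMSEQ_unique)
next
  assume eq: "\<forall>t. 0 \<le> t \<and> ereal t < T \<longrightarrow> f t = g t"
  have "AE t in lborel. t \<in> horizon T \<longrightarrow> f t = g t"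
  proof (rule AE_I')
    show "{real_of_ereal T} \<in> null_sets lborel" by (simp add: null_sets_def)
    show "{t \<in> space lborel. \<not> (t \<in> horizon T \<longrightarrow> f t = g t)} \<subseteq> {real_of_ereal T}"
    proof
      fix t assume "t \<in> {t \<in> space lborel. \<not> (t \<in> horizon T \<longrightarrow> f t = g t)}"
      then have "0 \<le> t" "ereal t \<le> T" "\<not> ereal t < T" using eq by (auto simp: horizon_def)
      then have "T = ereal t" by (simp add: less_le)
      then show "t \<in> {real_of_ereal T}" by simp
    qed
  qed
  then show "AE t in leb T. f t = g t"
    using horizon_measurable[OF T] unfolding leb_def by (subst AE_restrict_space_iff) auto
qed

section \<open>Budgets and costs on the product space\<close>

context filtered
begin

definition contributions :: "('a \<times> real \<Rightarrow> real) set" where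
  "contributions = {C \<in> consumptions G. AE \<omega> in M. good_path T (\<lambda>t. C (\<omega>, t))}"

lemma consumptions_iff:
  "case_prod x \<in> consumptions G \<longleftrightarrow> optional_process M F T x \<and> (\<forall>\<omega>\<in>space M. \<forall>t\<in>horizon T. 0 \<le> x \<omega> t)"
  by (auto simp: consumptions_def optional_process_def space_optional)

lemma contributions_D:
  assumes "C \<in> contributions"
  shows "C \<in> consumptions G" "optional_process M F T (curry C)" "\<And>\<omega> t. \<omega> \<in> space M \<Longrightarrow> t \<in> horizon T \<Longrightarrow> 0 \<le> C (\<omega>, t)"
    "AE \<omega> in M. good_path T (\<lambda>t. C (\<omega>, t))"
  using assms by (auto simp: contributions_def consumptions_def optional_process_def space_optional)

lemma contributions_contrib:
  assumes "C \<in> contributions" "price M F T \<psi>"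
  shows "price.contrib M F T (curry C)"
  using contributions_D[OF assms(1)] optional_imp_adapted
  unfolding price.contrib_def[OF assms(2)] by (auto simp: curry_def)

text \<open>The factor \<open>exp (- t)\<close> turns time into a finite measure even on an infinite
  horizon; both the weight \<rho> and the bundle \<open>h\<close> are built from it.\<close>

lemma exp_leb: "(\<integral>\<^sup>+t. ennreal (exp (- t)) \<partial>leb T) \<le> 1"
proof -
  have "(\<integral>\<^sup>+t. ennreal (exp (- t)) \<partial>leb T) = (\<integral>\<^sup>+t. ennreal (exp (- t)) * indicator (horizon T) t \<partial>lborel)"
    unfolding leb_def using horizon_measurable[OF T] by (intro nn_integral_restrict_space) simp
  also have "\<dots> \<le> (\<integral>\<^sup>+t. ennreal (t ^ 0 * exp (- t)) * indicator {0..} t \<partial>lborel)"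
    using horizon_nonneg[OF T] by (intro nn_integral_mono) (auto simp: indicator_def)
  also have "\<dots> = 1" by (subst nn_intergal_power_times_exp_Ici) simp
  finally show ?thesis .
qed

lemma exp_optional: "(\<lambda>(\<omega>, t). exp (- t)) \<in> borel_measurable G"
proof -
  have "optional_process M F T (\<lambda>\<omega> t. exp (- t))"
  proof (rule cadlag_imp_optional)
    have lim: "((\<lambda>t. exp (- t)) \<longlongrightarrow> exp (- t)) (at t within S)" for t :: real and S
      by (intro tendsto_intros)
    then show "cadlag_adapted M F T (\<lambda>\<omega> t. exp (- t))"
      by (auto simp: cadlag_adapted_def adapted_def right_continuous_on_def has_left_limits_on_def)
  qed
  then show ?thesis by (simp add: optional_process_def)
qed

lemma product_exp_bound:
  assumes f: "f \<in> borel_measurable (M \<Otimes>\<^sub>M leb T)"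
    and b: "\<And>t. t \<in> horizon T \<Longrightarrow> (\<integral>\<^sup>+\<omega>. f (\<omega>, t) \<partial>M) \<le> \<beta>"
  shows "(\<integral>\<^sup>+z. ennreal (exp (- snd z)) * f z \<partial>(M \<Otimes>\<^sub>M leb T)) \<le> \<beta>"
proof -
  have e: "(\<lambda>t. ennreal (exp (- t))) \<in> borel_measurable (leb T)"
    by (rule measurable_compose[OF measurable_leb[of "\<lambda>t. exp (- t)"] measurable_ennreal]) simp
  have m: "(\<lambda>z. ennreal (exp (- snd z)) * f z) \<in> borel_measurable (M \<Otimes>\<^sub>M leb T)"
    using measurable_compose[OF measurable_snd e] f by measurable
  have "(\<integral>\<^sup>+z. ennreal (exp (- snd z)) * f z \<partial>(M \<Otimes>\<^sub>M leb T)) = (\<integral>\<^sup>+t. \<integral>\<^sup>+\<omega>. ennreal (exp (- t)) * f (\<omega>, t) \<partial>M \<partial>leb T)"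
    using P.nn_integral_snd[OF m] by simp
  also have "\<dots> \<le> (\<integral>\<^sup>+t. ennreal (exp (- t)) * \<beta> \<partial>leb T)"
  proof (rule nn_integral_mono)
    fix t assume "t \<in> space (leb T)"
    then have t: "t \<in> horizon T" by (simp add: space_leb)
    have "(\<lambda>\<omega>. f (\<omega>, t)) \<in> borel_measurable M"
      using measurable_compose[OF measurable_Pair2' f, of t] t by (simp add: space_leb)
    then show "(\<integral>\<^sup>+\<omega>. ennreal (exp (- t)) * f (\<omega>, t) \<partial>M) \<le> ennreal (exp (- t)) * \<beta>"
      using b[OF t] by (simp add: nn_integral_cmult mult_left_mono)
  qed
  also have "\<dots> = (\<integral>\<^sup>+t. ennreal (exp (- t)) \<partial>leb T) * \<beta>" using e by (rule nn_integral_multc)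
  also have "\<dots> \<le> 1 * \<beta>" using exp_leb by (intro mult_right_mono) auto
  finally show ?thesis by simp
qed

lemma product_nontrivial: "emeasure (M \<Otimes>\<^sub>M leb T) (space (M \<Otimes>\<^sub>M leb T)) \<noteq> 0"
proof -
  have b: "0 < tau T 1" using tau_less[OF T, of 0 1] T by (simp add: zero_ereal_def)
  have sub: "{0..tau T 1} \<subseteq> horizon T"
    using horizon_down[OF tau_horizon[OF T, of 1]] by auto
  have "emeasure lborel {0..tau T 1} \<le> emeasure lborel (horizon T)"
    using sub horizon_measurable[OF T] by (intro emeasure_mono) auto
  then have "emeasure (leb T) (horizon T) \<noteq> 0"
    unfolding leb_def using b horizon_measurable[OF T] by (auto simp: emeasure_restrict_space)
  moreover have "emeasure (M \<Otimes>\<^sub>M leb T) (space (M \<Otimes>\<^sub>M leb T)) = emeasure M (space M) * emeasure (leb T) (horizon T)"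
    unfolding space_product space_leb[symmetric] by (intro P.M2.emeasure_pair_measure_Times) auto
  ultimately show ?thesis by (simp add: emeasure_space_1)
qed

lemma price_product_measurable:
  assumes "price M F T \<psi>" shows "(\<lambda>z. \<psi> (fst z) (snd z)) \<in> borel_measurable (M \<Otimes>\<^sub>M leb T)"
proof -
  interpret c: price M F T \<psi> by fact
  show ?thesis using right_continuous_measurable[OF c.psi_measurable c.rc] by (simp add: split_def)
qed

text \<open>
  By the supermartingale property, a contribution at time \<open>t\<close> weighted with the price at a fixed later time, here the next
  integer, is bounded by the cost of the contribution.
\<close>

definition floor_weight :: "('a \<Rightarrow> real \<Rightarrow> real) \<Rightarrow> 'a \<times> real \<Rightarrow> real" where
  "floor_weight \<psi> z = (let m = real (nat \<lfloor>snd z\<rfloor> + 1) in min (\<psi> (fst z) (tau T m)) m)"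

lemma floor_weight:
  assumes "price M F T \<psi>"
  shows floor_weight_measurable: "floor_weight \<psi> \<in> borel_measurable (M \<Otimes>\<^sub>M leb T)"
    and floor_weight_pos: "z \<in> space (M \<Otimes>\<^sub>M leb T) \<Longrightarrow> 0 < floor_weight \<psi> z"
    and floor_weight_le_cost: "C \<in> contributions \<Longrightarrow> t \<in> horizon T \<Longrightarrow>
      (\<integral>\<^sup>+\<omega>. ennreal (floor_weight \<psi> (\<omega>, t) * C (\<omega>, t)) \<partial>M) \<le> contribution_cost M T \<psi> (curry C)"
proof -
  interpret c: price M F T \<psi> by fact
  have "(\<lambda>z. nat \<lfloor>snd z\<rfloor> + 1) \<in> (M \<Otimes>\<^sub>M leb T) \<rightarrow>\<^sub>M count_space UNIV"
  proof -
    have "(\<lambda>t::real. nat \<lfloor>t\<rfloor> + 1) \<in> leb T \<rightarrow>\<^sub>M count_space UNIV"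
      unfolding leb_def by (intro measurable_restrict_space1) measurable
    from measurable_compose[OF measurable_snd this] show ?thesis .
  qed
  moreover have "(\<lambda>z. min (\<psi> (fst z) (tau T (real m))) (real m)) \<in> borel_measurable (M \<Otimes>\<^sub>M leb T)" for m
    using measurable_compose[OF measurable_fst c.psi_measurable[OF tau_horizon[OF T]], of "real m"] by measurable
  ultimately show "floor_weight \<psi> \<in> borel_measurable (M \<Otimes>\<^sub>M leb T)"
    unfolding floor_weight_def Let_def
    by (rule measurable_compose_countable[where f = "\<lambda>m z. min (\<psi> (fst z) (tau T (real m))) (real m)", rotated])
  show "0 < floor_weight \<psi> z" if "z \<in> space (M \<Otimes>\<^sub>M leb T)"
    using that c.pos[OF _ tau_horizon[OF T]] unfolding floor_weight_def Let_def space_product by auto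
  show "(\<integral>\<^sup>+\<omega>. ennreal (floor_weight \<psi> (\<omega>, t) * C (\<omega>, t)) \<partial>M) \<le> contribution_cost M T \<psi> (curry C)"
    if C: "C \<in> contributions" and t: "t \<in> horizon T"
  proof -
    have "t \<le> real (nat \<lfloor>t\<rfloor> + 1)" by linarith
    from c.weighted_le_cost[OF contributions_contrib[OF C assms] t this] show ?thesis
      by (simp only: floor_weight_def Let_def fst_conv snd_conv curry_def)
  qed
qed

lemma total_cost_eq:
  assumes \<psi>: "price M F T \<psi>x" "price M F T \<psi>c" and x: "case_prod x \<in> consumptions G" and C: "case_prod C \<in> contributions"
  shows "total_cost M T \<psi>x \<psi>c x C
    = (\<integral>\<^sup>+z. ennreal (\<psi>x (fst z) (snd z) * case_prod x z) \<partial>(M \<Otimes>\<^sub>M leb T)) + contribution_cost M T \<psi>c C"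
proof -
  interpret c: price M F T \<psi>c by fact
  obtain g where g: "g \<in> borel_measurable M" "AE \<omega> in M. stieltjes_integral T (\<psi>c \<omega>) (C \<omega>) = g \<omega>"
    using c.stieltjes_measurable[OF contributions_contrib[OF C \<psi>(2)]] by auto
  have "case_prod x \<in> borel_measurable (M \<Otimes>\<^sub>M leb T)"
    using x optional_product_measurable[of x] by (simp add: consumptions_iff)
  then have f: "(\<lambda>z. ennreal (\<psi>x (fst z) (snd z) * case_prod x z)) \<in> borel_measurable (M \<Otimes>\<^sub>M leb T)"
    using price_product_measurable[OF \<psi>(1)] by measurable
  have "total_cost M T \<psi>x \<psi>c x C = (\<integral>\<^sup>+\<omega>. (\<integral>\<^sup>+t. ennreal (\<psi>x \<omega> t * x \<omega> t) \<partial>leb T) + g \<omega> \<partial>M)"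
    unfolding total_cost_def using g(2) by (intro nn_integral_cong_AE) (auto elim: eventually_mono)
  also have "\<dots> = (\<integral>\<^sup>+\<omega>. \<integral>\<^sup>+t. ennreal (\<psi>x \<omega> t * x \<omega> t) \<partial>leb T \<partial>M) + (\<integral>\<^sup>+\<omega>. g \<omega> \<partial>M)"
    using P.M2.borel_measurable_nn_integral_fst[OF f] g(1) by (intro nn_integral_add) auto
  also have "(\<integral>\<^sup>+\<omega>. \<integral>\<^sup>+t. ennreal (\<psi>x \<omega> t * x \<omega> t) \<partial>leb T \<partial>M)
      = (\<integral>\<^sup>+z. ennreal (\<psi>x (fst z) (snd z) * case_prod x z) \<partial>(M \<Otimes>\<^sub>M leb T))"
    using P.M2.nn_integral_fst[OF f] by simp
  also have "(\<integral>\<^sup>+\<omega>. g \<omega> \<partial>M) = contribution_cost M T \<psi>c C"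
    unfolding contribution_cost_def using g(2) by (intro nn_integral_cong_AE) (auto elim: eventually_mono)
  finally show ?thesis .
qed

lemma budget_iff:
  assumes \<psi>: "price M F T \<psi>x" "price M F T \<psi>c"
  shows "(x, C) \<in> budget M F T \<psi>x \<psi>c w \<longleftrightarrow> case_prod x \<in> consumptions G \<and> case_prod C \<in> contributions \<and>
    (\<integral>\<^sup>+z. ennreal (\<psi>x (fst z) (snd z) * case_prod x z) \<partial>(M \<Otimes>\<^sub>M leb T)) + contribution_cost M T \<psi>c C \<le> ennreal w"
proof -
  have "case_prod C \<in> contributions \<longleftrightarrow> optional_process M F T C \<and> (\<forall>\<omega>\<in>space M. \<forall>t\<in>horizon T. 0 \<le> C \<omega> t) \<and>
      (AE \<omega> in M. right_continuous_on (horizon T) (C \<omega>) \<and> mono_on (horizon T) (C \<omega>))"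
    unfolding contributions_def mem_Collect_eq consumptions_iff prod.case conj_assoc
    by (intro conj_cong refl AE_cong) (auto simp: good_path_def)
  then have "(x, C) \<in> budget M F T \<psi>x \<psi>c w \<longleftrightarrow> case_prod x \<in> consumptions G \<and> case_prod C \<in> contributions \<and>
      total_cost M T \<psi>x \<psi>c x C \<le> ennreal w"
    unfolding budget_def consumptions_iff by auto
  then show ?thesis using total_cost_eq[OF \<psi>] by auto
qed

end

lemma uniformly_integrableD:
  assumes "uniformly_integrable N S" "0 < \<epsilon>"
  shows "\<exists>g. integrable N g \<and> (\<forall>z\<in>space N. 0 \<le> g z) \<and>
    (\<forall>f\<in>S. (\<integral>\<^sup>+z\<in>{z. g z < \<bar>f z\<bar>}. ennreal \<bar>f z\<bar> \<partial>N) \<le> ennreal \<epsilon>)"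
  by (rule assms(1)[unfolded uniformly_integrable_def, THEN conjunct2, THEN spec, THEN mp, OF assms(2)])

section \<open>The market as an instance of the abstract problem\<close>

locale market = filtered M F T for M :: "'a measure" and F T +
  fixes \<psi>x \<psi>c r :: "'a \<Rightarrow> real \<Rightarrow> real" and u :: "real \<times> real \<Rightarrow> real" and n :: nat and w0 :: real
  assumes \<psi>x: "price M F T \<psi>x" and \<psi>c: "price M F T \<psi>c"
    and \<psi>x_mean: "\<And>t. t \<in> horizon T \<Longrightarrow> (\<integral>\<^sup>+\<omega>. ennreal (\<psi>x \<omega> t) \<partial>M) \<le> 1"
    and r: "optional_process M F T r"
    and n: "0 < n" and w0: "0 < w0"
    and U: "assumption_U M F T \<psi>x \<psi>c r n (\<lambda>i. w0) (\<lambda>i. u)"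
    and mixed: "\<forall>p\<in>{0<..} \<times> {0<..}. 0 \<le> partial_c (partial_x u) p"
begin

abbreviation N where "N \<equiv> M \<Otimes>\<^sub>M leb T"
abbreviation d where "d \<equiv> \<lambda>z. discount r (fst z) (snd z)"
abbreviation p where "p \<equiv> \<lambda>z. \<psi>x (fst z) (snd z)"

definition b where "b C = contribution_cost M T \<psi>c (curry C)"

text \<open>The minimum runs over \<open>d\<close>, \<open>p\<close> and
  \<open>floor_weight \<psi>c\<close>, one for each domination that the abstract problem asks for.
  The time factor and the cap 1 make the weight integrable.\<close>

definition \<rho> where "\<rho> z = exp (- snd z) * min (min (d z) (p z)) (min 1 (floor_weight \<psi>c z))"

lemma utility: "utility_function u"
  using U n by (auto simp: assumption_U_def)

lemma d_measurable: "d \<in> borel_measurable N"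
  using discount_measurable[OF optional_product_measurable[OF r]] by (simp add: split_def)

lemma exp_measurable: "(\<lambda>z. exp (- snd z)) \<in> borel_measurable N"
  using measurable_from_subalg[OF optional_subalgebra exp_optional] by (simp add: split_def)

lemma \<rho>_measurable: "\<rho> \<in> borel_measurable N"
  unfolding \<rho>_def
  using exp_measurable d_measurable price_product_measurable[OF \<psi>x] floor_weight_measurable[OF \<psi>c] by measurable

lemma \<rho>_bounds:
  assumes "z \<in> space N"
  shows "0 < \<rho> z" "\<rho> z \<le> d z" "\<rho> z \<le> p z" "\<rho> z \<le> exp (- snd z) * floor_weight \<psi>c z" "\<rho> z \<le> exp (- snd z)"
proof -
  have z: "fst z \<in> space M" "snd z \<in> horizon T" using assms by (auto simp: space_product)
  have e: "exp (- snd z) \<le> 1" using horizon_nonneg[OF T z(2)] by simp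
  define y where "y = min (min (d z) (p z)) (min 1 (floor_weight \<psi>c z))"
  have y: "0 < y" "y \<le> d z" "y \<le> p z" "y \<le> 1" "y \<le> floor_weight \<psi>c z"
    using price.pos[OF \<psi>x z] floor_weight_pos[OF \<psi>c assms] by (auto simp: y_def discount_def)
  have \<rho>: "\<rho> z = exp (- snd z) * y" by (simp add: \<rho>_def y_def)
  have "exp (- snd z) * y \<le> 1 * y" using e y(1) by (intro mult_right_mono) auto
  then show "\<rho> z \<le> d z" "\<rho> z \<le> p z" using y unfolding \<rho> by linarith+
  show "0 < \<rho> z" "\<rho> z \<le> exp (- snd z) * floor_weight \<psi>c z" unfolding \<rho> using y by auto
  have "exp (- snd z) * y \<le> exp (- snd z) * 1" using y(4) by (intro mult_left_mono) auto
  then show "\<rho> z \<le> exp (- snd z)" unfolding \<rho> by simp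
qed

lemma contributions_intros:
  assumes "C \<in> contributions" "D \<in> contributions"
  shows "(\<lambda>z. C z + D z) \<in> contributions" "(\<lambda>z. max (C z) (D z)) \<in> contributions"
    "(\<lambda>z. min (C z) (D z)) \<in> contributions" "0 \<le> s \<Longrightarrow> (\<lambda>z. s * C z) \<in> contributions"
proof -
  have ae: "AE \<omega> in M. good_path T (\<lambda>t. C (\<omega>, t))" "AE \<omega> in M. good_path T (\<lambda>t. D (\<omega>, t))"
    using assms by (auto dest: contributions_D)
  have path: "AE \<omega> in M. good_path T (\<lambda>t. C (\<omega>, t) + D (\<omega>, t))" "AE \<omega> in M. good_path T (\<lambda>t. max (C (\<omega>, t)) (D (\<omega>, t)))"
    "AE \<omega> in M. good_path T (\<lambda>t. min (C (\<omega>, t)) (D (\<omega>, t)))"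
    by (rule eventually_elim2[OF ae]; rule good_path_intros; assumption)+
  have path': "AE \<omega> in M. good_path T (\<lambda>t. s * C (\<omega>, t))" if "0 \<le> s"
    using ae(1) by (rule eventually_mono) (rule good_path_intros(4)[OF _ _ that]; assumption)
  have m [measurable]: "C \<in> borel_measurable G" "D \<in> borel_measurable G"
    and nn: "\<And>z. z \<in> space G \<Longrightarrow> 0 \<le> C z" "\<And>z. z \<in> space G \<Longrightarrow> 0 \<le> D z"
    using assms by (auto simp: contributions_def consumptions_def)
  show "(\<lambda>z. C z + D z) \<in> contributions" "(\<lambda>z. max (C z) (D z)) \<in> contributions"
    "(\<lambda>z. min (C z) (D z)) \<in> contributions" "0 \<le> s \<Longrightarrow> (\<lambda>z. s * C z) \<in> contributions"
    unfolding contributions_def consumptions_def using nn path path'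
    by (auto intro: le_max_iff_disj[THEN iffD2])
qed

lemma zero_contribution: "(\<lambda>z. 0) \<in> contributions"
  by (auto simp: contributions_def consumptions_def good_path_def right_continuous_on_def mono_on_def)

lemma b_mono:
  assumes "C \<in> contributions" "D \<in> contributions" "\<And>z. z \<in> space N \<Longrightarrow> C z \<le> D z"
  shows "b C \<le> b D"
  unfolding b_def
  using price.cost_mono[OF \<psi>c contributions_contrib[OF assms(1) \<psi>c] contributions_contrib[OF assms(2) \<psi>c]] assms(3)
  by (auto simp: space_product)

sublocale problem: contribution_problem u N G d p \<rho> "\<lambda>z. exp (- snd z)" contributions b w0
proof unfold_locales
  show "utility_function u" by (rule utility)
  show "\<forall>p\<in>{0<..} \<times> {0<..}. 0 \<le> partial_c (partial_x u) p" by (rule mixed)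
  show "subalgebra N G" by (rule optional_subalgebra)
  show "emeasure N (space N) \<noteq> 0" by (rule product_nontrivial)
  show "0 < w0" by (rule w0)
  show "d \<in> borel_measurable N" by (rule d_measurable)
  show p_meas: "p \<in> borel_measurable N" by (rule price_product_measurable[OF \<psi>x])
  show "\<rho> \<in> borel_measurable N" by (rule \<rho>_measurable)
  show "0 < \<rho> z" "\<rho> z \<le> d z" "\<rho> z \<le> p z" if "z \<in> space N" for z using \<rho>_bounds[OF that] by auto
  show "integrable N \<rho>"
  proof (rule integrableI_bounded)
    have "(\<integral>\<^sup>+z. ennreal (norm (\<rho> z)) \<partial>N) \<le> (\<integral>\<^sup>+z. ennreal (exp (- snd z)) * 1 \<partial>N)"
      using \<rho>_bounds by (intro nn_integral_mono) (auto intro!: ennreal_leI simp: less_imp_le)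
    also have "\<dots> \<le> 1" by (rule product_exp_bound) (auto simp: emeasure_space_1)
    finally show "(\<integral>\<^sup>+z. ennreal (norm (\<rho> z)) \<partial>N) < \<infinity>" by (rule le_less_trans) simp
  qed (rule \<rho>_measurable)
  show "(\<lambda>z. exp (- snd z)) \<in> consumptions G"
    using exp_optional by (simp add: consumptions_def split_def)
  show "0 < exp (- snd z)" if "z \<in> space N" for z :: "'a \<times> real" by simp
  show "integrable N (\<lambda>z. p z * exp (- snd z))"
  proof (rule integrableI_bounded)
    show "(\<lambda>z. p z * exp (- snd z)) \<in> borel_measurable N" using p_meas exp_measurable by measurable
    have "(\<integral>\<^sup>+z. ennreal (norm (p z * exp (- snd z))) \<partial>N) = (\<integral>\<^sup>+z. ennreal (exp (- snd z)) * ennreal (p z) \<partial>N)"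
    proof (rule nn_integral_cong)
      fix z assume "z \<in> space N"
      then have "0 < p z" using price.pos[OF \<psi>x] by (auto simp: space_product)
      then show "ennreal (norm (p z * exp (- snd z))) = ennreal (exp (- snd z)) * ennreal (p z)"
        by (simp add: abs_mult mult.commute flip: ennreal_mult)
    qed
    \<comment> \<open>The expected price is at most 1 at every time, so the bundle
      \<open>exp (- t)\<close> has finite cost.\<close>
    also have "\<dots> \<le> 1" using p_meas \<psi>x_mean by (intro product_exp_bound) auto
    finally show "(\<integral>\<^sup>+z. ennreal (norm (p z * exp (- snd z))) \<partial>N) < \<infinity>" by (rule le_less_trans) simp
  qed
  show "contributions \<subseteq> consumptions G" by (auto simp: contributions_def)
  show "(\<lambda>z. C z + D z) \<in> contributions" "(\<lambda>z. max (C z) (D z)) \<in> contributions"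
    "(\<lambda>z. min (C z) (D z)) \<in> contributions" if "C \<in> contributions" "D \<in> contributions" for C D
    using contributions_intros[OF that] by auto
  show "(\<lambda>z. s * C z) \<in> contributions" if "C \<in> contributions" "0 \<le> s" for C s
    using contributions_intros(4)[OF that(1,1,2)] .
  show "(\<lambda>z. 0) \<in> contributions" by (rule zero_contribution)
  show "b (\<lambda>z. C z + D z) = b C + b D" if "C \<in> contributions" "D \<in> contributions" for C D
    using price.cost_add[OF \<psi>c contributions_contrib[OF that(1) \<psi>c] contributions_contrib[OF that(2) \<psi>c]]
    by (simp add: b_def curry_def)
  show "b (\<lambda>z. s * C z) = ennreal s * b C" if "C \<in> contributions" "0 \<le> s" for C s
    using price.cost_scale[OF \<psi>c contributions_contrib[OF that(1) \<psi>c] that(2)] by (simp add: b_def curry_def)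
  show "b C \<le> b D" if "C \<in> contributions" "D \<in> contributions" "\<And>z. z \<in> space N \<Longrightarrow> C z \<le> D z" for C D
    using that by (rule b_mono)
  show "(\<integral>\<^sup>+z. ennreal (\<rho> z * C z) \<partial>N) \<le> b C" if C: "C \<in> contributions" for C
  proof -
    have C_meas: "C \<in> borel_measurable N"
      using C measurable_from_subalg[OF optional_subalgebra] by (auto simp: contributions_def consumptions_def)
    have "(\<integral>\<^sup>+z. ennreal (\<rho> z * C z) \<partial>N) \<le> (\<integral>\<^sup>+z. ennreal (exp (- snd z)) * ennreal (floor_weight \<psi>c z * C z) \<partial>N)"
    proof (rule nn_integral_mono)
      fix z assume z: "z \<in> space N"
      then have C0: "0 \<le> C z" using contributions_D(3)[OF C] by (auto simp: space_product)
      have "\<rho> z * C z \<le> exp (- snd z) * (floor_weight \<psi>c z * C z)"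
        using mult_right_mono[OF \<rho>_bounds(4)[OF z] C0] by (simp add: mult.assoc)
      then show "ennreal (\<rho> z * C z) \<le> ennreal (exp (- snd z)) * ennreal (floor_weight \<psi>c z * C z)"
        using floor_weight_pos[OF \<psi>c z] C0 by (simp add: ennreal_leI flip: ennreal_mult)
    qed
    also have "\<dots> \<le> b C"
      using C_meas floor_weight_measurable[OF \<psi>c] floor_weight_le_cost[OF \<psi>c C, folded b_def] by (intro product_exp_bound) auto
    finally show ?thesis .
  qed
  show "\<exists>C\<in>contributions. (AE z in N. C z = L z) \<and> b C \<le> ennreal \<beta>"
    if Cs: "\<And>k. Cs k \<in> contributions" and L: "L \<in> borel_measurable G" "AE z in N. (\<lambda>k. Cs k z) \<longlonglongrightarrow> L z"
      and cost: "\<And>k::nat. b (Cs k) \<le> ennreal (Bs k)" "Bs \<longlonglongrightarrow> \<beta>" for Cs L Bs \<beta>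
  proof -
    obtain C where C: "optional_process M F T C" "\<And>\<omega>. \<omega> \<in> space M \<Longrightarrow> good_path T (C \<omega>)"
      "AE z in N. C (fst z) (snd z) = L z" "contribution_cost M T \<psi>c C \<le> ennreal \<beta>"
    proof (rule limit_contribution[OF \<psi>c, of "\<lambda>k. curry (Cs k)" L Bs \<beta>])
      show "L \<in> borel_measurable N" using L(1) by (rule measurable_from_subalg[OF optional_subalgebra])
    qed (use contributions_D[OF Cs] L(2) cost in \<open>auto simp: b_def curry_def\<close>)
    have "case_prod C \<in> contributions"
      using C(1,2) by (auto simp: contributions_def consumptions_iff good_path_def)
    then show ?thesis using C(3,4) by (intro bexI[of _ "case_prod C"]) (simp_all add: b_def split_def curry_def)
  qed
  show "\<exists>g. integrable N g \<and> (\<forall>z\<in>space N. 0 \<le> g z) \<and>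
        (\<forall>x\<in>consumptions G. \<forall>C\<in>contributions. (\<integral>\<^sup>+z. ennreal (p z * x z) \<partial>N) + b C \<le> ennreal w0 \<longrightarrow>
           (\<integral>\<^sup>+z. ennreal (d z * u (x z, C z) - g z) \<partial>N) \<le> ennreal \<epsilon>)" if \<epsilon>: "0 < \<epsilon>" for \<epsilon>
  proof -
    let ?S = "{(\<lambda>(\<omega>, t). discount r \<omega> t * u (x 1 \<omega> t, \<Sum>j\<in>{1..n}. C j \<omega> t)) | x C.
           \<forall>j\<in>{1..n}. (x j, C j) \<in> budget M F T \<psi>x \<psi>c w0}"
    have ui: "uniformly_integrable N ?S" using U n unfolding assumption_U_def by force
    from uniformly_integrableD[OF ui \<epsilon>] obtain g where g: "integrable N g" "\<forall>z\<in>space N. 0 \<le> g z"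
      "\<forall>f\<in>?S. (\<integral>\<^sup>+z\<in>{z. g z < \<bar>f z\<bar>}. ennreal \<bar>f z\<bar> \<partial>N) \<le> ennreal \<epsilon>"
      by (elim exE conjE)
    have "(\<integral>\<^sup>+z. ennreal (d z * u (x z, C z) - g z) \<partial>N) \<le> ennreal \<epsilon>"
      if x: "x \<in> consumptions G" and C: "C \<in> contributions"
        and le: "(\<integral>\<^sup>+z. ennreal (p z * x z) \<partial>N) + b C \<le> ennreal w0" for x C
    proof -
      \<comment> \<open>Uniform integrability is assumed for profiles of \<open>n\<close> agents.
        The plan \<open>(x, C)\<close> has the payoff of the symmetric profile in which everybody
        consumes \<open>x\<close> and contributes \<open>C / n\<close>, which is no more
        expensive.\<close>
      let ?C = "\<lambda>z. (1 / real n) * C z"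
      have C': "?C \<in> contributions" using contributions_intros(4)[OF C C, of "1 / real n"] by simp
      have "b ?C \<le> b C"
      proof (rule b_mono[OF C' C])
        fix z assume "z \<in> space N"
        then have "0 \<le> C z" using contributions_D(3)[OF C] by (auto simp: space_product)
        then have "(1 / real n) * C z \<le> 1 * C z" using n by (intro mult_right_mono) auto
        then show "(1 / real n) * C z \<le> C z" by simp
      qed
      then have "(\<integral>\<^sup>+z. ennreal (p z * x z) \<partial>N) + b ?C \<le> ennreal w0"
        using le by (meson add_left_mono order_trans)
      then have "(curry x, curry ?C) \<in> budget M F T \<psi>x \<psi>c w0"
        unfolding budget_iff[OF \<psi>x \<psi>c] case_prod_curry b_def[symmetric] using x C' by blast
      then have "(\<lambda>(\<omega>, t). discount r \<omega> t * u (curry x \<omega> t, \<Sum>j\<in>{1..n}. curry ?C \<omega> t)) \<in> ?S"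
        by (intro CollectI exI[of _ "\<lambda>j. curry x"] exI[of _ "\<lambda>j. curry ?C"]) auto
      moreover have "(\<lambda>(\<omega>, t). discount r \<omega> t * u (curry x \<omega> t, \<Sum>j\<in>{1..n}. curry ?C \<omega> t)) = (\<lambda>z. d z * u (x z, C z))"
        using n by (auto simp: fun_eq_iff)
      ultimately have "(\<lambda>z. d z * u (x z, C z)) \<in> ?S" by (simp only:)
      note bound = bspec[OF g(3) this]
      have "(\<integral>\<^sup>+z. ennreal (d z * u (x z, C z) - g z) \<partial>N)
          \<le> (\<integral>\<^sup>+z\<in>{z. g z < \<bar>d z * u (x z, C z)\<bar>}. ennreal \<bar>d z * u (x z, C z)\<bar> \<partial>N)"
      proof (rule nn_integral_mono)
        fix z assume z: "z \<in> space N"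
        define f where "f = d z * u (x z, C z)"
        have g0: "0 \<le> g z" using bspec[OF g(2) z] .
        have "ennreal (f - g z) \<le> ennreal \<bar>f\<bar> * indicator {z. g z < \<bar>f\<bar>} z"
        proof (cases "g z < \<bar>f\<bar>")
          case True
          then show ?thesis using g0 by (auto intro!: ennreal_leI)
        next
          case False
          then have "f - g z \<le> 0" by linarith
          then show ?thesis by (simp add: ennreal_neg)
        qed
        then show "ennreal (d z * u (x z, C z) - g z)
            \<le> ennreal \<bar>d z * u (x z, C z)\<bar> * indicator {z. g z < \<bar>d z * u (x z, C z)\<bar>} z"
          by (simp add: f_def indicator_def)
      qed
      also note bound
      finally show ?thesis .
    qed
    then show ?thesis using g(1,2) by (intro exI[of _ g] conjI ballI impI) auto
  qed
qed

end

lemma all_case_prod: "(\<forall>f g. Q (case_prod f) (case_prod g)) \<longleftrightarrow> (\<forall>f g. Q f g)"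
  by (metis case_prod_curry)

section \<open>Nash equilibria in terms of the abstract problem\<close>

context market
begin

lemma in_budget_iff:
  "(x, C) \<in> budget M F T \<psi>x \<psi>c w0 \<longleftrightarrow>
    problem.adm (case_prod x) (case_prod C) \<and> problem.A (case_prod x) + problem.B (case_prod C) \<le> w0"
  unfolding budget_iff[OF \<psi>x \<psi>c]
  using problem.cost_le_iff[of "case_prod x" "case_prod C" w0] w0
  by (auto simp: problem.adm_def b_def)

lemma payoff_eq:
  assumes "problem.adm (case_prod x) (\<lambda>(\<omega>, t). C \<omega> t + D \<omega> t)"
  shows "payoff M T r u x C D = ennreal (problem.U (case_prod x) (\<lambda>(\<omega>, t). C \<omega> t + D \<omega> t))"
proof -
  let ?f = "\<lambda>z. ennreal (d z * u (case_prod x z, (\<lambda>(\<omega>, t). C \<omega> t + D \<omega> t) z))"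
  have "?f \<in> borel_measurable N"
    using problem.payoff_measurable[OF assms] by measurable
  from P.M2.nn_integral_fst[OF this] have "payoff M T r u x C D = (\<integral>\<^sup>+z. ?f z \<partial>N)"
    by (simp add: payoff_def)
  then show ?thesis using problem.nn_payoff[OF assms] by simp
qed

text \<open>If some plan exceeds its budget, both sides fail. Otherwise all payoffs involved are
  finite, so attaining the supremum means that no feasible deviation has a larger real
  payoff.\<close>

lemma nash_equilibrium_iff:
  "nash_equilibrium M F T \<psi>x \<psi>c r n (\<lambda>i. w0) (\<lambda>i. u) x C \<longleftrightarrow> problem.ne n (\<lambda>i. case_prod (x i)) (\<lambda>i. case_prod (C i))"
proof (cases "\<forall>i\<in>{1..n}. (x i, C i) \<in> budget M F T \<psi>x \<psi>c w0")
  case False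
  then show ?thesis unfolding nash_equilibrium_def problem.ne_def in_budget_iff by blast
next
  case True
  then have adm: "problem.adm (case_prod (x i)) (case_prod (C i))" if "i \<in> {1..n}" for i
    using that in_budget_iff by blast
  have "payoff M T r u (x i) (C i) (others n C i) = best_value M F T \<psi>x \<psi>c r w0 u (others n C i) \<longleftrightarrow>
      (\<forall>x' C'. problem.adm x' C' \<longrightarrow> problem.A x' + problem.B C' \<le> w0 \<longrightarrow>
        problem.U x' (\<lambda>z. C' z + (\<Sum>j\<in>{1..n} - {i}. case_prod (C j) z))
          \<le> problem.U (case_prod (x i)) (\<lambda>z. \<Sum>j\<in>{1..n}. case_prod (C j) z))" (is "?L \<longleftrightarrow> ?R")
    if i: "i \<in> {1..n}" for i
  proof -
    let ?D = "\<lambda>z. \<Sum>j\<in>{1..n} - {i}. case_prod (C j) z"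
    have D: "(\<lambda>(\<omega>, t). C' \<omega> t + others n C i \<omega> t) = (\<lambda>z. case_prod C' z + ?D z)" for C'
      by (auto simp: others_def fun_eq_iff)
    have tot: "(\<lambda>z. case_prod (C i) z + ?D z) = (\<lambda>z. \<Sum>j\<in>{1..n}. case_prod (C j) z)"
      by (rule ext) (rule sum.remove[OF finite_atLeastAtMost i, symmetric])
    have pay: "payoff M T r u x' C' (others n C i) = ennreal (problem.U (case_prod x') (\<lambda>z. case_prod C' z + ?D z))"
      "problem.adm (case_prod x') (\<lambda>z. case_prod C' z + ?D z)"
      if "problem.adm (case_prod x') (case_prod C')" for x' C'
    proof -
      show a: "problem.adm (case_prod x') (\<lambda>z. case_prod C' z + ?D z)"
      proof -
        have "problem.adm (\<lambda>z. 0) ?D"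
          by (rule problem.adm_sum(1)[of _ "\<lambda>i. case_prod (x i)", OF _ _ problem.adm_zero(1)]) (use adm in auto)
        from problem.adm_add(1)[OF that this] show ?thesis by simp
      qed
      show "payoff M T r u x' C' (others n C i) = ennreal (problem.U (case_prod x') (\<lambda>z. case_prod C' z + ?D z))"
        using payoff_eq[of x' C' "others n C i"] a unfolding D by simp
    qed
    have "?L \<longleftrightarrow> (\<forall>(x', C')\<in>budget M F T \<psi>x \<psi>c w0.
        payoff M T r u x' C' (others n C i) \<le> payoff M T r u (x i) (C i) (others n C i))" (is "_ \<longleftrightarrow> ?M")
    proof
      assume ?L
      have "payoff M T r u x' C' (others n C i) \<le> best_value M F T \<psi>x \<psi>c r w0 u (others n C i)"
        if "(x', C') \<in> budget M F T \<psi>x \<psi>c w0" for x' C'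
        unfolding best_value_def using that by (rule SUP_upper2) simp
      then show ?M using \<open>?L\<close> by auto
    next
      assume m: ?M
      show ?L unfolding best_value_def
      proof (rule antisym)
        show "payoff M T r u (x i) (C i) (others n C i) \<le> (SUP (x, Ca)\<in>budget M F T \<psi>x \<psi>c w0. payoff M T r u x Ca (others n C i))"
          using True i by (intro SUP_upper2[of "(x i, C i)"]) auto
        show "(SUP (x, Ca)\<in>budget M F T \<psi>x \<psi>c w0. payoff M T r u x Ca (others n C i)) \<le> payoff M T r u (x i) (C i) (others n C i)"
          using m by (intro SUP_least) auto
      qed
    qed
    have key: "payoff M T r u x' C' (others n C i) \<le> payoff M T r u (x i) (C i) (others n C i) \<longleftrightarrow>
        problem.U (case_prod x') (\<lambda>z. case_prod C' z + ?D z) \<le> problem.U (case_prod (x i)) (\<lambda>z. case_prod (C i) z + ?D z)"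
      if "problem.adm (case_prod x') (case_prod C')" for x' C'
      unfolding pay(1)[OF that] pay(1)[OF adm[OF i]]
      by (rule ennreal_le_iff[OF problem.U_nonneg[OF pay(2)[OF adm[OF i]]]])
    note \<open>?L \<longleftrightarrow> ?M\<close>
    also have "?M \<longleftrightarrow> (\<forall>x' C'. problem.adm (case_prod x') (case_prod C') \<longrightarrow>
        problem.A (case_prod x') + problem.B (case_prod C') \<le> w0 \<longrightarrow>
        problem.U (case_prod x') (\<lambda>z. case_prod C' z + ?D z) \<le> problem.U (case_prod (x i)) (\<lambda>z. case_prod (C i) z + ?D z))"
      unfolding Ball_def split_paired_All prod.case in_budget_iff using key by blast
    also have "\<dots> \<longleftrightarrow> ?R"
      unfolding tot
      by (rule all_case_prod[of "\<lambda>x' C'. problem.adm x' C' \<longrightarrow> problem.A x' + problem.B C' \<le> w0 \<longrightarrow>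
        problem.U x' (\<lambda>z. C' z + ?D z) \<le> problem.U (case_prod (x i)) (\<lambda>z. \<Sum>j\<in>{1..n}. case_prod (C j) z)"])
    finally show ?thesis .
  qed
  then show ?thesis using True unfolding nash_equilibrium_def problem.ne_def in_budget_iff by blast
qed

text \<open>Tonelli's theorem passes to almost every path, where right-continuity upgrades equality
  at almost all times to all times before \<open>T\<close>.\<close>

lemma sum_AE_eq_iff:
  assumes "\<And>i. i \<in> {1..n} \<Longrightarrow> problem.adm (x i) (case_prod (C i))" "problem.adm y (case_prod D)"
  shows "(AE z in N. (\<Sum>i\<in>{1..n}. case_prod (C i) z) = case_prod D z) \<longleftrightarrow>
    (AE \<omega> in M. \<forall>t. 0 \<le> t \<and> ereal t < T \<longrightarrow> (\<Sum>i\<in>{1..n}. C i \<omega> t) = D \<omega> t)"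
proof -
  have adm: "problem.adm y (\<lambda>z. \<Sum>i\<in>{1..n}. case_prod (C i) z)"
    using assms by (intro problem.adm_sum(1)) auto
  have good: "AE \<omega> in M. good_path T (\<lambda>t. \<Sum>i\<in>{1..n}. C i \<omega> t)" "AE \<omega> in M. good_path T (D \<omega>)"
    using contributions_D(4)[OF problem.admD(2)[OF adm]] contributions_D(4)[OF problem.admD(2)[OF assms(2)]] by simp_all
  have "(AE z in N. (\<Sum>i\<in>{1..n}. case_prod (C i) z) = case_prod D z) \<longleftrightarrow>
      (AE \<omega> in M. AE t in leb T. (\<Sum>i\<in>{1..n}. C i \<omega> t) = D \<omega> t)"
  proof -
    have "{z \<in> space N. (\<Sum>i\<in>{1..n}. case_prod (C i) z) = case_prod D z} \<in> sets N"
      using problem.admD(6)[OF adm] problem.admD(6)[OF assms(2)] by measurable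
    from P.AE_pair_iff[of "\<lambda>\<omega> t. (\<Sum>i\<in>{1..n}. C i \<omega> t) = D \<omega> t"] this show ?thesis
      by (simp add: split_def)
  qed
  also have "\<dots> \<longleftrightarrow> (AE \<omega> in M. \<forall>t. 0 \<le> t \<and> ereal t < T \<longrightarrow> (\<Sum>i\<in>{1..n}. C i \<omega> t) = D \<omega> t)"
  proof
    assume "AE \<omega> in M. AE t in leb T. (\<Sum>i\<in>{1..n}. C i \<omega> t) = D \<omega> t"
    with good show "AE \<omega> in M. \<forall>t. 0 \<le> t \<and> ereal t < T \<longrightarrow> (\<Sum>i\<in>{1..n}. C i \<omega> t) = D \<omega> t"
      by eventually_elim (simp only: good_path_AE_eq_iff[OF T])
  next
    assume "AE \<omega> in M. \<forall>t. 0 \<le> t \<and> ereal t < T \<longrightarrow> (\<Sum>i\<in>{1..n}. C i \<omega> t) = D \<omega> t"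
    with good show "AE \<omega> in M. AE t in leb T. (\<Sum>i\<in>{1..n}. C i \<omega> t) = D \<omega> t"
      by eventually_elim (simp only: good_path_AE_eq_iff[OF T])
  qed
  finally show ?thesis .
qed

lemma symmetric_nash_equilibrium:
  "\<exists>xh Ch :: nat \<Rightarrow> 'a \<Rightarrow> real \<Rightarrow> real.
    nash_equilibrium M F T \<psi>x \<psi>c r n (\<lambda>i. w0) (\<lambda>i. u) xh Ch \<and>
    (\<forall>i\<in>{1..n}. (xh i, Ch i) = (xh 1, Ch 1)) \<and>
    (\<forall>xt Ct :: nat \<Rightarrow> 'a \<Rightarrow> real \<Rightarrow> real.
       nash_equilibrium M F T \<psi>x \<psi>c r n (\<lambda>i. w0) (\<lambda>i. u) xt Ct \<longleftrightarrow>
         (\<forall>i\<in>{1..n}.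
            (xt i, Ct i) \<in> budget M F T \<psi>x \<psi>c w0 \<and>
            (AE (\<omega>, t) in M \<Otimes>\<^sub>M leb T. xt i \<omega> t = xh i \<omega> t) \<and>
            contribution_cost M T \<psi>c (Ct i) = contribution_cost M T \<psi>c (Ch i)) \<and>
         (AE \<omega> in M. \<forall>t. 0 \<le> t \<and> ereal t < T \<longrightarrow>
            (\<Sum>i\<in>{1..n}. Ct i \<omega> t) = (\<Sum>i\<in>{1..n}. Ch i \<omega> t)))"
proof -
  obtain x C where x: "problem.adm x C"
    "\<And>xt Ct. problem.ne n xt Ct \<longleftrightarrow>
      (\<forall>i\<in>{1..n}. problem.adm (xt i) (Ct i) \<and> problem.A (xt i) + problem.B (Ct i) \<le> w0 \<and>
        (AE z in N. xt i z = x z) \<and> problem.B (Ct i) = problem.B C / real n) \<and>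
      (AE z in N. (\<Sum>j\<in>{1..n}. Ct j z) = C z)"
    "problem.A x + problem.B C / real n = w0"
    using problem.ne_characterization[OF n] by blast
  \<comment> \<open>Each agent contributes an equal share of the balanced one-agent
    contribution.\<close>
  define D where "D z = (1 / real n) * C z" for z
  have D: "problem.adm x D" "problem.B D = problem.B C / real n"
    using problem.adm_scale(1)[OF x(1), of 1 "1 / real n"] problem.adm_scale(3)[OF x(1), of 0 "1 / real n"]
    by (simp_all add: D_def[abs_def])
  have sum_D: "(\<Sum>i\<in>{1..n}. D z) = C z" for z using n by (simp add: D_def)
  show ?thesis
  proof (rule exI[of _ "\<lambda>i. curry x"], rule exI[of _ "\<lambda>i. curry D"], intro conjI allI)
    show "nash_equilibrium M F T \<psi>x \<psi>c r n (\<lambda>i. w0) (\<lambda>i. u) (\<lambda>i. curry x) (\<lambda>i. curry D)"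
      unfolding nash_equilibrium_iff x(2) using D x(3) sum_D by simp
    fix xt Ct :: "nat \<Rightarrow> 'a \<Rightarrow> real \<Rightarrow> real"
    show "nash_equilibrium M F T \<psi>x \<psi>c r n (\<lambda>i. w0) (\<lambda>i. u) xt Ct \<longleftrightarrow>
         (\<forall>i\<in>{1..n}.
            (xt i, Ct i) \<in> budget M F T \<psi>x \<psi>c w0 \<and>
            (AE (\<omega>, t) in M \<Otimes>\<^sub>M leb T. xt i \<omega> t = curry x \<omega> t) \<and>
            contribution_cost M T \<psi>c (Ct i) = contribution_cost M T \<psi>c (curry D)) \<and>
         (AE \<omega> in M. \<forall>t. 0 \<le> t \<and> ereal t < T \<longrightarrow>
            (\<Sum>i\<in>{1..n}. Ct i \<omega> t) = (\<Sum>i\<in>{1..n}. curry D \<omega> t))"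
    proof (cases "\<forall>i\<in>{1..n}. (xt i, Ct i) \<in> budget M F T \<psi>x \<psi>c w0")
      case False
      then show ?thesis unfolding nash_equilibrium_def by blast
    next
      case True
      then have adm: "problem.adm (case_prod (xt i)) (case_prod (Ct i))"
        "problem.A (case_prod (xt i)) + problem.B (case_prod (Ct i)) \<le> w0" if "i \<in> {1..n}" for i
        using that in_budget_iff by blast+
      have cost: "contribution_cost M T \<psi>c (Ct i) = contribution_cost M T \<psi>c (curry D) \<longleftrightarrow>
          problem.B (case_prod (Ct i)) = problem.B C / real n" if "i \<in> {1..n}" for i
      proof -
        have "contribution_cost M T \<psi>c (Ct i) = ennreal (problem.B (case_prod (Ct i)))"
          using problem.admD(9)[OF adm(1)[OF that]] by (simp add: b_def)
        moreover have "contribution_cost M T \<psi>c (curry D) = ennreal (problem.B D)"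
          using problem.admD(9)[OF D(1)] by (simp add: b_def)
        ultimately show ?thesis
          using problem.admD(10)[OF adm(1)[OF that]] problem.admD(10)[OF D(1)] D(2) by (simp add: ennreal_inj)
      qed
      have sums: "(AE z in N. (\<Sum>i\<in>{1..n}. case_prod (Ct i) z) = C z) \<longleftrightarrow>
          (AE \<omega> in M. \<forall>t. 0 \<le> t \<and> ereal t < T \<longrightarrow> (\<Sum>i\<in>{1..n}. Ct i \<omega> t) = (\<Sum>i\<in>{1..n}. curry D \<omega> t))"
        using sum_AE_eq_iff[of "\<lambda>i. case_prod (xt i)" Ct x "curry C"] adm(1) x(1) sum_D by (simp add: curry_def)
      have cons: "(AE (\<omega>, t) in M \<Otimes>\<^sub>M leb T. xt i \<omega> t = curry x \<omega> t) \<longleftrightarrow> (AE z in N. case_prod (xt i) z = x z)" for i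
        by (simp add: split_def)
      show ?thesis
        unfolding nash_equilibrium_iff x(2) sums[symmetric] cons using True adm cost by blast
    qed
  qed auto
qed

end

theorem theorem4p3:
  fixes M :: "'a measure" and F :: "real \<Rightarrow> 'a measure" and T :: ereal
    and \<psi>x \<psi>c r :: "'a \<Rightarrow> real \<Rightarrow> real"
    and n :: nat and w :: real and u :: "real \<times> real \<Rightarrow> real"
  assumes "prob_space M" and "0 < T"
    and "filtration_on M F T" and "usual_conditions M F T"
    and "1 < n" and "0 < w / real n"
    and "assumption_P M F T \<psi>x \<psi>c r"
    and "assumption_U M F T \<psi>x \<psi>c r n (\<lambda>i. w / real n) (\<lambda>i. u)"
    and "\<forall>p\<in>{0<..} \<times> {0<..}. 0 \<le> partial_c (partial_x u) p"
  shows "\<exists>xh Ch :: nat \<Rightarrow> 'a \<Rightarrow> real \<Rightarrow> real.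
    nash_equilibrium M F T \<psi>x \<psi>c r n (\<lambda>i. w / real n) (\<lambda>i. u) xh Ch \<and>
    (\<forall>i\<in>{1..n}. (xh i, Ch i) = (xh 1, Ch 1)) \<and>
    (\<forall>xt Ct :: nat \<Rightarrow> 'a \<Rightarrow> real \<Rightarrow> real.
       nash_equilibrium M F T \<psi>x \<psi>c r n (\<lambda>i. w / real n) (\<lambda>i. u) xt Ct \<longleftrightarrow>
         (\<forall>i\<in>{1..n}.
            (xt i, Ct i) \<in> budget M F T \<psi>x \<psi>c (w / real n) \<and>
            (AE (\<omega>, t) in M \<Otimes>\<^sub>M leb T. xt i \<omega> t = xh i \<omega> t) \<and>
            contribution_cost M T \<psi>c (Ct i) = contribution_cost M T \<psi>c (Ch i)) \<and>
         (AE \<omega> in M. \<forall>t. 0 \<le> t \<and> ereal t < T \<longrightarrow>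
            (\<Sum>i\<in>{1..n}. Ct i \<omega> t) = (\<Sum>i\<in>{1..n}. Ch i \<omega> t)))"
proof -
  interpret filtered M F T
    using assms(1-4) by (simp add: filtered_def filtered_axioms_def)
  have pp: "price_process M F T \<psi>x" "price_process M F T \<psi>c"
    using assms(7) by (auto simp: assumption_P_def)
  \<comment> \<open>Prices are regular only almost surely. Their regular versions agree with them at
    all times outside a null set, and prices enter the game through expectations, so costs, budgets
    and equilibria do not change.\<close>
  obtain \<psi>x' where x: "price M F T \<psi>x'" "AE \<omega> in M. \<forall>t\<in>horizon T. \<psi>x' \<omega> t = \<psi>x \<omega> t"
    "\<And>t. t \<in> horizon T \<Longrightarrow> (\<integral>\<^sup>+\<omega>. ennreal (\<psi>x' \<omega> t) \<partial>M) \<le> 1"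
    by (rule price_good_version[OF pp(1)]) (rule that; (assumption | blast))
  obtain \<psi>c' where c: "price M F T \<psi>c'" "AE \<omega> in M. \<forall>t\<in>horizon T. \<psi>c' \<omega> t = \<psi>c \<omega> t"
    by (rule price_good_version[OF pp(2)])
  \<comment> \<open>The quantifier over paths stands inside, because the path integrated later
    depends on \<omega> and the null set must not depend on it.\<close>
  have st: "AE \<omega> in M. \<forall>C. stieltjes_integral T (\<psi>c' \<omega>) C = stieltjes_integral T (\<psi>c \<omega>) C"
    using c(2)
  proof eventually_elim
    case (elim \<omega>)
    show ?case
    proof
      fix C
      show "stieltjes_integral T (\<psi>c' \<omega>) C = stieltjes_integral T (\<psi>c \<omega>) C"
        unfolding stieltjes_integral_def using elim by (intro nn_integral_cong) (simp add: indicator_def)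
    qed
  qed
  have cost: "contribution_cost M T \<psi>c C = contribution_cost M T \<psi>c' C" for C
    unfolding contribution_cost_def using st by (intro nn_integral_cong_AE) (auto elim: eventually_mono)
  have total: "total_cost M T \<psi>x \<psi>c = total_cost M T \<psi>x' \<psi>c'"
  proof (intro ext)
    fix y C
    have "AE \<omega> in M. (\<integral>\<^sup>+t. ennreal (\<psi>x \<omega> t * y \<omega> t) \<partial>leb T) = (\<integral>\<^sup>+t. ennreal (\<psi>x' \<omega> t * y \<omega> t) \<partial>leb T)"
      using x(2) by eventually_elim (auto intro!: nn_integral_cong simp: space_leb)
    with st have "AE \<omega> in M. (\<integral>\<^sup>+t. ennreal (\<psi>x \<omega> t * y \<omega> t) \<partial>leb T) + stieltjes_integral T (\<psi>c \<omega>) (C \<omega>)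
        = (\<integral>\<^sup>+t. ennreal (\<psi>x' \<omega> t * y \<omega> t) \<partial>leb T) + stieltjes_integral T (\<psi>c' \<omega>) (C \<omega>)"
      by eventually_elim auto
    then show "total_cost M T \<psi>x \<psi>c y C = total_cost M T \<psi>x' \<psi>c' y C"
      unfolding total_cost_def by (rule nn_integral_cong_AE)
  qed
  have budget: "budget M F T \<psi>x \<psi>c = budget M F T \<psi>x' \<psi>c'"
    unfolding budget_def total ..
  have nash: "nash_equilibrium M F T \<psi>x \<psi>c = nash_equilibrium M F T \<psi>x' \<psi>c'"
    unfolding nash_equilibrium_def best_value_def budget ..
  interpret market M F T \<psi>x' \<psi>c' r u n "w / real n"
  proof (rule market.intro[OF filtered_axioms market_axioms.intro])
    show "price M F T \<psi>x'" "price M F T \<psi>c'" by (fact x(1) c(1))+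
    show "(\<integral>\<^sup>+\<omega>. ennreal (\<psi>x' \<omega> t) \<partial>M) \<le> 1" if "t \<in> horizon T" for t by (rule x(3)[OF that])
    show "optional_process M F T r" using assms(7) by (simp add: assumption_P_def)
    show "0 < n" "0 < w / real n" using assms by auto
    show "assumption_U M F T \<psi>x' \<psi>c' r n (\<lambda>i. w / real n) (\<lambda>i. u)"
      using assms(8) unfolding assumption_U_def budget .
    show "\<forall>p\<in>{0<..} \<times> {0<..}. 0 \<le> partial_c (partial_x u) p" by fact
  qed
  show ?thesis unfolding nash budget cost by (rule symmetric_nash_equilibrium)
qed

end
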